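(* Let $\psi$ be a mother wavelet of regularity $r$ and let $\hat f_n$ be the corresponding level-wise Bayesian maximum a posteriori wavelet estimator (defined in the context) of $f$ in the Gaussian white noise model $dY_n(t)=f(t)dt+\frac{\sigma}{\sqrt n}dW(t)$, $t\in[0,1]$, where $f\in B^s_{p,q}(M)$, $0<p,q\le\infty$, $1/p<s<r$ and $M>0$. Assume that there exist positive constants $\gamma_-$ and $\gamma_+$ such that $\gamma_-\le\gamma_j\le\gamma_+$ for all $j=j_0,\ldots,J-1$. Let the priors $\pi_j$ satisfy the following conditions for all $j=j_0,\ldots,J-1$: (1) $\pi_j(0)\ge2^{-c_1j}$ for some $c_1>0$; (2) $\pi_j(\kappa)\ge(\kappa2^{-j})^{c_2\kappa}$ for all $\kappa=1,2,\ldots,\alpha_j2^j$, where $c_2>0$ and $0<c_\alpha\le\alpha_j\le\exp\{-c(\gamma_j)\}$ for some constant $c_\alpha>0$, and $c(\gamma_j)=8(\gamma_j+3/4)^2$; (3) $\pi_j(2^j)\ge e^{-c_02^j}$ for some $c_0>0$. Then, as $n\to\infty$, $$\sup_{f\in B^s_{p,q}(M)}E(\|\hat f_n-f\|_2^2)=O\Big(n^{-\frac{2s}{2s+1}}\Big).$$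
   Context: Model: one observes $Y_n$ with $dY_n(t)=f(t)dt+\frac{\sigma}{\sqrt n}dW(t)$, $t\in[0,1]$, where $\sigma>0$ is known, $W$ is a standard Wiener process and $f\in L^2[0,1]$ is unknown. $B^s_{p,q}(M)$ is the ball of radius $M$ in the Besov space $B^s_{p,q}[0,1]$. Wavelets: given a compactly supported scaling function $\phi$ of regularity $r$ and the corresponding mother wavelet $\psi$, consider the associated boundary-corrected orthonormal wavelet basis of $L^2[0,1]$ (Cohen–Daubechies–Vial type), consisting of a finite number $C_{j_0}$ of scaling functions $\phi_{j_0k}$ at a fixed primary resolution level $j_0$, denoted $\psi_{j_0-1,k}$, $k=0,\ldots,C_{j_0}-1$, and wavelets $\psi_{jk}$, $j\ge j_0$, $k=0,\ldots,2^j-1$ (the same notation is used for interior and edge wavelets). Put $\theta_{jk}=\int_0^1f\psi_{jk}$ and $Y_{jk}=\int_0^1\psi_{jk}(t)dY_n(t)=\theta_{jk}+\epsilon_{jk}$, with $\epsilon_{jk}$ independent $N(0,\sigma^2/n)$. Let $J=\log_2n$ (with $n$ a power of 2). Level-wise estimator: $\hat\theta_{j_0-1,k}=Y_{j_0-1,k}$; $\hat\theta_{jk}=0$ for $j\ge J$; and for each level $j_0\le j<J$ separately the following procedure is applied. Let $n_j=2^j$. Let $\pi_j$ be a probability distribution on $\{0,\ldots,2^j\}$ with $\pi_j(\kappa)>0$ for all $\kappa$ (prior on the number of non-zero coefficients at level $j$), let $\tau_j^2/n>0$ be the prior variance of the non-zero coefficients at level $j$, and $\gamma_j=\tau_j^2/\sigma^2$.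 Let $|Y_j|_{(1)}\ge\cdots\ge|Y_j|_{(n_j)}$ be the ordered values of $|Y_{jk}|$, $k=0,\ldots,2^j-1$, and let $\hat\kappa_j\in\{0,\ldots,n_j\}$ be a minimizer over $\kappa$ of $$\sum_{i=\kappa+1}^{n_j}|Y_j|_{(i)}^2+\frac{2\sigma^2}{n}(1+1/\gamma_j)\log\Big\{\binom{n_j}\kappa\pi_j^{-1}(\kappa)(1+\gamma_j)^{\kappa/2}\Big\}.$$ Set $\hat\theta_{jk}=Y_{jk}$ if $|Y_{jk}|\ge|Y_j|_{(\hat\kappa_j)}$ and $\hat\theta_{jk}=0$ otherwise (all $\hat\theta_{jk}=0$ at level $j$ if $\hat\kappa_j=0$). Finally $$\hat f_n(t)=\sum_{k=0}^{C_{j_0}-1}Y_{j_0-1,k}\psi_{j_0-1,k}(t)+\sum_{j=j_0}^{J-1}\sum_{k=0}^{2^j-1}\hat\theta_{jk}\psi_{jk}(t).$$ The constants $\gamma_\pm,c_0,c_1,c_2,c_\alpha$ do not depend on $j$ or $n$. *)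

theory Defs
  imports "HOL-Probability.Probability"
begin

section \<open>Functions on the unit interval\<close>

definition L2_unit :: "(real \<Rightarrow> real) set" where
  "L2_unit = {f. set_borel_measurable lborel {0..1} f \<and> set_integrable lborel {0..1} (\<lambda>t. (f t)\<^sup>2)}"

definition inner_unit :: "(real \<Rightarrow> real) \<Rightarrow> (real \<Rightarrow> real) \<Rightarrow> real" where
  "inner_unit f g = (\<integral>t\<in>{0..1}. f t * g t \<partial>lborel)"

definition sq_dist_unit :: "(real \<Rightarrow> real) \<Rightarrow> (real \<Rightarrow> real) \<Rightarrow> ennreal" where
  "sq_dist_unit f g = (\<integral>\<^sup>+t\<in>{0..1}. ennreal ((f t - g t)\<^sup>2) \<partial>lborel)"


section \<open>Besov balls\<close>

text \<open>Besov spaces are defined through moduli of smoothness, which covers all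
  \<open>0 < p, q \<le> \<infinity>\<close>; the integrability indices are of type \<^typ>\<open>ennreal\<close> so that \<open>\<infinity>\<close> is allowed.\<close>

text \<open>\<open>x\<close> to the power \<open>a\<close>, only used for \<open>a > 0\<close>.\<close>
definition enn_powr :: "ennreal \<Rightarrow> real \<Rightarrow> ennreal" where
  "enn_powr x a = (if x = \<top> then \<top> else ennreal (enn2real x powr a))"

definition Lp_norm :: "ennreal \<Rightarrow> real set \<Rightarrow> (real \<Rightarrow> real) \<Rightarrow> ennreal" where
  "Lp_norm p A f =
    (if p = \<infinity> then esssup (restrict_space lborel A) (\<lambda>x. ennreal \<bar>f x\<bar>)
     else enn_powr (\<integral>\<^sup>+x\<in>A. ennreal (\<bar>f x\<bar> powr enn2real p) \<partial>lborel) (1 / enn2real p))"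

definition fin_diff :: "nat \<Rightarrow> real \<Rightarrow> (real \<Rightarrow> real) \<Rightarrow> real \<Rightarrow> real" where
  "fin_diff m h f x = (\<Sum>i\<le>m. (-1) ^ (m - i) * real (m choose i) * f (x + real i * h))"

text \<open>The interval \<open>[0, 1 - m h]\<close> is the set of \<open>x\<close> for which all nodes \<open>x + i h\<close> lie in \<open>[0,1]\<close>;
  it is empty if \<open>m h > 1\<close>, and the corresponding norm is then \<open>0\<close>.\<close>
definition modulus :: "nat \<Rightarrow> (real \<Rightarrow> real) \<Rightarrow> ennreal \<Rightarrow> real \<Rightarrow> ennreal" where
  "modulus m f p t = (SUP h\<in>{0<..t}. Lp_norm p {0..1 - real m * h} (fin_diff m h f))"

definition besov_seminorm :: "real \<Rightarrow> ennreal \<Rightarrow> ennreal \<Rightarrow> (real \<Rightarrow> real) \<Rightarrow> ennreal" where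
  "besov_seminorm s p q f =
    (let w = (\<lambda>t. ennreal (t powr (-s)) * modulus (nat \<lfloor>s\<rfloor> + 1) f p t) in
     if q = \<infinity> then (SUP t\<in>{0<..}. w t)
     else enn_powr (\<integral>\<^sup>+t\<in>{0<..}. enn_powr (w t) (enn2real q) * ennreal (1 / t) \<partial>lborel)
            (1 / enn2real q))"

definition besov_norm :: "real \<Rightarrow> ennreal \<Rightarrow> ennreal \<Rightarrow> (real \<Rightarrow> real) \<Rightarrow> ennreal" where
  "besov_norm s p q f = Lp_norm p {0..1} f + besov_seminorm s p q f"

definition besov_ball :: "real \<Rightarrow> ennreal \<Rightarrow> ennreal \<Rightarrow> real \<Rightarrow> (real \<Rightarrow> real) set" where
  "besov_ball s p q R = {f \<in> L2_unit. besov_norm s p q f \<le> ennreal R}"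


section \<open>Compactly supported wavelets and boundary-corrected bases\<close>

text \<open>Compactly supported orthonormal scaling function with finite filter \<open>h\<close>
  (two-scale equation).\<close>
definition scaling_function :: "(int \<Rightarrow> real) \<Rightarrow> (real \<Rightarrow> real) \<Rightarrow> bool" where
  "scaling_function h \<phi> \<longleftrightarrow>
     \<phi> \<in> borel_measurable lborel \<and> integrable lborel (\<lambda>x. (\<phi> x)\<^sup>2) \<and>
     bounded {x. \<phi> x \<noteq> 0} \<and>
     (\<integral>x. \<phi> x \<partial>lborel) = 1 \<and>
     (\<forall>m::int. (\<integral>x. \<phi> x * \<phi> (x - of_int m) \<partial>lborel) = (if m = 0 then 1 else 0)) \<and>
     finite {m. h m \<noteq> 0} \<and>
     (\<forall>x. \<phi> x = sqrt 2 * (\<Sum>m | h m \<noteq> 0. h m * \<phi> (2 * x - of_int m)))"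

definition mother_wavelet :: "(int \<Rightarrow> real) \<Rightarrow> (real \<Rightarrow> real) \<Rightarrow> real \<Rightarrow> real" where
  "mother_wavelet h \<phi> x =
     sqrt 2 * (\<Sum>m | h (1 - m) \<noteq> 0. (-1) powi m * h (1 - m) * \<phi> (2 * x - of_int m))"

definition cont_diff :: "nat \<Rightarrow> (real \<Rightarrow> real) \<Rightarrow> bool" where
  "cont_diff r g \<longleftrightarrow>
     (\<exists>D. D 0 = g \<and> (\<forall>i<r. \<forall>x. (D i has_real_derivative D (Suc i) x) (at x)) \<and>
        continuous_on UNIV (D r))"

text \<open>Regularity \<open>r\<close>: \<open>r\<close> continuous derivatives and \<open>r\<close> vanishing moments.\<close>
definition wavelet_regularity :: "nat \<Rightarrow> (real \<Rightarrow> real) \<Rightarrow> (real \<Rightarrow> real) \<Rightarrow> bool" where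
  "wavelet_regularity r \<phi> \<psi> \<longleftrightarrow>
     cont_diff r \<phi> \<and> cont_diff r \<psi> \<and> (\<forall>d<r. (\<integral>x. x ^ d * \<psi> x \<partial>lborel) = 0)"

text \<open>Finite linear combinations of the functions \<open>x \<mapsto> \<phi> (\<rho> x - m)\<close>, \<open>m\<close> an integer.  Edge functions
  are expressed in the rescaled distance \<open>x \<ge> 0\<close> to the end point, so that \<open>\<rho>\<close> is \<open>1\<close> (left) or
  \<open>-1\<close> (right) for scaling functions, and \<open>2\<close> or \<open>-2\<close> for wavelets.\<close>
definition edge_functions :: "(real \<Rightarrow> real) \<Rightarrow> real \<Rightarrow> (real \<Rightarrow> real) set" where
  "edge_functions \<phi> \<rho> =
     {e. \<exists>S c. finite S \<and> e = (\<lambda>x. \<Sum>m\<in>S. c m * \<phi> (\<rho> * x - of_int (m::int)))}"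

text \<open>\<open>G j 0, \<dots>, G j (N j - 1)\<close> are, at every level \<open>j \<ge> j0\<close>: dilations by \<open>2^j\<close> of \<open>a\<close> left edge
  functions, dilations and translations of \<open>g\<close> supported in \<open>[0,1]\<close>, and dilations of \<open>b\<close> right
  edge functions.  The edge functions and the index shift \<open>u\<close> do not depend on \<open>j\<close>.\<close>
definition boundary_adapted ::
  "nat \<Rightarrow> (nat \<Rightarrow> nat) \<Rightarrow> (real \<Rightarrow> real) \<Rightarrow> (real \<Rightarrow> real) set \<Rightarrow> (real \<Rightarrow> real) set \<Rightarrow>
     (nat \<Rightarrow> nat \<Rightarrow> real \<Rightarrow> real) \<Rightarrow> bool" where
  "boundary_adapted j0 N g EL ER G \<longleftrightarrow>
     (\<exists>(a::nat) (b::nat) (u::int) gl gr.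
        (\<forall>i<a. gl i \<in> EL) \<and> (\<forall>i<b. gr i \<in> ER) \<and>
        (\<forall>j\<ge>j0. a + b \<le> N j \<and>
           (\<forall>k<N j. \<forall>t\<in>{0..1}. G j k t = 2 powr (real j / 2) *
              (if k < a then gl k (2 ^ j * t)
               else if k < N j - b then g (2 ^ j * t - (real k + of_int u))
               else gr (N j - 1 - k) (2 ^ j * (1 - t)))) \<and>
           (\<forall>k. a \<le> k \<and> k < N j - b \<longrightarrow>
              (\<forall>t. g (2 ^ j * t - (real k + of_int u)) \<noteq> 0 \<longrightarrow> t \<in> {0..1}))))"

text \<open>Linear span, as functions on \<open>[0,1]\<close>, of \<open>G 0, \<dots>, G (N - 1)\<close>.\<close>
definition span_unit :: "nat \<Rightarrow> (nat \<Rightarrow> real \<Rightarrow> real) \<Rightarrow> (real \<Rightarrow> real) set" where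
  "span_unit N G = {f. \<exists>c. \<forall>t\<in>{0..1}. f t = (\<Sum>k<N. c k * G k t)}"

text \<open>Boundary-corrected orthonormal wavelet basis of Cohen--Daubechies--Vial type.
  With \<open>V j = span_unit (C j) (\<Phi> j)\<close>, the spaces \<open>V j\<close> (\<open>j \<ge> j0\<close>) form a multiresolution analysis of
  \<open>L\<^sup>2[0,1]\<close> containing the polynomials of degree less than \<open>r\<close>, \<open>\<Psi> j\<close> is an orthonormal basis of the
  orthogonal complement of \<open>V j\<close> in \<open>V (j + 1)\<close>, and hence
  \<open>{\<Phi> j0 k | k < C j0} \<union> {\<Psi> j k | j \<ge> j0, k < 2^j}\<close> is an orthonormal basis of \<open>L\<^sup>2[0,1]\<close>.\<close>
definition cdv_basis ::
  "nat \<Rightarrow> (real \<Rightarrow> real) \<Rightarrow> (real \<Rightarrow> real) \<Rightarrow> nat \<Rightarrow> (nat \<Rightarrow> nat) \<Rightarrow>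
     (nat \<Rightarrow> nat \<Rightarrow> real \<Rightarrow> real) \<Rightarrow> (nat \<Rightarrow> nat \<Rightarrow> real \<Rightarrow> real) \<Rightarrow> bool" where
  "cdv_basis r \<phi> \<psi> j0 C \<Phi> \<Psi> \<longleftrightarrow>
     (\<exists>h. scaling_function h \<phi> \<and> \<psi> = mother_wavelet h \<phi>) \<and>
     wavelet_regularity r \<phi> \<psi> \<and>
     boundary_adapted j0 C \<phi> (edge_functions \<phi> 1) (edge_functions \<phi> (-1)) \<Phi> \<and>
     boundary_adapted j0 (\<lambda>j. 2 ^ j) \<psi> (edge_functions \<phi> 2) (edge_functions \<phi> (-2)) \<Psi> \<and>
     (\<forall>j\<ge>j0.
        (\<forall>d<r. (\<lambda>t. t ^ d) \<in> span_unit (C j) (\<Phi> j)) \<and>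
        (\<forall>k<C j. \<forall>l<C j. inner_unit (\<Phi> j k) (\<Phi> j l) = (if k = l then 1 else 0)) \<and>
        (\<forall>k<2 ^ j. \<forall>l<2 ^ j. inner_unit (\<Psi> j k) (\<Psi> j l) = (if k = l then 1 else 0)) \<and>
        (\<forall>k<C j. \<forall>l<2 ^ j. inner_unit (\<Phi> j k) (\<Psi> j l) = 0) \<and>
        span_unit (C (Suc j)) (\<Phi> (Suc j)) =
          {(\<lambda>t. v t + w t) | v w. v \<in> span_unit (C j) (\<Phi> j) \<and> w \<in> span_unit (2 ^ j) (\<Psi> j)}) \<and>
     (\<forall>f\<in>L2_unit. \<forall>e>0. \<exists>j\<ge>j0. \<exists>v\<in>span_unit (C j) (\<Phi> j). sq_dist_unit f v < ennreal e)"


section \<open>The Gaussian white noise model\<close>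

definition wiener_process :: "'a measure \<Rightarrow> (real \<Rightarrow> 'a \<Rightarrow> real) \<Rightarrow> bool" where
  "wiener_process P W \<longleftrightarrow>
     prob_space P \<and>
     (\<forall>t\<in>{0..1}. W t \<in> borel_measurable P) \<and>
     (AE \<omega> in P. W 0 \<omega> = 0) \<and>
     (\<forall>s t. 0 \<le> s \<and> s < t \<and> t \<le> 1 \<longrightarrow>
        distributed P lborel (\<lambda>\<omega>. W t \<omega> - W s \<omega>) (normal_density 0 (sqrt (t - s)))) \<and>
     (\<forall>(m::nat) t. 0 \<le> t 0 \<and> (\<forall>i<m. t i < t (Suc i)) \<and> t m \<le> 1 \<longrightarrow>
        prob_space.indep_vars P (\<lambda>_. borel) (\<lambda>i \<omega>. W (t (Suc i)) \<omega> - W (t i) \<omega>) {..<m}) \<and>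
     (AE \<omega> in P. continuous_on {0..1} (\<lambda>t. W t \<omega>))"

text \<open>\<open>dY(t) = f(t) dt + \<epsilon> dW(t)\<close>, \<open>Y(0) = 0\<close>.\<close>
definition white_noise_obs ::
  "(real \<Rightarrow> real) \<Rightarrow> real \<Rightarrow> (real \<Rightarrow> 'a \<Rightarrow> real) \<Rightarrow> real \<Rightarrow> 'a \<Rightarrow> real" where
  "white_noise_obs f \<epsilon> W t \<omega> = (\<integral>x\<in>{0..t}. f x \<partial>lborel) + \<epsilon> * W t \<omega>"

definition is_partition :: "nat \<Rightarrow> (nat \<Rightarrow> real) \<Rightarrow> bool" where
  "is_partition m t \<longleftrightarrow> 0 \<le> t 0 \<and> (\<forall>i<m. t i < t (Suc i)) \<and> t m \<le> 1"

definition step_fun :: "nat \<Rightarrow> (nat \<Rightarrow> real) \<Rightarrow> (nat \<Rightarrow> real) \<Rightarrow> real \<Rightarrow> real" where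
  "step_fun m t a x = (\<Sum>i<m. a i * indicator {t i<..t (Suc i)} x)"

definition step_integral ::
  "(real \<Rightarrow> 'a \<Rightarrow> real) \<Rightarrow> nat \<Rightarrow> (nat \<Rightarrow> real) \<Rightarrow> (nat \<Rightarrow> real) \<Rightarrow> 'a \<Rightarrow> real" where
  "step_integral Y m t a \<omega> = (\<Sum>i<m. a i * (Y (t (Suc i)) \<omega> - Y (t i) \<omega>))"

text \<open>\<open>I\<close> is a version of the stochastic integral of the deterministic function \<open>g\<close> over \<open>[0,1]\<close> with
  respect to \<open>Y\<close>, that is, the \<open>L\<^sup>2(P)\<close>-limit of integrals of step functions converging to \<open>g\<close> in
  \<open>L\<^sup>2[0,1]\<close>.  For the processes \<^const>\<open>white_noise_obs\<close> with \<open>f \<in> L\<^sup>2[0,1]\<close> such a limit exists for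
  every \<open>g\<close> in \<open>L\<^sup>2[0,1]\<close>, does not depend on the approximating sequence, and is unique almost
  surely.\<close>
definition is_stoch_integral ::
  "'a measure \<Rightarrow> (real \<Rightarrow> 'a \<Rightarrow> real) \<Rightarrow> (real \<Rightarrow> real) \<Rightarrow> ('a \<Rightarrow> real) \<Rightarrow> bool" where
  "is_stoch_integral P Y g I \<longleftrightarrow>
     I \<in> borel_measurable P \<and>
     (\<exists>m t a. (\<forall>i. is_partition (m i) (t i)) \<and>
        (\<lambda>i. sq_dist_unit g (step_fun (m i) (t i) (a i))) \<longlonglongrightarrow> 0 \<and>
        (\<lambda>i. \<integral>\<^sup>+\<omega>. ennreal ((I \<omega> - step_integral Y (m i) (t i) (a i) \<omega>)\<^sup>2) \<partial>P) \<longlonglongrightarrow> 0)"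


section \<open>Level-wise maximum a posteriori estimator\<close>

text \<open>The \<open>i\<close>-th largest of \<open>\<bar>y 0\<bar>, \<dots>, \<bar>y (N - 1)\<bar>\<close>, for \<open>1 \<le> i \<le> N\<close>.\<close>
definition ord_abs :: "nat \<Rightarrow> (nat \<Rightarrow> real) \<Rightarrow> nat \<Rightarrow> real" where
  "ord_abs N y i = rev (sort (map (\<lambda>k. \<bar>y k\<bar>) [0..<N])) ! (i - 1)"

text \<open>Here \<open>v\<close> is the noise variance \<open>\<sigma>\<^sup>2 / n\<close>, and \<open>\<gamma>\<close> the ratio of the prior variance of the non-zero
  coefficients to \<open>v\<close>.\<close>
definition map_criterion ::
  "nat \<Rightarrow> real \<Rightarrow> real \<Rightarrow> nat pmf \<Rightarrow> (nat \<Rightarrow> real) \<Rightarrow> nat \<Rightarrow> real" where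
  "map_criterion N v \<gamma> \<pi> y \<kappa> =
     (\<Sum>i=\<kappa>+1..N. (ord_abs N y i)\<^sup>2) +
     2 * v * (1 + 1 / \<gamma>) *
       ln (real (N choose \<kappa>) * inverse (pmf \<pi> \<kappa>) * (1 + \<gamma>) powr (real \<kappa> / 2))"

definition threshold :: "nat \<Rightarrow> nat \<Rightarrow> (nat \<Rightarrow> real) \<Rightarrow> nat \<Rightarrow> real" where
  "threshold N \<kappa> y k = (if \<kappa> \<noteq> 0 \<and> \<bar>y k\<bar> \<ge> ord_abs N y \<kappa> then y k else 0)"

text \<open>\<open>y0 k\<close> are the empirical scaling coefficients at level \<open>j0\<close>, \<open>y j k\<close> the empirical wavelet
  coefficients, and \<open>K j\<close> selects the number of non-zero coefficients at level \<open>j\<close> from the data of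
  that level.\<close>
definition map_estimator ::
  "nat \<Rightarrow> (nat \<Rightarrow> nat) \<Rightarrow> (nat \<Rightarrow> nat \<Rightarrow> real \<Rightarrow> real) \<Rightarrow> (nat \<Rightarrow> nat \<Rightarrow> real \<Rightarrow> real) \<Rightarrow> nat \<Rightarrow>
     (nat \<Rightarrow> (nat \<Rightarrow> real) \<Rightarrow> nat) \<Rightarrow> (nat \<Rightarrow> real) \<Rightarrow> (nat \<Rightarrow> nat \<Rightarrow> real) \<Rightarrow> real \<Rightarrow> real" where
  "map_estimator j0 C \<Phi> \<Psi> J K y0 y t =
     (\<Sum>k<C j0. y0 k * \<Phi> j0 k t) +
     (\<Sum>j=j0..<J. \<Sum>k<2 ^ j. threshold (2 ^ j) (K j (y j)) (y j) k * \<Psi> j k t)"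

definition L2_risk :: "'a measure \<Rightarrow> ('a \<Rightarrow> real \<Rightarrow> real) \<Rightarrow> (real \<Rightarrow> real) \<Rightarrow> ennreal" where
  "L2_risk P fhat f = (\<integral>\<^sup>+\<omega>. sq_dist_unit (fhat \<omega>) f \<partial>P)"

end

theory Submission
  imports Defs "HOL-Computational_Algebra.Polynomial"
begin

text \<open>On one level, the estimator minimizes a penalized residual sum of squares.  Comparing its criterion
  with that of an arbitrary index set \<open>S\<close> bounds the loss by a multiple of the squared coefficients
  outside \<open>S\<close>, the penalty of \<open>card S\<close>, the noise energy on \<open>S\<close>, and the excess over all \<open>S'\<close> of the
  noise energy on \<open>S'\<close> over \<open>1 - \<delta>\<close> times the penalty of \<open>card S'\<close>.  The expected excess is bounded
  uniformly in the level and the prior: this follows from exponential moments, by a union bound over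
  \<open>S'\<close> if \<open>card S'\<close> is small, by a sharpened union bound for proportional sizes, and by the total
  energy if \<open>S'\<close> is almost everything.

  The wavelet coefficients of a function in a Besov ball are controlled by its finite differences:
  a wavelet is orthogonal to polynomials, and the function is compared with polynomials interpolating
  it on nested dyadic lattices, with an average over the shift of the lattices.  Since \<open>s > 1/p\<close>, the
  contributions of the lattices are summable.

  It remains to choose \<open>S\<close>: all indices up to the level where squared bias and variance balance, and
  on finer levels the largest coefficients, whose number decreases geometrically in the level.\<close>

subsection \<open>Penalized selection\<close>

text \<open>The penalty is calibrated: with exponent
  \<open>a = \<gamma> / (2 * (1 + \<gamma>))\<close> the exponential moment of the noise energy on
  \<kappa> indices is \<open>(1 + \<gamma>) powr (\<kappa> / 2)\<close>, and the union bound over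
  all sets of size \<kappa> gives \<open>pmf \<pi> \<kappa>\<close> up to the factor 1 / a. Nothing
  is left for the factor 1 - \<delta>, without which the products of signal and noise cannot be
  absorbed. The slack has a different source in each range of \<kappa>: a larger exponent, paid for
  by the binomial coefficient, for small sets; the waste of the union bound for proportional ones; a
  smaller exponent, together with (1 + \<gamma>/2)^2 > 1 + \<gamma>, for nearly full ones. On the
  analytic side, the Besov norm is given by moduli of smoothness, and single point values of f carry
  no information. Averaging over the shift of a lattice turns sums of point values into integrals;
  passing from averages to maxima over a level loses the factor \<open>2 ^ l\<close>, which s > 1/p
  compensates.\<close>

definition top_set :: "nat \<Rightarrow> (nat \<Rightarrow> real) \<Rightarrow> nat \<Rightarrow> nat set" where
  "top_set N y \<kappa> = {k\<in>{..<N}. \<kappa> \<noteq> 0 \<and> ord_abs N y \<kappa> \<le> \<bar>y k\<bar>}"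

lemma ord_abs_eq:
  assumes "1 \<le> i" "i \<le> N"
  shows "ord_abs N y i = sort (map (\<lambda>k. \<bar>y k\<bar>) [0..<N]) ! (N - i)"
  using assms by (simp add: ord_abs_def rev_nth)

text \<open>Without ties the sorted absolute values are strictly increasing, so thresholding at the
  \<kappa>-th largest keeps exactly \<kappa> indices, and what it discards is the residual sum in
  the criterion. With ties it could keep more; for the Gaussian coefficients
  \<open>AE_no_ties\<close> excludes them.\<close>

lemma
  assumes inj: "inj_on (\<lambda>k. \<bar>y k\<bar>) {..<N}" and \<kappa>: "\<kappa> \<le> N"
  shows card_top_set: "card (top_set N y \<kappa>) = \<kappa>"
    and sum_ord_abs: "(\<Sum>i=\<kappa>+1..N. (ord_abs N y i)\<^sup>2) = (\<Sum>k\<in>{..<N} - top_set N y \<kappa>. (y k)\<^sup>2)"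
proof -
  define xs where "xs = sort (map (\<lambda>k. \<bar>y k\<bar>) [0..<N])"
  have len: "length xs = N" and srt: "sorted xs"
    and set: "set xs = (\<lambda>k. \<bar>y k\<bar>) ` {..<N}"
    by (auto simp: xs_def atLeast0LessThan)
  have dist: "distinct xs"
    using inj by (simp add: xs_def distinct_map atLeast0LessThan)
  have ge: "{x\<in>set xs. \<kappa> \<noteq> 0 \<and> ord_abs N y \<kappa> \<le> x} = set (drop (N - \<kappa>) xs)"
  proof (cases "\<kappa> = 0")
    case False
    then have "ord_abs N y \<kappa> = xs ! (N - \<kappa>)"
      using ord_abs_eq[of \<kappa> N y] \<kappa> by (simp add: xs_def)
    moreover have "xs ! a \<le> xs ! b \<longleftrightarrow> a \<le> b" if "a < N" "b < N" for a b
      using srt dist that len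
      by (metis linorder_le_cases nth_eq_iff_index_eq order_antisym sorted_nth_mono)
    ultimately have *: "ord_abs N y \<kappa> \<le> xs ! b \<longleftrightarrow> N - \<kappa> \<le> b" if "b < N" for b
      using that False \<kappa> by (metis diff_less neq0_conv order_less_le_trans)
    show ?thesis
    proof (intro subset_antisym subsetI)
      fix x assume x: "x \<in> {x\<in>set xs. \<kappa> \<noteq> 0 \<and> ord_abs N y \<kappa> \<le> x}"
      then obtain b where b: "b < N" "x = xs ! b" using len by (auto simp: in_set_conv_nth)
      then have "N - \<kappa> \<le> b" using x * by auto
      then have "x = drop (N - \<kappa>) xs ! (b - (N - \<kappa>))" "b - (N - \<kappa>) < length (drop (N - \<kappa>) xs)"
        using b len by auto
      then show "x \<in> set (drop (N - \<kappa>) xs)" by (metis nth_mem)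
    next
      fix x assume "x \<in> set (drop (N - \<kappa>) xs)"
      then obtain c where c: "c < \<kappa>" "x = xs ! (N - \<kappa> + c)" using len \<kappa> by (auto simp: in_set_conv_nth)
      then have "N - \<kappa> + c < N" using \<kappa> by linarith
      then show "x \<in> {x\<in>set xs. \<kappa> \<noteq> 0 \<and> ord_abs N y \<kappa> \<le> x}"
        using c * False len by auto
    qed
  qed (use len in auto)
  have img: "(\<lambda>k. \<bar>y k\<bar>) ` top_set N y \<kappa> = set (drop (N - \<kappa>) xs)"
    unfolding ge[symmetric] set top_set_def by auto
  have inj': "inj_on (\<lambda>k. \<bar>y k\<bar>) A" if "A \<subseteq> {..<N}" for A
    using inj that by (rule inj_on_subset)
  have "card (top_set N y \<kappa>) = card (set (drop (N - \<kappa>) xs))"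
    unfolding img[symmetric] by (rule card_image[symmetric], rule inj') (auto simp: top_set_def)
  also have "\<dots> = \<kappa>" using dist \<kappa> len by (simp add: distinct_card)
  finally show "card (top_set N y \<kappa>) = \<kappa>" .
  have "(\<lambda>k. \<bar>y k\<bar>) ` ({..<N} - top_set N y \<kappa>) = set xs - set (drop (N - \<kappa>) xs)"
    unfolding img[symmetric] set
    by (rule inj_on_image_set_diff[OF inj]) (auto simp: top_set_def)
  also have "\<dots> = set (take (N - \<kappa>) xs)"
    using dist set_take_disj_set_drop_if_distinct[OF dist order_refl, of "N - \<kappa>"]
    by (metis Diff_cancel Diff_empty Un_Diff append_take_drop_id set_append Diff_triv sup_bot.right_neutral)
  finally have img2: "(\<lambda>k. \<bar>y k\<bar>) ` ({..<N} - top_set N y \<kappa>) = set (take (N - \<kappa>) xs)" .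
  have "(\<Sum>k\<in>{..<N} - top_set N y \<kappa>. (y k)\<^sup>2) = (\<Sum>x\<in>set (take (N - \<kappa>) xs). x\<^sup>2)"
    unfolding img2[symmetric] by (subst sum.reindex) (auto intro!: inj')
  also have "\<dots> = (\<Sum>i<N - \<kappa>. (xs ! i)\<^sup>2)"
    using dist len
    by (simp add: sum.distinct_set_conv_list sum_list_sum_nth atLeast0LessThan)
  also have "\<dots> = (\<Sum>i=\<kappa>+1..N. (ord_abs N y i)\<^sup>2)"
    by (rule sum.reindex_bij_witness[of _ "\<lambda>i. N - i" "\<lambda>i. N - i"])
       (use \<kappa> in \<open>auto simp: ord_abs_eq xs_def\<close>)
  finally show "(\<Sum>i=\<kappa>+1..N. (ord_abs N y i)\<^sup>2) = (\<Sum>k\<in>{..<N} - top_set N y \<kappa>. (y k)\<^sup>2)" ..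
qed

text \<open>Exchange argument: with T the top set of size \<open>card S\<close>, the sets
  \<open>S - T\<close> and \<open>T - S\<close> have equally many elements, the squares in the
  former are at most the squared threshold, and those in the latter at least.\<close>

lemma sum_sq_le_top_set:
  assumes inj: "inj_on (\<lambda>k. \<bar>y k\<bar>) {..<N}" and S: "S \<subseteq> {..<N}"
  shows "(\<Sum>k\<in>S. (y k)\<^sup>2) \<le> (\<Sum>k\<in>top_set N y (card S). (y k)\<^sup>2)"
\<comment> \<open>The threshold argument needs a positive size: \<open>ord_abs N y 0\<close> is, by
  truncated subtraction, the largest value.\<close>
proof (cases "card S = 0")
  case True
  then show ?thesis using S finite_subset[OF S] by (auto intro!: sum_nonneg)
next
  case False
  let ?T = "top_set N y (card S)" and ?c = "(ord_abs N y (card S))\<^sup>2"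
  have finS: "finite S" using S finite_subset by auto
  have cS: "card S \<le> N" using card_mono[OF _ S] by simp
  have finT: "finite ?T" by (simp add: top_set_def)
  have cT: "card ?T = card S" by (rule card_top_set[OF inj cS])
  have "0 \<le> ord_abs N y (card S)"
  proof -
    have "sort (map (\<lambda>k. \<bar>y k\<bar>) [0..<N]) ! (N - card S) \<in> set (sort (map (\<lambda>k. \<bar>y k\<bar>) [0..<N]))"
      using False cS by (intro nth_mem) auto
    then show ?thesis using ord_abs_eq[of "card S" N y] False cS by auto
  qed
  then have lo: "(y k)\<^sup>2 \<le> ?c" if "k \<in> S - ?T" for k
    using that S False by (auto simp: top_set_def subset_iff abs_le_square_iff[symmetric])
  have hi: "?c \<le> (y k)\<^sup>2" if "k \<in> ?T - S" for k
    using that \<open>0 \<le> ord_abs N y (card S)\<close> by (auto simp: top_set_def abs_le_square_iff[symmetric])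
  have "card (S - ?T) = card (?T - S)"
    using cT finS finT by (simp add: card_Diff_subset_Int Int_commute)
  have "(\<Sum>k\<in>S. (y k)\<^sup>2) = (\<Sum>k\<in>S \<inter> ?T. (y k)\<^sup>2) + (\<Sum>k\<in>S - ?T. (y k)\<^sup>2)"
    using finS by (rule sum.Int_Diff)
  also have "(\<Sum>k\<in>S - ?T. (y k)\<^sup>2) \<le> of_nat (card (S - ?T)) * ?c"
    using lo by (rule sum_bounded_above)
  also have "\<dots> = of_nat (card (?T - S)) * ?c" using \<open>card (S - ?T) = _\<close> by simp
  also have "\<dots> \<le> (\<Sum>k\<in>?T - S. (y k)\<^sup>2)"
    using hi by (rule sum_bounded_below)
  also have "(\<Sum>k\<in>S \<inter> ?T. (y k)\<^sup>2) + (\<Sum>k\<in>?T - S. (y k)\<^sup>2) = (\<Sum>k\<in>?T. (y k)\<^sup>2)"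
    using sum.Int_Diff[OF finT, of "\<lambda>k. (y k)\<^sup>2" S] by (simp add: Int_commute)
  finally show ?thesis by simp
qed

lemma sum_threshold:
  "(\<Sum>k<N. (threshold N \<kappa> y k - \<theta> k)\<^sup>2) =
     (\<Sum>k\<in>top_set N y \<kappa>. (y k - \<theta> k)\<^sup>2) + (\<Sum>k\<in>{..<N} - top_set N y \<kappa>. (\<theta> k)\<^sup>2)"
proof -
  have "(\<Sum>k<N. (threshold N \<kappa> y k - \<theta> k)\<^sup>2) =
      (\<Sum>k\<in>{..<N} \<inter> top_set N y \<kappa>. (threshold N \<kappa> y k - \<theta> k)\<^sup>2) +
      (\<Sum>k\<in>{..<N} - top_set N y \<kappa>. (threshold N \<kappa> y k - \<theta> k)\<^sup>2)"
    by (rule sum.Int_Diff) simp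
  also have "{..<N} \<inter> top_set N y \<kappa> = top_set N y \<kappa>" by (auto simp: top_set_def)
  also have "(\<Sum>k\<in>top_set N y \<kappa>. (threshold N \<kappa> y k - \<theta> k)\<^sup>2) = (\<Sum>k\<in>top_set N y \<kappa>. (y k - \<theta> k)\<^sup>2)"
    by (rule sum.cong) (auto simp: top_set_def threshold_def)
  also have "(\<Sum>k\<in>{..<N} - top_set N y \<kappa>. (threshold N \<kappa> y k - \<theta> k)\<^sup>2) =
      (\<Sum>k\<in>{..<N} - top_set N y \<kappa>. (\<theta> k)\<^sup>2)"
    by (rule sum.cong) (auto simp: top_set_def threshold_def)
  finally show ?thesis .
qed

text \<open>Young's inequality; the weight decides how much of a product of signal and noise is
  charged to the noise.\<close>

lemma two_mult_le_weighted:
  fixes a b w :: real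
  assumes "0 < w"
  shows "2 * (a * b) \<le> a\<^sup>2 / w + w * b\<^sup>2"
proof -
  have "0 \<le> (a - w * b)\<^sup>2 / w" using assms by simp
  also have "\<dots> = a\<^sup>2 / w + w * b\<^sup>2 - 2 * (a * b)"
    using assms by (simp add: power2_eq_square field_simps)
  finally show ?thesis by simp
qed

text \<open>A deterministic oracle inequality. All randomness is in the hypothesis on the noise,
  which must hold for every index set at once because the selected set depends on the noise. The
  comparison set S is arbitrary and is later chosen from the unknown coefficients.\<close>

lemma penalized_selection_loss:
  fixes y \<theta> e :: "nat \<Rightarrow> real" and pen :: "nat \<Rightarrow> real"
  assumes inj: "inj_on (\<lambda>k. \<bar>y k\<bar>) {..<N}"
    and y: "\<And>k. k < N \<Longrightarrow> y k = \<theta> k + e k"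
    and min: "is_arg_min (\<lambda>\<kappa>. (\<Sum>i=\<kappa>+1..N. (ord_abs N y i)\<^sup>2) + pen \<kappa>) (\<lambda>\<kappa>. \<kappa> \<le> N) \<kappa>"
    and \<delta>: "0 < \<delta>" "\<delta> \<le> 1 / 2"
    and noise: "\<And>S. S \<subseteq> {..<N} \<Longrightarrow> (\<Sum>k\<in>S. (e k)\<^sup>2) \<le> (1 - \<delta>) * pen (card S) + R"
    and pen: "\<And>\<kappa>. \<kappa> \<le> N \<Longrightarrow> 0 \<le> pen \<kappa>" and R: "0 \<le> R" and S: "S \<subseteq> {..<N}"
  shows "(\<Sum>k<N. (threshold N \<kappa> y k - \<theta> k)\<^sup>2) \<le>
    2 / \<delta> * (1 + 2 / \<delta>) * ((\<Sum>k\<in>{..<N} - S. (\<theta> k)\<^sup>2) + pen (card S) + (\<Sum>k\<in>S. (e k)\<^sup>2) + R)"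
proof -
  let ?T = "top_set N y \<kappa>"
  have \<kappa>: "\<kappa> \<le> N" using min by (auto simp: is_arg_min_def)
  have cS: "card S \<le> N" using card_mono[OF _ S] by simp
  have T: "?T \<subseteq> {..<N}" by (auto simp: top_set_def)
  have fin: "finite S" "finite ?T" using S T finite_subset by auto
  have cT: "card ?T = \<kappa>" by (rule card_top_set[OF inj \<kappa>])
  define B where "B = (\<Sum>k\<in>{..<N} - ?T. (\<theta> k)\<^sup>2)"
  define V where "V = (\<Sum>k\<in>?T. (e k)\<^sup>2)"
  define b where "b = (\<Sum>k\<in>{..<N} - S. (\<theta> k)\<^sup>2)"
  define V0 where "V0 = (\<Sum>k\<in>S. (e k)\<^sup>2)"
  have nonneg: "0 \<le> B" "0 \<le> V" "0 \<le> b" "0 \<le> V0"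
    by (auto simp: B_def V_def b_def V0_def intro!: sum_nonneg)
  have compl: "(\<Sum>k\<in>{..<N} - A. (y k)\<^sup>2) = (\<Sum>k<N. (y k)\<^sup>2) - (\<Sum>k\<in>A. (y k)\<^sup>2)"
    if "A \<subseteq> {..<N}" for A
    using sum_diff[OF _ that, of "\<lambda>k. (y k)\<^sup>2"] by simp
  \<comment> \<open>Optimality compares \<kappa> with the size of S; the comparison extends to S
    itself, because the top set of that size leaves the smallest residual.\<close>
  have "(\<Sum>k\<in>{..<N} - ?T. (y k)\<^sup>2) + pen \<kappa> \<le> (\<Sum>i=card S+1..N. (ord_abs N y i)\<^sup>2) + pen (card S)"
    using min cS sum_ord_abs[OF inj \<kappa>] by (auto simp: is_arg_min_linorder)
  also have "(\<Sum>i=card S+1..N. (ord_abs N y i)\<^sup>2) = (\<Sum>k\<in>{..<N} - top_set N y (card S). (y k)\<^sup>2)"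
    by (rule sum_ord_abs[OF inj cS])
  also have "\<dots> \<le> (\<Sum>k\<in>{..<N} - S. (y k)\<^sup>2)"
  proof -
    have "top_set N y (card S) \<subseteq> {..<N}" by (auto simp: top_set_def)
    then show ?thesis using sum_sq_le_top_set[OF inj S] compl[OF S] compl by simp
  qed
  finally have basic: "pen \<kappa> + (\<Sum>k\<in>S. (y k)\<^sup>2) \<le> pen (card S) + (\<Sum>k\<in>?T. (y k)\<^sup>2)"
    using compl[OF S] compl[OF T] by simp
  have splitS: "(\<Sum>k\<in>S. g k) = (\<Sum>k\<in>S \<inter> ?T. g k) + (\<Sum>k\<in>S - ?T. g k)" for g :: "nat \<Rightarrow> real"
    using fin by (intro sum.Int_Diff)
  have splitT: "(\<Sum>k\<in>?T. g k) = (\<Sum>k\<in>S \<inter> ?T. g k) + (\<Sum>k\<in>?T - S. g k)" for g :: "nat \<Rightarrow> real"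
    using sum.Int_Diff[OF fin(2), of g S] by (simp add: Int_commute)
  have "(\<Sum>k\<in>?T - S. (y k)\<^sup>2) = (\<Sum>k\<in>?T - S. (\<theta> k)\<^sup>2 + 2 * (\<theta> k * e k) + (e k)\<^sup>2)"
    using T y by (intro sum.cong) (auto simp: power2_eq_square algebra_simps)
  \<comment> \<open>On the selected indices the noise may be charged at most 1 + \<delta> times,
    hence the small weight \<delta> / 2; the bias there is part of b and may get the large
    factor.\<close>
  also have "\<dots> \<le> (\<Sum>k\<in>?T - S. (\<theta> k)\<^sup>2 + ((\<theta> k)\<^sup>2 / (\<delta> / 2) + \<delta> / 2 * (e k)\<^sup>2) + (e k)\<^sup>2)"
    using \<delta> by (intro sum_mono add_mono order_refl two_mult_le_weighted) auto
  also have "\<dots> = (1 + 2 / \<delta>) * (\<Sum>k\<in>?T - S. (\<theta> k)\<^sup>2) + (1 + \<delta> / 2) * (\<Sum>k\<in>?T - S. (e k)\<^sup>2)"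
    unfolding sum_distrib_left sum.distrib[symmetric] using \<delta> by (intro sum.cong) (auto simp: field_simps)
  also have "(\<Sum>k\<in>?T - S. (e k)\<^sup>2) \<le> V"
    unfolding V_def using fin by (intro sum_mono2) auto
  finally have 1: "(\<Sum>k\<in>?T - S. (y k)\<^sup>2) \<le> (1 + 2 / \<delta>) * (\<Sum>k\<in>?T - S. (\<theta> k)\<^sup>2) + (1 + \<delta> / 2) * V"
    using \<delta> by simp
  \<comment> \<open>The noise on S is allowed on the right-hand side with any constant, so the fixed
    weight 2 does, and half of the bias survives.\<close>
  have "(\<Sum>k\<in>S - ?T. (y k)\<^sup>2) \<ge> (\<Sum>k\<in>S - ?T. (\<theta> k)\<^sup>2 - ((\<theta> k)\<^sup>2 / 2 + 2 * (e k)\<^sup>2))"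
  proof (rule sum_mono)
    fix k assume "k \<in> S - ?T"
    then have "y k = \<theta> k + e k" using S y by auto
    then have "(y k)\<^sup>2 = (\<theta> k)\<^sup>2 + 2 * (\<theta> k * e k) + (e k)\<^sup>2"
      by (simp add: power2_eq_square algebra_simps)
    moreover have "- (2 * (\<theta> k * e k)) \<le> (\<theta> k)\<^sup>2 / 2 + 2 * (e k)\<^sup>2"
      using two_mult_le_weighted[of 2 "\<theta> k" "- e k"] by simp
    moreover have "0 \<le> (e k)\<^sup>2" by simp
    ultimately show "(\<theta> k)\<^sup>2 - ((\<theta> k)\<^sup>2 / 2 + 2 * (e k)\<^sup>2) \<le> (y k)\<^sup>2" by linarith
  qed
  moreover have "(\<Sum>k\<in>S - ?T. (\<theta> k)\<^sup>2 - ((\<theta> k)\<^sup>2 / 2 + 2 * (e k)\<^sup>2)) =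
      (\<Sum>k\<in>S - ?T. (\<theta> k)\<^sup>2) / 2 - 2 * (\<Sum>k\<in>S - ?T. (e k)\<^sup>2)"
    unfolding sum_distrib_left sum_divide_distrib sum_subtractf[symmetric] by (intro sum.cong) auto
  moreover have "(\<Sum>k\<in>S - ?T. (e k)\<^sup>2) \<le> V0"
    unfolding V0_def using fin by (intro sum_mono2) auto
  ultimately have 2: "(\<Sum>k\<in>S - ?T. (y k)\<^sup>2) \<ge> (\<Sum>k\<in>S - ?T. (\<theta> k)\<^sup>2) / 2 - 2 * V0" by linarith
  have disj: "({..<N} - (S \<union> ?T)) \<inter> (S - ?T) = {}" "({..<N} - (S \<union> ?T)) \<inter> (?T - S) = {}" by auto
  have part: "B = (\<Sum>k\<in>{..<N} - (S \<union> ?T). (\<theta> k)\<^sup>2) + (\<Sum>k\<in>S - ?T. (\<theta> k)\<^sup>2)"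
      "b = (\<Sum>k\<in>{..<N} - (S \<union> ?T). (\<theta> k)\<^sup>2) + (\<Sum>k\<in>?T - S. (\<theta> k)\<^sup>2)"
  proof -
    have "{..<N} - ?T = ({..<N} - (S \<union> ?T)) \<union> (S - ?T)" "{..<N} - S = ({..<N} - (S \<union> ?T)) \<union> (?T - S)"
      using S T by auto
    then show "B = (\<Sum>k\<in>{..<N} - (S \<union> ?T). (\<theta> k)\<^sup>2) + (\<Sum>k\<in>S - ?T. (\<theta> k)\<^sup>2)"
        "b = (\<Sum>k\<in>{..<N} - (S \<union> ?T). (\<theta> k)\<^sup>2) + (\<Sum>k\<in>?T - S. (\<theta> k)\<^sup>2)"
      unfolding B_def b_def using fin disj
      by (simp_all only: sum.union_disjoint finite_Diff finite_lessThan)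
  qed
  define r where "r = (\<Sum>k\<in>{..<N} - (S \<union> ?T). (\<theta> k)\<^sup>2)"
  have r: "0 \<le> r" unfolding r_def by (auto intro!: sum_nonneg)
  have D: "(\<Sum>k\<in>?T - S. (\<theta> k)\<^sup>2) \<ge> 0" by (auto intro!: sum_nonneg)
  have main: "B / 2 + pen \<kappa> \<le> (1 + 2 / \<delta>) * b + pen (card S) + (1 + \<delta> / 2) * V + 2 * V0"
  proof -
    have "pen \<kappa> + (\<Sum>k\<in>S - ?T. (y k)\<^sup>2) \<le> pen (card S) + (\<Sum>k\<in>?T - S. (y k)\<^sup>2)"
      using basic by (simp add: splitS[of "\<lambda>k. (y k)\<^sup>2"] splitT[of "\<lambda>k. (y k)\<^sup>2"])
    \<comment> \<open>The bias r outside both sets cancels in the comparison of criteria, but is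
      contained in B as well as in b.\<close>
    moreover have "r / 2 \<le> (1 + 2 / \<delta>) * r"
    proof -
      have "1 / 2 * r \<le> (1 + 2 / \<delta>) * r" using r \<delta> by (intro mult_right_mono) (auto simp: field_simps)
      then show ?thesis by simp
    qed
    moreover have "(1 + 2 / \<delta>) * b = (1 + 2 / \<delta>) * r + (1 + 2 / \<delta>) * (\<Sum>k\<in>?T - S. (\<theta> k)\<^sup>2)"
      unfolding part(2) r_def by (rule distrib_left)
    moreover have "B / 2 = r / 2 + (\<Sum>k\<in>S - ?T. (\<theta> k)\<^sup>2) / 2"
      unfolding part(1) r_def by (rule add_divide_distrib)
    ultimately show ?thesis
      using 1 2 by linarith
  qed
  \<comment> \<open>Since (1 + \<delta>) (1 - \<delta>) \<le> 1, the penalty of the selected set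
    pays for (1 + \<delta>) V, of which \<open>main\<close> uses only (1 + \<delta>/2) V; the
    difference remains on the left.\<close>
  have "V \<le> (1 - \<delta>) * pen \<kappa> + R"
    using noise[OF T] cT by (simp add: V_def)
  moreover have "(1 + \<delta>) * (1 - \<delta>) * pen \<kappa> \<le> 1 * pen \<kappa>"
    using pen[OF \<kappa>] \<delta> by (intro mult_right_mono) (auto simp: algebra_simps)
  ultimately have "(1 + \<delta>) * V \<le> pen \<kappa> + (1 + \<delta>) * R"
    using mult_left_mono[of V "(1 - \<delta>) * pen \<kappa> + R" "1 + \<delta>"] \<delta> by (simp add: algebra_simps)
  moreover have "(1 + \<delta>) * R \<le> 2 * R" using R \<delta> by (intro mult_right_mono) auto
  ultimately have "B / 2 + \<delta> / 2 * V \<le> (1 + 2 / \<delta>) * b + pen (card S) + 2 * V0 + 2 * R"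
    using main by (simp add: algebra_simps)
  moreover have "\<delta> / 2 * B \<le> B / 2" using nonneg \<delta> by (simp add: mult_left_le_one_le)
  moreover have "(1 + 2 / \<delta>) * (b + pen (card S) + V0 + R) \<ge> (1 + 2 / \<delta>) * b + pen (card S) + 2 * V0 + 2 * R"
  proof -
    have "1 + 2 / \<delta> \<ge> 2" using \<delta> by (simp add: field_simps)
    then have "(1 + 2 / \<delta>) * pen (card S) \<ge> 2 * pen (card S)" "(1 + 2 / \<delta>) * V0 \<ge> 2 * V0"
      "(1 + 2 / \<delta>) * R \<ge> 2 * R"
      using pen[OF cS] R nonneg by (auto intro!: mult_right_mono)
    then show ?thesis using pen[OF cS] unfolding distrib_left by linarith
  qed
  ultimately have "\<delta> / 2 * (B + V) \<le> (1 + 2 / \<delta>) * (b + pen (card S) + V0 + R)"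
    by (simp add: distrib_left)
  then have "B + V \<le> 2 / \<delta> * ((1 + 2 / \<delta>) * (b + pen (card S) + V0 + R))"
    using \<delta> by (simp add: field_simps)
  moreover have "(\<Sum>k\<in>?T. (y k - \<theta> k)\<^sup>2) = V"
    unfolding V_def using T y by (intro sum.cong) auto
  ultimately show ?thesis
    unfolding sum_threshold B_def[symmetric] b_def[symmetric] V0_def[symmetric] by (simp only: mult.assoc add.commute[of V B])
qed

subsection \<open>Domination of the noise energy by the penalty\<close>

text \<open>Of the N + 1 binomial probabilities with success probability \<kappa> / N, which add up
  to 1, the one at \<kappa> is the largest. This replaces Stirling's formula: the binomial
  coefficient is its entropy bound up to the factor N + 1.\<close>

lemma binomial_mode_bound:
  fixes N \<kappa> :: nat
  assumes \<kappa>: "0 < \<kappa>" "\<kappa> < N"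
  defines "x \<equiv> real \<kappa> / real N"
  shows "1 \<le> (real N + 1) * (real (N choose \<kappa>) * x ^ \<kappa> * (1 - x) ^ (N - \<kappa>))"
proof -
  define b where "b k = real (N choose k) * x ^ k * (1 - x) ^ (N - k)" for k
  have x: "0 < x" "x < 1" using \<kappa> by (auto simp: x_def)
  have b0: "0 \<le> b k" for k using x by (simp add: b_def)
  \<comment> \<open>The ratio of consecutive probabilities, with denominators cleared; it passes 1
    at \<kappa>.\<close>
  have step: "b (Suc k) * (real (Suc k) * (real N - real \<kappa>)) = b k * (real (N - k) * real \<kappa>)" if "k < N" for k
  proof -
    have "Suc k * (N choose Suc k) = (N - k) * (N choose k)"
      using binomial_absorption[of k N] binomial_absorb_comp[of N k] by simp
    then have e: "real (Suc k) * real (N choose Suc k) = real (N - k) * real (N choose k)"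
      by (metis of_nat_mult)
    have "N - k = Suc (N - Suc k)" using that by simp
    then have p: "(1 - x) ^ (N - k) = (1 - x) * (1 - x) ^ (N - Suc k)" by simp
    have "b (Suc k) * (real (Suc k) * (1 - x)) = b k * (real (N - k) * x)"
    proof -
      have "b (Suc k) * (real (Suc k) * (1 - x)) =
          (real (Suc k) * real (N choose Suc k)) * (x * x ^ k * (1 - x) * (1 - x) ^ (N - Suc k))"
        unfolding b_def power_Suc by (simp only: mult_ac)
      also have "\<dots> = b k * (real (N - k) * x)" unfolding e b_def p by (simp only: mult_ac)
      finally show ?thesis .
    qed
    moreover have "1 - x = (real N - real \<kappa>) / real N" using \<kappa> by (simp add: x_def field_simps)
    ultimately show ?thesis using \<kappa> unfolding x_def by (simp add: field_simps)
  qed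
  have up: "b k \<le> b (Suc k)" if "k < \<kappa>" for k
  proof -
    have k: "k < N" using that \<kappa> by simp
    have "real (Suc k) * (real N - real \<kappa>) \<le> real (N - k) * real \<kappa>"
      using that \<kappa> k by (subst mult.commute, intro mult_mono) auto
    then have "b k * (real (Suc k) * (real N - real \<kappa>)) \<le> b (Suc k) * (real (Suc k) * (real N - real \<kappa>))"
      unfolding step[OF k] using b0 by (intro mult_left_mono) auto
    then show ?thesis using \<kappa> by (subst (asm) mult_le_cancel_right_pos) auto
  qed
  have down: "b (Suc k) \<le> b k" if "\<kappa> \<le> k" "k < N" for k
  proof -
    have "real (N - k) * real \<kappa> \<le> real (Suc k) * (real N - real \<kappa>)"
      using that \<kappa> by (subst mult.commute, intro mult_mono) auto
    then have "b (Suc k) * (real (Suc k) * (real N - real \<kappa>)) \<le> b k * (real (Suc k) * (real N - real \<kappa>))"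
      unfolding step[OF that(2)] using b0 by (intro mult_left_mono) auto
    then show ?thesis using \<kappa> by (subst (asm) mult_le_cancel_right_pos) auto
  qed
  have lo: "b (\<kappa> - i) \<le> b \<kappa>" if "i \<le> \<kappa>" for i
    using that
  proof (induction i)
    case (Suc i)
    have "b (\<kappa> - Suc i) \<le> b (Suc (\<kappa> - Suc i))" using Suc.prems by (intro up) simp
    also have "Suc (\<kappa> - Suc i) = \<kappa> - i" using Suc.prems by simp
    finally show ?case using Suc by simp
  qed simp
  have hi: "b (\<kappa> + i) \<le> b \<kappa>" if "\<kappa> + i \<le> N" for i
    using that
  proof (induction i)
    case (Suc i)
    have "b (\<kappa> + Suc i) \<le> b (\<kappa> + i)" using Suc.prems by (simp add: down)
    then show ?case using Suc by simp
  qed simp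
  have le: "b k \<le> b \<kappa>" if "k \<le> N" for k
    using lo[of "\<kappa> - k"] hi[of "k - \<kappa>"] that by (cases "k \<le> \<kappa>") auto
  have "1 = (x + (1 - x)) ^ N" by simp
  also have "\<dots> = (\<Sum>k\<le>N. b k)" unfolding b_def by (rule binomial_ring)
  also have "\<dots> \<le> of_nat (card {..N}) * b \<kappa>" using le by (intro sum_bounded_above) auto
  finally show ?thesis by (simp add: b_def add.commute)
qed

text \<open>The penalty of \<^const>\<open>map_criterion\<close> in units of the noise variance.\<close>
definition map_pen :: "nat \<Rightarrow> real \<Rightarrow> nat pmf \<Rightarrow> nat \<Rightarrow> real" where
  "map_pen N \<gamma> \<pi> \<kappa> =
     2 * (1 + 1 / \<gamma>) * ln (real (N choose \<kappa>) * inverse (pmf \<pi> \<kappa>) * (1 + \<gamma>) powr (real \<kappa> / 2))"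

lemma map_pen_eq:
  assumes "\<gamma> > 0" "\<kappa> \<le> N" "pmf \<pi> \<kappa> > 0"
  shows "map_pen N \<gamma> \<pi> \<kappa> =
    2 * (1 + 1 / \<gamma>) * (ln (real (N choose \<kappa>)) + (- ln (pmf \<pi> \<kappa>)) + real \<kappa> * (ln (1 + \<gamma>) / 2))"
  using assms unfolding map_pen_def
  by (simp add: ln_mult ln_inverse ln_powr zero_less_binomial_iff)

lemma ln_binomial_nonneg: "\<kappa> \<le> N \<Longrightarrow> 0 \<le> ln (real (N choose \<kappa>))"
  by (simp add: Suc_leI zero_less_binomial_iff)

text \<open>Because of ln (1 + \<gamma>) \<ge> \<gamma> / (1 + \<gamma>), the last summand of the
  penalty alone suffices. Hence the expected noise energy on a comparison set, of the order of its
  cardinality, is absorbed by the penalty of that set.\<close>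

lemma map_pen_ge:
  assumes "\<gamma> > 0" "\<kappa> \<le> N" "pmf \<pi> \<kappa> > 0"
  shows "real \<kappa> \<le> map_pen N \<gamma> \<pi> \<kappa>"
proof -
  have "\<gamma> / (1 + \<gamma>) \<le> ln (1 + \<gamma>)"
    using ln_ge_iff ln_one_minus_pos_lower_bound ln_diff_le[of 1 "1 + \<gamma>"] assms
    by (simp add: field_simps)
  then have "1 \<le> (1 + 1 / \<gamma>) * ln (1 + \<gamma>)"
    using assms by (simp add: field_simps)
  then have "real \<kappa> * 1 \<le> real \<kappa> * ((1 + 1 / \<gamma>) * ln (1 + \<gamma>))" by (intro mult_left_mono) auto
  also have "\<dots> = 2 * (1 + 1 / \<gamma>) * (real \<kappa> * (ln (1 + \<gamma>) / 2))" by simp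
  also have "\<dots> \<le> map_pen N \<gamma> \<pi> \<kappa>"
    unfolding map_pen_eq[OF assms]
    using ln_binomial_nonneg[OF assms(2)] assms pmf_le_1[of \<pi> \<kappa>]
    by (intro mult_left_mono) auto
  finally show ?thesis by simp
qed

text \<open>From t \<le> exp t at t = a (u - q). The excess of u over a level q is bounded by an
  exponential, so that expectations follow from exponential moments without integrating tail
  probabilities.\<close>

lemma le_add_exp_div:
  fixes a q u :: real
  assumes "0 < a"
  shows "u \<le> q + exp (a * u - a * q) / a"
proof -
  have "a * (u - q) \<le> exp (a * (u - q))" using exp_ge_add_one_self[of "a * (u - q)"] by linarith
  then have "u - q \<le> exp (a * (u - q)) / a" using assms by (simp add: field_simps)
  then show ?thesis by (simp add: right_diff_distrib)
qed

text \<open>Squared noise restricted to index sets \<open>S\<close>, known only through its exponential moments,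
  which are those of independent standard normal variables.\<close>
locale chi_square_family =
  fixes M :: "'a measure" and N :: nat and z :: "nat \<Rightarrow> 'a \<Rightarrow> real"
  assumes z_meas [measurable]: "\<And>k. k < N \<Longrightarrow> z k \<in> borel_measurable M"
    and z_exp: "\<And>S a. S \<subseteq> {..<N} \<Longrightarrow> 0 < a \<Longrightarrow> a < 1 / 2 \<Longrightarrow>
      (\<integral>\<^sup>+\<omega>. ennreal (exp (a * (\<Sum>k\<in>S. (z k \<omega>)\<^sup>2))) \<partial>M) \<le> ennreal ((1 - 2 * a) powr (- real (card S) / 2))"
begin

lemma energy_meas: "S \<subseteq> {..<N} \<Longrightarrow> (\<lambda>\<omega>. \<Sum>k\<in>S. (z k \<omega>)\<^sup>2) \<in> borel_measurable M"
  by (intro borel_measurable_sum borel_measurable_power z_meas) auto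

text \<open>R stands in for the largest excess over the level q among the sets of size \<kappa>; an
  explicit majorant with a known integral is easier to handle than that maximum.\<close>

definition dominates :: "nat \<Rightarrow> real \<Rightarrow> ('a \<Rightarrow> real) \<Rightarrow> real \<Rightarrow> bool" where
  "dominates \<kappa> q R K \<longleftrightarrow> R \<in> borel_measurable M \<and> (\<forall>\<omega>. 0 \<le> R \<omega>) \<and>
     (\<forall>\<omega> S. S \<subseteq> {..<N} \<longrightarrow> card S = \<kappa> \<longrightarrow> (\<Sum>k\<in>S. (z k \<omega>)\<^sup>2) \<le> q + R \<omega>) \<and>
     (\<integral>\<^sup>+\<omega>. ennreal (R \<omega>) \<partial>M) \<le> ennreal K"

lemma nn_integral_scaled_exp:
  assumes "S \<subseteq> {..<N}" "0 < a" "a < 1 / 2" "0 \<le> c"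
  shows "(\<integral>\<^sup>+\<omega>. ennreal (c * exp (a * (\<Sum>k\<in>S. (z k \<omega>)\<^sup>2))) \<partial>M) \<le>
    ennreal (c * (1 - 2 * a) powr (- real (card S) / 2))"
proof -
  have "(\<integral>\<^sup>+\<omega>. ennreal (c * exp (a * (\<Sum>k\<in>S. (z k \<omega>)\<^sup>2))) \<partial>M) =
      ennreal c * (\<integral>\<^sup>+\<omega>. ennreal (exp (a * (\<Sum>k\<in>S. (z k \<omega>)\<^sup>2))) \<partial>M)"
    using assms energy_meas[OF assms(1)]
    by (subst nn_integral_cmult[symmetric]) (auto simp: ennreal_mult)
  also have "\<dots> \<le> ennreal c * ennreal ((1 - 2 * a) powr (- real (card S) / 2))"
    using z_exp[OF assms(1-3)] by (intro mult_left_mono) auto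
  finally show ?thesis using assms by (simp add: ennreal_mult)
qed

lemma nn_integral_sum_scaled_exp:
  assumes "finite F" "\<And>S. S \<in> F \<Longrightarrow> S \<subseteq> {..<N}" "0 < a" "a < 1 / 2" "\<And>S. S \<in> F \<Longrightarrow> 0 \<le> c S"
  shows "(\<integral>\<^sup>+\<omega>. ennreal (\<Sum>S\<in>F. c S * exp (a * (\<Sum>k\<in>S. (z k \<omega>)\<^sup>2))) \<partial>M) \<le>
    ennreal (\<Sum>S\<in>F. c S * (1 - 2 * a) powr (- real (card S) / 2))"
proof -
  have "(\<integral>\<^sup>+\<omega>. ennreal (\<Sum>S\<in>F. c S * exp (a * (\<Sum>k\<in>S. (z k \<omega>)\<^sup>2))) \<partial>M) =
      (\<integral>\<^sup>+\<omega>. (\<Sum>S\<in>F. ennreal (c S * exp (a * (\<Sum>k\<in>S. (z k \<omega>)\<^sup>2)))) \<partial>M)"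
    using assms by (simp add: sum_ennreal)
  also have "\<dots> = (\<Sum>S\<in>F. \<integral>\<^sup>+\<omega>. ennreal (c S * exp (a * (\<Sum>k\<in>S. (z k \<omega>)\<^sup>2))) \<partial>M)"
    using assms(2) energy_meas by (intro nn_integral_sum) auto
  also have "\<dots> \<le> (\<Sum>S\<in>F. ennreal (c S * (1 - 2 * a) powr (- real (card S) / 2)))"
    using assms by (intro sum_mono nn_integral_scaled_exp) auto
  also have "\<dots> = ennreal (\<Sum>S\<in>F. c S * (1 - 2 * a) powr (- real (card S) / 2))"
    using assms by (simp add: sum_ennreal)
  finally show ?thesis .
qed

text \<open>The maximum over the sets is replaced by the sum of the exponential bounds; all sets of
  one size contribute the same moment, which produces the binomial coefficient.\<close>

lemma dominates_union:
  assumes a: "0 < a" "a < 1 / 2"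
  shows "\<exists>R. dominates \<kappa> q R (real (N choose \<kappa>) * (1 - 2 * a) powr (- real \<kappa> / 2) * exp (- a * q) / a)"
proof -
  define F where "F = {S. S \<subseteq> {..<N} \<and> card S = \<kappa>}"
  define R where "R \<omega> = (\<Sum>S\<in>F. exp (- a * q) / a * exp (a * (\<Sum>k\<in>S. (z k \<omega>)\<^sup>2)))" for \<omega>
  have finF: "finite F" by (simp add: F_def)
  have cF: "card F = N choose \<kappa>" unfolding F_def by (subst n_subsets) auto
  have "(\<Sum>k\<in>S. (z k \<omega>)\<^sup>2) \<le> q + R \<omega>" if "S \<in> F" for S \<omega>
  proof -
    have "(\<Sum>k\<in>S. (z k \<omega>)\<^sup>2) \<le> q + exp (- a * q) / a * exp (a * (\<Sum>k\<in>S. (z k \<omega>)\<^sup>2))"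
      using le_add_exp_div[OF a(1), of "\<Sum>k\<in>S. (z k \<omega>)\<^sup>2" q] by (simp add: exp_diff exp_minus field_simps)
    also have "exp (- a * q) / a * exp (a * (\<Sum>k\<in>S. (z k \<omega>)\<^sup>2)) \<le> R \<omega>"
      unfolding R_def using that finF a by (intro member_le_sum) auto
    finally show ?thesis by simp
  qed
  moreover have "R \<in> borel_measurable M"
    unfolding R_def using energy_meas by (intro borel_measurable_sum) (auto simp: F_def)
  moreover have "(\<integral>\<^sup>+\<omega>. ennreal (R \<omega>) \<partial>M) \<le>
      ennreal (\<Sum>S\<in>F. exp (- a * q) / a * (1 - 2 * a) powr (- real (card S) / 2))"
    unfolding R_def using finF a by (intro nn_integral_sum_scaled_exp) (auto simp: F_def)
  moreover have "(\<Sum>S\<in>F. exp (- a * q) / a * (1 - 2 * a) powr (- real (card S) / 2)) =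
      real (N choose \<kappa>) * (1 - 2 * a) powr (- real \<kappa> / 2) * exp (- a * q) / a"
  proof -
    have "(\<Sum>S\<in>F. exp (- a * q) / a * (1 - 2 * a) powr (- real (card S) / 2)) =
        (\<Sum>S\<in>F. exp (- a * q) / a * (1 - 2 * a) powr (- real \<kappa> / 2))"
      by (intro sum.cong) (auto simp: F_def)
    then show ?thesis by (simp add: cF mult_ac)
  qed
  moreover have "0 \<le> R \<omega>" for \<omega> unfolding R_def using a by (intro sum_nonneg) auto
  ultimately have "dominates \<kappa> q R (real (N choose \<kappa>) * (1 - 2 * a) powr (- real \<kappa> / 2) * exp (- a * q) / a)"
    unfolding dominates_def F_def by (simp only: mem_Collect_eq) blast
  then show ?thesis by blast
qed

text \<open>The energy on any set is at most the total energy, so a single exponential moment does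
  and no binomial coefficient appears. The price is N instead of \<kappa> in the moment.\<close>

lemma dominates_total:
  assumes a: "0 < a" "a < 1 / 2"
  shows "\<exists>R. dominates \<kappa> q R ((1 - 2 * a) powr (- real N / 2) * exp (- a * q) / a)"
proof -
  define R where "R \<omega> = exp (- a * q) / a * exp (a * (\<Sum>k<N. (z k \<omega>)\<^sup>2))" for \<omega>
  have "(\<Sum>k\<in>S. (z k \<omega>)\<^sup>2) \<le> q + R \<omega>" if "S \<subseteq> {..<N}" for S \<omega>
  proof -
    have "(\<Sum>k\<in>S. (z k \<omega>)\<^sup>2) \<le> (\<Sum>k<N. (z k \<omega>)\<^sup>2)" using that by (intro sum_mono2) auto
    also have "\<dots> \<le> q + R \<omega>" unfolding R_def
      using le_add_exp_div[OF a(1), of "\<Sum>k<N. (z k \<omega>)\<^sup>2" q] by (simp add: exp_diff exp_minus field_simps)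
    finally show ?thesis .
  qed
  moreover have "R \<in> borel_measurable M"
    unfolding R_def using energy_meas[of "{..<N}"] by auto
  moreover have "(\<integral>\<^sup>+\<omega>. ennreal (R \<omega>) \<partial>M) \<le> ennreal ((1 - 2 * a) powr (- real N / 2) * exp (- a * q) / a)"
    unfolding R_def using a nn_integral_scaled_exp[of "{..<N}" a "exp (- a * q) / a"] by (simp add: mult.commute)
  moreover have "0 \<le> R \<omega>" for \<omega> unfolding R_def using a by auto
  ultimately show ?thesis unfolding dominates_def by blast
qed

text \<open>Here the union bound over all \<open>S\<close> of size \<open>\<kappa> = x N\<close> is sharpened: with
  \<open>\<beta> = (1 - 2 a) powr (-1/2)\<close>, the product over \<open>k\<close> of the sums \<open>(1 - x) + x exp (a z\<^sup>2) / \<beta>\<close>, which have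
  expectation 1, is replaced by the product of the maxima of the two summands, and the
  minimum is at least the constant \<open>min (1 - x) (x / \<beta>)\<close>.\<close>
lemma dominates_max:
  assumes a: "0 < a" "a < 1 / 2" and \<kappa>: "0 < \<kappa>" "\<kappa> < N"
  defines "\<beta> \<equiv> (1 - 2 * a) powr (- 1 / 2)" and "x \<equiv> real \<kappa> / real N"
  shows "\<exists>R. dominates \<kappa> q R
    ((real N + 1) * real (N choose \<kappa>) * \<beta> ^ \<kappa> * exp (- a * q) / a * (1 - min (1 - x) (x / \<beta>)) ^ N)"
proof -
  have \<beta>: "\<beta> > 0" using a by (simp add: \<beta>_def)
  have x: "0 < x" "x < 1" using \<kappa> by (auto simp: x_def)
  \<comment> \<open>For e \<ge> 1 the affine expression \<open>A + B * e\<close> is above both 1 - x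
    and \<open>B * e\<close>; at e = \<beta> it equals 1 minus the minimum, which is the gain per
    index.\<close>
  define A where "A = 1 - x - min (1 - x) (x / \<beta>)"
  define B where "B = x / \<beta>"
  have AB: "0 \<le> A" "0 \<le> B" using x \<beta> by (auto simp: A_def B_def)
  have V: "1 - x \<le> A + B * exp (a * u\<^sup>2)" "B * exp (a * u\<^sup>2) \<le> A + B * exp (a * u\<^sup>2)" for u
  proof -
    have "B * 1 \<le> B * exp (a * u\<^sup>2)" using a AB by (intro mult_left_mono) auto
    then show "1 - x \<le> A + B * exp (a * u\<^sup>2)" by (auto simp: A_def B_def)
  qed (use AB in auto)
  define c where "c = (real N + 1) * real (N choose \<kappa>) * \<beta> ^ \<kappa> * exp (- a * q) / a"
  have c: "0 \<le> c" using a \<beta> by (simp add: c_def)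
  define R where "R \<omega> = c * (\<Prod>k<N. A + B * exp (a * (z k \<omega>)\<^sup>2))" for \<omega>
  \<comment> \<open>Expanded over subsets, the product becomes a combination of exponentials of
    energies, whose expectations are all that the locale provides.\<close>
  have expand: "(\<Prod>k<N. A + B * e k) = (\<Sum>S\<in>Pow {..<N}. A ^ (N - card S) * B ^ card S * (\<Prod>k\<in>S. e k))" for e :: "nat \<Rightarrow> real"
  proof -
    have "(\<Prod>k<N. A + B * e k) = (\<Prod>k<N. B * e k + A)" by (simp add: add.commute)
    also have "\<dots> = (\<Sum>S\<in>Pow {..<N}. (\<Prod>k\<in>S. B * e k) * (\<Prod>k\<in>{..<N} - S. A))"
      by (rule prod_add) simp
    also have "\<dots> = (\<Sum>S\<in>Pow {..<N}. A ^ (N - card S) * B ^ card S * (\<Prod>k\<in>S. e k))"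
      by (rule sum.cong) (auto simp: prod.distrib card_Diff_subset finite_subset algebra_simps)
    finally show ?thesis .
  qed
  have dom: "(\<Sum>k\<in>S. (z k \<omega>)\<^sup>2) \<le> q + R \<omega>" if S: "S \<subseteq> {..<N}" "card S = \<kappa>" for S \<omega>
  proof -
    define E where "E = exp (a * (\<Sum>k\<in>S. (z k \<omega>)\<^sup>2))"
    have finS: "finite S" using S finite_subset by auto
    have E: "E = (\<Prod>k\<in>S. exp (a * (z k \<omega>)\<^sup>2))"
      using finS by (simp add: E_def exp_sum[symmetric] sum_distrib_left)
    \<comment> \<open>For the given S each factor is bounded below by the summand that belongs to
      its index; the mode bound then compensates the powers of x and 1 - x.\<close>
    have "(\<Prod>k<N. A + B * exp (a * (z k \<omega>)\<^sup>2)) \<ge> (\<Prod>k<N. if k \<in> S then B * exp (a * (z k \<omega>)\<^sup>2) else 1 - x)"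
      using V AB x by (intro prod_mono) auto
    also have "(\<Prod>k<N. if k \<in> S then B * exp (a * (z k \<omega>)\<^sup>2) else 1 - x) = B ^ \<kappa> * E * (1 - x) ^ (N - \<kappa>)"
    proof -
      have "{..<N} \<inter> {k. k \<in> S} = S" "{..<N} \<inter> {k. k \<notin> S} = {..<N} - S" using S by auto
      moreover have "card ({..<N} - S) = N - \<kappa>" using S finS by (simp add: card_Diff_subset)
      ultimately show ?thesis using S
        by (subst prod.If_cases) (auto simp: prod.distrib E Compl_eq Collect_neg_eq[symmetric])
    qed
    finally have "c * (B ^ \<kappa> * E * (1 - x) ^ (N - \<kappa>)) \<le> R \<omega>"
      unfolding R_def using c by (intro mult_left_mono) auto
    moreover have "c * (B ^ \<kappa> * E * (1 - x) ^ (N - \<kappa>)) =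
        ((real N + 1) * (real (N choose \<kappa>) * x ^ \<kappa> * (1 - x) ^ (N - \<kappa>))) * (E * exp (- a * q) / a)"
    proof -
      have "\<beta> ^ \<kappa> * (x / \<beta>) ^ \<kappa> = x ^ \<kappa>" using \<beta> by (simp add: power_divide)
      then have p: "\<beta> ^ \<kappa> * B ^ \<kappa> = x ^ \<kappa>" by (simp add: B_def)
      have "c * (B ^ \<kappa> * E * (1 - x) ^ (N - \<kappa>)) =
          (real N + 1) * real (N choose \<kappa>) * (\<beta> ^ \<kappa> * B ^ \<kappa>) * (1 - x) ^ (N - \<kappa>) * (E * exp (- a * q) / a)"
        unfolding c_def by simp
      then show ?thesis unfolding p by (simp only: mult.assoc)
    qed
    moreover have "1 * (E * exp (- a * q) / a) \<le>
        ((real N + 1) * (real (N choose \<kappa>) * x ^ \<kappa> * (1 - x) ^ (N - \<kappa>))) * (E * exp (- a * q) / a)"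
      using binomial_mode_bound[OF \<kappa>] a unfolding x_def E_def by (intro mult_right_mono) auto
    ultimately have "E * exp (- a * q) / a \<le> R \<omega>" by linarith
    then show ?thesis
      using le_add_exp_div[OF a(1), of "\<Sum>k\<in>S. (z k \<omega>)\<^sup>2" q]
      by (simp add: E_def exp_diff exp_minus field_simps)
  qed
  have "R \<in> borel_measurable M" unfolding R_def by (intro borel_measurable_times borel_measurable_prod) auto
  moreover have "0 \<le> R \<omega>" for \<omega> unfolding R_def using c AB by (intro mult_nonneg_nonneg prod_nonneg) auto
  moreover have "(\<integral>\<^sup>+\<omega>. ennreal (R \<omega>) \<partial>M) \<le> ennreal (c * (1 - min (1 - x) (x / \<beta>)) ^ N)"
  proof -
    have "R \<omega> = (\<Sum>S\<in>Pow {..<N}. c * (A ^ (N - card S) * B ^ card S) * exp (a * (\<Sum>k\<in>S. (z k \<omega>)\<^sup>2)))" for \<omega>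
    proof -
      have "(\<Prod>k\<in>S. exp (a * (z k \<omega>)\<^sup>2)) = exp (a * (\<Sum>k\<in>S. (z k \<omega>)\<^sup>2))" if "S \<in> Pow {..<N}" for S
        using that finite_subset[of S "{..<N}"] by (simp add: exp_sum[symmetric] sum_distrib_left)
      then show ?thesis
        unfolding R_def expand by (subst sum_distrib_left) (auto intro!: sum.cong)
    qed
    then have "(\<integral>\<^sup>+\<omega>. ennreal (R \<omega>) \<partial>M) \<le>
        ennreal (\<Sum>S\<in>Pow {..<N}. c * (A ^ (N - card S) * B ^ card S) * (1 - 2 * a) powr (- real (card S) / 2))"
      using a c AB by (simp only:, intro nn_integral_sum_scaled_exp) auto
    also have "(\<Sum>S\<in>Pow {..<N}. c * (A ^ (N - card S) * B ^ card S) * (1 - 2 * a) powr (- real (card S) / 2)) =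
        c * (\<Sum>S\<in>Pow {..<N}. A ^ (N - card S) * B ^ card S * (\<Prod>k\<in>S. \<beta>))"
      unfolding sum_distrib_left \<beta>_def using a
      by (intro sum.cong) (auto simp: powr_powr powr_realpow[symmetric])
    also have "\<dots> = c * (\<Prod>k<N. A + B * \<beta>)" unfolding expand[of "\<lambda>_. \<beta>"] ..
    also have "A + B * \<beta> = 1 - min (1 - x) (x / \<beta>)" using \<beta> by (simp add: A_def B_def)
    finally show ?thesis by simp
  qed
  ultimately show ?thesis
    using dom unfolding dominates_def c_def by blast
qed

end

context chi_square_family
begin

lemma dominates_mono: "dominates \<kappa> q R K \<Longrightarrow> K \<le> K' \<Longrightarrow> dominates \<kappa> q R K'"
  unfolding dominates_def by (meson ennreal_leI order_trans)

text \<open>Few selected coefficients: the exponent \<open>(1 + 2\<gamma>) / (4 (1 + \<gamma>))\<close> exceeds \<open>\<gamma> / (2 (1 + \<gamma>))\<close>, for which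
  the union bound reproduces the penalty exactly; the resulting loss \<open>\<kappa> ln 2 / 2\<close> is compensated by
  the binomial coefficient.\<close>
lemma dominates_sparse:
  assumes \<gamma>: "0 < \<gamma>" and \<kappa>: "\<kappa> \<le> N" and \<pi>: "0 < pmf \<pi> \<kappa>"
    and sparse: "real \<kappa> \<le> 4 powr (- \<gamma>) * real N" and \<delta>: "\<delta> \<le> 1 / (2 * (1 + 2 * \<gamma>))"
  shows "\<exists>R. dominates \<kappa> ((1 - \<delta>) * map_pen N \<gamma> \<pi> \<kappa>) R (4 * pmf \<pi> \<kappa>)"
proof -
  define a where "a = (1 + 2 * \<gamma>) / (4 * (1 + \<gamma>))"
  have a: "1 / 4 \<le> a" "a < 1 / 2" using \<gamma> by (auto simp: a_def field_simps)
  have a2: "1 - 2 * a = 1 / (2 * (1 + \<gamma>))" using \<gamma> by (simp add: a_def field_simps)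
  define L where "L = ln (real (N choose \<kappa>)) + (- ln (pmf \<pi> \<kappa>)) + real \<kappa> * (ln (1 + \<gamma>) / 2)"
  have binom: "0 < real (N choose \<kappa>)" using \<kappa> by (simp add: zero_less_binomial_iff)
  have ap: "a * map_pen N \<gamma> \<pi> \<kappa> = (1 + 2 * \<gamma>) / (2 * \<gamma>) * L"
    unfolding map_pen_eq[OF \<gamma> \<kappa> \<pi>] L_def[symmetric] a_def using \<gamma> by (simp add: divide_simps)
  have "- a * ((1 - \<delta>) * map_pen N \<gamma> \<pi> \<kappa>) = - ((1 - \<delta>) * (a * map_pen N \<gamma> \<pi> \<kappa>))" by (simp add: algebra_simps)
  also have "\<dots> = - ((1 - \<delta>) * (1 + 2 * \<gamma>) / (2 * \<gamma>)) * L" unfolding ap by simp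
  finally have e: "- a * ((1 - \<delta>) * map_pen N \<gamma> \<pi> \<kappa>) = - ((1 - \<delta>) * (1 + 2 * \<gamma>) / (2 * \<gamma>)) * L" .
  \<comment> \<open>Origin of the bound \<open>4 powr (- \<gamma>)\<close> on the proportion: (N /
    \<kappa>)^\<kappa> is a lower bound for the binomial coefficient, and L / (4 \<gamma>) then
    covers the loss \<kappa> ln 2 / 2.\<close>
  have lnb: "real \<kappa> * (2 * \<gamma> * ln 2) \<le> ln (real (N choose \<kappa>))"
  proof (cases "\<kappa> = 0")
    case False
    then have N: "0 < N" using \<kappa> by simp
    have "4 powr \<gamma> \<le> real N / real \<kappa>"
      using sparse False by (simp add: powr_minus field_simps)
    then have "ln (4 powr \<gamma>) \<le> ln (real N / real \<kappa>)" using False N by (subst ln_le_cancel_iff) auto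
    moreover have "ln (4::real) = 2 * ln 2" using ln_realpow[of 2 2] by simp
    ultimately have "2 * \<gamma> * ln 2 \<le> ln (real N / real \<kappa>)" by (simp add: ln_powr)
    then have "real \<kappa> * (2 * \<gamma> * ln 2) \<le> real \<kappa> * ln (real N / real \<kappa>)" by (intro mult_left_mono) auto
    also have "\<dots> = ln ((real N / real \<kappa>) ^ \<kappa>)" using False N by (simp add: ln_realpow)
    also have "\<dots> \<le> ln (real (N choose \<kappa>))"
      using binomial_ge_n_over_k_pow_k[OF \<kappa>, where 'a = real] False N binom by (subst ln_le_cancel_iff) auto
    finally show ?thesis .
  qed auto
  have Lge: "real \<kappa> * (2 * \<gamma> * ln 2) \<le> L"
  proof -
    have "ln (pmf \<pi> \<kappa>) \<le> 0" using \<pi> by (simp add: pmf_le_1)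
    moreover have "0 \<le> real \<kappa> * (ln (1 + \<gamma>) / 2)" using \<gamma> by simp
    ultimately show ?thesis using lnb unfolding L_def by linarith
  qed
  have "0 \<le> real \<kappa> * (2 * \<gamma> * ln 2)" using \<gamma> by simp
  with Lge have L0: "0 \<le> L" by (rule order_trans[rotated])
  \<comment> \<open>Without \<delta> the right-hand side would be 1 + 1 / (2 \<gamma>); at most half
    of the surplus is spent on \<delta>.\<close>
  have "1 + 1 / (4 * \<gamma>) \<le> (1 - \<delta>) * (1 + 2 * \<gamma>) / (2 * \<gamma>)"
  proof -
    have "\<delta> * (1 + 2 * \<gamma>) \<le> 1 / (2 * (1 + 2 * \<gamma>)) * (1 + 2 * \<gamma>)" using \<delta> \<gamma> by (intro mult_right_mono) auto
    also have "\<dots> = 1 / 2" using \<gamma> by simp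
    finally have "1 / 2 + 2 * \<gamma> \<le> (1 - \<delta>) * (1 + 2 * \<gamma>)" by (simp add: algebra_simps)
    then have "(1 / 2 + 2 * \<gamma>) / (2 * \<gamma>) \<le> (1 - \<delta>) * (1 + 2 * \<gamma>) / (2 * \<gamma>)"
      using \<gamma> by (intro divide_right_mono) auto
    moreover have "(1 / 2 + 2 * \<gamma>) / (2 * \<gamma>) = 1 + 1 / (4 * \<gamma>)" using \<gamma> by (simp add: field_simps)
    ultimately show ?thesis by simp
  qed
  then have "(1 + 1 / (4 * \<gamma>)) * L \<le> (1 - \<delta>) * (1 + 2 * \<gamma>) / (2 * \<gamma>) * L" using L0 by (intro mult_right_mono)
  moreover have "real \<kappa> * ln 2 / 2 \<le> 1 / (4 * \<gamma>) * L" using Lge \<gamma> by (simp add: field_simps)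
  ultimately have "L + real \<kappa> * ln 2 / 2 \<le> (1 - \<delta>) * (1 + 2 * \<gamma>) / (2 * \<gamma>) * L" by (simp add: distrib_right)
  then have key: "ln (real (N choose \<kappa>)) + real \<kappa> / 2 * ln (2 * (1 + \<gamma>)) - (1 - \<delta>) * (1 + 2 * \<gamma>) / (2 * \<gamma>) * L \<le> ln (pmf \<pi> \<kappa>)"
  proof -
    have "ln (2 * (1 + \<gamma>)) = ln 2 + ln (1 + \<gamma>)" using \<gamma> by (subst ln_mult) auto
    then have "real \<kappa> / 2 * ln (2 * (1 + \<gamma>)) = real \<kappa> * ln 2 / 2 + real \<kappa> * (ln (1 + \<gamma>) / 2)"
      by (simp add: distrib_left)
    moreover have "L = ln (real (N choose \<kappa>)) - ln (pmf \<pi> \<kappa>) + real \<kappa> * (ln (1 + \<gamma>) / 2)" by (simp add: L_def)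
    moreover note \<open>L + real \<kappa> * ln 2 / 2 \<le> (1 - \<delta>) * (1 + 2 * \<gamma>) / (2 * \<gamma>) * L\<close>
    ultimately show ?thesis by linarith
  qed
  have "real (N choose \<kappa>) * (1 - 2 * a) powr (- real \<kappa> / 2) * exp (- a * ((1 - \<delta>) * map_pen N \<gamma> \<pi> \<kappa>)) =
      exp (ln (real (N choose \<kappa>)) + real \<kappa> / 2 * ln (2 * (1 + \<gamma>)) - (1 - \<delta>) * (1 + 2 * \<gamma>) / (2 * \<gamma>) * L)"
  proof -
    have "(1 / (2 * (1 + \<gamma>))) powr (- real \<kappa> / 2) = exp (real \<kappa> / 2 * ln (2 * (1 + \<gamma>)))"
      using \<gamma> by (simp add: powr_def ln_div)
    then show ?thesis unfolding e a2 using binom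
      by (simp only: diff_conv_add_uminus exp_add exp_ln minus_mult_left)
  qed
  also have "\<dots> \<le> pmf \<pi> \<kappa>" using key \<pi> by (metis exp_le_cancel_iff exp_ln)
  finally have "real (N choose \<kappa>) * (1 - 2 * a) powr (- real \<kappa> / 2) * exp (- a * ((1 - \<delta>) * map_pen N \<gamma> \<pi> \<kappa>)) / a
      \<le> pmf \<pi> \<kappa> / a" using a by (intro divide_right_mono) auto
  also have "\<dots> \<le> pmf \<pi> \<kappa> / (1 / 4)" using a \<pi> by (intro divide_left_mono) auto
  also have "\<dots> = 4 * pmf \<pi> \<kappa>" by simp
  finally have le: "real (N choose \<kappa>) * (1 - 2 * a) powr (- real \<kappa> / 2) * exp (- a * ((1 - \<delta>) * map_pen N \<gamma> \<pi> \<kappa>)) / a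
      \<le> 4 * pmf \<pi> \<kappa>" .
  have "0 < a" using a by simp
  from dominates_union[OF this a(2), of \<kappa> "(1 - \<delta>) * map_pen N \<gamma> \<pi> \<kappa>"] show ?thesis
    using dominates_mono[OF _ le] by blast
qed

text \<open>The exponent is half of the one matched to the penalty. The moment of the total energy
  costs N/2 times ln (1 + \<gamma>) - ln (1 + \<gamma>/2), and the penalty of an almost full set
  returns nearly N/4 times ln (1 + \<gamma>). The balance is negative because (1 + \<gamma>/2)^2 > 1
  + \<gamma>; g bounds the logarithm of this ratio from below, uniformly in \<gamma>.\<close>

lemma dominates_dense:
  assumes \<gamma>: "0 < \<gamma>min" "\<gamma>min \<le> \<gamma>" "\<gamma> \<le> \<gamma>max" and \<kappa>: "\<kappa> \<le> N" and \<pi>: "0 < pmf \<pi> \<kappa>"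
    and dense: "(1 - c) * real N \<le> real \<kappa>" and c: "0 \<le> c" "c \<le> 1" and \<delta>: "0 \<le> \<delta>" "\<delta> \<le> 1"
  defines "g \<equiv> ln (1 + \<gamma>min\<^sup>2 / (4 * (1 + \<gamma>max)))"
  assumes g: "(\<delta> + c) * \<gamma>max \<le> g / 2"
  shows "\<exists>R. dominates \<kappa> ((1 - \<delta>) * map_pen N \<gamma> \<pi> \<kappa>) R (4 * (1 + 1 / \<gamma>min) * exp (- (g / 8) * real N))"
proof -
  have \<gamma>0: "0 < \<gamma>" using \<gamma> by simp
  define a where "a = \<gamma> / (4 * (1 + \<gamma>))"
  have a: "0 < a" "a < 1 / 2" using \<gamma>0 by (auto simp: a_def field_simps)
  have a2: "1 - 2 * a = (1 + \<gamma> / 2) / (1 + \<gamma>)" using \<gamma>0 by (simp add: a_def field_simps)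
  define L where "L = ln (real (N choose \<kappa>)) + (- ln (pmf \<pi> \<kappa>)) + real \<kappa> * (ln (1 + \<gamma>) / 2)"
  define l where "l = ln (1 + \<gamma>)"
  have l: "0 \<le> l" "l \<le> \<gamma>max" using \<gamma> \<gamma>0 ln_add_one_self_le_self[of \<gamma>] by (auto simp: l_def)
  have e: "a * map_pen N \<gamma> \<pi> \<kappa> = L / 2"
    unfolding map_pen_eq[OF \<gamma>0 \<kappa> \<pi>] L_def[symmetric] a_def using \<gamma>0 by (simp add: divide_simps)
  have "real \<kappa> * (l / 2) \<le> L"
  proof -
    have "ln (pmf \<pi> \<kappa>) \<le> 0" using \<pi> by (simp add: pmf_le_1)
    then show ?thesis using ln_binomial_nonneg[OF \<kappa>] unfolding L_def l_def by linarith
  qed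
  moreover have "(1 - c) * real N * (l / 2) \<le> real \<kappa> * (l / 2)" using dense l by (intro mult_right_mono) auto
  ultimately have "(1 - \<delta>) / 2 * ((1 - c) * real N * (l / 2)) \<le> (1 - \<delta>) / 2 * L"
    using \<delta> by (intro mult_left_mono) auto
  moreover have "(1 - \<delta>) / 2 * ((1 - c) * real N * (l / 2)) \<ge> (1 - \<delta> - c) / 4 * l * real N"
  proof -
    have "(1 - \<delta> - c) \<le> (1 - \<delta>) * (1 - c)" using \<delta> c by (simp add: algebra_simps)
    then have "(1 - \<delta> - c) * (l * real N / 4) \<le> (1 - \<delta>) * (1 - c) * (l * real N / 4)"
      using l by (intro mult_right_mono) auto
    then show ?thesis by (simp add: field_simps)
  qed
  ultimately have pen: "(1 - \<delta> - c) / 4 * l * real N \<le> (1 - \<delta>) * L / 2" by linarith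
  have "g \<le> ln ((1 + \<gamma> / 2)\<^sup>2 / (1 + \<gamma>))"
  proof -
    have "\<gamma>min\<^sup>2 \<le> \<gamma>\<^sup>2" using \<gamma> by (intro power_mono) auto
    then have "\<gamma>min\<^sup>2 / (4 * (1 + \<gamma>max)) \<le> \<gamma>\<^sup>2 / (4 * (1 + \<gamma>))" using \<gamma> \<gamma>0 by (intro frac_le) auto
    also have "\<dots> = (1 + \<gamma> / 2)\<^sup>2 / (1 + \<gamma>) - 1" using \<gamma>0 by (simp add: field_simps power2_eq_square)
    finally have "1 + \<gamma>min\<^sup>2 / (4 * (1 + \<gamma>max)) \<le> (1 + \<gamma> / 2)\<^sup>2 / (1 + \<gamma>)" by simp
    moreover have "0 \<le> \<gamma>min\<^sup>2 / (4 * (1 + \<gamma>max))" using \<gamma> by auto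
    ultimately show ?thesis unfolding g_def by (subst ln_le_cancel_iff) auto
  qed
  also have "\<dots> = 2 * ln (1 + \<gamma> / 2) - l"
    using \<gamma>0 by (simp add: ln_div ln_realpow l_def)
  finally have g': "g + l \<le> 2 * ln (1 + \<gamma> / 2)" by simp
  \<comment> \<open>Half of the available rate g / 4 pays for \<delta> and for the missing fraction
    c of the indices.\<close>
  have "(\<delta> + c) * l \<le> g / 2"
    using mult_left_mono[OF l(2), of "\<delta> + c"] g \<delta> c by linarith
  then have rate: "(l - ln (1 + \<gamma> / 2)) / 2 - (1 - \<delta> - c) / 4 * l \<le> - (g / 8)"
    using g' by (simp add: field_simps)
  have "real N / 2 * (l - ln (1 + \<gamma> / 2)) - (1 - \<delta>) * L / 2 \<le>
      real N * ((l - ln (1 + \<gamma> / 2)) / 2 - (1 - \<delta> - c) / 4 * l)"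
  proof -
    have "real N * ((l - ln (1 + \<gamma> / 2)) / 2 - (1 - \<delta> - c) / 4 * l) =
        real N / 2 * (l - ln (1 + \<gamma> / 2)) - (1 - \<delta> - c) / 4 * l * real N"
    proof -
      have "real N * (u / 2 - w) = real N / 2 * u - w * real N" for u w :: real by (simp add: algebra_simps)
      then show ?thesis .
    qed
    then show ?thesis using pen by linarith
  qed
  also have "\<dots> \<le> real N * (- (g / 8))" using rate by (intro mult_left_mono) auto
  finally have key: "real N / 2 * (l - ln (1 + \<gamma> / 2)) - (1 - \<delta>) * L / 2 \<le> - (g / 8) * real N" by (simp add: mult.commute)
  have "- a * ((1 - \<delta>) * map_pen N \<gamma> \<pi> \<kappa>) = - ((1 - \<delta>) * (a * map_pen N \<gamma> \<pi> \<kappa>))" by (simp add: algebra_simps)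
  also have "\<dots> = - ((1 - \<delta>) * L / 2)" unfolding e by simp
  finally have e2: "- a * ((1 - \<delta>) * map_pen N \<gamma> \<pi> \<kappa>) = - ((1 - \<delta>) * L / 2)" .
  have "(1 - 2 * a) powr (- real N / 2) * exp (- a * ((1 - \<delta>) * map_pen N \<gamma> \<pi> \<kappa>)) =
      exp (real N / 2 * (l - ln (1 + \<gamma> / 2)) - (1 - \<delta>) * L / 2)"
  proof -
    have "((1 + \<gamma> / 2) / (1 + \<gamma>)) powr (- real N / 2) = exp (real N / 2 * (l - ln (1 + \<gamma> / 2)))"
      using \<gamma>0 by (simp add: powr_def ln_div l_def right_diff_distrib)
    then show ?thesis unfolding a2 e2 by (simp only: diff_conv_add_uminus exp_add)
  qed
  also have "\<dots> \<le> exp (- (g / 8) * real N)" using key by simp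
  finally have "(1 - 2 * a) powr (- real N / 2) * exp (- a * ((1 - \<delta>) * map_pen N \<gamma> \<pi> \<kappa>)) / a
      \<le> exp (- (g / 8) * real N) / a" using a by (intro divide_right_mono) auto
  also have "\<dots> = 4 * (1 + 1 / \<gamma>) * exp (- (g / 8) * real N)" using \<gamma>0 by (simp add: a_def field_simps)
  also have "\<dots> \<le> 4 * (1 + 1 / \<gamma>min) * exp (- (g / 8) * real N)"
    using \<gamma> by (intro mult_right_mono mult_left_mono add_left_mono) (auto simp: frac_le)
  finally show ?thesis using dominates_total[OF a, of \<kappa> "(1 - \<delta>) * map_pen N \<gamma> \<pi> \<kappa>"] dominates_mono by blast
qed

text \<open>With the matched exponent the penalty cancels the binomial coefficient and the moment,
  except for what \<delta> takes away, at most d N / 2 in the exponent. The sharpened union bound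
  gains d N, since 1 - x and x / \<beta> both stay above d for proportional sizes; the mode bound
  costs only the factor N + 1.\<close>

lemma dominates_middle:
  assumes \<gamma>: "0 < \<gamma>min" "\<gamma>min \<le> \<gamma>" "\<gamma> \<le> \<gamma>max" and \<kappa>: "0 < \<kappa>" "\<kappa> < N" and \<pi>: "0 < pmf \<pi> \<kappa>"
    and c: "0 < c" "c * real N \<le> real \<kappa>" "real \<kappa> \<le> (1 - c) * real N"
    and \<delta>: "0 \<le> \<delta>" "\<delta> \<le> 1" "\<delta> * (1 + \<gamma>max) \<le> c / (1 + \<gamma>max) / 2"
  shows "\<exists>R. dominates \<kappa> ((1 - \<delta>) * map_pen N \<gamma> \<pi> \<kappa>) R
    (4 * (1 + 1 / \<gamma>min) * (real N + 1) * exp (- (c / (1 + \<gamma>max) / 2) * real N))"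
proof -
  have \<gamma>0: "0 < \<gamma>" using \<gamma> by simp
  have N: "0 < N" using \<kappa> by simp
  define a where "a = \<gamma> / (2 * (1 + \<gamma>))"
  have a: "0 < a" "a < 1 / 2" using \<gamma>0 by (auto simp: a_def field_simps)
  have a2: "1 - 2 * a = 1 / (1 + \<gamma>)" using \<gamma>0 by (simp add: a_def field_simps)
  define \<beta> where "\<beta> = (1 - 2 * a) powr (- 1 / 2)"
  define l where "l = ln (1 + \<gamma>)"
  have l: "0 \<le> l" "l \<le> \<gamma>max" using \<gamma> \<gamma>0 ln_add_one_self_le_self[of \<gamma>] by (auto simp: l_def)
  have \<beta>: "\<beta> = exp (l / 2)"
    unfolding \<beta>_def a2 l_def using \<gamma>0 by (simp add: powr_def ln_div)
  have \<beta>le: "1 \<le> \<beta>" "\<beta> \<le> 1 + \<gamma>max"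
  proof -
    have "\<beta> \<le> exp l" unfolding \<beta> using l by simp
    also have "\<dots> = 1 + \<gamma>" using \<gamma>0 by (simp add: l_def)
    finally show "\<beta> \<le> 1 + \<gamma>max" using \<gamma> by simp
  qed (use l \<beta> in auto)
  define x where "x = real \<kappa> / real N"
  have x: "c \<le> x" "x \<le> 1 - c" using c N by (auto simp: x_def field_simps)
  define d where "d = c / (1 + \<gamma>max)"
  have d: "0 < d" "d \<le> min (1 - x) (x / \<beta>)"
  proof -
    have "d \<le> c / 1" unfolding d_def using c \<gamma> by (intro divide_left_mono) auto
    moreover have "d \<le> x / \<beta>" unfolding d_def using x \<beta>le c by (intro frac_le) auto
    ultimately show "d \<le> min (1 - x) (x / \<beta>)" using x by auto
  qed (use c \<gamma> in \<open>auto simp: d_def\<close>)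
  define L where "L = ln (real (N choose \<kappa>)) + (- ln (pmf \<pi> \<kappa>)) + real \<kappa> * (ln (1 + \<gamma>) / 2)"
  have \<kappa>N: "\<kappa> \<le> N" using \<kappa> by simp
  have binom: "0 < real (N choose \<kappa>)" using \<kappa> by (simp add: zero_less_binomial_iff)
  have e: "a * map_pen N \<gamma> \<pi> \<kappa> = L"
    unfolding map_pen_eq[OF \<gamma>0 \<kappa>N \<pi>] L_def[symmetric] a_def using \<gamma>0 by (simp add: divide_simps)
  have L0: "ln (real (N choose \<kappa>)) + real \<kappa> * (l / 2) \<le> L"
    using pmf_le_1[of \<pi> \<kappa>] \<pi> by (simp add: L_def l_def)
  have lnb: "ln (real (N choose \<kappa>)) \<le> real N"
  proof -
    have "real (N choose \<kappa>) \<le> 2 ^ N" using binomial_le_pow2[of N \<kappa>] by (metis of_nat_le_iff of_nat_numeral of_nat_power)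
    then have "ln (real (N choose \<kappa>)) \<le> ln (2 ^ N)" using binom by (subst ln_le_cancel_iff) auto
    also have "\<dots> = real N * ln 2" by (simp add: ln_realpow)
    also have "\<dots> \<le> real N * 1" using ln_2_less_1 by (intro mult_left_mono) auto
    finally show ?thesis by simp
  qed
  have "real \<kappa> * (l / 2) \<le> real N * \<gamma>max" using \<kappa> l by (intro mult_mono) auto
  then have "\<delta> * (ln (real (N choose \<kappa>)) + real \<kappa> * (l / 2)) \<le> \<delta> * (real N * (1 + \<gamma>max))"
    using lnb \<delta> by (intro mult_left_mono) (auto simp: algebra_simps)
  also have "\<dots> = \<delta> * (1 + \<gamma>max) * real N" by simp
  also have "\<dots> \<le> d / 2 * real N" using \<delta> by (intro mult_right_mono) (auto simp: d_def)
  finally have 1: "\<delta> * (ln (real (N choose \<kappa>)) + real \<kappa> * (l / 2)) \<le> d / 2 * real N" .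
  have 2: "(1 - \<delta>) * (ln (real (N choose \<kappa>)) + real \<kappa> * (l / 2)) \<le> (1 - \<delta>) * L"
    using L0 \<delta> by (intro mult_left_mono) auto
  have "(1 - min (1 - x) (x / \<beta>)) ^ N \<le> (1 - d) ^ N" using d x c \<beta>le by (intro power_mono) auto
  also have "\<dots> \<le> exp (- d) ^ N"
  proof (rule power_mono)
    show "1 - d \<le> exp (- d)" using exp_ge_add_one_self[of "- d"] by simp
    have "d \<le> 1 - x" using d by simp
    then show "0 \<le> 1 - d" using x c by simp
  qed
  also have "\<dots> = exp (- d * real N)" by (simp add: exp_of_nat_mult[symmetric] mult.commute)
  finally have 3: "(1 - min (1 - x) (x / \<beta>)) ^ N \<le> exp (- d * real N)" .
  have "- a * ((1 - \<delta>) * map_pen N \<gamma> \<pi> \<kappa>) = - (1 - \<delta>) * (a * map_pen N \<gamma> \<pi> \<kappa>)" by (simp add: algebra_simps)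
  then have e': "- a * ((1 - \<delta>) * map_pen N \<gamma> \<pi> \<kappa>) = - ((1 - \<delta>) * L)" unfolding e by (simp add: algebra_simps)
  have "real (N choose \<kappa>) * \<beta> ^ \<kappa> * exp (- a * ((1 - \<delta>) * map_pen N \<gamma> \<pi> \<kappa>)) =
      exp (ln (real (N choose \<kappa>)) + real \<kappa> * (l / 2) - (1 - \<delta>) * L)"
    unfolding e' \<beta> using binom by (simp only: diff_conv_add_uminus exp_add exp_ln exp_of_nat_mult)
  also have "\<dots> \<le> exp (d / 2 * real N)" using 1 2 by (simp add: left_diff_distrib)
  finally have 4: "real (N choose \<kappa>) * \<beta> ^ \<kappa> * exp (- a * ((1 - \<delta>) * map_pen N \<gamma> \<pi> \<kappa>)) \<le> exp (d / 2 * real N)" .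
  have ia: "1 / a \<le> 4 * (1 + 1 / \<gamma>min)"
  proof -
    have "1 / a = 2 * (1 + 1 / \<gamma>)" using \<gamma>0 by (simp add: a_def field_simps)
    also have "\<dots> \<le> 4 * (1 + 1 / \<gamma>)" using \<gamma>0 by (intro mult_right_mono) auto
    also have "\<dots> \<le> 4 * (1 + 1 / \<gamma>min)" using \<gamma> by (intro mult_left_mono add_left_mono) (auto simp: frac_le)
    finally show ?thesis .
  qed
  have "(real N + 1) * real (N choose \<kappa>) * \<beta> ^ \<kappa> * exp (- a * ((1 - \<delta>) * map_pen N \<gamma> \<pi> \<kappa>)) / a * (1 - min (1 - x) (x / \<beta>)) ^ N
    = 1 / a * (real N + 1) * ((real (N choose \<kappa>) * \<beta> ^ \<kappa> * exp (- a * ((1 - \<delta>) * map_pen N \<gamma> \<pi> \<kappa>))) * (1 - min (1 - x) (x / \<beta>)) ^ N)"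
    by simp
  also have "\<dots> \<le> 4 * (1 + 1 / \<gamma>min) * (real N + 1) * (exp (d / 2 * real N) * exp (- d * real N))"
    using 3 4 ia a d x c \<beta>le \<gamma> by (intro mult_mono) auto
  also have "exp (d / 2 * real N) * exp (- d * real N) = exp (- (d / 2) * real N)"
    by (simp add: exp_add[symmetric] field_simps)
  finally show ?thesis using dominates_max[OF a \<kappa>, of "(1 - \<delta>) * map_pen N \<gamma> \<pi> \<kappa>"] dominates_mono
    unfolding \<beta>_def x_def d_def by blast
qed

end

text \<open>Used for the N + 1 sizes times the factor N + 1 of the mode bound, and again at the end,
  where a power of the sample size absorbs the square of the number of levels.\<close>

lemma polynomial_exp_bound:
  fixes \<eta> :: real
  assumes "0 < \<eta>"
  shows "(real N + 1)\<^sup>2 * exp (- \<eta> * real N) \<le> 2 * exp \<eta> / \<eta>\<^sup>2"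
proof -
  have "(\<eta> * (real N + 1))\<^sup>2 / 2 \<le> exp (\<eta> * (real N + 1))"
    using exp_lower_Taylor_quadratic[of "\<eta> * (real N + 1)"] assms
    by (smt (verit) mult_nonneg_nonneg of_nat_0_le_iff)
  then have "(real N + 1)\<^sup>2 \<le> 2 * exp (\<eta> * (real N + 1)) / \<eta>\<^sup>2"
    using assms unfolding power_mult_distrib by (simp add: pos_le_divide_eq mult.commute)
  then have "(real N + 1)\<^sup>2 * exp (- \<eta> * real N) \<le> 2 * exp (\<eta> * (real N + 1)) / \<eta>\<^sup>2 * exp (- \<eta> * real N)"
    by (intro mult_right_mono) auto
  also have "\<dots> = 2 * (exp (\<eta> * (real N + 1)) * exp (- \<eta> * real N)) / \<eta>\<^sup>2" by simp
  also have "exp (\<eta> * (real N + 1)) * exp (- \<eta> * real N) = exp \<eta>"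
    by (simp add: exp_add[symmetric] algebra_simps)
  finally show ?thesis .
qed

text \<open>\<delta> and K depend on the range of \<gamma> only. Uniformity in N and in the prior is
  essential: every level then adds at most K noise variances, and the number of levels is
  logarithmic in the sample size.\<close>

lemma noise_domination:
  assumes \<gamma>m: "0 < \<gamma>min" "\<gamma>min \<le> \<gamma>max"
  shows "\<exists>\<delta> K. 0 < \<delta> \<and> \<delta> \<le> 1 / 2 \<and> 0 \<le> K \<and>
    (\<forall>(M::'a measure) N z \<gamma> \<pi>. chi_square_family M N z \<longrightarrow> \<gamma>min \<le> \<gamma> \<longrightarrow> \<gamma> \<le> \<gamma>max \<longrightarrow> set_pmf \<pi> = {0..N} \<longrightarrow>
      (\<exists>R\<in>borel_measurable M. (\<forall>\<omega>. 0 \<le> R \<omega>) \<and>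
        (\<forall>\<omega> S. S \<subseteq> {..<N} \<longrightarrow> (\<Sum>k\<in>S. (z k \<omega>)\<^sup>2) \<le> (1 - \<delta>) * map_pen N \<gamma> \<pi> (card S) + R \<omega>) \<and>
        (\<integral>\<^sup>+\<omega>. ennreal (R \<omega>) \<partial>M) \<le> ennreal K))"
proof -
  define g where "g = ln (1 + \<gamma>min\<^sup>2 / (4 * (1 + \<gamma>max)))"
  have g: "0 < g" unfolding g_def using \<gamma>m by (intro ln_gt_zero) auto
  have \<gamma>M: "0 < \<gamma>max" using \<gamma>m by simp
  \<comment> \<open>c separates the three ranges: sizes up to c N are sparse for every admissible
    \<gamma>, sizes from (1 - c) N on are dense. \<delta> is then chosen below the slack of each
    range, in the middle one depending on c.\<close>
  define c where "c = min (4 powr (- \<gamma>max)) (min (g / (4 * \<gamma>max)) (1 / 2))"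
  have c: "0 < c" "c \<le> 1 / 2" "c \<le> 4 powr (- \<gamma>max)" "c \<le> g / (4 * \<gamma>max)" using g \<gamma>M by (auto simp: c_def)
  define \<delta> where "\<delta> = min (1 / (2 * (1 + 2 * \<gamma>max))) (min (g / (4 * \<gamma>max)) (c / (1 + \<gamma>max) / 2 / (1 + \<gamma>max)))"
  have \<delta>: "0 < \<delta>" "\<delta> \<le> 1 / (2 * (1 + 2 * \<gamma>max))" "\<delta> \<le> g / (4 * \<gamma>max)" "\<delta> \<le> c / (1 + \<gamma>max) / 2 / (1 + \<gamma>max)"
    using g \<gamma>M c by (auto simp: \<delta>_def)
  have \<delta>2: "\<delta> \<le> 1 / 2" using \<delta>(2) by (rule order_trans) (use \<gamma>M in \<open>auto simp: field_simps\<close>)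
  have \<delta>3: "\<delta> * (1 + \<gamma>max) \<le> c / (1 + \<gamma>max) / 2"
    using mult_right_mono[OF \<delta>(4), of "1 + \<gamma>max"] \<gamma>M by simp
  have gc: "(\<delta> + c) * \<gamma>max \<le> g / 2"
  proof -
    have "(\<delta> + c) * \<gamma>max \<le> (g / (4 * \<gamma>max) + g / (4 * \<gamma>max)) * \<gamma>max"
      using \<delta>(3) c(4) \<gamma>M by (intro mult_right_mono) auto
    then show ?thesis using \<gamma>M by simp
  qed
  define \<eta> where "\<eta> = min (g / 8) (c / (1 + \<gamma>max) / 2)"
  have \<eta>: "0 < \<eta>" using g c \<gamma>M by (auto simp: \<eta>_def)
  have \<eta>2: "\<eta> \<le> g / 8" "\<eta> \<le> c / (1 + \<gamma>max) / 2" unfolding \<eta>_def by (rule min.cobounded1 min.cobounded2)+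
  define D where "D = 4 * (1 + 1 / \<gamma>min)"
  have D: "0 \<le> D" using \<gamma>m by (simp add: D_def)
  define K where "K = 4 + D * (2 * exp \<eta> / \<eta>\<^sup>2)"
  have K: "0 \<le> K" using D \<eta> by (simp add: K_def)
  show ?thesis
  proof (rule exI[of _ \<delta>], rule exI[of _ K], intro conjI allI impI)
    fix M :: "'a measure" and N z \<gamma> \<pi>
    assume fam: "chi_square_family M N z" and \<gamma>: "\<gamma>min \<le> \<gamma>" "\<gamma> \<le> \<gamma>max" and \<pi>: "set_pmf \<pi> = {0..N}"
    interpret chi_square_family M N z by fact
    define q where "q \<kappa> = (1 - \<delta>) * map_pen N \<gamma> \<pi> \<kappa>" for \<kappa>
    have pos: "0 < pmf \<pi> \<kappa>" if "\<kappa> \<le> N" for \<kappa> using that \<pi> by (auto simp: pmf_positive_iff)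
    have exN: "exp (- u * real N) \<le> exp (- \<eta> * real N)" if "\<eta> \<le> u" for u
      using that by (simp add: mult_right_mono)
    have "\<exists>R. dominates \<kappa> (q \<kappa>) R (4 * pmf \<pi> \<kappa> + D * ((real N + 1) * exp (- \<eta> * real N)))" if \<kappa>: "\<kappa> \<le> N" for \<kappa>
    proof -
      note p = pos[OF \<kappa>]
      have nn: "0 \<le> D * ((real N + 1) * exp (- \<eta> * real N))" "0 \<le> 4 * pmf \<pi> \<kappa>" using D by auto
      consider "real \<kappa> \<le> c * real N" | "(1 - c) * real N \<le> real \<kappa>" | "c * real N < real \<kappa>" "real \<kappa> < (1 - c) * real N"
        by linarith
      then show ?thesis
      proof cases
        case 1
        have "c \<le> 4 powr (- \<gamma>)" using c(3) \<gamma> by (smt (verit) powr_mono)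
        then have "real \<kappa> \<le> 4 powr (- \<gamma>) * real N" using 1 mult_right_mono[of c "4 powr (- \<gamma>)" "real N"] by linarith
        moreover have "\<delta> \<le> 1 / (2 * (1 + 2 * \<gamma>))" using \<delta>(2) by (rule order_trans) (use \<gamma> \<gamma>m in \<open>auto intro!: divide_left_mono\<close>)
        ultimately obtain R where "dominates \<kappa> (q \<kappa>) R (4 * pmf \<pi> \<kappa>)"
          using dominates_sparse[OF _ \<kappa> p, of \<gamma> \<delta>] \<gamma> \<gamma>m unfolding q_def by auto
        then show ?thesis using nn dominates_mono by (metis le_add_same_cancel1)
      next
        case 2
        obtain R where R: "dominates \<kappa> (q \<kappa>) R (D * exp (- (g / 8) * real N))"
          using dominates_dense[OF \<gamma>m(1) \<gamma> \<kappa> p 2, of \<delta>] c \<delta> \<delta>2 gc unfolding g_def[symmetric] q_def D_def by auto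
        have "D * exp (- (g / 8) * real N) \<le> D * (1 * exp (- \<eta> * real N))"
          using mult_left_mono[OF exN[OF \<eta>2(1)] D] by simp
        also have "\<dots> \<le> D * ((real N + 1) * exp (- \<eta> * real N))" using D by (intro mult_left_mono mult_right_mono) auto
        also have "\<dots> \<le> 4 * pmf \<pi> \<kappa> + D * ((real N + 1) * exp (- \<eta> * real N))" using nn by simp
        finally show ?thesis using R dominates_mono by blast
      next
        case 3
        have "0 < \<kappa>" using 3(1) c by (cases \<kappa>) (auto simp: mult_less_0_iff)
        moreover have "\<kappa> < N"
        proof -
          have "(1 - c) * real N \<le> 1 * real N" using c by (intro mult_right_mono) auto
          then show ?thesis using 3(2) by simp
        qed
        ultimately obtain R where R: "dominates \<kappa> (q \<kappa>) R (D * (real N + 1) * exp (- (c / (1 + \<gamma>max) / 2) * real N))"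
          using dominates_middle[OF \<gamma>m(1) \<gamma> _ _ p c(1), of \<delta>] 3 \<delta> \<delta>2 \<delta>3 unfolding q_def D_def by auto
        have "D * (real N + 1) * exp (- (c / (1 + \<gamma>max) / 2) * real N) \<le> D * (real N + 1) * exp (- \<eta> * real N)"
          using D by (intro mult_left_mono exN \<eta>2) auto
        also have "\<dots> \<le> 4 * pmf \<pi> \<kappa> + D * ((real N + 1) * exp (- \<eta> * real N))" using nn by (simp add: mult.assoc)
        finally show ?thesis using R dominates_mono by blast
      qed
    qed
    then obtain R where R: "\<And>\<kappa>. \<kappa> \<le> N \<Longrightarrow> dominates \<kappa> (q \<kappa>) (R \<kappa>) (4 * pmf \<pi> \<kappa> + D * ((real N + 1) * exp (- \<eta> * real N)))"
      by metis
    define R' where "R' \<omega> = (\<Sum>\<kappa>\<le>N. R \<kappa> \<omega>)" for \<omega>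
    have Rnn: "0 \<le> R \<kappa> \<omega>" if "\<kappa> \<le> N" for \<kappa> \<omega> using R[OF that] by (auto simp: dominates_def)
    have Rm: "R \<kappa> \<in> borel_measurable M" if "\<kappa> \<le> N" for \<kappa> using R[OF that] by (auto simp: dominates_def)
    show "\<exists>R\<in>borel_measurable M. (\<forall>\<omega>. 0 \<le> R \<omega>) \<and>
        (\<forall>\<omega> S. S \<subseteq> {..<N} \<longrightarrow> (\<Sum>k\<in>S. (z k \<omega>)\<^sup>2) \<le> (1 - \<delta>) * map_pen N \<gamma> \<pi> (card S) + R \<omega>) \<and>
        (\<integral>\<^sup>+\<omega>. ennreal (R \<omega>) \<partial>M) \<le> ennreal K"
    proof (intro bexI[of _ R'] conjI allI impI)
      show "R' \<in> borel_measurable M" unfolding R'_def using Rm by (intro borel_measurable_sum) auto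
      show "0 \<le> R' \<omega>" for \<omega> unfolding R'_def using Rnn by (intro sum_nonneg) auto
    next
      fix \<omega> S assume S: "S \<subseteq> {..<N}"
      then have cS: "card S \<le> N" using card_mono[OF _ S] by simp
      have "(\<Sum>k\<in>S. (z k \<omega>)\<^sup>2) \<le> q (card S) + R (card S) \<omega>"
        using R[OF cS] S by (auto simp: dominates_def)
      also have "R (card S) \<omega> \<le> R' \<omega>" unfolding R'_def using Rnn cS by (intro member_le_sum) auto
      finally show "(\<Sum>k\<in>S. (z k \<omega>)\<^sup>2) \<le> (1 - \<delta>) * map_pen N \<gamma> \<pi> (card S) + R' \<omega>" by (simp add: q_def)
    next
      have "(\<integral>\<^sup>+\<omega>. ennreal (R' \<omega>) \<partial>M) = (\<Sum>\<kappa>\<le>N. \<integral>\<^sup>+\<omega>. ennreal (R \<kappa> \<omega>) \<partial>M)"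
        unfolding R'_def using Rnn Rm
        by (subst nn_integral_sum[symmetric]) (auto intro!: nn_integral_cong sum_ennreal[symmetric])
      also have "\<dots> \<le> (\<Sum>\<kappa>\<le>N. ennreal (4 * pmf \<pi> \<kappa> + D * ((real N + 1) * exp (- \<eta> * real N))))"
        using R by (intro sum_mono) (auto simp: dominates_def)
      also have "\<dots> = ennreal (\<Sum>\<kappa>\<le>N. 4 * pmf \<pi> \<kappa> + D * ((real N + 1) * exp (- \<eta> * real N)))"
        using D by (intro sum_ennreal) auto
      also have "\<dots> \<le> ennreal K"
      proof (rule ennreal_leI)
        \<comment> \<open>Summability over the small sizes comes from the prior being a probability,
          whatever its shape.\<close>
        have "(\<Sum>\<kappa>\<le>N. pmf \<pi> \<kappa>) \<le> 1"
          using measure_measure_pmf_finite[of "{..N}" \<pi>] by (metis finite_atMost measure_pmf.prob_le_1)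
        moreover have "(\<Sum>\<kappa>\<le>N. 4 * pmf \<pi> \<kappa> + D * ((real N + 1) * exp (- \<eta> * real N))) =
            4 * (\<Sum>\<kappa>\<le>N. pmf \<pi> \<kappa>) + real (Suc N) * (D * ((real N + 1) * exp (- \<eta> * real N)))"
          by (simp only: sum.distrib sum_distrib_left[of 4, symmetric] sum_constant card_atMost)
        moreover have "real (Suc N) * (D * ((real N + 1) * exp (- \<eta> * real N))) = D * ((real N + 1)\<^sup>2 * exp (- \<eta> * real N))"
          by (simp add: power2_eq_square add.commute)
        ultimately have "(\<Sum>\<kappa>\<le>N. 4 * pmf \<pi> \<kappa> + D * ((real N + 1) * exp (- \<eta> * real N))) \<le>
            4 + D * ((real N + 1)\<^sup>2 * exp (- \<eta> * real N))" by linarith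
        also have "\<dots> \<le> K" unfolding K_def using polynomial_exp_bound[OF \<eta>, of N] D
          by (intro add_left_mono mult_left_mono) auto
        finally show "(\<Sum>\<kappa>\<le>N. 4 * pmf \<pi> \<kappa> + D * ((real N + 1) * exp (- \<eta> * real N))) \<le> K" .
      qed
      finally show "(\<integral>\<^sup>+\<omega>. ennreal (R' \<omega>) \<partial>M) \<le> ennreal K" .
    qed
  qed (use \<delta> \<delta>2 K in auto)
qed

subsection \<open>The space \<open>L\<^sup>2[0,1]\<close>\<close>

abbreviation unit_meas :: "real measure" where
  "unit_meas \<equiv> restrict_space lborel {0..1}"

lemma space_unit_meas: "space unit_meas = {0..1}"
  by (simp add: space_restrict_space)

lemma finite_measure_unit: "finite_measure unit_meas"
  by (rule finite_measureI) (simp add: emeasure_restrict_space space_restrict_space)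

lemma L2_unit_iff: "f \<in> L2_unit \<longleftrightarrow> f \<in> borel_measurable unit_meas \<and> integrable unit_meas (\<lambda>t. (f t)\<^sup>2)"
  unfolding L2_unit_def set_borel_measurable_def set_integrable_def
  by (simp add: borel_measurable_restrict_space_iff integrable_restrict_space)

lemma inner_unit_eq: "inner_unit f g = (\<integral>t. f t * g t \<partial>unit_meas)"
  unfolding inner_unit_def set_lebesgue_integral_def by (simp add: integral_restrict_space)

lemma sq_dist_unit_eq: "sq_dist_unit f g = (\<integral>\<^sup>+t. ennreal ((f t - g t)\<^sup>2) \<partial>unit_meas)"
  unfolding sq_dist_unit_def by (simp add: nn_integral_restrict_space)

lemma L2_unit_meas [measurable_dest]: "f \<in> L2_unit \<Longrightarrow> f \<in> borel_measurable unit_meas"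
  by (simp add: L2_unit_iff)

lemma L2_unit_mult_integrable:
  assumes "f \<in> L2_unit" "g \<in> L2_unit"
  shows "integrable unit_meas (\<lambda>t. f t * g t)"
proof (rule Bochner_Integration.integrable_bound)
  show "integrable unit_meas (\<lambda>t. (f t)\<^sup>2 + (g t)\<^sup>2)"
    using assms by (simp add: L2_unit_iff)
  show "(\<lambda>t. f t * g t) \<in> borel_measurable unit_meas"
    using assms by (auto simp: L2_unit_iff)
  have "\<bar>a * b\<bar> \<le> a\<^sup>2 + b\<^sup>2" for a b :: real
  proof -
    have "2 * \<bar>a\<bar> * \<bar>b\<bar> \<le> \<bar>a\<bar>\<^sup>2 + \<bar>b\<bar>\<^sup>2" by (rule sum_squares_bound)
    moreover have "0 \<le> \<bar>a\<bar> * \<bar>b\<bar>" by simp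
    ultimately show ?thesis unfolding abs_mult power2_abs by linarith
  qed
  then show "AE t in unit_meas. norm (f t * g t) \<le> norm ((f t)\<^sup>2 + (g t)\<^sup>2)"
    by (intro AE_I2) simp
qed

lemma L2_unit_integrable: "f \<in> L2_unit \<Longrightarrow> integrable unit_meas f"
proof -
  assume f: "f \<in> L2_unit"
  interpret finite_measure unit_meas by (rule finite_measure_unit)
  have "(\<lambda>_. 1) \<in> L2_unit" by (simp add: L2_unit_iff)
  from L2_unit_mult_integrable[OF f this] show ?thesis by simp
qed

lemma L2_unit_cmult: "f \<in> L2_unit \<Longrightarrow> (\<lambda>t. c * f t) \<in> L2_unit"
  by (auto simp: L2_unit_iff power_mult_distrib)

lemma L2_unit_add:
  assumes "f \<in> L2_unit" "g \<in> L2_unit"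
  shows "(\<lambda>t. f t + g t) \<in> L2_unit"
proof -
  have "integrable unit_meas (\<lambda>t. (f t)\<^sup>2 + 2 * (f t * g t) + (g t)\<^sup>2)"
    using assms L2_unit_mult_integrable[OF assms] by (simp add: L2_unit_iff)
  then show ?thesis using assms by (auto simp: L2_unit_iff power2_sum algebra_simps)
qed

lemma L2_unit_diff:
  assumes "f \<in> L2_unit" "g \<in> L2_unit"
  shows "(\<lambda>t. f t - g t) \<in> L2_unit"
  using L2_unit_add[OF assms(1) L2_unit_cmult[OF assms(2), of "-1"]] by simp

lemma L2_unit_sum: "(\<And>k. k \<in> A \<Longrightarrow> f k \<in> L2_unit) \<Longrightarrow> (\<lambda>t. \<Sum>k\<in>A. f k t) \<in> L2_unit"
proof (induction A rule: infinite_finite_induct)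
  case (insert a A)
  then show ?case using L2_unit_add[of "f a" "\<lambda>t. \<Sum>k\<in>A. f k t"] by simp
qed (auto simp: L2_unit_iff)

lemma L2_unit_lincomb: "(\<And>k. k \<in> A \<Longrightarrow> f k \<in> L2_unit) \<Longrightarrow> (\<lambda>t. \<Sum>k\<in>A. c k * f k t) \<in> L2_unit"
  by (intro L2_unit_sum L2_unit_cmult) auto

lemma inner_unit_cong:
  "(\<And>t. t \<in> {0..1} \<Longrightarrow> f t = f' t) \<Longrightarrow> (\<And>t. t \<in> {0..1} \<Longrightarrow> g t = g' t) \<Longrightarrow> inner_unit f g = inner_unit f' g'"
  unfolding inner_unit_eq by (intro Bochner_Integration.integral_cong) (auto simp: space_unit_meas)

lemma inner_unit_commute: "inner_unit f g = inner_unit g f"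
  by (simp add: inner_unit_eq mult.commute)

lemma inner_unit_nonneg: "0 \<le> inner_unit f f"
  unfolding inner_unit_eq by (intro Bochner_Integration.integral_nonneg) auto

lemma inner_unit_cmult_left: "inner_unit (\<lambda>t. c * f t) g = c * inner_unit f g"
  by (simp add: inner_unit_eq mult.assoc)

lemma inner_unit_diff_left:
  "f \<in> L2_unit \<Longrightarrow> g \<in> L2_unit \<Longrightarrow> h \<in> L2_unit \<Longrightarrow>
    inner_unit (\<lambda>t. f t - g t) h = inner_unit f h - inner_unit g h"
  unfolding inner_unit_eq
  by (subst Bochner_Integration.integral_diff[symmetric]) (auto simp: L2_unit_mult_integrable left_diff_distrib)

lemma inner_unit_lincomb_left:
  "(\<And>k. k \<in> A \<Longrightarrow> f k \<in> L2_unit) \<Longrightarrow> h \<in> L2_unit \<Longrightarrow>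
    inner_unit (\<lambda>t. \<Sum>k\<in>A. c k * f k t) h = (\<Sum>k\<in>A. c k * inner_unit (f k) h)"
  unfolding inner_unit_eq sum_distrib_right
  by (subst Bochner_Integration.integral_sum) (auto simp: mult.assoc intro!: L2_unit_mult_integrable)

lemma sq_dist_unit_inner:
  assumes "f \<in> L2_unit" "g \<in> L2_unit"
  shows "sq_dist_unit f g = ennreal (inner_unit (\<lambda>t. f t - g t) (\<lambda>t. f t - g t))"
proof -
  have "integrable unit_meas (\<lambda>t. (f t - g t)\<^sup>2)" using L2_unit_diff[OF assms] by (simp add: L2_unit_iff)
  then show ?thesis unfolding sq_dist_unit_eq inner_unit_eq
    by (subst nn_integral_eq_integral) (auto simp: power2_eq_square)
qed

lemma inner_unit_diff_square:
  assumes f: "f \<in> L2_unit" and g: "g \<in> L2_unit"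
  shows "inner_unit (\<lambda>t. f t - c * g t) (\<lambda>t. f t - c * g t) =
    inner_unit f f - 2 * c * inner_unit f g + c\<^sup>2 * inner_unit g g"
proof -
  note cg = L2_unit_cmult[OF g, of c]
  have "inner_unit h (\<lambda>t. f t - c * g t) = inner_unit h f - c * inner_unit h g" if "h \<in> L2_unit" for h
    using inner_unit_diff_left[OF f cg that] inner_unit_cmult_left[of c g h]
    by (simp add: inner_unit_commute[of h])
  then have "inner_unit (\<lambda>t. f t - c * g t) (\<lambda>t. f t - c * g t) =
      (inner_unit f f - c * inner_unit f g) - (c * inner_unit g f - c * (c * inner_unit g g))"
    using inner_unit_diff_left[OF f cg L2_unit_diff[OF f cg]] f cg g
    by (simp add: inner_unit_cmult_left right_diff_distrib)
  then show ?thesis by (simp add: inner_unit_commute[of g f] power2_eq_square algebra_simps)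
qed

lemma inner_unit_Cauchy_Schwarz:
  assumes f: "f \<in> L2_unit" and g: "g \<in> L2_unit"
  shows "\<bar>inner_unit f g\<bar> \<le> sqrt (inner_unit f f) * sqrt (inner_unit g g)"
proof -
  define A where "A = inner_unit f f"
  define B where "B = inner_unit f g"
  define C where "C = inner_unit g g"
  have q: "0 \<le> A - 2 * c * B + c\<^sup>2 * C" for c
    unfolding A_def B_def C_def inner_unit_diff_square[OF f g, symmetric] by (rule inner_unit_nonneg)
  have AC: "0 \<le> A" "0 \<le> C" by (auto simp: A_def C_def inner_unit_nonneg)
  have "B\<^sup>2 \<le> A * C"
  proof (cases "C = 0")
    case True
    have "B = 0"
    proof (rule ccontr)
      assume "B \<noteq> 0"
      \<comment> \<open>With C = 0 the quadratic is affine in c, and at this point its value is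
        -1.\<close>
      then show False using q[of "(A + 1) / (2 * B)"] True AC by (simp add: field_simps)
    qed
    then show ?thesis using True by simp
  next
    case False
    then show ?thesis using q[of "B / C"] AC by (simp add: field_simps power2_eq_square)
  qed
  then have "sqrt (B\<^sup>2) \<le> sqrt (A * C)" by (rule real_sqrt_le_mono)
  then show ?thesis by (simp add: real_sqrt_mult A_def B_def C_def)
qed

definition norm_unit :: "(real \<Rightarrow> real) \<Rightarrow> real" where
  "norm_unit f = sqrt (inner_unit f f)"

lemma norm_unit_nonneg: "0 \<le> norm_unit f" by (simp add: norm_unit_def inner_unit_nonneg)

lemma norm_unit_sq: "(norm_unit f)\<^sup>2 = inner_unit f f" by (simp add: norm_unit_def inner_unit_nonneg)

lemma sq_dist_unit_norm: "f \<in> L2_unit \<Longrightarrow> g \<in> L2_unit \<Longrightarrow> sq_dist_unit f g = ennreal ((norm_unit (\<lambda>t. f t - g t))\<^sup>2)"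
  by (simp add: norm_unit_sq sq_dist_unit_inner)

lemma norm_unit_diff_triangle:
  assumes "f \<in> L2_unit" "g \<in> L2_unit"
  shows "norm_unit (\<lambda>t. f t - g t) \<le> norm_unit f + norm_unit g"
proof -
  have "(norm_unit (\<lambda>t. f t - g t))\<^sup>2 \<le> (norm_unit f + norm_unit g)\<^sup>2"
    using inner_unit_diff_square[OF assms, of 1] inner_unit_Cauchy_Schwarz[OF assms]
    by (simp add: norm_unit_sq power2_sum) (simp add: norm_unit_def)
  then show ?thesis using norm_unit_nonneg by (simp add: power2_le_iff_abs_le)
qed

lemma norm_unit_cmult: "norm_unit (\<lambda>t. c * f t) = \<bar>c\<bar> * norm_unit f"
proof -
  have "inner_unit (\<lambda>t. c * f t) (\<lambda>t. c * f t) = c * (c * inner_unit f f)"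
    by (metis inner_unit_cmult_left inner_unit_commute)
  then show ?thesis by (simp add: norm_unit_def real_sqrt_mult mult.assoc[symmetric])
qed

lemma norm_unit_add_triangle:
  assumes "f \<in> L2_unit" "g \<in> L2_unit"
  shows "norm_unit (\<lambda>t. f t + g t) \<le> norm_unit f + norm_unit g"
  using norm_unit_diff_triangle[OF assms(1) L2_unit_cmult[OF assms(2), of "-1"]] norm_unit_cmult[of "-1" g] by simp

lemma norm_unit_lincomb_le:
  assumes "\<And>k. k \<in> A \<Longrightarrow> f k \<in> L2_unit"
  shows "norm_unit (\<lambda>t. \<Sum>k\<in>A. c k * f k t) \<le> (\<Sum>k\<in>A. \<bar>c k\<bar> * norm_unit (f k))"
  using assms
proof (induction A rule: infinite_finite_induct)
  case (insert a A)
  then have "norm_unit (\<lambda>t. c a * f a t + (\<Sum>k\<in>A. c k * f k t)) \<le>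
      norm_unit (\<lambda>t. c a * f a t) + norm_unit (\<lambda>t. \<Sum>k\<in>A. c k * f k t)"
    by (intro norm_unit_add_triangle L2_unit_cmult L2_unit_lincomb) auto
  then show ?case using insert by (simp add: norm_unit_cmult)
qed (auto simp: norm_unit_def inner_unit_eq)

lemma L2_unit_continuous:
  assumes "continuous_on {0..1} g" "\<And>t. t \<in> {0..1} \<Longrightarrow> f t = g t"
  shows "f \<in> L2_unit"
proof -
  interpret finite_measure unit_meas by (rule finite_measure_unit)
  have g: "g \<in> borel_measurable unit_meas"
  proof -
    have "sets (restrict_space borel {0..1::real}) = sets unit_meas" by (rule sets_restrict_space_cong) simp
    then have "borel_measurable (restrict_space borel {0..1}) = (borel_measurable unit_meas :: (real \<Rightarrow> real) set)"
      by (rule measurable_cong_sets) simp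
    then show ?thesis using borel_measurable_continuous_on_restrict[OF assms(1)] by simp
  qed
  have "bounded (g ` {0..1})" using compact_imp_bounded[OF compact_continuous_image[OF assms(1)]] by simp
  then obtain B where B: "\<And>t. t \<in> {0..1} \<Longrightarrow> \<bar>g t\<bar> \<le> B"
    unfolding bounded_iff real_norm_def by blast
  have "integrable unit_meas (\<lambda>t. (g t)\<^sup>2)"
  proof (rule integrable_const_bound[where B = "B\<^sup>2"])
    show "AE t in unit_meas. norm ((g t)\<^sup>2) \<le> B\<^sup>2"
    proof (rule AE_I2)
      fix t assume "t \<in> space unit_meas"
      then have "\<bar>g t\<bar>\<^sup>2 \<le> B\<^sup>2" using B by (intro power_mono) (auto simp: space_unit_meas)
      then show "norm ((g t)\<^sup>2) \<le> B\<^sup>2" by simp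
    qed
  qed (use g in simp)
  moreover have "f \<in> borel_measurable unit_meas \<longleftrightarrow> g \<in> borel_measurable unit_meas"
    using assms(2) by (intro measurable_cong) (auto simp: space_unit_meas)
  moreover have "integrable unit_meas (\<lambda>t. (f t)\<^sup>2) \<longleftrightarrow> integrable unit_meas (\<lambda>t. (g t)\<^sup>2)"
    using assms(2) by (intro Bochner_Integration.integrable_cong) (auto simp: space_unit_meas)
  ultimately show ?thesis using g by (simp add: L2_unit_iff)
qed

subsection \<open>Gaussian empirical coefficients\<close>

lemma nn_integral_std_normal_exp:
  "(\<integral>\<^sup>+x. ennreal (std_normal_density x * exp (b * x)) \<partial>lborel) = ennreal (exp (b\<^sup>2 / 2))"
proof -
  have "std_normal_density x * exp (b * x) = exp (b\<^sup>2 / 2) * normal_density b 1 x" for x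
    unfolding std_normal_density_def normal_density_def
    by (simp add: exp_add[symmetric] power2_eq_square field_simps)
  then have "(\<integral>\<^sup>+x. ennreal (std_normal_density x * exp (b * x)) \<partial>lborel) =
      (\<integral>\<^sup>+x. ennreal (exp (b\<^sup>2 / 2)) * ennreal (normal_density b 1 x) \<partial>lborel)"
    by (simp add: ennreal_mult')
  also have "\<dots> = ennreal (exp (b\<^sup>2 / 2)) * (\<integral>\<^sup>+x. ennreal (normal_density b 1 x) \<partial>lborel)"
    by (rule nn_integral_cmult) simp
  also have "(\<integral>\<^sup>+x. ennreal (normal_density b 1 x) \<partial>lborel) = 1"
    using prob_space.emeasure_space_1[OF prob_space_normal_density[of 1 b]]
    by (simp add: emeasure_density)
  finally show ?thesis by simp
qed

lemma nn_integral_std_normal_exp_sq: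
  assumes "a < 1 / 2"
  shows "(\<integral>\<^sup>+x. ennreal (std_normal_density x * exp (a * x\<^sup>2)) \<partial>lborel) = ennreal ((1 - 2 * a) powr (- 1 / 2))"
proof -
  define s where "s = 1 / sqrt (1 - 2 * a)"
  have s: "s > 0" "s\<^sup>2 = 1 / (1 - 2 * a)" using assms by (auto simp: s_def power_divide)
  have s': "s = (1 - 2 * a) powr (- 1 / 2)"
  proof -
    have "(1 - 2 * a) powr (- (1 / 2)) = 1 / (1 - 2 * a) powr (1 / 2)" by (rule powr_minus_divide)
    also have "\<dots> = s" unfolding s_def using assms by (subst powr_half_sqrt) auto
    finally show ?thesis by simp
  qed
  have "std_normal_density x * exp (a * x\<^sup>2) = s * normal_density 0 s x" for x
  proof -
    have "- (x\<^sup>2) / 2 + a * x\<^sup>2 = - (x\<^sup>2) / (2 * s\<^sup>2)"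
      unfolding s(2) by (simp add: algebra_simps)
    then have "exp (- (x\<^sup>2) / 2) * exp (a * x\<^sup>2) = exp (- (x\<^sup>2) / (2 * s\<^sup>2))"
      by (simp add: exp_add[symmetric])
    then show ?thesis
      unfolding std_normal_density_def normal_density_def using s(1) by (simp add: real_sqrt_mult)
  qed
  then have "(\<integral>\<^sup>+x. ennreal (std_normal_density x * exp (a * x\<^sup>2)) \<partial>lborel) =
      (\<integral>\<^sup>+x. ennreal s * ennreal (normal_density 0 s x) \<partial>lborel)"
    using s by (simp add: ennreal_mult')
  also have "\<dots> = ennreal s * (\<integral>\<^sup>+x. ennreal (normal_density 0 s x) \<partial>lborel)"
    by (rule nn_integral_cmult) simp
  also have "(\<integral>\<^sup>+x. ennreal (normal_density 0 s x) \<partial>lborel) = 1"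
    using prob_space.emeasure_space_1[OF prob_space_normal_density[OF s(1), of 0]]
    by (simp add: emeasure_density)
  finally show ?thesis by (simp add: s')
qed

text \<open>A square in the exponent is linearized by an independent standard normal variable \<open>x\<close>:
  \<open>exp (a y\<^sup>2) = E exp (sqrt (2 a) y x)\<close>.\<close>
lemma nn_integral_exp_linear_quadratic:
  fixes z :: "nat \<Rightarrow> 'a \<Rightarrow> real"
  assumes M: "sigma_finite_measure M" and a: "0 \<le> a" "a < 1 / 2"
    and meas: "\<And>k. k < N \<Longrightarrow> z k \<in> borel_measurable M"
    and mgf: "\<And>c T. T \<subseteq> {..<N} \<Longrightarrow>
      (\<integral>\<^sup>+\<omega>. ennreal (exp (\<Sum>k\<in>T. c k * z k \<omega>)) \<partial>M) = ennreal (exp ((\<Sum>k\<in>T. (c k)\<^sup>2) / 2))"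
    and S: "finite S" "S \<subseteq> {..<N}" and T: "T \<subseteq> {..<N}" "S \<inter> T = {}"
  shows "(\<integral>\<^sup>+\<omega>. ennreal (exp ((\<Sum>k\<in>T. c k * z k \<omega>) + a * (\<Sum>k\<in>S. (z k \<omega>)\<^sup>2))) \<partial>M) =
    ennreal (exp ((\<Sum>k\<in>T. (c k)\<^sup>2) / 2) * (1 - 2 * a) powr (- real (card S) / 2))"
  using S T
proof (induction S arbitrary: T c rule: finite_induct)
  case empty
  then show ?case using mgf[of T c] a by simp
next
  case (insert j S)
  interpret sigma_finite_measure M by fact
  interpret pair: pair_sigma_finite M lborel ..
  have j: "j < N" "j \<notin> T" using insert by auto
  have finT: "finite T" using insert.prems finite_subset by blast
  have m[measurable]: "z j \<in> borel_measurable M"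
    "(\<lambda>\<omega>. \<Sum>k\<in>T. c k * z k \<omega>) \<in> borel_measurable M" "(\<lambda>\<omega>. \<Sum>k\<in>S. (z k \<omega>)\<^sup>2) \<in> borel_measurable M"
    using insert.prems meas j by (auto intro!: borel_measurable_sum borel_measurable_times borel_measurable_power)
  have sq: "ennreal (exp ((\<Sum>k\<in>T. c k * z k \<omega>) + a * (\<Sum>k\<in>insert j S. (z k \<omega>)\<^sup>2))) =
      (\<integral>\<^sup>+x. ennreal (std_normal_density x * exp ((\<Sum>k\<in>T. c k * z k \<omega>) + sqrt (2 * a) * x * z j \<omega> + a * (\<Sum>k\<in>S. (z k \<omega>)\<^sup>2))) \<partial>lborel)" for \<omega>
  proof -
    define E where "E = exp ((\<Sum>k\<in>T. c k * z k \<omega>) + a * (\<Sum>k\<in>S. (z k \<omega>)\<^sup>2))"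
    have "(\<integral>\<^sup>+x. ennreal (std_normal_density x * exp ((\<Sum>k\<in>T. c k * z k \<omega>) + sqrt (2 * a) * x * z j \<omega> + a * (\<Sum>k\<in>S. (z k \<omega>)\<^sup>2))) \<partial>lborel)
      = (\<integral>\<^sup>+x. ennreal E * ennreal (std_normal_density x * exp ((sqrt (2 * a) * z j \<omega>) * x)) \<partial>lborel)"
      by (intro nn_integral_cong) (simp add: E_def ennreal_mult'[symmetric] exp_add mult_ac)
    also have "\<dots> = ennreal E * ennreal (exp ((sqrt (2 * a) * z j \<omega>)\<^sup>2 / 2))"
      by (subst nn_integral_cmult) (auto simp: nn_integral_std_normal_exp)
    also have "(sqrt (2 * a) * z j \<omega>)\<^sup>2 / 2 = a * (z j \<omega>)\<^sup>2" using a by (simp add: power_mult_distrib)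
    also have "ennreal E * ennreal (exp (a * (z j \<omega>)\<^sup>2)) = ennreal (exp ((\<Sum>k\<in>T. c k * z k \<omega>) + a * (\<Sum>k\<in>insert j S. (z k \<omega>)\<^sup>2)))"
      using insert.hyps by (simp add: E_def ennreal_mult'[symmetric] exp_add[symmetric] algebra_simps)
    finally show ?thesis ..
  qed
  \<comment> \<open>For fixed x the index j has moved from the quadratic to the linear part, with
    coefficient \<open>sqrt (2 * a) * x\<close>; hence the induction over all T and c. The square of
    this coefficient contributes exp (a x^2), which the remaining integral over x turns into one
    more factor (1 - 2 a)^(-1/2).\<close>
  have IH: "(\<integral>\<^sup>+\<omega>. ennreal (std_normal_density x * exp ((\<Sum>k\<in>T. c k * z k \<omega>) + sqrt (2 * a) * x * z j \<omega> + a * (\<Sum>k\<in>S. (z k \<omega>)\<^sup>2))) \<partial>M) =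
      ennreal (exp ((\<Sum>k\<in>T. (c k)\<^sup>2) / 2) * (1 - 2 * a) powr (- real (card S) / 2)) * ennreal (std_normal_density x * exp (a * x\<^sup>2))" for x
  proof -
    define c' where "c' = c(j := sqrt (2 * a) * x)"
    have sumc: "(\<Sum>k\<in>insert j T. c' k * z k \<omega>) = (\<Sum>k\<in>T. c k * z k \<omega>) + sqrt (2 * a) * x * z j \<omega>" for \<omega>
    proof -
      have "(\<Sum>k\<in>T. c' k * z k \<omega>) = (\<Sum>k\<in>T. c k * z k \<omega>)" using j by (intro sum.cong) (auto simp: c'_def)
      then show ?thesis using finT j by (simp add: c'_def)
    qed
    have sumsq: "(\<Sum>k\<in>insert j T. (c' k)\<^sup>2) = (\<Sum>k\<in>T. (c k)\<^sup>2) + 2 * a * x\<^sup>2"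
    proof -
      have "(\<Sum>k\<in>T. (c' k)\<^sup>2) = (\<Sum>k\<in>T. (c k)\<^sup>2)" using j by (intro sum.cong) (auto simp: c'_def)
      then show ?thesis using finT j a by (simp add: c'_def power_mult_distrib)
    qed
    have "(\<integral>\<^sup>+\<omega>. ennreal (std_normal_density x * exp ((\<Sum>k\<in>T. c k * z k \<omega>) + sqrt (2 * a) * x * z j \<omega> + a * (\<Sum>k\<in>S. (z k \<omega>)\<^sup>2))) \<partial>M) =
      ennreal (std_normal_density x) * (\<integral>\<^sup>+\<omega>. ennreal (exp ((\<Sum>k\<in>insert j T. c' k * z k \<omega>) + a * (\<Sum>k\<in>S. (z k \<omega>)\<^sup>2))) \<partial>M)"
      unfolding sumc by (subst nn_integral_cmult[symmetric]) (auto simp: ennreal_mult')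
    also have "(\<integral>\<^sup>+\<omega>. ennreal (exp ((\<Sum>k\<in>insert j T. c' k * z k \<omega>) + a * (\<Sum>k\<in>S. (z k \<omega>)\<^sup>2))) \<partial>M) =
        ennreal (exp ((\<Sum>k\<in>insert j T. (c' k)\<^sup>2) / 2) * (1 - 2 * a) powr (- real (card S) / 2))"
      using insert.prems insert.hyps by (intro insert.IH) auto
    also have "exp ((\<Sum>k\<in>insert j T. (c' k)\<^sup>2) / 2) = exp ((\<Sum>k\<in>T. (c k)\<^sup>2) / 2) * exp (a * x\<^sup>2)"
      unfolding sumsq by (simp add: exp_add[symmetric] add_divide_distrib)
    finally show ?thesis by (simp add: ennreal_mult'[symmetric] mult_ac)
  qed
  have "(\<integral>\<^sup>+\<omega>. ennreal (exp ((\<Sum>k\<in>T. c k * z k \<omega>) + a * (\<Sum>k\<in>insert j S. (z k \<omega>)\<^sup>2))) \<partial>M) =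
      (\<integral>\<^sup>+x. (\<integral>\<^sup>+\<omega>. ennreal (std_normal_density x * exp ((\<Sum>k\<in>T. c k * z k \<omega>) + sqrt (2 * a) * x * z j \<omega> + a * (\<Sum>k\<in>S. (z k \<omega>)\<^sup>2))) \<partial>M) \<partial>lborel)"
    unfolding sq by (rule pair.Fubini'[symmetric]) simp
  also have "\<dots> = ennreal (exp ((\<Sum>k\<in>T. (c k)\<^sup>2) / 2) * (1 - 2 * a) powr (- real (card S) / 2)) * ennreal ((1 - 2 * a) powr (- 1 / 2))"
    unfolding IH by (subst nn_integral_cmult) (auto simp: nn_integral_std_normal_exp_sq[OF a(2)])
  also have "\<dots> = ennreal (exp ((\<Sum>k\<in>T. (c k)\<^sup>2) / 2) * ((1 - 2 * a) powr (- real (card S) / 2) * (1 - 2 * a) powr (- 1 / 2)))"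
    by (simp add: ennreal_mult'[symmetric] mult.assoc)
  also have "(1 - 2 * a) powr (- real (card S) / 2) * (1 - 2 * a) powr (- 1 / 2) = (1 - 2 * a) powr (- real (card (insert j S)) / 2)"
  proof -
    have "- real (card S) / 2 + (- 1 / 2) = - real (card (insert j S)) / 2" using insert.hyps by (simp add: field_simps)
    then show ?thesis by (metis powr_add)
  qed
  finally show ?case .
qed

lemma chi_square_familyI:
  assumes "sigma_finite_measure M" and "\<And>k. k < N \<Longrightarrow> z k \<in> borel_measurable M"
    and "\<And>c T. T \<subseteq> {..<N} \<Longrightarrow>
      (\<integral>\<^sup>+\<omega>. ennreal (exp (\<Sum>k\<in>T. c k * z k \<omega>)) \<partial>M) = ennreal (exp ((\<Sum>k\<in>T. (c k)\<^sup>2) / 2))"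
  shows "chi_square_family M N z"
proof
  fix S :: "nat set" and a :: real
  assume S: "S \<subseteq> {..<N}" and a: "0 < a" "a < 1 / 2"
  show "(\<integral>\<^sup>+\<omega>. ennreal (exp (a * (\<Sum>k\<in>S. (z k \<omega>)\<^sup>2))) \<partial>M) \<le> ennreal ((1 - 2 * a) powr (- real (card S) / 2))"
    using nn_integral_exp_linear_quadratic[OF assms(1) _ a(2) assms(2,3) _ S, of "{}" "\<lambda>_. 0"] a S finite_subset[OF S]
    by simp
qed (use assms in auto)

section \<open>Partitions and integrals of step functions\<close>

lemma is_partition_less:
  assumes "is_partition m t" "i < j" "j \<le> m"
  shows "t i < t j"
  using assms(2,3)
proof (induction j)
  case (Suc j)
  have "t j < t (Suc j)" using assms(1) Suc.prems by (auto simp: is_partition_def)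
  then show ?case using Suc by (cases "i = j") auto
qed simp

lemma is_partition_range:
  assumes "is_partition m t" "i \<le> m"
  shows "t i \<in> {0..1}"
proof -
  have "t 0 \<le> t i" using is_partition_less[OF assms(1), of 0 i] assms(2) by (cases "i = 0") auto
  moreover have "t i \<le> t m" using is_partition_less[OF assms(1), of i m] assms(2) by (cases "i = m") auto
  ultimately show ?thesis using assms(1) by (auto simp: is_partition_def)
qed

text \<open>An increment telescopes over the cells of a finer grid; testing the half-open interval
  at the right end points selects exactly the cells inside it.\<close>

lemma sum_increments_refine:
  fixes h F :: "_ \<Rightarrow> real"
  assumes h: "strict_mono_on {..<n} h" and p: "p \<in> h ` {..<n}" and q: "q \<in> h ` {..<n}" and pq: "p < q"
  shows "(\<Sum>i<n - 1. indicator {p<..q} (h (Suc i)) * (F (h (Suc i)) - F (h i))) = F q - F p"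
proof -
  obtain \<alpha> \<beta> where ab: "p = h \<alpha>" "q = h \<beta>" "\<alpha> < n" "\<beta> < n" using p q by auto
  have less: "h i < h j \<longleftrightarrow> i < j" if "i < n" "j < n" for i j
    using h that by (simp add: strict_mono_on_less)
  have le: "h i \<le> h j \<longleftrightarrow> i \<le> j" if "i < n" "j < n" for i j
    using h that by (simp add: strict_mono_on_less_eq)
  have "\<alpha> < \<beta>" using less ab pq by auto
  have "(\<Sum>i<n - 1. indicator {p<..q} (h (Suc i)) * (F (h (Suc i)) - F (h i))) =
      (\<Sum>i<n - 1. if i \<in> {\<alpha>..<\<beta>} then F (h (Suc i)) - F (h i) else 0)"
    using less le ab by (intro sum.cong) (auto simp: indicator_def less_Suc_eq_le Suc_le_eq)
  also have "\<dots> = (\<Sum>i\<in>{\<alpha>..<\<beta>}. F (h (Suc i)) - F (h i))"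
    using ab by (subst sum.inter_restrict[symmetric]) (auto intro!: sum.cong)
  also have "\<dots> = F q - F p" using sum_Suc_diff'[of \<alpha> \<beta> "\<lambda>i. F (h i)"] \<open>\<alpha> < \<beta>\<close> ab by simp
  finally show ?thesis .
qed

text \<open>The coefficients b do not depend on F. Taking for F a path of the process gives the
  integral of the linear combination, taking the indicator of x \<le> r as a function of r gives its
  value at x, so both are represented by the same data.\<close>

lemma step_common_refinement:
  assumes A: "finite A" and part: "\<And>k. k \<in> A \<Longrightarrow> is_partition (m k) (t k)"
  obtains n h b where "is_partition n h"
    "\<And>F :: real \<Rightarrow> real. (\<Sum>k\<in>A. c k * (\<Sum>i<m k. a k i * (F (t k (Suc i)) - F (t k i)))) =
       (\<Sum>i<n. b i * (F (h (Suc i)) - F (h i)))"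
proof (cases "A = {}")
  case True
  show ?thesis by (rule that[of 0 "\<lambda>_. 0" "\<lambda>_. 0"]) (auto simp: True is_partition_def)
next
  case False
  define T where "T = (\<Union>k\<in>A. t k ` {..m k})"
  have finT: "finite T" using A by (simp add: T_def)
  have T01: "T \<subseteq> {0..1}" using is_partition_range[OF part] by (auto simp: T_def)
  have neT: "T \<noteq> {}" using False by (auto simp: T_def)
  define n where "n = card T"
  have n: "0 < n" using finT neT by (simp add: n_def card_gt_0_iff)
  define h where "h i = sorted_list_of_set T ! i" for i
  have h: "strict_mono_on {..<n} h"
    using strict_sorted_list_of_set[of T]
    by (auto simp: strict_mono_on_def h_def n_def intro: sorted_wrt_nth_less)
  have "T = set (sorted_list_of_set T)" using finT by simp
  also have "\<dots> = h ` {..<n}" by (auto simp: set_conv_nth h_def n_def image_iff)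
  finally have hT: "h ` {..<n} = T" ..
  have isp: "is_partition (n - 1) h"
  proof -
    have "h 0 \<in> T" "h (n - 1) \<in> T" using hT n by auto
    moreover have "h i < h (Suc i)" if "i < n - 1" for i
    proof -
      have "i \<in> {..<n}" "Suc i \<in> {..<n}" using that by auto
      then show ?thesis using h by (simp add: strict_mono_onD)
    qed
    ultimately show ?thesis using T01 by (auto simp: is_partition_def)
  qed
  define b where "b j = (\<Sum>k\<in>A. c k * (\<Sum>i<m k. a k i * indicator {t k i<..t k (Suc i)} (h (Suc j))))" for j
  show ?thesis
  proof (rule that[OF isp, of b])
    fix F :: "real \<Rightarrow> real"
    have "F (t k (Suc i)) - F (t k i) =
        (\<Sum>j<n - 1. indicator {t k i<..t k (Suc i)} (h (Suc j)) * (F (h (Suc j)) - F (h j)))" if "k \<in> A" "i < m k" for k i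
      using that part[OF that(1)]
      by (intro sum_increments_refine[symmetric] h) (auto simp: hT T_def is_partition_def intro!: bexI[of _ k])
    then have "(\<Sum>k\<in>A. c k * (\<Sum>i<m k. a k i * (F (t k (Suc i)) - F (t k i)))) =
      (\<Sum>k\<in>A. c k * (\<Sum>i<m k. a k i * (\<Sum>j<n - 1. indicator {t k i<..t k (Suc i)} (h (Suc j)) * (F (h (Suc j)) - F (h j)))))"
      by (intro sum.cong refl arg_cong2[where f = times]) auto
    also have "\<dots> = (\<Sum>k\<in>A. \<Sum>i<m k. \<Sum>j<n - 1. c k * (a k i * indicator {t k i<..t k (Suc i)} (h (Suc j))) * (F (h (Suc j)) - F (h j)))"
      by (simp only: sum_distrib_left mult.assoc)
    also have "\<dots> = (\<Sum>k\<in>A. \<Sum>j<n - 1. \<Sum>i<m k. c k * (a k i * indicator {t k i<..t k (Suc i)} (h (Suc j))) * (F (h (Suc j)) - F (h j)))"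
      by (intro sum.cong refl sum.swap)
    also have "\<dots> = (\<Sum>j<n - 1. \<Sum>k\<in>A. \<Sum>i<m k. c k * (a k i * indicator {t k i<..t k (Suc i)} (h (Suc j))) * (F (h (Suc j)) - F (h j)))"
      by (rule sum.swap)
    also have "\<dots> = (\<Sum>j<n - 1. b j * (F (h (Suc j)) - F (h j)))"
      by (simp only: b_def sum_distrib_left sum_distrib_right)
    finally show "(\<Sum>k\<in>A. c k * (\<Sum>i<m k. a k i * (F (t k (Suc i)) - F (t k i)))) =
       (\<Sum>j<n - 1. b j * (F (h (Suc j)) - F (h j)))" .
  qed
qed

text \<open>Brings the value at x into the form of a sum of increments, as needed for
  \<open>step_common_refinement\<close>.\<close>

lemma step_fun_increments:
  assumes "is_partition m t"
  shows "step_fun m t a x = (\<Sum>i<m. a i * (of_bool (x \<le> t (Suc i)) - of_bool (x \<le> t i)))"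
  unfolding step_fun_def using assms
  by (intro sum.cong) (auto simp: indicator_def is_partition_def dest!: spec)

lemma indicator_L2_unit: "A \<in> sets borel \<Longrightarrow> indicator A \<in> L2_unit"
proof -
  assume A: "A \<in> sets borel"
  interpret finite_measure unit_meas by (rule finite_measure_unit)
  have m: "indicator A \<in> borel_measurable unit_meas"
    using A by (intro measurable_restrict_space1) simp
  moreover have "integrable unit_meas (\<lambda>t. (indicator A t :: real)\<^sup>2)"
    using borel_measurable_power[OF m, of 2] by (intro integrable_const_bound[where B = 1]) (auto simp: indicator_def)
  ultimately show ?thesis by (simp add: L2_unit_iff)
qed

lemma step_fun_L2_unit: "step_fun m t a \<in> L2_unit"
proof -
  have "(\<lambda>x. \<Sum>i<m. a i * indicator {t i<..t (Suc i)} x) \<in> L2_unit"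
    by (intro L2_unit_lincomb indicator_L2_unit) simp
  then show ?thesis by (simp add: step_fun_def[abs_def])
qed

lemma inner_unit_step_fun:
  assumes "is_partition m t"
  shows "inner_unit (step_fun m t a) (step_fun m t a) = (\<Sum>i<m. (a i)\<^sup>2 * (t (Suc i) - t i))"
proof -
  define e where "e i = (indicator {t i<..t (Suc i)} :: real \<Rightarrow> real)" for i
  have e: "e i \<in> L2_unit" for i unfolding e_def by (rule indicator_L2_unit) simp
  have step: "step_fun m t a = (\<lambda>x. \<Sum>i<m. a i * e i x)" by (simp add: step_fun_def[abs_def] e_def)
  have ee: "inner_unit (e i) (e j) = (if i = j then t (Suc i) - t i else 0)" if "i < m" "j < m" for i j
  proof (cases "i = j")
    case True
    have sub: "{t i<..t (Suc i)} \<subseteq> {0..1}"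
      using is_partition_range[OF assms, of i] is_partition_range[OF assms, of "Suc i"] that by auto
    have "inner_unit (e i) (e i) = (\<integral>x. indicator {0..1} x *\<^sub>R (e i x * e i x) \<partial>lborel)"
      unfolding inner_unit_eq by (simp add: integral_restrict_space)
    also have "\<dots> = (\<integral>x. indicator {t i<..t (Suc i)} x \<partial>lborel)"
      using sub by (intro Bochner_Integration.integral_cong) (auto simp: e_def indicator_def)
    also have "\<dots> = t (Suc i) - t i"
      using is_partition_less[OF assms, of i "Suc i"] that by simp
    finally show ?thesis using True by simp
  next
    case False
    have "e i x * e j x = 0" for x
    proof (cases "i < j")
      case True
      then have "t (Suc i) \<le> t j" using is_partition_less[OF assms, of "Suc i" j] that by (cases "Suc i = j") auto
      then show ?thesis by (auto simp: e_def indicator_def)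
    next
      case False
      with \<open>i \<noteq> j\<close> have "j < i" by simp
      then have "t (Suc j) \<le> t i" using is_partition_less[OF assms, of "Suc j" i] that by (cases "Suc j = i") auto
      then show ?thesis by (auto simp: e_def indicator_def)
    qed
    then have "(\<lambda>x. e i x * e j x) = (\<lambda>_. 0)" by auto
    then show ?thesis using False unfolding inner_unit_eq by simp
  qed
  have "inner_unit (step_fun m t a) (step_fun m t a) = (\<Sum>i<m. a i * inner_unit (e i) (step_fun m t a))"
    using e step_fun_L2_unit[of m t a] unfolding step by (intro inner_unit_lincomb_left) auto
  also have "\<dots> = (\<Sum>i<m. a i * (\<Sum>j<m. a j * inner_unit (e j) (e i)))"
  proof -
    have "inner_unit (e i) (step_fun m t a) = (\<Sum>j<m. a j * inner_unit (e j) (e i))" for i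
      unfolding inner_unit_commute[of "e i"] step using e by (intro inner_unit_lincomb_left) auto
    then show ?thesis by simp
  qed
  also have "\<dots> = (\<Sum>i<m. a i * (\<Sum>j<m. if i = j then a i * (t (Suc i) - t i) else 0))"
    using ee by (intro sum.cong refl arg_cong2[where f = times]) auto
  also have "\<dots> = (\<Sum>i<m. (a i)\<^sup>2 * (t (Suc i) - t i))"
    by (intro sum.cong) (auto simp: power2_eq_square)
  finally show ?thesis .
qed

lemma white_noise_step_integral:
  assumes f: "f \<in> L2_unit" and part: "is_partition m t"
  shows "step_integral (white_noise_obs f \<epsilon> W) m t a \<omega> =
    inner_unit f (step_fun m t a) + \<epsilon> * step_integral W m t a \<omega>"
proof -
  define Fi where "Fi s = (\<integral>x\<in>{0..s}. f x \<partial>lborel)" for s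
  have Fi: "Fi s = (\<integral>x. indicator {0..s} x * f x \<partial>unit_meas)" if "s \<in> {0..1}" for s
    unfolding Fi_def set_lebesgue_integral_def
    using that by (simp add: integral_restrict_space) (intro Bochner_Integration.integral_cong, auto simp: indicator_def)
  have int: "integrable unit_meas (\<lambda>x. indicator A x * f x)" if "A \<in> sets borel" for A
    using L2_unit_mult_integrable[OF indicator_L2_unit[OF that] f] .
  have diff: "Fi (t (Suc i)) - Fi (t i) = inner_unit (indicator {t i<..t (Suc i)}) f" if "i < m" for i
  proof -
    have r: "t i \<in> {0..1}" "t (Suc i) \<in> {0..1}" "t i < t (Suc i)"
      using is_partition_range[OF part] is_partition_less[OF part, of i "Suc i"] that by auto
    have "Fi (t (Suc i)) - Fi (t i) = (\<integral>x. indicator {0..t (Suc i)} x * f x - indicator {0..t i} x * f x \<partial>unit_meas)"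
      unfolding Fi[OF r(1)] Fi[OF r(2)] by (rule Bochner_Integration.integral_diff[symmetric]) (auto intro: int)
    also have "\<dots> = inner_unit (indicator {t i<..t (Suc i)}) f"
      unfolding inner_unit_eq using r
      by (intro Bochner_Integration.integral_cong) (auto simp: indicator_def space_unit_meas)
    finally show ?thesis .
  qed
  have "inner_unit f (step_fun m t a) = (\<Sum>i<m. a i * inner_unit (indicator {t i<..t (Suc i)}) f)"
    unfolding inner_unit_commute[of f] step_fun_def[abs_def]
    by (rule inner_unit_lincomb_left) (auto intro: indicator_L2_unit f)
  then have 1: "inner_unit f (step_fun m t a) = (\<Sum>i<m. a i * (Fi (t (Suc i)) - Fi (t i)))" using diff by simp
  show ?thesis
    unfolding 1 step_integral_def white_noise_obs_def Fi_def[symmetric]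
    by (simp add: sum_distrib_left sum.distrib[symmetric] algebra_simps)
qed

section \<open>Characteristic functions of stochastic integrals\<close>

lemma char_distr_eq:
  assumes "X \<in> borel_measurable P"
  shows "char (distr P borel X) u = (CLINT \<omega>|P. iexp (u * X \<omega>))"
  unfolding char_def using assms by (subst integral_distr) auto

lemma norm_iexp_diff_le: "norm (iexp a - iexp b) \<le> \<bar>a - b\<bar>"
proof -
  have "iexp a - iexp b = iexp b * (iexp (a - b) - 1)"
    by (simp add: exp_diff right_diff_distrib)
  moreover have "norm (iexp (a - b) - 1) \<le> \<bar>a - b\<bar>"
    using iexp_approx1[of "a - b" 0] by simp
  ultimately show ?thesis by (simp add: norm_mult)
qed

text \<open>The integrand is Lipschitz, and a distance d is at most \<eta> + d^2 / \<eta>; so mean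
  square convergence suffices and only nonnegative integrals of squares occur, for which no
  integrability has to be known.\<close>

lemma char_limit:
  assumes P: "prob_space P" and X: "\<And>n. X n \<in> borel_measurable P" and Z: "Z \<in> borel_measurable P"
    and lim: "(\<lambda>n::nat. \<integral>\<^sup>+\<omega>. ennreal ((Z \<omega> - X n \<omega>)\<^sup>2) \<partial>P) \<longlonglongrightarrow> 0"
  shows "(\<lambda>n. char (distr P borel (X n)) u) \<longlonglongrightarrow> char (distr P borel Z) u"
proof -
  interpret prob_space P by fact
  have integ: "integrable P (\<lambda>\<omega>. iexp (u * V \<omega>))" if [measurable]: "V \<in> borel_measurable P" for V
    by (rule integrable_const_bound[where B = 1]) auto
  have bound: "ennreal (norm (char (distr P borel (X n)) u - char (distr P borel Z) u)) \<le>
      ennreal \<eta> + ennreal (u\<^sup>2 / \<eta>) * (\<integral>\<^sup>+\<omega>. ennreal ((Z \<omega> - X n \<omega>)\<^sup>2) \<partial>P)" if \<eta>: "0 < \<eta>" for \<eta> n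
  proof -
    note [measurable] = X[of n] Z
    have "char (distr P borel (X n)) u - char (distr P borel Z) u = (CLINT \<omega>|P. iexp (u * X n \<omega>) - iexp (u * Z \<omega>))"
      unfolding char_distr_eq[OF X] char_distr_eq[OF Z]
      by (rule Bochner_Integration.integral_diff[symmetric]) (intro integ X Z)+
    also have "ennreal (norm \<dots>) \<le> (\<integral>\<^sup>+\<omega>. ennreal (norm (iexp (u * X n \<omega>) - iexp (u * Z \<omega>))) \<partial>P)"
      by (intro integral_norm_bound_ennreal Bochner_Integration.integrable_diff integ X Z)
    also have "\<dots> \<le> (\<integral>\<^sup>+\<omega>. ennreal \<eta> + ennreal (u\<^sup>2 / \<eta>) * ennreal ((Z \<omega> - X n \<omega>)\<^sup>2) \<partial>P)"
    proof (rule nn_integral_mono)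
      fix \<omega>
      define d where "d = \<bar>u\<bar> * \<bar>Z \<omega> - X n \<omega>\<bar>"
      have "norm (iexp (u * X n \<omega>) - iexp (u * Z \<omega>)) \<le> \<bar>u * X n \<omega> - u * Z \<omega>\<bar>" by (rule norm_iexp_diff_le)
      also have "\<dots> = d" by (simp add: d_def abs_mult[symmetric] right_diff_distrib abs_minus_commute)
      also have "d \<le> \<eta> + d\<^sup>2 / \<eta>"
      proof (cases "d \<le> \<eta>")
        case False
        then have "\<eta> * d \<le> d * d" using \<eta> by (intro mult_right_mono) auto
        then have "d \<le> d\<^sup>2 / \<eta>" using \<eta> by (simp add: power2_eq_square field_simps)
        then show ?thesis using \<eta> by simp
      next
        case True
        moreover have "0 \<le> d\<^sup>2 / \<eta>" using \<eta> by simp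
        ultimately show ?thesis by linarith
      qed
      also have "d\<^sup>2 / \<eta> = u\<^sup>2 / \<eta> * (Z \<omega> - X n \<omega>)\<^sup>2" by (simp add: d_def power_mult_distrib)
      finally have "ennreal (norm (iexp (u * X n \<omega>) - iexp (u * Z \<omega>))) \<le> ennreal (\<eta> + u\<^sup>2 / \<eta> * (Z \<omega> - X n \<omega>)\<^sup>2)"
        by (rule ennreal_leI)
      also have "\<dots> = ennreal \<eta> + ennreal (u\<^sup>2 / \<eta>) * ennreal ((Z \<omega> - X n \<omega>)\<^sup>2)"
        using \<eta> by (simp add: ennreal_mult[symmetric] ennreal_plus[symmetric] del: ennreal_plus)
      finally show "ennreal (norm (iexp (u * X n \<omega>) - iexp (u * Z \<omega>))) \<le>
          ennreal \<eta> + ennreal (u\<^sup>2 / \<eta>) * ennreal ((Z \<omega> - X n \<omega>)\<^sup>2)" .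
    qed
    also have "\<dots> = ennreal \<eta> + ennreal (u\<^sup>2 / \<eta>) * (\<integral>\<^sup>+\<omega>. ennreal ((Z \<omega> - X n \<omega>)\<^sup>2) \<partial>P)"
      by (simp add: nn_integral_add nn_integral_cmult emeasure_space_1)
    finally show ?thesis .
  qed
  show ?thesis
  proof (rule tendstoI, unfold dist_norm)
    fix e :: real assume e: "0 < e"
    define \<eta> where "\<eta> = e / 3"
    have \<eta>: "0 < \<eta>" using e by (simp add: \<eta>_def)
    have "0 < ennreal (\<eta>\<^sup>2 / (u\<^sup>2 + 1))"
    proof -
      have "0 < \<eta>\<^sup>2 / (u\<^sup>2 + 1)" using \<eta> by (intro divide_pos_pos) (auto simp: add_nonneg_pos)
      then show ?thesis by simp
    qed
    from order_tendstoD(2)[OF lim this]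
    show "\<forall>\<^sub>F n in sequentially. norm (char (distr P borel (X n)) u - char (distr P borel Z) u) < e"
    proof eventually_elim
      case (elim n)
      have "ennreal (u\<^sup>2 / \<eta>) * (\<integral>\<^sup>+\<omega>. ennreal ((Z \<omega> - X n \<omega>)\<^sup>2) \<partial>P) \<le> ennreal (u\<^sup>2 / \<eta>) * ennreal (\<eta>\<^sup>2 / (u\<^sup>2 + 1))"
        using elim by (intro mult_left_mono) auto
      also have "\<dots> = ennreal (u\<^sup>2 / \<eta> * (\<eta>\<^sup>2 / (u\<^sup>2 + 1)))" using \<eta> by (intro ennreal_mult[symmetric]) auto
      also have "\<dots> \<le> ennreal \<eta>"
      proof (rule ennreal_leI)
        have "u\<^sup>2 / \<eta> * (\<eta>\<^sup>2 / (u\<^sup>2 + 1)) = \<eta> * (u\<^sup>2 / (u\<^sup>2 + 1))" using \<eta> by (simp add: power2_eq_square)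
        also have "\<dots> \<le> \<eta> * 1" using \<eta> by (intro mult_left_mono) (auto simp: add_nonneg_pos divide_le_eq)
        finally show "u\<^sup>2 / \<eta> * (\<eta>\<^sup>2 / (u\<^sup>2 + 1)) \<le> \<eta>" by simp
      qed
      finally have "ennreal (norm (char (distr P borel (X n)) u - char (distr P borel Z) u)) \<le> ennreal \<eta> + ennreal \<eta>"
        using bound[OF \<eta>, of n] by (meson add_left_mono order_trans)
      also have "\<dots> = ennreal (2 * \<eta>)" using \<eta> by (simp add: ennreal_plus[symmetric] del: ennreal_plus)
      finally have "norm (char (distr P borel (X n)) u - char (distr P borel Z) u) \<le> 2 * \<eta>"
        using \<eta> by (simp add: ennreal_le_iff)
      then show ?case using e by (simp add: \<eta>_def)
    qed
  qed
qed

text \<open>The factor a is moved into the argument of the characteristic function, so that a = 0 is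
  not a special case.\<close>

lemma char_scaled_std_normal:
  assumes X: "distributed P lborel X (normal_density 0 s)" and s: "0 < s" and P: "prob_space P"
  shows "char (distr P borel (\<lambda>\<omega>. a * X \<omega>)) u = complex_of_real (exp (- ((u * a * s)\<^sup>2) / 2))"
proof -
  interpret prob_space P by fact
  have Xm[measurable]: "X \<in> borel_measurable P" using distributed_measurable[OF X] by simp
  have "distributed P lborel (\<lambda>\<omega>. (X \<omega> - 0) / s) std_normal_density"
    using X normal_standard_normal_convert[OF s, of X 0] by blast
  then have "distr P lborel (\<lambda>\<omega>. X \<omega> / s) = density lborel std_normal_density"
    by (simp add: distributed_def)
  moreover have "distr P lborel (\<lambda>\<omega>. X \<omega> / s) = distr P borel (\<lambda>\<omega>. X \<omega> / s)" by (rule distr_cong) auto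
  ultimately have d: "distr P borel (\<lambda>\<omega>. X \<omega> / s) = density lborel std_normal_density" by simp
  have "char (distr P borel (\<lambda>\<omega>. a * X \<omega>)) u = char (distr P borel (\<lambda>\<omega>. X \<omega> / s)) (u * a * s)"
    using s by (simp add: char_distr_eq mult_ac)
  also have "\<dots> = complex_of_real (exp (- ((u * a * s)\<^sup>2) / 2))"
    unfolding d using char_std_normal_distribution by (simp add: fun_eq_iff)
  finally show ?thesis .
qed

lemma wiener_step_measurable:
  assumes W: "wiener_process P W" and part: "is_partition m t"
  shows "step_integral W m t a \<in> borel_measurable P"
proof -
  have "W (t i) \<in> borel_measurable P" if "i \<le> m" for i
    using W is_partition_range[OF part that] by (auto simp: wiener_process_def)
  then show ?thesis unfolding step_integral_def[abs_def] by (intro borel_measurable_sum) auto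
qed

lemma char_wiener_step:
  assumes W: "wiener_process P W" and part: "is_partition m t"
  shows "char (distr P borel (step_integral W m t a)) u =
    complex_of_real (exp (- (u\<^sup>2) / 2 * inner_unit (step_fun m t a) (step_fun m t a)))"
proof -
  interpret prob_space P using W by (simp add: wiener_process_def)
  define X where "X i \<omega> = W (t (Suc i)) \<omega> - W (t i) \<omega>" for i \<omega>
  have "indep_vars (\<lambda>_. borel) X {..<m}"
    using W part unfolding wiener_process_def is_partition_def X_def by blast
  then have ind: "indep_vars (\<lambda>_. borel) (\<lambda>i \<omega>. a i * X i \<omega>) {..<m}"
    by (rule indep_vars_compose2) auto
  have dist: "distributed P lborel (X i) (normal_density 0 (sqrt (t (Suc i) - t i)))" if "i < m" for i
  proof -
    have "0 \<le> t i \<and> t i < t (Suc i) \<and> t (Suc i) \<le> 1"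
      using is_partition_range[OF part, of i] is_partition_range[OF part, of "Suc i"] is_partition_less[OF part, of i "Suc i"] that by auto
    then show ?thesis using W unfolding wiener_process_def X_def[abs_def] by blast
  qed
  have "step_integral W m t a = (\<lambda>\<omega>. \<Sum>i<m. a i * X i \<omega>)" by (auto simp: step_integral_def X_def)
  then have "char (distr P borel (step_integral W m t a)) u = (\<Prod>i<m. char (distr P borel (\<lambda>\<omega>. a i * X i \<omega>)) u)"
    using char_distr_sum[OF ind] by simp
  also have "\<dots> = (\<Prod>i<m. complex_of_real (exp (- (u\<^sup>2) / 2 * ((a i)\<^sup>2 * (t (Suc i) - t i)))))"
  proof (rule prod.cong[OF refl])
    fix i assume "i \<in> {..<m}"
    then have i: "i < m" by simp
    have d: "0 < t (Suc i) - t i" using is_partition_less[OF part, of i "Suc i"] i by simp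
    have "(u * a i * sqrt (t (Suc i) - t i))\<^sup>2 = u\<^sup>2 * ((a i)\<^sup>2 * (t (Suc i) - t i))"
      using d by (simp add: power_mult_distrib)
    then show "char (distr P borel (\<lambda>\<omega>. a i * X i \<omega>)) u = complex_of_real (exp (- (u\<^sup>2) / 2 * ((a i)\<^sup>2 * (t (Suc i) - t i))))"
      using char_scaled_std_normal[OF dist[OF i] _ prob_space_axioms, of "a i" u] d by simp
  qed
  also have "\<dots> = complex_of_real (exp (\<Sum>i<m. - (u\<^sup>2) / 2 * ((a i)\<^sup>2 * (t (Suc i) - t i))))"
    by (simp add: exp_sum)
  finally show ?thesis unfolding inner_unit_step_fun[OF part] sum_distrib_left .
qed

lemma nn_integral_square_le:
  assumes [measurable]: "U \<in> borel_measurable P" "V \<in> borel_measurable P" and "prob_space P" "\<And>\<omega>. D \<omega> = U \<omega> + v"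
  shows "(\<integral>\<^sup>+\<omega>. ennreal ((D \<omega>)\<^sup>2) \<partial>P) \<le> 2 * (\<integral>\<^sup>+\<omega>. ennreal ((U \<omega>)\<^sup>2) \<partial>P) + ennreal (2 * v\<^sup>2)"
proof -
  interpret prob_space P by fact
  have "(\<integral>\<^sup>+\<omega>. ennreal ((D \<omega>)\<^sup>2) \<partial>P) \<le> (\<integral>\<^sup>+\<omega>. 2 * ennreal ((U \<omega>)\<^sup>2) + ennreal (2 * v\<^sup>2) \<partial>P)"
  proof (rule nn_integral_mono)
    fix \<omega>
    have "(D \<omega>)\<^sup>2 \<le> 2 * (U \<omega>)\<^sup>2 + 2 * v\<^sup>2"
      using sum_squares_bound[of "U \<omega>" v] unfolding assms(4) by (simp add: power2_sum)
    then have "ennreal ((D \<omega>)\<^sup>2) \<le> ennreal (2 * (U \<omega>)\<^sup>2 + 2 * v\<^sup>2)" by (rule ennreal_leI)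
    also have "\<dots> = 2 * ennreal ((U \<omega>)\<^sup>2) + ennreal (2 * v\<^sup>2)"
      by (subst ennreal_plus) (auto simp: ennreal_mult)
    finally show "ennreal ((D \<omega>)\<^sup>2) \<le> 2 * ennreal ((U \<omega>)\<^sup>2) + ennreal (2 * v\<^sup>2)" .
  qed
  also have "\<dots> = 2 * (\<integral>\<^sup>+\<omega>. ennreal ((U \<omega>)\<^sup>2) \<partial>P) + ennreal (2 * v\<^sup>2)"
    by (simp add: nn_integral_add nn_integral_cmult emeasure_space_1)
  finally show ?thesis .
qed

text \<open>A linear combination of the approximating step integrals is the integral of one step
  function over a common refinement, hence normal with variance its squared norm, and both sides
  pass to the limit. Knowing this for all linear combinations amounts to knowing the joint
  law.\<close>

lemma char_stoch_integrals:
  assumes W: "wiener_process P W" and f: "f \<in> L2_unit" and \<epsilon>: "0 < \<epsilon>" and A: "finite A"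
    and g: "\<And>k. k \<in> A \<Longrightarrow> g k \<in> L2_unit"
    and I: "\<And>k. k \<in> A \<Longrightarrow> is_stoch_integral P (white_noise_obs f \<epsilon> W) (g k) (I k)"
  shows "char (distr P borel (\<lambda>\<omega>. \<Sum>k\<in>A. c k * ((I k \<omega> - inner_unit f (g k)) / \<epsilon>))) u =
    complex_of_real (exp (- (u\<^sup>2) / 2 * inner_unit (\<lambda>x. \<Sum>k\<in>A. c k * g k x) (\<lambda>x. \<Sum>k\<in>A. c k * g k x)))"
proof -
  interpret prob_space P using W by (simp add: wiener_process_def)
  have Im: "I k \<in> borel_measurable P" if "k \<in> A" for k using I[OF that] by (simp add: is_stoch_integral_def)
  define Q where "Q k m t a \<longleftrightarrow> (\<forall>i. is_partition (m i) (t i)) \<and>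
        (\<lambda>i. sq_dist_unit (g k) (step_fun (m i) (t i) (a i))) \<longlonglongrightarrow> 0 \<and>
        (\<lambda>i. \<integral>\<^sup>+\<omega>. ennreal ((I k \<omega> - step_integral (white_noise_obs f \<epsilon> W) (m i) (t i) (a i) \<omega>)\<^sup>2) \<partial>P) \<longlonglongrightarrow> 0"
    for k m t a
  have "\<forall>k\<in>A. \<exists>m t a. Q k m t a"
    using I unfolding is_stoch_integral_def Q_def by blast
  then obtain m t a where "\<And>k. k \<in> A \<Longrightarrow> Q k (m k) (t k) (a k)" by metis
  then have part: "\<And>k i. k \<in> A \<Longrightarrow> is_partition (m k i) (t k i)"
    and lim1: "\<And>k. k \<in> A \<Longrightarrow> (\<lambda>i. sq_dist_unit (g k) (step_fun (m k i) (t k i) (a k i))) \<longlonglongrightarrow> 0"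
    and lim2: "\<And>k. k \<in> A \<Longrightarrow> (\<lambda>i. \<integral>\<^sup>+\<omega>. ennreal ((I k \<omega> - step_integral (white_noise_obs f \<epsilon> W) (m k i) (t k i) (a k i) \<omega>)\<^sup>2) \<partial>P) \<longlonglongrightarrow> 0"
    unfolding Q_def by blast+
  define s where "s k i = step_fun (m k i) (t k i) (a k i)" for k i
  define S where "S k i = step_integral W (m k i) (t k i) (a k i)" for k i
  have sL: "s k i \<in> L2_unit" for k i unfolding s_def by (rule step_fun_L2_unit)
  have Sm: "S k i \<in> borel_measurable P" if "k \<in> A" for k i
    unfolding S_def using wiener_step_measurable[OF W part[OF that]] .
  have norm_lim: "(\<lambda>i. norm_unit (\<lambda>x. g k x - s k i x)) \<longlonglongrightarrow> 0" if k: "k \<in> A" for k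
  proof -
    have "(\<lambda>i. ennreal ((norm_unit (\<lambda>x. g k x - s k i x))\<^sup>2)) \<longlonglongrightarrow> ennreal 0"
      using lim1[OF k] unfolding s_def[symmetric] sq_dist_unit_norm[OF g[OF k] sL] by simp
    then have "(\<lambda>i. (norm_unit (\<lambda>x. g k x - s k i x))\<^sup>2) \<longlonglongrightarrow> 0"
      by (subst (asm) tendsto_ennreal_iff) auto
    then have "(\<lambda>i. sqrt ((norm_unit (\<lambda>x. g k x - s k i x))\<^sup>2)) \<longlonglongrightarrow> sqrt 0" by (rule tendsto_real_sqrt)
    then show ?thesis by (simp add: norm_unit_nonneg)
  qed
  define G where "G x = (\<Sum>k\<in>A. c k * g k x)" for x
  define \<phi> where "\<phi> i x = (\<Sum>k\<in>A. c k * s k i x)" for i x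
  define X where "X i \<omega> = (\<Sum>k\<in>A. c k * S k i \<omega>)" for i \<omega>
  define Z where "Z \<omega> = (\<Sum>k\<in>A. c k * ((I k \<omega> - inner_unit f (g k)) / \<epsilon>))" for \<omega>
  have GL: "G \<in> L2_unit" unfolding G_def[abs_def] using g by (rule L2_unit_lincomb)
  have \<phi>L: "\<phi> i \<in> L2_unit" for i unfolding \<phi>_def[abs_def] using sL by (rule L2_unit_lincomb)
  have Xm: "X i \<in> borel_measurable P" for i
    unfolding X_def[abs_def] using Sm by (intro borel_measurable_sum) auto
  have Zm: "Z \<in> borel_measurable P"
    unfolding Z_def[abs_def] using Im by (intro borel_measurable_sum) auto
  have charX: "char (distr P borel (X i)) u = complex_of_real (exp (- (u\<^sup>2) / 2 * inner_unit (\<phi> i) (\<phi> i)))" for i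
  proof -
    obtain n h b where h: "is_partition n h"
      and eq: "\<And>F :: real \<Rightarrow> real. (\<Sum>k\<in>A. c k * (\<Sum>j<m k i. a k i j * (F (t k i (Suc j)) - F (t k i j)))) =
       (\<Sum>j<n. b j * (F (h (Suc j)) - F (h j)))"
      by (rule step_common_refinement[OF A, of "\<lambda>k. m k i" "\<lambda>k. t k i" c "\<lambda>k. a k i"]) (use part in blast)+
    have "X i = step_integral W n h b"
    proof
      fix \<omega> show "X i \<omega> = step_integral W n h b \<omega>"
        using eq[of "\<lambda>r. W r \<omega>"] by (simp add: X_def S_def step_integral_def)
    qed
    moreover have "\<phi> i = step_fun n h b"
    proof
      fix x show "\<phi> i x = step_fun n h b x"
        using eq[of "\<lambda>r. of_bool (x \<le> r)"] part h by (simp add: \<phi>_def s_def step_fun_increments)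
    qed
    ultimately show ?thesis using char_wiener_step[OF W h] by simp
  qed
  have "(\<lambda>i. norm_unit (\<phi> i)) \<longlonglongrightarrow> norm_unit G"
  proof (rule LIM_zero_cancel, rule tendsto_rabs_zero_cancel, rule tendsto_sandwich[OF _ _ tendsto_const])
    show "(\<lambda>i. \<Sum>k\<in>A. \<bar>c k\<bar> * norm_unit (\<lambda>x. g k x - s k i x)) \<longlonglongrightarrow> 0"
      using norm_lim by (intro tendsto_null_sum tendsto_mult_right_zero) auto
    show "\<forall>\<^sub>F i in sequentially. \<bar>norm_unit (\<phi> i) - norm_unit G\<bar> \<le> (\<Sum>k\<in>A. \<bar>c k\<bar> * norm_unit (\<lambda>x. g k x - s k i x))"
    proof (rule always_eventually, rule allI)
      fix i
      have d: "norm_unit (\<lambda>x. G x - \<phi> i x) \<le> (\<Sum>k\<in>A. \<bar>c k\<bar> * norm_unit (\<lambda>x. g k x - s k i x))"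
      proof -
        have "(\<lambda>x. G x - \<phi> i x) = (\<lambda>x. \<Sum>k\<in>A. c k * (g k x - s k i x))"
          by (simp add: G_def \<phi>_def sum_subtractf right_diff_distrib fun_eq_iff)
        then show ?thesis using norm_unit_lincomb_le[of A "\<lambda>k x. g k x - s k i x" c] L2_unit_diff g sL by auto
      qed
      have "norm_unit (\<lambda>x. \<phi> i x + (G x - \<phi> i x)) \<le> norm_unit (\<phi> i) + norm_unit (\<lambda>x. G x - \<phi> i x)"
        by (intro norm_unit_add_triangle L2_unit_diff GL \<phi>L)
      moreover have "norm_unit (\<lambda>x. G x - (G x - \<phi> i x)) \<le> norm_unit G + norm_unit (\<lambda>x. G x - \<phi> i x)"
        by (intro norm_unit_diff_triangle L2_unit_diff GL \<phi>L)
      ultimately show "\<bar>norm_unit (\<phi> i) - norm_unit G\<bar> \<le> (\<Sum>k\<in>A. \<bar>c k\<bar> * norm_unit (\<lambda>x. g k x - s k i x))"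
        using d by simp
    qed
  qed auto
  then have "(\<lambda>i. (norm_unit (\<phi> i))\<^sup>2) \<longlonglongrightarrow> (norm_unit G)\<^sup>2" by (rule tendsto_power)
  then have V: "(\<lambda>i. inner_unit (\<phi> i) (\<phi> i)) \<longlonglongrightarrow> inner_unit G G" by (simp add: norm_unit_sq)
  have lim: "(\<lambda>i. \<integral>\<^sup>+\<omega>. ennreal ((Z \<omega> - X i \<omega>)\<^sup>2) \<partial>P) \<longlonglongrightarrow> 0"
  proof -
    define E where "E k i = (\<integral>\<^sup>+\<omega>. ennreal ((I k \<omega> - step_integral (white_noise_obs f \<epsilon> W) (m k i) (t k i) (a k i) \<omega>)\<^sup>2) \<partial>P)" for k i
    \<comment> \<open>The drift of an approximating integral is the inner product with the step
      function; v is its distance from the true coefficient and vanishes by the Cauchy-Schwarz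
      inequality.\<close>
    define v where "v k i = inner_unit f (s k i) - inner_unit f (g k)" for k i
    have vlim: "(\<lambda>i. v k i) \<longlonglongrightarrow> 0" if k: "k \<in> A" for k
    proof (rule tendsto_rabs_zero_cancel, rule tendsto_sandwich[OF _ _ tendsto_const])
      show "(\<lambda>i. norm_unit f * norm_unit (\<lambda>x. g k x - s k i x)) \<longlonglongrightarrow> 0"
        using norm_lim[OF k] by (rule tendsto_mult_right_zero)
      show "\<forall>\<^sub>F i in sequentially. \<bar>v k i\<bar> \<le> norm_unit f * norm_unit (\<lambda>x. g k x - s k i x)"
      proof (rule always_eventually, rule allI)
        fix i
        have "v k i = - inner_unit f (\<lambda>x. g k x - s k i x)"
          unfolding v_def inner_unit_commute[of f] using inner_unit_diff_left[OF g[OF k] sL f] by simp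
        then show "\<bar>v k i\<bar> \<le> norm_unit f * norm_unit (\<lambda>x. g k x - s k i x)"
          using inner_unit_Cauchy_Schwarz[OF f L2_unit_diff[OF g[OF k] sL]] by (simp add: norm_unit_def)
      qed
    qed auto
    define K where "K = real (card A) * (\<Sum>k\<in>A. (c k / \<epsilon>)\<^sup>2)"
    have bound: "(\<integral>\<^sup>+\<omega>. ennreal ((Z \<omega> - X i \<omega>)\<^sup>2) \<partial>P) \<le>
        ennreal K * (\<Sum>k\<in>A. 2 * E k i + ennreal (2 * (v k i)\<^sup>2))" for i
    proof -
      define D where "D k \<omega> = I k \<omega> - inner_unit f (g k) - \<epsilon> * S k i \<omega>" for k \<omega>
      have Dm: "D k \<in> borel_measurable P" if "k \<in> A" for k
        unfolding D_def[abs_def] using Im[OF that] Sm[OF that] by auto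
      have "Z \<omega> - X i \<omega> = (\<Sum>k\<in>A. c k / \<epsilon> * D k \<omega>)" for \<omega>
        unfolding Z_def X_def sum_subtractf[symmetric] D_def using \<epsilon>
        by (intro sum.cong) (auto simp: field_simps)
      moreover have "(\<Sum>k\<in>A. c k / \<epsilon> * D k \<omega>)\<^sup>2 \<le> K * (\<Sum>k\<in>A. (D k \<omega>)\<^sup>2)" for \<omega>
      proof -
        have "(\<Sum>k\<in>A. c k / \<epsilon> * D k \<omega>)\<^sup>2 \<le> (\<Sum>k\<in>A. (c k / \<epsilon>)\<^sup>2) * (\<Sum>k\<in>A. (D k \<omega>)\<^sup>2)"
          by (rule Cauchy_Schwarz_ineq_sum)
        also have "\<dots> \<le> K * (\<Sum>k\<in>A. (D k \<omega>)\<^sup>2)"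
        proof (cases "A = {}")
          case False
          then have "1 \<le> real (card A)" using A by (simp add: Suc_leI card_gt_0_iff)
          then have "1 * (\<Sum>k\<in>A. (c k / \<epsilon>)\<^sup>2) \<le> K" unfolding K_def by (intro mult_right_mono sum_nonneg) auto
          then show ?thesis by (intro mult_right_mono sum_nonneg) auto
        qed simp
        finally show ?thesis .
      qed
      ultimately have "(\<integral>\<^sup>+\<omega>. ennreal ((Z \<omega> - X i \<omega>)\<^sup>2) \<partial>P) \<le> (\<integral>\<^sup>+\<omega>. ennreal (K * (\<Sum>k\<in>A. (D k \<omega>)\<^sup>2)) \<partial>P)"
        by (intro nn_integral_mono ennreal_leI) simp
      also have "\<dots> = (\<integral>\<^sup>+\<omega>. ennreal K * (\<Sum>k\<in>A. ennreal ((D k \<omega>)\<^sup>2)) \<partial>P)"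
        by (intro nn_integral_cong) (simp add: ennreal_mult'' sum_nonneg sum_ennreal)
      also have "\<dots> = ennreal K * (\<Sum>k\<in>A. \<integral>\<^sup>+\<omega>. ennreal ((D k \<omega>)\<^sup>2) \<partial>P)"
      proof -
        have m: "(\<lambda>\<omega>. ennreal ((D k \<omega>)\<^sup>2)) \<in> borel_measurable P" if "k \<in> A" for k
          using Dm[OF that] by auto
        have "(\<integral>\<^sup>+\<omega>. ennreal K * (\<Sum>k\<in>A. ennreal ((D k \<omega>)\<^sup>2)) \<partial>P) =
            ennreal K * (\<integral>\<^sup>+\<omega>. (\<Sum>k\<in>A. ennreal ((D k \<omega>)\<^sup>2)) \<partial>P)"
          by (intro nn_integral_cmult borel_measurable_sum m)
        also have "(\<integral>\<^sup>+\<omega>. (\<Sum>k\<in>A. ennreal ((D k \<omega>)\<^sup>2)) \<partial>P) = (\<Sum>k\<in>A. \<integral>\<^sup>+\<omega>. ennreal ((D k \<omega>)\<^sup>2) \<partial>P)"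
          by (intro nn_integral_sum m)
        finally show ?thesis .
      qed
      also have "\<dots> \<le> ennreal K * (\<Sum>k\<in>A. 2 * E k i + ennreal (2 * (v k i)\<^sup>2))"
      proof (intro mult_left_mono sum_mono)
        fix k assume k: "k \<in> A"
        have "step_integral (white_noise_obs f \<epsilon> W) (m k i) (t k i) (a k i) = (\<lambda>\<omega>. inner_unit f (s k i) + \<epsilon> * S k i \<omega>)"
          by (rule ext) (simp add: s_def S_def white_noise_step_integral[OF f part[OF k]])
        then have "D k \<omega> = (I k \<omega> - step_integral (white_noise_obs f \<epsilon> W) (m k i) (t k i) (a k i) \<omega>) + v k i"
          and m: "(\<lambda>\<omega>. I k \<omega> - step_integral (white_noise_obs f \<epsilon> W) (m k i) (t k i) (a k i) \<omega>) \<in> borel_measurable P" for \<omega>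
          using Im[OF k] Sm[OF k] by (auto simp: D_def v_def)
        then show "(\<integral>\<^sup>+\<omega>. ennreal ((D k \<omega>)\<^sup>2) \<partial>P) \<le> 2 * E k i + ennreal (2 * (v k i)\<^sup>2)"
          unfolding E_def by (intro nn_integral_square_le m prob_space_axioms)
      qed auto
      finally show ?thesis .
    qed
    have "(\<lambda>i. ennreal K * (\<Sum>k\<in>A. 2 * E k i + ennreal (2 * (v k i)\<^sup>2))) \<longlonglongrightarrow> ennreal K * (\<Sum>k\<in>A. 2 * 0 + ennreal (2 * 0\<^sup>2))"
    proof (intro ennreal_tendsto_cmult tendsto_sum tendsto_add tendsto_ennrealI)
      fix k assume k: "k \<in> A"
      show "(\<lambda>i. E k i) \<longlonglongrightarrow> 0" using lim2[OF k] unfolding E_def .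
      show "(\<lambda>i. 2 * (v k i)\<^sup>2) \<longlonglongrightarrow> 2 * 0\<^sup>2" using vlim[OF k] by (intro tendsto_intros)
    qed auto
    then have L: "(\<lambda>i. ennreal K * (\<Sum>k\<in>A. 2 * E k i + ennreal (2 * (v k i)\<^sup>2))) \<longlonglongrightarrow> 0" by simp
    show ?thesis
      by (rule tendsto_sandwich[OF always_eventually always_eventually tendsto_const L]) (intro allI zero_le bound)+
  qed
  have "(\<lambda>i. char (distr P borel (X i)) u) \<longlonglongrightarrow> char (distr P borel Z) u"
    by (rule char_limit[OF prob_space_axioms Xm Zm lim])
  moreover have "(\<lambda>i. char (distr P borel (X i)) u) \<longlonglongrightarrow> complex_of_real (exp (- (u\<^sup>2) / 2 * inner_unit G G))"
    unfolding charX by (intro tendsto_of_real tendsto_exp tendsto_mult tendsto_const V)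
  ultimately have "char (distr P borel Z) u = complex_of_real (exp (- (u\<^sup>2) / 2 * inner_unit G G))"
    by (rule LIMSEQ_unique)
  then show ?thesis unfolding Z_def[abs_def] G_def[abs_def] .
qed

lemma std_normal_of_char:
  assumes P: "prob_space P" and Z: "Z \<in> borel_measurable P" and V: "0 < V"
    and char: "\<And>u. char (distr P borel Z) u = complex_of_real (exp (- (u\<^sup>2) / 2 * V))"
  shows "distr P borel (\<lambda>\<omega>. Z \<omega> / sqrt V) = density lborel std_normal_density"
proof -
  interpret prob_space P by fact
  have m: "(\<lambda>\<omega>. Z \<omega> / sqrt V) \<in> borel_measurable P" using Z by simp
  show ?thesis
  proof (rule Levy_uniqueness)
    show "real_distribution (distr P borel (\<lambda>\<omega>. Z \<omega> / sqrt V))"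
      using m by (rule real_distribution_distr)
    show "real_distribution (density lborel std_normal_density)" by (rule real_dist_normal_dist)
    show "char (distr P borel (\<lambda>\<omega>. Z \<omega> / sqrt V)) = char (density lborel std_normal_density)"
    proof
      fix u
      have "char (distr P borel (\<lambda>\<omega>. Z \<omega> / sqrt V)) u = char (distr P borel Z) (u / sqrt V)"
        unfolding char_distr_eq[OF m] char_distr_eq[OF Z] by simp
      also have "\<dots> = complex_of_real (exp (- (u\<^sup>2) / 2))"
        unfolding char using V by (simp add: power_divide)
      finally show "char (distr P borel (\<lambda>\<omega>. Z \<omega> / sqrt V)) u = char (density lborel std_normal_density) u"
        using char_std_normal_distribution by (simp add: fun_eq_iff)
    qed
  qed
qed

text \<open>Characteristic functions pass to the limit of step integrals because their integrands
  are bounded. Exponential moments do not have this property and are recovered only here, from the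
  identified law.\<close>

lemma mgf_of_char:
  assumes P: "prob_space P" and Z: "Z \<in> borel_measurable P" and V: "0 < V"
    and char: "\<And>u. char (distr P borel Z) u = complex_of_real (exp (- (u\<^sup>2) / 2 * V))"
  shows "(\<integral>\<^sup>+\<omega>. ennreal (exp (Z \<omega>)) \<partial>P) = ennreal (exp (V / 2))"
proof -
  note d = std_normal_of_char[OF assms]
  have m: "(\<lambda>\<omega>. Z \<omega> / sqrt V) \<in> measurable P borel" using Z by simp
  have "(\<integral>\<^sup>+\<omega>. ennreal (exp (Z \<omega>)) \<partial>P) = (\<integral>\<^sup>+\<omega>. ennreal (exp (sqrt V * (Z \<omega> / sqrt V))) \<partial>P)"
    using V by simp
  also have "\<dots> = (\<integral>\<^sup>+x. ennreal (exp (sqrt V * x)) \<partial>distr P borel (\<lambda>\<omega>. Z \<omega> / sqrt V))"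
    by (subst nn_integral_distr[OF m]) auto
  also have "\<dots> = (\<integral>\<^sup>+x. ennreal (std_normal_density x * exp (sqrt V * x)) \<partial>lborel)"
    unfolding d by (subst nn_integral_density) (auto simp: ennreal_mult' mult.commute)
  also have "\<dots> = ennreal (exp (V / 2))" using nn_integral_std_normal_exp[of "sqrt V"] V by simp
  finally show ?thesis .
qed

lemma AE_neq_of_char:
  assumes P: "prob_space P" and Z: "Z \<in> borel_measurable P" and V: "0 < V"
    and char: "\<And>u. char (distr P borel Z) u = complex_of_real (exp (- (u\<^sup>2) / 2 * V))"
  shows "AE \<omega> in P. Z \<omega> \<noteq> a"
proof -
  note d = std_normal_of_char[OF assms]
  have m: "(\<lambda>\<omega>. Z \<omega> / sqrt V) \<in> measurable P borel" using Z by simp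
  have "AE x in density lborel std_normal_density. x \<noteq> a / sqrt V"
    by (subst AE_density) (auto intro: AE_mp[OF AE_lborel_singleton])
  then have "AE x in distr P borel (\<lambda>\<omega>. Z \<omega> / sqrt V). x \<noteq> a / sqrt V" unfolding d .
  then have "AE \<omega> in P. Z \<omega> / sqrt V \<noteq> a / sqrt V"
    by (subst (asm) AE_distr_iff[OF m]) auto
  then show ?thesis by eventually_elim auto
qed

section \<open>Empirical coefficients of one orthonormal family\<close>

locale white_noise_coefficients =
  fixes P :: "'a measure" and W f \<epsilon> N and g :: "nat \<Rightarrow> real \<Rightarrow> real" and Y :: "nat \<Rightarrow> 'a \<Rightarrow> real"
  assumes W: "wiener_process P W" and f: "f \<in> L2_unit" and \<epsilon>: "0 < \<epsilon>"
    and g: "\<And>k. k < N \<Longrightarrow> g k \<in> L2_unit"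
    and orth: "\<And>k l. k < N \<Longrightarrow> l < N \<Longrightarrow> inner_unit (g k) (g l) = (if k = l then 1 else 0)"
    and Y: "\<And>k. k < N \<Longrightarrow> is_stoch_integral P (white_noise_obs f \<epsilon> W) (g k) (Y k)"
begin

definition z :: "nat \<Rightarrow> 'a \<Rightarrow> real" where
  "z k \<omega> = (Y k \<omega> - inner_unit f (g k)) / \<epsilon>"

lemma Y_eq: "Y k \<omega> = inner_unit f (g k) + \<epsilon> * z k \<omega>"
  using \<epsilon> by (simp add: z_def)

lemma z_measurable: "k < N \<Longrightarrow> z k \<in> borel_measurable P"
proof -
  assume "k < N"
  then have "Y k \<in> borel_measurable P" using Y by (simp add: is_stoch_integral_def)
  then show ?thesis unfolding z_def[abs_def] by measurable
qed

lemma prob: "prob_space P" using W by (simp add: wiener_process_def)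

lemma inner_lincomb:
  assumes T: "T \<subseteq> {..<N}"
  shows "inner_unit (\<lambda>x. \<Sum>k\<in>T. c k * g k x) (\<lambda>x. \<Sum>k\<in>T. c k * g k x) = (\<Sum>k\<in>T. (c k)\<^sup>2)"
proof -
  have gT: "g k \<in> L2_unit" if "k \<in> T" for k using T g that by auto
  have finT: "finite T" using T finite_subset by blast
  have "inner_unit (\<lambda>x. \<Sum>k\<in>T. c k * g k x) (\<lambda>x. \<Sum>k\<in>T. c k * g k x) =
      (\<Sum>k\<in>T. c k * inner_unit (g k) (\<lambda>x. \<Sum>k\<in>T. c k * g k x))"
    by (intro inner_unit_lincomb_left L2_unit_lincomb gT)
  also have "\<dots> = (\<Sum>k\<in>T. c k * c k)"
  proof (intro sum.cong refl)
    fix k assume k: "k \<in> T"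
    have "inner_unit (g k) (\<lambda>x. \<Sum>l\<in>T. c l * g l x) = (\<Sum>l\<in>T. c l * inner_unit (g l) (g k))"
      unfolding inner_unit_commute[of "g k"] by (intro inner_unit_lincomb_left gT k)
    also have "\<dots> = (\<Sum>l\<in>T. if l = k then c l else 0)"
    proof (intro sum.cong refl)
      fix l assume "l \<in> T"
      then have "l < N" "k < N" using T k by auto
      then show "c l * inner_unit (g l) (g k) = (if l = k then c l else 0)" using orth by simp
    qed
    also have "\<dots> = c k" using k finT by simp
    finally show "c k * inner_unit (g k) (\<lambda>x. \<Sum>k\<in>T. c k * g k x) = c k * c k" by simp
  qed
  finally show ?thesis by (simp add: power2_eq_square)
qed

lemma char_lincomb:
  assumes T: "T \<subseteq> {..<N}"
  shows "char (distr P borel (\<lambda>\<omega>. \<Sum>k\<in>T. c k * z k \<omega>)) u = complex_of_real (exp (- (u\<^sup>2) / 2 * (\<Sum>k\<in>T. (c k)\<^sup>2)))"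
proof -
  have "finite T" using T finite_subset by blast
  then show ?thesis
    using char_stoch_integrals[OF W f \<epsilon>, of T g Y c u] T g Y unfolding z_def inner_lincomb[OF T] by auto
qed

lemma lincomb_measurable: "T \<subseteq> {..<N} \<Longrightarrow> (\<lambda>\<omega>. \<Sum>k\<in>T. c k * z k \<omega>) \<in> borel_measurable P"
  by (intro borel_measurable_sum borel_measurable_times z_measurable) auto

lemma mgf_lincomb:
  assumes T: "T \<subseteq> {..<N}"
  shows "(\<integral>\<^sup>+\<omega>. ennreal (exp (\<Sum>k\<in>T. c k * z k \<omega>)) \<partial>P) = ennreal (exp ((\<Sum>k\<in>T. (c k)\<^sup>2) / 2))"
\<comment> \<open>A vanishing variance is treated separately, since the identification of the law
  divides by its root.\<close>
proof (cases "(\<Sum>k\<in>T. (c k)\<^sup>2) = 0")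
  case True
  have finT: "finite T" using T finite_subset by blast
  then have "c k = 0" if "k \<in> T" for k using True that by (simp add: sum_nonneg_eq_0_iff)
  then have "(\<Sum>k\<in>T. c k * z k \<omega>) = 0" for \<omega> by simp
  then show ?thesis using True prob_space.emeasure_space_1[OF prob] by simp
next
  case False
  then have "0 < (\<Sum>k\<in>T. (c k)\<^sup>2)" using sum_nonneg[of T "\<lambda>k. (c k)\<^sup>2"] by fastforce
  then show ?thesis using mgf_of_char[OF prob lincomb_measurable[OF T] _ char_lincomb[OF T]] by blast
qed

sublocale chi_square_family P N z
  by (rule chi_square_familyI)
     (auto simp: z_measurable mgf_lincomb prob prob_space_imp_sigma_finite)

text \<open>A tie means that Y k equals Y l or its negative. In units of \<epsilon> the noise in the
  difference, or in the sum, is normal with variance 2, and such a law has no atoms.\<close>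

lemma AE_no_ties: "AE \<omega> in P. inj_on (\<lambda>k. \<bar>Y k \<omega>\<bar>) {..<N}"
proof -
  have pair: "AE \<omega> in P. k \<noteq> l \<longrightarrow> \<bar>Y k \<omega>\<bar> \<noteq> \<bar>Y l \<omega>\<bar>" if "k < N" "l < N" for k l
  proof (cases "k = l")
    case False
    have sgn: "AE \<omega> in P. Y k \<omega> \<noteq> s * Y l \<omega>" if "s\<^sup>2 = 1" for s
    proof -
      define c where "c i = (if i = k then 1 else - s)" for i
      have T: "{k, l} \<subseteq> {..<N}" using \<open>k < N\<close> \<open>l < N\<close> by auto
      have V: "(\<Sum>i\<in>{k, l}. (c i)\<^sup>2) = 2" using False that by (simp add: c_def)
      have "AE \<omega> in P. (\<Sum>i\<in>{k, l}. c i * z i \<omega>) \<noteq> (s * inner_unit f (g l) - inner_unit f (g k)) / \<epsilon>"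
        using char_lincomb[OF T, of c] unfolding V
        by (intro AE_neq_of_char[where V = 2] prob lincomb_measurable[OF T]) auto
      then show ?thesis
      proof eventually_elim
        case (elim \<omega>)
        have "(\<Sum>i\<in>{k, l}. c i * z i \<omega>) = z k \<omega> - s * z l \<omega>" using False by (simp add: c_def)
        then have "z k \<omega> - s * z l \<omega> \<noteq> (s * inner_unit f (g l) - inner_unit f (g k)) / \<epsilon>" using elim by simp
        then show ?case using \<epsilon> by (auto simp: z_def field_simps)
      qed
    qed
    have "AE \<omega> in P. Y k \<omega> \<noteq> 1 * Y l \<omega>" "AE \<omega> in P. Y k \<omega> \<noteq> (-1) * Y l \<omega>" by (rule sgn, simp)+
    then show ?thesis by eventually_elim (auto simp: abs_if split: if_splits)
  qed simp
  have "AE \<omega> in P. \<forall>k\<in>{..<N}. \<forall>l\<in>{..<N}. k \<noteq> l \<longrightarrow> \<bar>Y k \<omega>\<bar> \<noteq> \<bar>Y l \<omega>\<bar>"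
    using pair by (intro AE_finite_allI) auto
  then show ?thesis by eventually_elim (auto simp: inj_on_def)
qed

end

text \<open>From y \<le> 4 exp (y / 4) and the exponential moment sqrt 2 at 1/4: 4 sqrt 2 \<le> 6.
  The constant is crude, standard normal variables having second moment 1, but only the exponential
  moments of the locale enter.\<close>

lemma (in chi_square_family) nn_integral_energy_le:
  assumes S: "S \<subseteq> {..<N}"
  shows "(\<integral>\<^sup>+\<omega>. ennreal (\<Sum>k\<in>S. (z k \<omega>)\<^sup>2) \<partial>M) \<le> ennreal (6 * real (card S))"
proof -
  have finS: "finite S" using S finite_subset by blast
  have one: "(\<integral>\<^sup>+\<omega>. ennreal ((z k \<omega>)\<^sup>2) \<partial>M) \<le> ennreal 6" if k: "k \<in> S" for k
  proof -
    have "(\<integral>\<^sup>+\<omega>. ennreal ((z k \<omega>)\<^sup>2) \<partial>M) \<le> (\<integral>\<^sup>+\<omega>. ennreal (4 * exp (1 / 4 * (\<Sum>k\<in>{k}. (z k \<omega>)\<^sup>2))) \<partial>M)"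
    proof (intro nn_integral_mono ennreal_leI)
      fix \<omega>
      have "1 + y / 4 \<le> exp (1 / 4 * y)" for y :: real using exp_ge_add_one_self[of "1 / 4 * y"] by simp
      from this[of "(z k \<omega>)\<^sup>2"] have "(z k \<omega>)\<^sup>2 \<le> 4 * exp (1 / 4 * (z k \<omega>)\<^sup>2)" by linarith
      then show "(z k \<omega>)\<^sup>2 \<le> 4 * exp (1 / 4 * (\<Sum>k\<in>{k}. (z k \<omega>)\<^sup>2))" by simp
    qed
    also have "\<dots> \<le> ennreal (4 * (1 - 2 * (1 / 4)) powr (- real (card {k}) / 2))"
      using k S by (intro nn_integral_scaled_exp) auto
    also have "\<dots> \<le> ennreal 6"
    proof (rule ennreal_leI)
      have "(1 / 2 :: real) powr (- (1 / 2)) = 1 / sqrt (1 / 2)"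
        by (simp add: powr_minus_divide powr_half_sqrt)
      also have "\<dots> = sqrt 2" by (simp add: real_sqrt_divide)
      also have "\<dots> \<le> 3 / 2" by (rule real_le_lsqrt) (auto simp: power2_eq_square)
      finally show "4 * (1 - 2 * (1 / 4)) powr (- real (card {k}) / 2) \<le> (6 :: real)" by simp
    qed
    finally show ?thesis .
  qed
  have "(\<integral>\<^sup>+\<omega>. ennreal (\<Sum>k\<in>S. (z k \<omega>)\<^sup>2) \<partial>M) = (\<integral>\<^sup>+\<omega>. (\<Sum>k\<in>S. ennreal ((z k \<omega>)\<^sup>2)) \<partial>M)"
    by (simp add: sum_ennreal)
  also have "\<dots> = (\<Sum>k\<in>S. \<integral>\<^sup>+\<omega>. ennreal ((z k \<omega>)\<^sup>2) \<partial>M)"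
  proof (rule nn_integral_sum)
    fix k assume "k \<in> S"
    then have [measurable]: "z k \<in> borel_measurable M" using S by (intro z_meas) auto
    show "(\<lambda>\<omega>. ennreal ((z k \<omega>)\<^sup>2)) \<in> borel_measurable M" by measurable
  qed
  also have "\<dots> \<le> (\<Sum>k\<in>S. ennreal 6)" by (intro sum_mono one)
  also have "\<dots> = ennreal (6 * real (card S))"
    by (simp add: ennreal_of_nat_eq_real_of_nat ennreal_mult' mult.commute)
  finally show ?thesis .
qed

subsection \<open>Finite differences and interpolation\<close>

text \<open>Pascal's rule. Taking the innermost difference first makes induction on the order
  applicable to polynomials.\<close>

lemma fin_diff_Suc: "fin_diff (Suc m) h f x = fin_diff m h (\<lambda>y. f (y + h) - f y) x"
proof -
  let ?a = "\<lambda>i. f (x + real i * h)"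
  have "fin_diff (Suc m) h f x = (\<Sum>i\<le>Suc m. (-1) ^ (Suc m - i) * real (Suc m choose i) * ?a i)"
    by (simp only: fin_diff_def)
  also have "\<dots> = (-1) ^ Suc m * ?a 0 + (\<Sum>i\<le>m. (-1) ^ (m - i) * real (Suc m choose Suc i) * ?a (Suc i))"
    by (subst sum.atMost_Suc_shift) simp
  also have "(\<Sum>i\<le>m. (-1) ^ (m - i) * real (Suc m choose Suc i) * ?a (Suc i)) =
      (\<Sum>i\<le>m. (-1) ^ (m - i) * real (m choose i) * ?a (Suc i)) + (\<Sum>i\<le>m. (-1) ^ (m - i) * real (m choose Suc i) * ?a (Suc i))"
    by (simp add: sum.distrib[symmetric] algebra_simps)
  also have "(-1) ^ Suc m * ?a 0 + ((\<Sum>i\<le>m. (-1) ^ (m - i) * real (m choose i) * ?a (Suc i)) +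
      (\<Sum>i\<le>m. (-1) ^ (m - i) * real (m choose Suc i) * ?a (Suc i))) =
      (\<Sum>i\<le>m. (-1) ^ (m - i) * real (m choose i) * ?a (Suc i)) - (\<Sum>i\<le>m. (-1) ^ (m - i) * real (m choose i) * ?a i)"
  proof -
    have "(\<Sum>i\<le>m. (-1) ^ (m - i) * real (m choose i) * ?a i) = (\<Sum>i\<le>Suc m. (-1) ^ (m - i) * real (m choose i) * ?a i)"
      by simp
    also have "\<dots> = (-1) ^ m * ?a 0 + (\<Sum>i\<le>m. (-1) ^ (m - Suc i) * real (m choose Suc i) * ?a (Suc i))"
      by (subst sum.atMost_Suc_shift) simp
    also have "(\<Sum>i\<le>m. (-1) ^ (m - Suc i) * real (m choose Suc i) * ?a (Suc i)) =
        - (\<Sum>i\<le>m. (-1) ^ (m - i) * real (m choose Suc i) * ?a (Suc i))"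
      unfolding sum_negf[symmetric]
    proof (intro sum.cong refl)
      fix i assume "i \<in> {..m}"
      show "(-1) ^ (m - Suc i) * real (m choose Suc i) * ?a (Suc i) = - ((-1) ^ (m - i) * real (m choose Suc i) * ?a (Suc i))"
      proof (cases "i < m")
        case True
        then have "m - i = Suc (m - Suc i)" by simp
        then show ?thesis by simp
      qed simp
    qed
    finally show ?thesis by simp
  qed
  also have "\<dots> = fin_diff m h (\<lambda>y. f (y + h) - f y) x"
    by (simp add: fin_diff_def sum_subtractf[symmetric] algebra_simps)
  finally show ?thesis .
qed

text \<open>Each difference lowers the degree, because the leading coefficients of q (y + h) and q
  (y) agree.\<close>

lemma fin_diff_poly: "degree q < m \<Longrightarrow> fin_diff m h (poly q) x = (0::real)"
proof (induction m arbitrary: q)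
  case (Suc m)
  define q' where "q' = pcompose q [:h, 1:] - q"
  have q': "poly q' = (\<lambda>y. poly q (y + h) - poly q y)"
    by (simp add: q'_def fun_eq_iff poly_pcompose add.commute)
  show ?case
  proof (cases "degree q = 0")
    case True
    then obtain c where "q = [:c:]" by (metis degree_eq_zeroE)
    then show ?thesis unfolding fin_diff_Suc by (simp add: fin_diff_def)
  next
    case False
    have "degree q' < degree q"
    proof (cases "q' = 0")
      case True then show ?thesis using False by simp
    next
      case nz: False
      have "degree (pcompose q [:h, 1:]) = degree q" by (simp add: degree_pcompose)
      moreover have "lead_coeff (pcompose q [:h, 1:]) = lead_coeff q"
        by (subst lead_coeff_comp) auto
      ultimately have "coeff q' (degree q) = 0" "degree q' \<le> degree q"
        unfolding q'_def using degree_diff_le_max[of "pcompose q [:h, 1:]" q] by (auto)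
      then show ?thesis using nz by (metis le_neq_implies_less leading_coeff_0_iff)
    qed
    then have "degree q' < m" using Suc.prems by simp
    from Suc.IH[OF this] show ?thesis unfolding fin_diff_Suc q' .
  qed
qed simp

lemma fin_diff_diff: "fin_diff m h (\<lambda>y. f y - g y) x = fin_diff m h f x - fin_diff m h g x"
  by (simp add: fin_diff_def sum_subtractf right_diff_distrib)

lemma fin_diff_affine: "fin_diff m 1 (\<lambda>u. f (a + u * h)) t = fin_diff m h f (a + t * h)"
  by (simp add: fin_diff_def algebra_simps)

definition lagrange_basis :: "nat \<Rightarrow> (nat \<Rightarrow> real) \<Rightarrow> nat \<Rightarrow> real poly" where
  "lagrange_basis m n i = smult (1 / (\<Prod>k\<in>{..<m} - {i}. n i - n k)) (\<Prod>k\<in>{..<m} - {i}. [:- n k, 1:])"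

lemma poly_lagrange_basis:
  "poly (lagrange_basis m n i) x = (\<Prod>k\<in>{..<m} - {i}. (x - n k) / (n i - n k))"
  by (simp add: lagrange_basis_def poly_prod prod_dividef)

lemma degree_lagrange_basis: "i < m \<Longrightarrow> degree (lagrange_basis m n i) < m"
proof -
  assume i: "i < m"
  have "degree (lagrange_basis m n i) \<le> degree (\<Prod>k\<in>{..<m} - {i}. [:- n k, 1:])"
    unfolding lagrange_basis_def by (rule degree_smult_le)
  also have "\<dots> \<le> sum (degree \<circ> (\<lambda>k. [:- n k, 1:])) ({..<m} - {i})"
    by (rule degree_prod_sum_le) simp
  also have "\<dots> = m - 1" using i by simp
  finally show ?thesis using i by simp
qed

lemma interpolation_exists:
  assumes m: "0 < m" and n: "inj_on n {..<m}"
  obtains q :: "real poly" where "degree q < m" "\<And>i. i < m \<Longrightarrow> poly q (n i) = v i"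
proof
  define q where "q = (\<Sum>i<m. smult (v i) (lagrange_basis m n i))"
  show "degree q < m" unfolding q_def
    using m degree_lagrange_basis by (intro degree_sum_less le_less_trans[OF degree_smult_le]) auto
  fix j assume j: "j < m"
  have "poly (lagrange_basis m n i) (n j) = (if i = j then 1 else 0)" if "i < m" for i
  proof (cases "i = j")
    case True
    have "(\<Prod>k\<in>{..<m} - {i}. (n i - n k) / (n i - n k)) = 1"
      using n that by (intro prod.neutral) (auto simp: inj_on_def)
    then show ?thesis using True by (simp add: poly_lagrange_basis)
  next
    case False
    then show ?thesis using j by (auto simp: poly_lagrange_basis intro!: prod_zero bexI[of _ j])
  qed
  then have "poly q (n j) = (\<Sum>i<m. if i = j then v i else 0)" unfolding q_def poly_sum by (intro sum.cong) auto
  then show "poly q (n j) = v j" using j by simp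
qed

text \<open>In the Lagrange form the denominators are at least 1 and the numerators at most D. The
  constant depends on the nodes only through D, so that windows of different spacing are treated
  alike.\<close>

lemma poly_bound_by_nodes:
  fixes q :: "real poly"
  assumes q: "degree q < m" and n: "\<And>i k. i < m \<Longrightarrow> k < m \<Longrightarrow> i \<noteq> k \<Longrightarrow> 1 \<le> \<bar>n i - n k\<bar>"
    and e: "\<And>i. i < m \<Longrightarrow> \<bar>poly q (n i)\<bar> \<le> e" and x: "\<And>k. k < m \<Longrightarrow> \<bar>x - n k\<bar> \<le> D" and D: "1 \<le> D"
  shows "\<bar>poly q x\<bar> \<le> real m * D ^ m * e"
proof -
  have m: "0 < m" using q by simp
  have e0: "0 \<le> e" using e[OF m] by linarith
  define q' where "q' = (\<Sum>i<m. smult (poly q (n i)) (lagrange_basis m n i))"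
  have inj: "inj_on n {..<m}" using n by (auto simp: inj_on_def) fastforce
  have "q = q'"
  proof (rule poly_eqI_degree[of "n ` {..<m}"])
    show "card (n ` {..<m}) > degree q" using inj q by (simp add: card_image)
    have "degree q' < m" unfolding q'_def
      using m degree_lagrange_basis by (intro degree_sum_less le_less_trans[OF degree_smult_le]) auto
    then show "card (n ` {..<m}) > degree q'" using inj by (simp add: card_image)
    fix y assume "y \<in> n ` {..<m}"
    then obtain j where j: "j < m" "y = n j" by auto
    have "poly (lagrange_basis m n i) (n j) = (if i = j then 1 else 0)" if "i < m" for i
    proof (cases "i = j")
      case True
      have "(\<Prod>k\<in>{..<m} - {i}. (n i - n k) / (n i - n k)) = 1"
        using inj that by (intro prod.neutral) (auto simp: inj_on_def)
      then show ?thesis using True by (simp add: poly_lagrange_basis)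
    next
      case False
      then show ?thesis using j by (auto simp: poly_lagrange_basis intro!: prod_zero bexI[of _ j])
    qed
    then have "poly q' (n j) = (\<Sum>i<m. if i = j then poly q (n i) else 0)" unfolding q'_def poly_sum by (intro sum.cong) auto
    then show "poly q y = poly q' y" using j by simp
  qed
  have basis: "\<bar>poly (lagrange_basis m n i) x\<bar> \<le> D ^ m" if i: "i < m" for i
  proof -
    have "\<bar>poly (lagrange_basis m n i) x\<bar> = (\<Prod>k\<in>{..<m} - {i}. \<bar>(x - n k) / (n i - n k)\<bar>)"
      unfolding poly_lagrange_basis by (rule abs_prod)
    also have "\<dots> \<le> (\<Prod>k\<in>{..<m} - {i}. D)"
    proof (intro prod_mono conjI)
      fix k assume k: "k \<in> {..<m} - {i}"
      have "\<bar>x - n k\<bar> / \<bar>n i - n k\<bar> \<le> D / 1" using k i n[of i k] x[of k] by (intro frac_le) auto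
      then show "\<bar>(x - n k) / (n i - n k)\<bar> \<le> D" by simp
    qed simp
    also have "\<dots> = D ^ (m - 1)" using i by simp
    also have "\<dots> \<le> D ^ m" using D by (intro power_increasing) auto
    finally show ?thesis .
  qed
  have "\<bar>poly q x\<bar> = \<bar>\<Sum>i<m. poly q (n i) * poly (lagrange_basis m n i) x\<bar>"
    by (subst \<open>q = q'\<close>) (simp add: q'_def poly_sum)
  also have "\<dots> \<le> (\<Sum>i<m. \<bar>poly q (n i)\<bar> * \<bar>poly (lagrange_basis m n i) x\<bar>)"
    by (rule order_trans[OF sum_abs]) (simp add: abs_mult)
  also have "\<dots> \<le> (\<Sum>i<m. e * D ^ m)" using e basis e0 by (intro sum_mono mult_mono) auto
  finally show ?thesis by (simp add: mult_ac)
qed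

text \<open>Solved for its last term, the m-th difference expresses a value by the m preceding ones.
  The binomial coefficients involved add up to less than 2^m, so the values grow at most
  geometrically with ratio 2^m + 1.\<close>

lemma discrete_growth:
  fixes H :: "real \<Rightarrow> real"
  assumes zero: "\<And>t::nat. t < m \<Longrightarrow> H t = 0" and e: "0 \<le> e"
    and diff: "\<And>t::nat. t < m \<Longrightarrow> \<bar>fin_diff m 1 H t\<bar> \<le> e" and t: "t < 2 * m"
  shows "\<bar>H (real t)\<bar> \<le> (2 ^ m + 1) ^ t * e"
  using t
proof (induction t rule: less_induct)
  case (less t)
  define B :: real where "B = 2 ^ m + 1"
  have B: "1 \<le> B" by (simp add: B_def)
  show ?case
  proof (cases "t < m")
    case True
    then show ?thesis using zero e by simp
  next
    case False
    define s where "s = t - m"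
    have s: "t = s + m" "s < m" using False less.prems by (auto simp: s_def)
    have tpos: "0 < t" using False less.prems by simp
    have "fin_diff m 1 H s = (\<Sum>i<m. (-1) ^ (m - i) * real (m choose i) * H (real s + real i * 1)) + H (real t)"
      unfolding fin_diff_def lessThan_Suc_atMost[symmetric] using s by simp
    then have "\<bar>H (real t)\<bar> \<le> e + \<bar>\<Sum>i<m. (-1) ^ (m - i) * real (m choose i) * H (real s + real i * 1)\<bar>"
      using diff[OF s(2)] by linarith
    also have "\<bar>\<Sum>i<m. (-1) ^ (m - i) * real (m choose i) * H (real s + real i * 1)\<bar> \<le>
        (\<Sum>i<m. real (m choose i) * (B ^ (t - 1) * e))"
    proof (rule order_trans[OF sum_abs], rule sum_mono)
      fix i assume i: "i \<in> {..<m}"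
      have "\<bar>H (real (s + i))\<bar> \<le> B ^ (s + i) * e" unfolding B_def using i s by (intro less.IH) auto
      also have "\<dots> \<le> B ^ (t - 1) * e" using i s B e by (intro mult_right_mono power_increasing) auto
      finally show "\<bar>(-1) ^ (m - i) * real (m choose i) * H (real s + real i * 1)\<bar> \<le> real (m choose i) * (B ^ (t - 1) * e)"
        by (simp add: abs_mult power_abs mult_left_mono)
    qed
    also have "\<dots> = (\<Sum>i<m. real (m choose i)) * (B ^ (t - 1) * e)" by (simp add: sum_distrib_right)
    also have "\<dots> \<le> 2 ^ m * (B ^ (t - 1) * e)"
    proof (intro mult_right_mono)
      have "(\<Sum>i<m. m choose i) \<le> (\<Sum>i\<le>m. m choose i)" by (intro sum_mono2) auto
      then have "(\<Sum>i<m. m choose i) \<le> 2 ^ m" by (simp add: choose_row_sum)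
      then have "real (\<Sum>i<m. m choose i) \<le> real (2 ^ m)" by (simp only: of_nat_le_iff)
      then show "(\<Sum>i<m. real (m choose i)) \<le> 2 ^ m" by simp
    qed (use B e in auto)
    also have "e + 2 ^ m * (B ^ (t - 1) * e) \<le> B ^ (t - 1) * e + 2 ^ m * (B ^ (t - 1) * e)"
      using mult_right_mono[OF one_le_power[OF B, of "t - 1"] e] by simp
    also have "\<dots> = B * B ^ (t - 1) * e" by (simp add: B_def algebra_simps)
    also have "B * B ^ (t - 1) = B ^ t" using tpos by (metis power_minus_mult mult.commute)
    finally show ?thesis by (simp add: B_def)
  qed
qed

text \<open>Both interpolants are compared with the one at the nodes \<open>0, \<dots>, m - 1\<close>, from which the
  \<open>2 m\<close> values of \<open>G\<close> deviate by a multiple of the \<open>m\<close>-th differences.\<close>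
lemma coarse_fine_interpolants:
  fixes G :: "real \<Rightarrow> real" and pc pf :: "real poly"
  assumes m: "0 < m" and pc: "degree pc < m" "\<And>i. i < m \<Longrightarrow> poly pc (real (2 * i + b)) = G (real (2 * i + b))" and b: "b \<le> 1"
    and pf: "degree pf < m" "\<And>i. i < m \<Longrightarrow> poly pf (real (\<tau> + i)) = G (real (\<tau> + i))" and \<tau>: "\<tau> \<le> m"
    and e: "0 \<le> e" "\<And>t::nat. t < m \<Longrightarrow> \<bar>fin_diff m 1 G t\<bar> \<le> e" and x: "-1 \<le> x" "x \<le> 2 * real m"
  shows "\<bar>poly pf x - poly pc x\<bar> \<le> 2 * (real m * (2 * real m + 1) ^ m * (2 ^ m + 1) ^ (2 * m)) * e"
proof -
  have "inj_on real {..<m}" by (auto simp: inj_on_def)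
  then obtain q where q: "degree q < m" "\<And>i. i < m \<Longrightarrow> poly q (real i) = G (real i)"
    by (rule interpolation_exists[OF m, of real "\<lambda>i. G (real i)"]) blast
  define H where "H y = G y - poly q y" for y
  define B :: real where "B = 2 ^ m + 1"
  have H: "\<bar>H (real t)\<bar> \<le> B ^ (2 * m) * e" if t: "t < 2 * m" for t
  proof -
    have "\<bar>H (real t)\<bar> \<le> B ^ t * e" unfolding B_def
    proof (rule discrete_growth[OF _ e(1) _ t])
      show "H (real t) = 0" if "t < m" for t using q that by (simp add: H_def)
      show "\<bar>fin_diff m 1 H (real t)\<bar> \<le> e" if "t < m" for t
        using e(2)[OF that] fin_diff_diff[of m 1 G "poly q" "real t"] fin_diff_poly[OF q(1), of 1 "real t"]
        by (simp add: H_def[abs_def])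
    qed
    also have "\<dots> \<le> B ^ (2 * m) * e" using t e by (intro mult_right_mono power_increasing) (auto simp: B_def)
    finally show ?thesis .
  qed
  have D: "1 \<le> 2 * real m + 1" by simp
  \<comment> \<open>Used for the nodes 2 i + b of the coarse window and \<tau> + i of the fine one;
    all of them lie below 2 m, where H is under control.\<close>
  have cmp: "\<bar>poly (p - q) x\<bar> \<le> real m * (2 * real m + 1) ^ m * (B ^ (2 * m) * e)"
    if p: "degree p < m" "\<And>i. i < m \<Longrightarrow> poly p (real (\<nu> i)) = G (real (\<nu> i))"
      and \<nu>: "inj_on \<nu> {..<m}" "\<And>i. i < m \<Longrightarrow> \<nu> i < 2 * m" for p \<nu>
  proof (rule poly_bound_by_nodes[where n = "\<lambda>i. real (\<nu> i)"])
    show "degree (p - q) < m" using p q degree_diff_less by blast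
    show "1 \<le> \<bar>real (\<nu> i) - real (\<nu> k)\<bar>" if "i < m" "k < m" "i \<noteq> k" for i k
    proof -
      have "\<nu> i \<noteq> \<nu> k" using \<nu>(1) that by (auto simp: inj_on_def)
      then show ?thesis by (cases "\<nu> i < \<nu> k") auto
    qed
    show "\<bar>poly (p - q) (real (\<nu> i))\<bar> \<le> B ^ (2 * m) * e" if "i < m" for i
      using H[OF \<nu>(2)[OF that]] p(2)[OF that] by (simp add: H_def)
    show "\<bar>x - real (\<nu> k)\<bar> \<le> 2 * real m + 1" if "k < m" for k
    proof -
      have "real (\<nu> k) \<le> 2 * real m" using \<nu>(2)[OF that] by (metis less_imp_le of_nat_le_iff of_nat_mult of_nat_numeral)
      then show ?thesis using x by linarith
    qed
  qed (rule D)
  have "\<bar>poly (pc - q) x\<bar> \<le> real m * (2 * real m + 1) ^ m * (B ^ (2 * m) * e)"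
    using b by (intro cmp[of _ "\<lambda>i. 2 * i + b"] pc) (auto simp: inj_on_def)
  moreover have "\<bar>poly (pf - q) x\<bar> \<le> real m * (2 * real m + 1) ^ m * (B ^ (2 * m) * e)"
    using \<tau> by (intro cmp[of _ "\<lambda>i. \<tau> + i"] pf) (auto simp: inj_on_def)
  ultimately show ?thesis by (simp add: B_def mult_ac)
qed

subsection \<open>Nested lattices\<close>

definition rmod :: "real \<Rightarrow> real \<Rightarrow> real" where
  "rmod y h = y - h * of_int \<lfloor>y / h\<rfloor>"

lemma rmod_range:
  assumes "0 < h" shows "0 \<le> rmod y h" "rmod y h < h"
proof -
  have "h * of_int \<lfloor>y / h\<rfloor> \<le> h * (y / h)" "h * (y / h) < h * (of_int \<lfloor>y / h\<rfloor> + 1)"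
    using assms by (intro mult_left_mono mult_strict_left_mono; linarith)+
  then show "0 \<le> rmod y h" "rmod y h < h" using assms by (auto simp: rmod_def algebra_simps)
qed

lemma rmod_eq: "0 < h \<Longrightarrow> 0 \<le> u \<Longrightarrow> u < h \<Longrightarrow> rmod (real i * h + u) h = u"
proof -
  assume h: "0 < h" "0 \<le> u" "u < h"
  have "\<lfloor>(real i * h + u) / h\<rfloor> = int i"
    using h by (intro floor_unique) (auto simp: field_simps)
  then show ?thesis by (simp add: rmod_def)
qed

text \<open>b records whether the points of the coarse lattice are the even or the odd points of the
  refined one.\<close>

lemma rmod_half:
  assumes h: "0 < h"
  obtains b :: nat where "b \<le> 1" "rmod y h = rmod y (h / 2) + real b * (h / 2)"
proof -
  define k where "k = \<lfloor>y / h\<rfloor>"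
  have *: "y / (h / 2) = 2 * (y / h)" by simp
  have "of_int k \<le> y / h" "y / h < of_int k + 1" unfolding k_def by linarith+
  then have "\<lfloor>y / (h / 2)\<rfloor> = 2 * k \<or> \<lfloor>y / (h / 2)\<rfloor> = 2 * k + 1"
    unfolding * by linarith
  then show ?thesis
  proof
    assume "\<lfloor>y / (h / 2)\<rfloor> = 2 * k"
    then show ?thesis using that[of 0] by (simp add: rmod_def k_def[symmetric])
  next
    assume "\<lfloor>y / (h / 2)\<rfloor> = 2 * k + 1"
    then show ?thesis using that[of 1] by (simp add: rmod_def k_def[symmetric] algebra_simps)
  qed
qed

text \<open>Reducing one offset y modulo every mesh size makes the lattices nested: by
  \<open>rmod_half\<close>, the points of level l are among those of level l + 1.\<close>

definition lat :: "real \<Rightarrow> real \<Rightarrow> real \<Rightarrow> nat \<Rightarrow> nat \<Rightarrow> real" where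
  "lat A h0 y l i = A + real i * (h0 / 2 ^ l) + rmod y (h0 / 2 ^ l)"

text \<open>Each lattice point at level \<open>L\<close> is reached by a chain of windows of \<open>m\<close> consecutive cells, one
  per level, each inside its predecessor.\<close>
lemma dyadic_chain:
  fixes f :: "real \<Rightarrow> real"
  assumes m: "0 < m" and h0: "0 < h0" and e0: "\<And>l. 0 \<le> e l"
    and e: "\<And>l i. 1 \<le> l \<Longrightarrow> i + m < m * 2 ^ l \<Longrightarrow> \<bar>fin_diff m (h0 / 2 ^ l) f (lat A h0 y l i)\<bar> \<le> e l"
  defines "C \<equiv> 2 * (real m * (2 * real m + 1) ^ m * (2 ^ m + 1) ^ (2 * m))"
  obtains p0 :: "real poly" where "degree p0 < m"
    "\<And>L i. i < m * 2 ^ L \<Longrightarrow> \<bar>f (lat A h0 y L i) - poly p0 (lat A h0 y L i)\<bar> \<le> C * (\<Sum>l=1..L. e l)"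
proof -
  define h where "h l = h0 / 2 ^ l" for l :: nat
  have h: "0 < h l" for l using h0 by (simp add: h_def)
  have lat: "lat A h0 y l i = A + real i * h l + rmod y (h l)" for l i by (simp add: lat_def h_def)
  have lat_inj: "inj_on (\<lambda>i. lat A h0 y l (a + i)) {..<m}" for l a
    using h[of l] by (auto simp: inj_on_def lat)
  obtain p0 where p0: "degree p0 < m" "\<And>i. i < m \<Longrightarrow> poly p0 (lat A h0 y 0 (0 + i)) = f (lat A h0 y 0 (0 + i))"
    by (rule interpolation_exists[OF m lat_inj[of 0 0], of "\<lambda>i. f (lat A h0 y 0 (0 + i))"]) blast
  have C: "0 \<le> C" by (simp add: C_def)
  \<comment> \<open>The distance from p0 is controlled on the whole interval of the window, not only
    at its nodes: the step to the next level needs it at arbitrary points of the smaller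
    window.\<close>
  have window: "\<exists>p. degree p < m \<and> (\<forall>i<m. poly p (lat A h0 y L (a + i)) = f (lat A h0 y L (a + i))) \<and>
      (\<forall>x. A + real a * h L \<le> x \<longrightarrow> x \<le> A + real (a + m) * h L \<longrightarrow> \<bar>poly p x - poly p0 x\<bar> \<le> C * (\<Sum>l=1..L. e l))"
    if "a + m \<le> m * 2 ^ L" for L a
    using that
  proof (induction L arbitrary: a)
    case 0
    then show ?case using p0 by (intro exI[of _ p0]) auto
  next
    case (Suc L a')
    \<comment> \<open>The parent window: half of a', moved back where it would leave the range. In
      both cases 2 a \<le> a' \<le> 2 a + m, so the m fine cells from a' on lie among the 2 m fine
      cells of the parent.\<close>
    define a where "a = min (a' div 2) (m * 2 ^ L - m)"
    have mL: "m \<le> m * 2 ^ L" by simp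
    have aL: "a + m \<le> m * 2 ^ L"
    proof -
      have "a \<le> m * 2 ^ L - m" unfolding a_def by (rule min.cobounded2)
      then show ?thesis using mL by linarith
    qed
    have a1: "2 * a \<le> a'" by (auto simp: a_def)
    have a2: "a' \<le> 2 * a + m"
    proof (cases "a' div 2 \<le> m * 2 ^ L - m")
      case True
      then have "a = a' div 2" by (simp add: a_def)
      then show ?thesis using m by linarith
    next
      case False
      then have "a = m * 2 ^ L - m" by (simp add: a_def)
      then show ?thesis using Suc.prems mL by (simp add: algebra_simps)
    qed
    define \<tau> where "\<tau> = a' - 2 * a"
    have \<tau>: "\<tau> \<le> m" "a' = 2 * a + \<tau>" using a1 a2 by (auto simp: \<tau>_def)
    obtain p where p: "degree p < m" "\<And>i. i < m \<Longrightarrow> poly p (lat A h0 y L (a + i)) = f (lat A h0 y L (a + i))"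
      "\<And>x. A + real a * h L \<le> x \<Longrightarrow> x \<le> A + real (a + m) * h L \<Longrightarrow> \<bar>poly p x - poly p0 x\<bar> \<le> C * (\<Sum>l=1..L. e l)"
      using Suc.IH[OF aL] by blast
    obtain p' where p': "degree p' < m" "\<And>i. i < m \<Longrightarrow> poly p' (lat A h0 y (Suc L) (a' + i)) = f (lat A h0 y (Suc L) (a' + i))"
      by (rule interpolation_exists[OF m lat_inj[of "Suc L" a'], of "\<lambda>i. f (lat A h0 y (Suc L) (a' + i))"]) blast
    have h2: "h L = 2 * h (Suc L)" by (simp add: h_def)
    have h3: "h L / 2 = h (Suc L)" by (simp add: h_def)
    obtain b where b: "b \<le> 1" "rmod y (h L) = rmod y (h (Suc L)) + real b * h (Suc L)"
      using rmod_half[OF h[of L], of y] unfolding h3 by blast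
    define x0 where "x0 = lat A h0 y (Suc L) (2 * a)"
    define k where "k = h (Suc L)"
    have k: "0 < k" using h by (simp add: k_def)
    have coarse: "lat A h0 y L (a + i) = x0 + real (2 * i + b) * k" for i
      unfolding lat x0_def k_def b(2) unfolding h2 by (simp add: algebra_simps)
    have fine: "lat A h0 y (Suc L) (2 * a + t) = x0 + real t * k" for t
      by (simp add: lat x0_def k_def algebra_simps)
    \<comment> \<open>Rescaled so that the fine mesh is 1 and the fine point number 2 a is the
      origin.\<close>
    define G where "G u = f (x0 + u * k)" for u
    have affine: "poly (pcompose q [:x0, k:]) u = poly q (x0 + u * k)" for q u by (simp add: poly_pcompose)
    have close: "\<bar>poly p' x - poly p x\<bar> \<le> C * e (Suc L)"
      if x: "A + real a' * h (Suc L) \<le> x" "x \<le> A + real (a' + m) * h (Suc L)" for x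
    proof -
      define u where "u = (x - x0) / k"
      have xu: "x = x0 + u * k" using k by (simp add: u_def)
      have r: "0 \<le> rmod y k" "rmod y k < k" using rmod_range[OF k] by auto
      have x0': "x0 = A + 2 * real a * k + rmod y k" by (simp add: x0_def lat k_def)
      have "-1 * k \<le> u * k"
      proof -
        have "2 * real a * k \<le> real a' * k" using a1 k by (intro mult_right_mono) auto
        then show ?thesis using x(1) r unfolding xu x0' k_def[symmetric] by linarith
      qed
      then have u1: "-1 \<le> u" using k by (simp only: mult_le_cancel_right_pos)
      have "u * k \<le> (2 * real m) * k"
      proof -
        have "real (a' + m) * k \<le> (2 * real a + 2 * real m) * k" using a2 k by (intro mult_right_mono) auto
        then have "real (a' + m) * k \<le> 2 * real a * k + 2 * real m * k" by (simp add: distrib_right)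
        then show ?thesis using x(2) r unfolding xu x0' k_def[symmetric] by linarith
      qed
      then have u2: "u \<le> 2 * real m" using k by (simp only: mult_le_cancel_right_pos)
      have "\<bar>poly (pcompose p' [:x0, k:]) u - poly (pcompose p [:x0, k:]) u\<bar> \<le> C * e (Suc L)"
        unfolding C_def
      proof (rule coarse_fine_interpolants[OF m _ _ b(1) _ _ \<tau>(1), where G = G])
        show "degree (pcompose p [:x0, k:]) < m" "degree (pcompose p' [:x0, k:]) < m"
          using p(1) p'(1) k by (simp_all add: degree_pcompose)
        show "poly (pcompose p [:x0, k:]) (real (2 * i + b)) = G (real (2 * i + b))" if "i < m" for i
          using p(2)[OF that] unfolding affine G_def coarse .
        show "poly (pcompose p' [:x0, k:]) (real (\<tau> + i)) = G (real (\<tau> + i))" if "i < m" for i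
          using p'(2)[OF that] unfolding affine G_def \<tau>(2) add.assoc fine .
        show "\<bar>fin_diff m 1 G (real t)\<bar> \<le> e (Suc L)" if "t < m" for t
        proof -
          have "2 * a + t + m < m * 2 ^ Suc L" using aL that by simp
          from e[OF _ this] show ?thesis
            unfolding G_def[abs_def] fin_diff_affine fine h_def[symmetric] k_def by simp
        qed
      qed (use e0 u1 u2 in auto)
      then show ?thesis unfolding affine xu[symmetric] .
    qed
    have "\<bar>poly p' x - poly p0 x\<bar> \<le> C * (\<Sum>l=1..Suc L. e l)"
      if x: "A + real a' * h (Suc L) \<le> x" "x \<le> A + real (a' + m) * h (Suc L)" for x
    proof -
      have "real a * h L \<le> real a' * h (Suc L)"
      proof -
        have "real (2 * a) * h (Suc L) \<le> real a' * h (Suc L)" using a1 h[of "Suc L"] by (intro mult_right_mono) auto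
        then show ?thesis by (simp add: h2)
      qed
      moreover have "real (a' + m) * h (Suc L) \<le> real (a + m) * h L"
      proof -
        have "real (a' + m) * h (Suc L) \<le> real (2 * (a + m)) * h (Suc L)" using a2 h[of "Suc L"] by (intro mult_right_mono) auto
        then show ?thesis by (simp add: h2 algebra_simps)
      qed
      ultimately have "\<bar>poly p x - poly p0 x\<bar> \<le> C * (\<Sum>l=1..L. e l)" using x by (intro p(3)) auto
      then show ?thesis using close[OF x] by (simp add: distrib_left)
    qed
    then show ?case using p' by blast
  qed
  show ?thesis
  proof (rule that[OF p0(1)])
    fix L i assume i: "i < m * 2 ^ L"
    \<comment> \<open>A window starting at i, moved back at the right end of the range, so that
      every lattice point belongs to some window.\<close>
    define a where "a = min i (m * 2 ^ L - m)"
    have mL: "m \<le> m * 2 ^ L" by simp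
    have "a \<le> m * 2 ^ L - m" "a \<le> i" unfolding a_def by (rule min.cobounded2, rule min.cobounded1)
    moreover have "i < a + m"
    proof (cases "i \<le> m * 2 ^ L - m")
      case False
      then have "a = m * 2 ^ L - m" by (simp add: a_def)
      then show ?thesis using i mL by linarith
    qed (use m in \<open>simp add: a_def\<close>)
    ultimately have a: "a + m \<le> m * 2 ^ L" "a \<le> i" "i < a + m" using mL by linarith+
    obtain p where p: "degree p < m" "\<And>i. i < m \<Longrightarrow> poly p (lat A h0 y L (a + i)) = f (lat A h0 y L (a + i))"
      "\<And>x. A + real a * h L \<le> x \<Longrightarrow> x \<le> A + real (a + m) * h L \<Longrightarrow> \<bar>poly p x - poly p0 x\<bar> \<le> C * (\<Sum>l=1..L. e l)"
      using window[OF a(1)] by blast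
    have eq: "f (lat A h0 y L i) = poly p (lat A h0 y L i)" using p(2)[of "i - a"] a by simp
    have r: "0 \<le> rmod y (h L)" "rmod y (h L) < h L" using rmod_range[OF h] by auto
    have "real a * h L \<le> real i * h L" using a h[of L] by (intro mult_right_mono) auto
    moreover have "(real i + 1) * h L \<le> real (a + m) * h L" using a h[of L] by (intro mult_right_mono) auto
    ultimately show "\<bar>f (lat A h0 y L i) - poly p0 (lat A h0 y L i)\<bar> \<le> C * (\<Sum>l=1..L. e l)"
      unfolding eq using r by (intro p(3); unfold lat; simp only: distrib_right mult_1_left; linarith)
  qed
qed

text \<open>Each x l is at most a geometric factor times the p-th root of the weighted sum. This
  argument is the same for p below and above 1, where otherwise subadditivity and Hoelder's
  inequality would be needed in turn.\<close>

lemma sum_powr_le_weighted: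
  fixes x :: "nat \<Rightarrow> real"
  assumes p: "0 < p" and \<delta>: "0 < \<delta>" and x: "\<And>l. 0 \<le> x l"
  shows "(\<Sum>l=1..L. x l) powr p \<le> (1 / (1 - 2 powr (- \<delta>))) powr p * (\<Sum>l=1..L. 2 powr (\<delta> * p * real l) * x l powr p)"
proof -
  define Q where "Q = (\<Sum>l=1..L. 2 powr (\<delta> * p * real l) * x l powr p)"
  define r :: real where "r = 2 powr (- \<delta>)"
  have r: "0 < r" "r < 1" using \<delta> by (auto simp: r_def powr_less_one)
  have Q: "0 \<le> Q" unfolding Q_def by (intro sum_nonneg) auto
  have "x l \<le> r ^ l * Q powr (1 / p)" if l: "l \<in> {1..L}" for l
  proof -
    have "2 powr (\<delta> * p * real l) * x l powr p \<le> Q" unfolding Q_def using l by (intro member_le_sum) auto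
    then have "(2 powr (\<delta> * p * real l) * x l powr p) powr (1 / p) \<le> Q powr (1 / p)" using p by (intro powr_mono2) auto
    moreover have "(2 powr (\<delta> * p * real l) * x l powr p) powr (1 / p) = 2 powr (\<delta> * real l) * x l"
      using p x[of l] by (simp add: powr_mult powr_powr)
    moreover have "2 powr (\<delta> * real l) * r ^ l = 1"
      by (simp add: r_def powr_realpow[symmetric] powr_powr powr_add[symmetric])
    ultimately have "r ^ l * (2 powr (\<delta> * real l) * x l) \<le> r ^ l * Q powr (1 / p)" "2 powr (\<delta> * real l) * r ^ l = 1"
      using r by (auto intro!: mult_left_mono)
    moreover have "r ^ l * (2 powr (\<delta> * real l) * x l) = (2 powr (\<delta> * real l) * r ^ l) * x l" by simp
    ultimately show ?thesis by simp
  qed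
  then have "(\<Sum>l=1..L. x l) \<le> (\<Sum>l=1..L. r ^ l * Q powr (1 / p))" by (intro sum_mono) auto
  also have "\<dots> = (\<Sum>l=1..L. r ^ l) * Q powr (1 / p)" by (simp add: sum_distrib_right)
  also have "\<dots> \<le> 1 / (1 - r) * Q powr (1 / p)"
  proof (rule mult_right_mono)
    have "(\<Sum>l=1..L. r ^ l) \<le> (\<Sum>l<Suc L. r ^ l)" using r by (intro sum_mono2) auto
    also have "\<dots> \<le> 1 / (1 - r)" using r by (subst sum_gp_strict) (auto simp: divide_right_mono)
    finally show "(\<Sum>l=1..L. r ^ l) \<le> 1 / (1 - r)" .
  qed simp
  finally have "(\<Sum>l=1..L. x l) powr p \<le> (1 / (1 - r) * Q powr (1 / p)) powr p"
    using p x by (intro powr_mono2) (auto intro: sum_nonneg)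
  also have "\<dots> = (1 / (1 - r)) powr p * Q" using p Q r by (simp add: powr_mult powr_powr powr_divide)
  finally show ?thesis by (simp add: Q_def r_def)
qed

lemma measurable_rmod [measurable]: "(\<lambda>y. rmod y h) \<in> borel_measurable borel"
  unfolding rmod_def by measurable

lemma nn_integral_cells:
  fixes \<Phi> :: "real \<Rightarrow> ennreal"
  assumes [measurable]: "\<Phi> \<in> borel_measurable borel" and h: "0 < h"
  shows "(\<integral>\<^sup>+y\<in>{A..<A + real n * h}. \<Phi> y \<partial>lborel) = (\<Sum>i<n. \<integral>\<^sup>+u\<in>{0..<h}. \<Phi> (A + real i * h + u) \<partial>lborel)"
proof (induction n)
  case (Suc n)
  define d where "d = real n * h"
  let ?a = "A + d"
  have d: "0 \<le> d" "real (Suc n) * h = d + h" using h by (auto simp: d_def distrib_right)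
  have "(\<integral>\<^sup>+y\<in>{A..<A + real (Suc n) * h}. \<Phi> y \<partial>lborel) =
      (\<integral>\<^sup>+y. \<Phi> y * indicator {A..<?a} y + \<Phi> y * indicator {?a..<?a + h} y \<partial>lborel)"
    unfolding d(2) using h d(1) by (intro nn_integral_cong) (auto simp: indicator_def)
  also have "\<dots> = (\<integral>\<^sup>+y\<in>{A..<?a}. \<Phi> y \<partial>lborel) + (\<integral>\<^sup>+y\<in>{?a..<?a + h}. \<Phi> y \<partial>lborel)"
    by (rule nn_integral_add) auto
  also have "(\<integral>\<^sup>+y\<in>{?a..<?a + h}. \<Phi> y \<partial>lborel) = (\<integral>\<^sup>+u\<in>{0..<h}. \<Phi> (?a + u) \<partial>lborel)"
    by (subst nn_integral_real_affine[where c = 1 and t = ?a]) (auto intro!: nn_integral_cong simp: indicator_def)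
  finally show ?case using Suc.IH by (simp add: d_def)
qed simp

lemma nn_integral_rmod:
  fixes \<psi> :: "real \<Rightarrow> ennreal"
  assumes [measurable]: "\<psi> \<in> borel_measurable borel" and h: "0 < h"
  shows "(\<integral>\<^sup>+y\<in>{0..<real n * h}. \<psi> (rmod y h) \<partial>lborel) = of_nat n * (\<integral>\<^sup>+u\<in>{0..<h}. \<psi> u \<partial>lborel)"
proof -
  have "(\<integral>\<^sup>+y\<in>{0..<real n * h}. \<psi> (rmod y h) \<partial>lborel) = (\<Sum>i<n. \<integral>\<^sup>+u\<in>{0..<h}. \<psi> (rmod (0 + real i * h + u) h) \<partial>lborel)"
    using nn_integral_cells[of "\<lambda>y. \<psi> (rmod y h)" h 0 n] h by simp
  also have "\<dots> = (\<Sum>i<n. \<integral>\<^sup>+u\<in>{0..<h}. \<psi> u \<partial>lborel)"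
    using rmod_eq[OF h] by (intro sum.cong refl nn_integral_cong) (auto simp: indicator_def)
  finally show ?thesis by simp
qed

text \<open>As y runs through [0, h0), its remainder runs 2^l times through one cell, and the
  lattice points then sweep all cells. This is how sums of point values become integrals.\<close>

lemma nn_integral_lattice:
  fixes \<Phi> :: "real \<Rightarrow> ennreal"
  assumes [measurable]: "\<Phi> \<in> borel_measurable borel" and h0: "0 < h0"
  shows "(\<integral>\<^sup>+y\<in>{0..<h0}. (\<Sum>i<n. \<Phi> (lat A h0 y l i)) \<partial>lborel) =
    2 ^ l * (\<integral>\<^sup>+x\<in>{A..<A + real n * (h0 / 2 ^ l)}. \<Phi> x \<partial>lborel)"
proof -
  define h where "h = h0 / 2 ^ l"
  have h: "0 < h" "h0 = real (2 ^ l) * h" using h0 by (auto simp: h_def)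
  define \<psi> where "\<psi> u = (\<Sum>i<n. \<Phi> (A + real i * h + u))" for u
  have [measurable]: "\<psi> \<in> borel_measurable borel" unfolding \<psi>_def by measurable
  have "(\<integral>\<^sup>+y\<in>{0..<h0}. (\<Sum>i<n. \<Phi> (lat A h0 y l i)) \<partial>lborel) = (\<integral>\<^sup>+y\<in>{0..<real (2 ^ l) * h}. \<psi> (rmod y h) \<partial>lborel)"
    unfolding h(2)[symmetric] by (simp add: lat_def \<psi>_def h_def)
  also have "\<dots> = of_nat (2 ^ l) * (\<integral>\<^sup>+u\<in>{0..<h}. \<psi> u \<partial>lborel)" by (rule nn_integral_rmod) (use h in auto)
  also have "(\<integral>\<^sup>+u\<in>{0..<h}. \<psi> u \<partial>lborel) = (\<Sum>i<n. \<integral>\<^sup>+u\<in>{0..<h}. \<Phi> (A + real i * h + u) \<partial>lborel)"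
    unfolding \<psi>_def sum_distrib_right by (rule nn_integral_sum) measurable
  also have "\<dots> = (\<integral>\<^sup>+x\<in>{A..<A + real n * h}. \<Phi> x \<partial>lborel)" using nn_integral_cells[of \<Phi> h A n] h by simp
  finally show ?thesis by (simp add: h_def)
qed

lemma lat_mem:
  assumes "0 < h0" "i < m * 2 ^ L"
  shows "lat A h0 y L i \<in> {A..A + real m * h0}"
proof -
  define h where "h = h0 / 2 ^ L"
  have h: "0 < h" using assms by (simp add: h_def)
  have "real (Suc i) \<le> real (m * 2 ^ L)" using assms by (simp only: of_nat_le_iff Suc_le_eq)
  then have "(real i + 1) * h \<le> real (m * 2 ^ L) * h" using h by (intro mult_right_mono) auto
  also have "\<dots> = real m * h0" by (simp add: h_def)
  finally show ?thesis using rmod_range[OF h, of y] h unfolding lat_def h_def[symmetric] by (auto simp: distrib_right)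
qed

text \<open>On each cell the integral is the length times the value at some intermediate point, and
  the sample point lies in the same cell; uniform continuity then gives a bound independent of the
  offset.\<close>

lemma Riemann_sums_uniform:
  fixes F :: "real \<Rightarrow> real"
  assumes F: "continuous_on {A..A + real m * h0} F" and h0: "0 < h0" and m: "0 < m" and \<eta>: "0 < \<eta>"
  obtains L0 where "\<And>L y. L0 \<le> L \<Longrightarrow>
    \<bar>(h0 / 2 ^ L) * (\<Sum>i<m * 2 ^ L. F (lat A h0 y L i)) - (\<integral>x. indicator {A..A + real m * h0} x * F x \<partial>lborel)\<bar> \<le> \<eta>"
proof -
  define I where "I = {A..A + real m * h0}"
  have AB: "A \<le> A + real m * h0" using h0 by simp
  obtain \<Theta> where \<Theta>: "\<And>x. x \<in> I \<Longrightarrow> (\<Theta> has_vector_derivative F x) (at x within I)"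
    using antiderivative_continuous[OF F] unfolding I_def by blast
  have J: "(\<integral>x. indicator I x * F x \<partial>lborel) = \<Theta> (A + real m * h0) - \<Theta> A"
    using integral_FTC_Icc[OF AB \<Theta>[unfolded I_def] F] by (simp add: I_def mult.commute)
  define \<eta>' where "\<eta>' = \<eta> / (real m * h0)"
  have \<eta>': "0 < \<eta>'" using \<eta> h0 m by (simp add: \<eta>'_def)
  have "uniformly_continuous_on I F" unfolding I_def using F by (intro compact_uniformly_continuous) auto
  then obtain \<delta> where \<delta>: "0 < \<delta>" "\<And>x x'. x \<in> I \<Longrightarrow> x' \<in> I \<Longrightarrow> \<bar>x' - x\<bar> < \<delta> \<Longrightarrow> \<bar>F x' - F x\<bar> < \<eta>'"
    using \<eta>' unfolding uniformly_continuous_on_def dist_real_def by metis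
  have "(\<lambda>L. h0 / 2 ^ L) \<longlonglongrightarrow> 0"
    using tendsto_mult_right_zero[OF LIMSEQ_realpow_zero[of "1 / 2 :: real"], of h0] by (simp add: power_divide)
  from order_tendstoD(2)[OF this \<delta>(1)] obtain L0 where L0: "\<And>L. L0 \<le> L \<Longrightarrow> h0 / 2 ^ L < \<delta>"
    unfolding eventually_sequentially by blast
  show ?thesis
  proof (rule that[of L0])
    fix L y assume "L0 \<le> L"
    define h where "h = h0 / 2 ^ L"
    have h: "0 < h" "h < \<delta>" using h0 L0[OF \<open>L0 \<le> L\<close>] by (auto simp: h_def)
    define N where "N = m * 2 ^ L"
    have Nh: "real N * h = real m * h0" by (simp add: N_def h_def)
    define a where "a i = A + real i * h" for i
    have aI: "a i \<in> I" if "i \<le> N" for i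
    proof -
      have "real i * h \<le> real N * h" using that h by (intro mult_right_mono) auto
      then show ?thesis using h Nh by (auto simp: a_def I_def)
    qed
    have cell: "\<bar>h * F (lat A h0 y L i) - (\<Theta> (a (Suc i)) - \<Theta> (a i))\<bar> \<le> h * \<eta>'" if i: "i < N" for i
    proof -
      have sub: "{a i..a (Suc i)} \<subseteq> I" using aI[of i] aI[of "Suc i"] i by (auto simp: I_def)
      have less: "a i < a (Suc i)" using h by (simp add: a_def distrib_right)
      have "(\<Theta> has_derivative (\<lambda>t. t *\<^sub>R F x)) (at x within {a i..a (Suc i)})" if "a i \<le> x" "x \<le> a (Suc i)" for x
      proof -
        have "x \<in> I" using sub that by auto
        from has_vector_derivative_within_subset[OF \<Theta>[OF this] sub] show ?thesis
          by (simp only: has_vector_derivative_def)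
      qed
      then have "\<exists>\<xi>\<in>{a i<..<a (Suc i)}. \<Theta> (a (Suc i)) - \<Theta> (a i) = (a (Suc i) - a i) *\<^sub>R F \<xi>"
        using mvt_simple[OF less, of \<Theta> "\<lambda>x t. t *\<^sub>R F x"] by auto
      then obtain \<xi> where \<xi>: "a i < \<xi>" "\<xi> < a (Suc i)" "\<Theta> (a (Suc i)) - \<Theta> (a i) = h * F \<xi>"
        by (auto simp: a_def distrib_right)
      have z: "a i \<le> lat A h0 y L i" "lat A h0 y L i < a (Suc i)"
        using rmod_range[OF h(1), of y] by (auto simp: lat_def a_def h_def[symmetric] distrib_right)
      have w: "a (Suc i) - a i = h" by (simp add: a_def distrib_right)
      have "\<bar>lat A h0 y L i - \<xi>\<bar> < \<delta>" using \<xi> z w h by linarith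
      then have "\<bar>F (lat A h0 y L i) - F \<xi>\<bar> < \<eta>'" using \<xi> z sub by (intro \<delta>(2)) auto
      then have "h * \<bar>F (lat A h0 y L i) - F \<xi>\<bar> \<le> h * \<eta>'" using h by (intro mult_left_mono) auto
      then show ?thesis unfolding \<xi>(3) using h by (simp add: abs_mult[symmetric] right_diff_distrib[symmetric] abs_mult)
    qed
    have tele: "(\<Sum>i<N. \<Theta> (a (Suc i)) - \<Theta> (a i)) = \<Theta> (A + real m * h0) - \<Theta> A"
      using sum_lessThan_telescope[of "\<lambda>i. \<Theta> (a i)" N] by (simp add: a_def Nh)
    have "\<bar>h * (\<Sum>i<N. F (lat A h0 y L i)) - (\<integral>x. indicator I x * F x \<partial>lborel)\<bar> =
        \<bar>\<Sum>i<N. h * F (lat A h0 y L i) - (\<Theta> (a (Suc i)) - \<Theta> (a i))\<bar>"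
      unfolding J tele[symmetric] sum_distrib_left sum_subtractf[symmetric] ..
    also have "\<dots> \<le> (\<Sum>i<N. h * \<eta>')" using cell by (intro order_trans[OF sum_abs] sum_mono) auto
    also have "\<dots> = \<eta>" using Nh h0 m by (simp add: \<eta>'_def mult.assoc[symmetric])
    finally show "\<bar>(h0 / 2 ^ L) * (\<Sum>i<m * 2 ^ L. F (lat A h0 y L i)) - (\<integral>x. indicator {A..A + real m * h0} x * F x \<partial>lborel)\<bar> \<le> \<eta>"
      by (simp add: h_def I_def N_def)
  qed
qed

text \<open>For an integrable F the Riemann sums may fail to converge at a given offset. On average
  over the offset they do converge, since by \<open>nn_integral_lattice\<close> the averaged
  distance between the sums of F and of a continuous F' is their L^1 distance.\<close>

lemma Riemann_sums_L1:
  fixes F :: "real \<Rightarrow> real"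
  assumes F [measurable]: "F \<in> borel_measurable borel" and int: "integrable lborel (\<lambda>x. indicator {A..A + real m * h0} x * F x)"
    and h0: "0 < h0" and m: "0 < m"
    and dense: "\<And>\<eta>. 0 < \<eta> \<Longrightarrow> \<exists>F'. F' \<in> borel_measurable borel \<and> continuous_on {A..A + real m * h0} F' \<and>
      (\<integral>\<^sup>+x\<in>{A..A + real m * h0}. ennreal \<bar>F x - F' x\<bar> \<partial>lborel) \<le> ennreal \<eta>"
  defines "J \<equiv> (\<integral>x. indicator {A..A + real m * h0} x * F x \<partial>lborel)"
    and "R \<equiv> \<lambda>L y. (h0 / 2 ^ L) * (\<Sum>i<m * 2 ^ L. F (lat A h0 y L i))"
  shows "(\<lambda>L. \<integral>\<^sup>+y\<in>{0..<h0}. ennreal \<bar>R L y - J\<bar> \<partial>lborel) \<longlonglongrightarrow> 0"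
proof (rule order_tendstoI)
  fix c :: ennreal assume c: "0 < c"
  obtain \<eta>0 where \<eta>0: "0 < \<eta>0" "ennreal \<eta>0 < c"
  proof -
    obtain d where d: "0 < d" "d < c" using Orderings.dense[OF c] by blast
    then obtain r where "d = ennreal r" "0 \<le> r" by (cases d) auto
    then show ?thesis using that[of r] d by simp
  qed
  \<comment> \<open>Three errors of at most h0 times \<eta>: the averaged distance of the Riemann
    sums of F and F', the error of the sums of F', and the distance of the two integrals.\<close>
  define \<eta> where "\<eta> = \<eta>0 / (3 * h0)"
  have \<eta>: "0 < \<eta>" using \<eta>0 h0 by (simp add: \<eta>_def)
  define I where "I = {A..A + real m * h0}"
  obtain F' where F'm [measurable]: "F' \<in> borel_measurable borel" and F'c: "continuous_on I F'"
    and close: "(\<integral>\<^sup>+x\<in>I. ennreal \<bar>F x - F' x\<bar> \<partial>lborel) \<le> ennreal \<eta>"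
    using dense[OF \<eta>] unfolding I_def by blast
  define J' where "J' = (\<integral>x. indicator I x * F' x \<partial>lborel)"
  obtain L0 where L0: "\<And>L y. L0 \<le> L \<Longrightarrow> \<bar>(h0 / 2 ^ L) * (\<Sum>i<m * 2 ^ L. F' (lat A h0 y L i)) - J'\<bar> \<le> \<eta>"
    using Riemann_sums_uniform[OF F'c[unfolded I_def] h0 m \<eta>] unfolding J'_def I_def by blast
  have intF': "integrable lborel (\<lambda>x. indicator I x * F' x)"
    using borel_integrable_atLeastAtMost'[of A "A + real m * h0" F'] F'c unfolding I_def set_integrable_def by simp
  have JJ': "\<bar>J - J'\<bar> \<le> \<eta>"
  proof -
    have "J - J' = (\<integral>x. indicator I x * F x - indicator I x * F' x \<partial>lborel)"
      unfolding J_def J'_def I_def[symmetric] using int intF' by (subst Bochner_Integration.integral_diff) (auto simp: I_def)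
    then have "ennreal \<bar>J - J'\<bar> \<le> (\<integral>\<^sup>+x. ennreal (norm (indicator I x * F x - indicator I x * F' x)) \<partial>lborel)"
      using integral_norm_bound_ennreal[OF Bochner_Integration.integrable_diff[OF int[folded I_def] intF']] by simp
    also have "\<dots> = (\<integral>\<^sup>+x\<in>I. ennreal \<bar>F x - F' x\<bar> \<partial>lborel)"
      by (intro nn_integral_cong) (auto simp: indicator_def)
    also have "\<dots> \<le> ennreal \<eta>" by (rule close)
    finally show ?thesis using \<eta> by (simp add: ennreal_le_iff)
  qed
  have "(\<integral>\<^sup>+y\<in>{0..<h0}. ennreal \<bar>R L y - J\<bar> \<partial>lborel) < c" if L: "L0 \<le> L" for L
  proof -
    define h where "h = h0 / 2 ^ L"
    have h: "0 < h" using h0 by (simp add: h_def)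
    have "(\<integral>\<^sup>+y\<in>{0..<h0}. ennreal \<bar>R L y - J\<bar> \<partial>lborel) \<le>
        (\<integral>\<^sup>+y. ennreal h * ((\<Sum>i<m * 2 ^ L. ennreal \<bar>F (lat A h0 y L i) - F' (lat A h0 y L i)\<bar>) * indicator {0..<h0} y) + ennreal (2 * \<eta>) * indicator {0..<h0} y \<partial>lborel)"
    proof (rule nn_integral_mono)
      fix y
      have "R L y - J = h * (\<Sum>i<m * 2 ^ L. F (lat A h0 y L i) - F' (lat A h0 y L i)) +
          ((h0 / 2 ^ L) * (\<Sum>i<m * 2 ^ L. F' (lat A h0 y L i)) - J') + (J' - J)"
        by (simp add: R_def h_def sum_subtractf right_diff_distrib)
      then have "\<bar>R L y - J\<bar> \<le> \<bar>h * (\<Sum>i<m * 2 ^ L. F (lat A h0 y L i) - F' (lat A h0 y L i))\<bar> + \<eta> + \<eta>"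
        using L0[OF L, of y] JJ' by linarith
      also have "\<bar>h * (\<Sum>i<m * 2 ^ L. F (lat A h0 y L i) - F' (lat A h0 y L i))\<bar> \<le>
          h * (\<Sum>i<m * 2 ^ L. \<bar>F (lat A h0 y L i) - F' (lat A h0 y L i)\<bar>)"
        using h by (simp add: abs_mult mult_left_mono)
      finally have "ennreal \<bar>R L y - J\<bar> \<le> ennreal (h * (\<Sum>i<m * 2 ^ L. \<bar>F (lat A h0 y L i) - F' (lat A h0 y L i)\<bar>) + 2 * \<eta>)"
        by (intro ennreal_leI) simp
      also have "\<dots> = ennreal h * (\<Sum>i<m * 2 ^ L. ennreal \<bar>F (lat A h0 y L i) - F' (lat A h0 y L i)\<bar>) + ennreal (2 * \<eta>)"
        using h \<eta> by (subst ennreal_plus) (auto simp: ennreal_mult' sum_ennreal intro!: mult_nonneg_nonneg sum_nonneg)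
      finally show "ennreal \<bar>R L y - J\<bar> * indicator {0..<h0} y \<le>
          ennreal h * ((\<Sum>i<m * 2 ^ L. ennreal \<bar>F (lat A h0 y L i) - F' (lat A h0 y L i)\<bar>) * indicator {0..<h0} y) + ennreal (2 * \<eta>) * indicator {0..<h0} y"
        by (auto simp: indicator_def)
    qed
    also have "\<dots> = ennreal h * (\<integral>\<^sup>+y\<in>{0..<h0}. (\<Sum>i<m * 2 ^ L. ennreal \<bar>F (lat A h0 y L i) - F' (lat A h0 y L i)\<bar>) \<partial>lborel) + ennreal (2 * \<eta>) * ennreal h0"
      unfolding lat_def using h0
      by (subst nn_integral_add, measurable) (simp add: nn_integral_cmult nn_integral_cmult_indicator)
    also have "(\<integral>\<^sup>+y\<in>{0..<h0}. (\<Sum>i<m * 2 ^ L. ennreal \<bar>F (lat A h0 y L i) - F' (lat A h0 y L i)\<bar>) \<partial>lborel) =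
        2 ^ L * (\<integral>\<^sup>+x\<in>{A..<A + real (m * 2 ^ L) * (h0 / 2 ^ L)}. ennreal \<bar>F x - F' x\<bar> \<partial>lborel)"
      by (rule nn_integral_lattice[of "\<lambda>x. ennreal \<bar>F x - F' x\<bar>"]) (use h0 in auto)
    also have "ennreal h * (2 ^ L * (\<integral>\<^sup>+x\<in>{A..<A + real (m * 2 ^ L) * (h0 / 2 ^ L)}. ennreal \<bar>F x - F' x\<bar> \<partial>lborel)) + ennreal (2 * \<eta>) * ennreal h0
        \<le> ennreal h * (2 ^ L * ennreal \<eta>) + ennreal (2 * \<eta>) * ennreal h0"
    proof -
      have "(\<integral>\<^sup>+x\<in>{A..<A + real (m * 2 ^ L) * (h0 / 2 ^ L)}. ennreal \<bar>F x - F' x\<bar> \<partial>lborel) \<le> ennreal \<eta>"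
        by (rule order_trans[OF _ close]) (auto intro!: nn_integral_mono simp: I_def indicator_def)
      then show ?thesis by (intro add_mono mult_left_mono order_refl) auto
    qed
    also have "ennreal h * (2 ^ L * ennreal \<eta>) + ennreal (2 * \<eta>) * ennreal h0 = ennreal \<eta>0"
    proof -
      have "ennreal h * (2 ^ L * ennreal \<eta>) = ennreal (h0 * \<eta>)"
      proof -
        have "(2 :: ennreal) ^ L = ennreal (2 ^ L)" by (simp add: ennreal_power[symmetric])
        then show ?thesis using h \<eta> by (simp add: h_def ennreal_mult'[symmetric])
      qed
      moreover have "ennreal (2 * \<eta>) * ennreal h0 = ennreal (2 * \<eta> * h0)" using h0 \<eta> by (simp add: ennreal_mult')
      moreover have "ennreal (h0 * \<eta>) + ennreal (2 * \<eta> * h0) = ennreal (h0 * \<eta> + 2 * \<eta> * h0)"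
        using h0 \<eta> by (intro ennreal_plus[symmetric]) auto
      moreover have "h0 * \<eta> + 2 * \<eta> * h0 = \<eta>0" using h0 by (simp add: \<eta>_def)
      ultimately show ?thesis by simp
    qed
    finally show ?thesis using \<eta>0(2) by (rule order_le_less_trans)
  qed
  then show "\<forall>\<^sub>F L in sequentially. (\<integral>\<^sup>+y\<in>{0..<h0}. ennreal \<bar>R L y - J\<bar> \<partial>lborel) < c"
    unfolding eventually_sequentially by blast
qed simp

lemma measurable_fin_diff [measurable]: "f \<in> borel_measurable borel \<Longrightarrow> fin_diff m h f \<in> borel_measurable borel"
proof -
  assume f: "f \<in> borel_measurable borel"
  have "(\<lambda>x. f (x + c)) \<in> borel_measurable borel" for c
    by (rule measurable_compose[OF _ f]) measurable
  then show ?thesis unfolding fin_diff_def[abs_def] by (intro borel_measurable_sum borel_measurable_times) auto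
qed

text \<open>For a suitable offset two things hold: the Riemann sums of f g converge to the integral
  along a subsequence, and the weighted sum of the p-th powers of the differences is less than twice
  the bound on its average. By the second, f is uniformly close to one polynomial on all lattices;
  the Riemann sums of this polynomial times g tend to 0 by orthogonality, so only the distance
  remains.\<close>

lemma difference_functional_bound:
  fixes f g :: "real \<Rightarrow> real" and A h0 \<Gamma> T p \<delta> :: real
  assumes m: "0 < m" and p: "0 < p" and \<delta>: "0 < \<delta>" and h0: "0 < h0"
  defines "I \<equiv> {A..A + real m * h0}"
  assumes f [measurable]: "f \<in> borel_measurable borel" and fint: "integrable lborel (\<lambda>x. indicator I x * f x)"
    and dense: "\<And>\<eta>. 0 < \<eta> \<Longrightarrow> \<exists>v. v \<in> borel_measurable borel \<and> continuous_on I v \<and>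
      (\<integral>\<^sup>+x\<in>I. ennreal \<bar>f x - v x\<bar> \<partial>lborel) \<le> ennreal \<eta>"
    and g [measurable]: "g \<in> borel_measurable borel" and gc: "continuous_on I g" and \<Gamma>: "\<And>x. x \<in> I \<Longrightarrow> \<bar>g x\<bar> \<le> \<Gamma>"
    and orth: "\<And>q. degree q < m \<Longrightarrow> (\<integral>x. indicator I x * (poly q x * g x) \<partial>lborel) = 0"
    and T: "0 < T" and bound: "\<And>L. (\<Sum>l=1..L. ennreal (2 powr (\<delta> * p * real l) * 2 ^ l) *
      (\<integral>\<^sup>+x\<in>{A..A + real m * h0 - real m * (h0 / 2 ^ l)}. ennreal (\<bar>fin_diff m (h0 / 2 ^ l) f x\<bar> powr p) \<partial>lborel)) \<le> ennreal T"
  shows "\<bar>\<integral>x. indicator I x * (f x * g x) \<partial>lborel\<bar> \<le>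
    real m * (2 * (real m * (2 * real m + 1) ^ m * (2 ^ m + 1) ^ (2 * m))) *
      (2 * (1 / (1 - 2 powr (- \<delta>))) powr p) powr (1 / p) * (\<Gamma> * h0 * (T / h0) powr (1 / p))"
proof -
  define C where "C = 2 * (real m * (2 * real m + 1) ^ m * (2 ^ m + 1) ^ (2 * m))"
  define Kc where "Kc = (1 / (1 - 2 powr (- \<delta>))) powr p"
  have C: "0 \<le> C" by (simp add: C_def)
  have \<Gamma>0: "0 \<le> \<Gamma>"
  proof -
    have "A \<in> I" using h0 by (simp add: I_def)
    then show ?thesis using \<Gamma>[of A] by linarith
  qed
  define F where "F x = f x * g x" for x
  define J where "J = (\<integral>x. indicator I x * F x \<partial>lborel)"
  define R where "R L y = (h0 / 2 ^ L) * (\<Sum>i<m * 2 ^ L. F (lat A h0 y L i))" for L y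
  have [measurable]: "F \<in> borel_measurable borel" unfolding F_def by measurable
  have Fint: "integrable lborel (\<lambda>x. indicator I x * F x)"
  proof (rule Bochner_Integration.integrable_bound)
    show "integrable lborel (\<lambda>x. \<Gamma> * (indicator I x * f x))" using fint by simp
    show "(\<lambda>x. indicator I x * F x) \<in> borel_measurable lborel" unfolding I_def by measurable
    show "AE x in lborel. norm (indicator I x * F x) \<le> norm (\<Gamma> * (indicator I x * f x))"
    proof (rule AE_I2)
      fix x show "norm (indicator I x * F x) \<le> norm (\<Gamma> * (indicator I x * f x))"
        using mult_right_mono[OF \<Gamma>[of x], of "\<bar>f x\<bar>"] \<Gamma>0 by (cases "x \<in> I") (auto simp: F_def abs_mult mult.commute)
    qed
  qed
  have L1: "(\<lambda>L. \<integral>\<^sup>+y\<in>{0..<h0}. ennreal \<bar>R L y - J\<bar> \<partial>lborel) \<longlonglongrightarrow> 0"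
    unfolding R_def J_def I_def
  proof (rule Riemann_sums_L1[OF _ Fint[unfolded I_def] h0 m])
    fix \<eta> :: real assume \<eta>: "0 < \<eta>"
    have "0 < \<eta> / (\<Gamma> + 1)" using \<eta> \<Gamma>0 by simp
    from dense[OF this] obtain v where v: "v \<in> borel_measurable borel" "continuous_on I v"
      "(\<integral>\<^sup>+x\<in>I. ennreal \<bar>f x - v x\<bar> \<partial>lborel) \<le> ennreal (\<eta> / (\<Gamma> + 1))" by blast
    note [measurable] = v(1)
    have "(\<integral>\<^sup>+x\<in>I. ennreal \<bar>F x - v x * g x\<bar> \<partial>lborel) \<le> (\<integral>\<^sup>+x. ennreal (\<Gamma> + 1) * (ennreal \<bar>f x - v x\<bar> * indicator I x) \<partial>lborel)"
    proof (rule nn_integral_mono)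
      fix x
      have "\<bar>F x - v x * g x\<bar> \<le> (\<Gamma> + 1) * \<bar>f x - v x\<bar>" if "x \<in> I"
      proof -
        have "F x - v x * g x = g x * (f x - v x)" by (simp add: F_def algebra_simps)
        then show ?thesis
          using mult_right_mono[of "\<bar>g x\<bar>" "\<Gamma> + 1" "\<bar>f x - v x\<bar>"] \<Gamma>[OF that] by (simp add: abs_mult)
      qed
      then show "ennreal \<bar>F x - v x * g x\<bar> * indicator I x \<le> ennreal (\<Gamma> + 1) * (ennreal \<bar>f x - v x\<bar> * indicator I x)"
        using \<Gamma>0 by (cases "x \<in> I") (auto simp: ennreal_mult[symmetric] simp del: ennreal_plus intro!: ennreal_leI)
    qed
    also have "\<dots> = ennreal (\<Gamma> + 1) * (\<integral>\<^sup>+x\<in>I. ennreal \<bar>f x - v x\<bar> \<partial>lborel)"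
      unfolding I_def by (rule nn_integral_cmult) measurable
    also have "\<dots> \<le> ennreal (\<Gamma> + 1) * ennreal (\<eta> / (\<Gamma> + 1))" using v(3) by (intro mult_left_mono) auto
    also have "\<dots> = ennreal \<eta>" using \<Gamma>0 \<eta> by (subst ennreal_mult[symmetric]) auto
    finally show "\<exists>F'. F' \<in> borel_measurable borel \<and> continuous_on {A..A + real m * h0} F' \<and>
        (\<integral>\<^sup>+x\<in>{A..A + real m * h0}. ennreal \<bar>F x - F' x\<bar> \<partial>lborel) \<le> ennreal \<eta>"
      using v gc unfolding I_def[symmetric]
      by (intro exI[of _ "\<lambda>x. v x * g x"] conjI continuous_on_mult) auto
  qed measurable
  \<comment> \<open>The largest difference of a level is bounded through the sum of all p-th powers.
    Averaging this sum over y produces the factor \<open>2 ^ l\<close>, which makes s > 1/p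
    necessary later on. Indices stop at m 2^l - m, so that all nodes of a difference lie in the
    interval.\<close>
  define D where "D l y = (\<Sum>i<m * 2 ^ l - m. \<bar>fin_diff m (h0 / 2 ^ l) f (lat A h0 y l i)\<bar> powr p)" for l y
  define Q where "Q L y = (\<Sum>l=1..L. 2 powr (\<delta> * p * real l) * D l y)" for L y
  have D0: "0 \<le> D l y" for l y unfolding D_def by (intro sum_nonneg) auto
  have Qn: "0 \<le> Q L y" for L y unfolding Q_def using D0 by (intro sum_nonneg mult_nonneg_nonneg) auto
  have Qmono: "Q L y \<le> Q (Suc L) y" for L y unfolding Q_def using D0 by simp
  have Dm [measurable]: "(\<lambda>y. D l y) \<in> borel_measurable borel" for l unfolding D_def lat_def by measurable
  have Qm [measurable]: "(\<lambda>y. Q L y) \<in> borel_measurable borel" for L unfolding Q_def by measurable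
  have intD: "(\<integral>\<^sup>+y\<in>{0..<h0}. ennreal (D l y) \<partial>lborel) \<le>
      ennreal (2 ^ l) * (\<integral>\<^sup>+x\<in>{A..A + real m * h0 - real m * (h0 / 2 ^ l)}. ennreal (\<bar>fin_diff m (h0 / 2 ^ l) f x\<bar> powr p) \<partial>lborel)" for l
  proof -
    have "(\<integral>\<^sup>+y\<in>{0..<h0}. ennreal (D l y) \<partial>lborel) =
        (\<integral>\<^sup>+y\<in>{0..<h0}. (\<Sum>i<m * 2 ^ l - m. ennreal (\<bar>fin_diff m (h0 / 2 ^ l) f (lat A h0 y l i)\<bar> powr p)) \<partial>lborel)"
      unfolding D_def by (simp add: sum_ennreal)
    also have "\<dots> = 2 ^ l * (\<integral>\<^sup>+x\<in>{A..<A + real (m * 2 ^ l - m) * (h0 / 2 ^ l)}. ennreal (\<bar>fin_diff m (h0 / 2 ^ l) f x\<bar> powr p) \<partial>lborel)"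
      by (rule nn_integral_lattice[of "\<lambda>x. ennreal (\<bar>fin_diff m (h0 / 2 ^ l) f x\<bar> powr p)"]) (use h0 in auto)
    also have "real (m * 2 ^ l - m) * (h0 / 2 ^ l) = real m * h0 - real m * (h0 / 2 ^ l)"
    proof -
      have "real (m * 2 ^ l - m) = real m * 2 ^ l - real m" by (simp add: of_nat_diff)
      then show ?thesis by (simp add: left_diff_distrib diff_divide_distrib)
    qed
    also have "2 ^ l * (\<integral>\<^sup>+x\<in>{A..<A + (real m * h0 - real m * (h0 / 2 ^ l))}. ennreal (\<bar>fin_diff m (h0 / 2 ^ l) f x\<bar> powr p) \<partial>lborel) \<le>
       2 ^ l * (\<integral>\<^sup>+x\<in>{A..A + real m * h0 - real m * (h0 / 2 ^ l)}. ennreal (\<bar>fin_diff m (h0 / 2 ^ l) f x\<bar> powr p) \<partial>lborel)"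
      by (intro mult_left_mono nn_integral_mono) (auto simp: indicator_def)
    also have "(2 :: ennreal) ^ l = ennreal (2 ^ l)" by (simp add: ennreal_power[symmetric])
    finally show ?thesis .
  qed
  have intQ: "(\<integral>\<^sup>+y\<in>{0..<h0}. ennreal (Q L y) \<partial>lborel) \<le> ennreal T" for L
  proof -
    have "(\<integral>\<^sup>+y\<in>{0..<h0}. ennreal (Q L y) \<partial>lborel) =
        (\<integral>\<^sup>+y. (\<Sum>l=1..L. ennreal (2 powr (\<delta> * p * real l)) * (ennreal (D l y) * indicator {0..<h0} y)) \<partial>lborel)"
      unfolding Q_def using D0 by (intro nn_integral_cong) (simp add: sum_ennreal[symmetric] ennreal_mult' sum_distrib_right mult.assoc)
    also have "\<dots> = (\<Sum>l=1..L. ennreal (2 powr (\<delta> * p * real l)) * (\<integral>\<^sup>+y\<in>{0..<h0}. ennreal (D l y) \<partial>lborel))"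
      by (subst nn_integral_sum) (auto simp: nn_integral_cmult)
    also have "\<dots> \<le> (\<Sum>l=1..L. ennreal (2 powr (\<delta> * p * real l)) * (ennreal (2 ^ l) *
        (\<integral>\<^sup>+x\<in>{A..A + real m * h0 - real m * (h0 / 2 ^ l)}. ennreal (\<bar>fin_diff m (h0 / 2 ^ l) f x\<bar> powr p) \<partial>lborel)))"
      by (intro sum_mono mult_left_mono intD) auto
    also have "\<dots> \<le> ennreal T"
      using bound[of L] by (simp add: ennreal_mult' mult.assoc)
    finally show ?thesis .
  qed
  \<comment> \<open>The supremum over L, so that one offset serves all levels.\<close>
  define Qs where "Qs y = (SUP L. ennreal (Q L y))" for y
  have [measurable]: "Qs \<in> borel_measurable borel" unfolding Qs_def by measurable
  have intQs: "(\<integral>\<^sup>+y\<in>{0..<h0}. Qs y \<partial>lborel) \<le> ennreal T"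
  proof -
    have inc: "incseq (\<lambda>L y. ennreal (Q L y) * indicator {0..<h0} y)"
      by (intro incseq_SucI le_funI mult_right_mono ennreal_leI Qmono) auto
    have "(\<integral>\<^sup>+y\<in>{0..<h0}. Qs y \<partial>lborel) = (\<integral>\<^sup>+y. (SUP L. ennreal (Q L y) * indicator {0..<h0} y) \<partial>lborel)"
      unfolding Qs_def by (simp add: SUP_mult_right_ennreal)
    also have "\<dots> = (SUP L. \<integral>\<^sup>+y. ennreal (Q L y) * indicator {0..<h0} y \<partial>lborel)"
      by (rule nn_integral_monotone_convergence_SUP[OF inc]) measurable
    also have "\<dots> \<le> ennreal T" by (intro SUP_least intQ)
    finally show ?thesis .
  qed
  \<comment> \<open>Mean convergence gives convergence almost everywhere only along a subsequence.
    Finitely many initial indices are dropped to make the errors integrable.\<close>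
  obtain r where r: "AE y in lborel. y \<in> {0..<h0} \<longrightarrow> (\<lambda>n. R (r n) y) \<longlonglongrightarrow> J" "filterlim r at_top sequentially"
  proof -
    have "\<forall>\<^sub>F L in sequentially. (\<integral>\<^sup>+y\<in>{0..<h0}. ennreal \<bar>R L y - J\<bar> \<partial>lborel) < 1"
      using order_tendstoD(2)[OF L1, of 1] by simp
    then obtain L1' where fin: "\<And>L. L1' \<le> L \<Longrightarrow> (\<integral>\<^sup>+y\<in>{0..<h0}. ennreal \<bar>R L y - J\<bar> \<partial>lborel) < 1"
      unfolding eventually_sequentially by blast
    define u where "u n y = indicator {0..<h0} y * (R (n + L1') y - J)" for n y
    have um: "u n \<in> borel_measurable lborel" for n unfolding u_def R_def lat_def by measurable
    have nu: "(\<integral>\<^sup>+y. ennreal (norm (u n y)) \<partial>lborel) = (\<integral>\<^sup>+y\<in>{0..<h0}. ennreal \<bar>R (n + L1') y - J\<bar> \<partial>lborel)" for n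
      by (intro nn_integral_cong) (auto simp: u_def indicator_def)
    have ui: "integrable lborel (u n)" for n
      using um nu[of n] order_less_trans[OF fin[of "n + L1'"] ennreal_one_less_top] by (intro integrableI_bounded) auto
    have "(\<lambda>n. ennreal (\<integral>y. norm (u n y) \<partial>lborel)) \<longlonglongrightarrow> ennreal 0"
      using LIMSEQ_ignore_initial_segment[OF L1, of L1'] unfolding nu[symmetric]
      by (subst (asm) nn_integral_eq_integral) (auto intro: integrable_norm ui)
    then have "(\<lambda>n. \<integral>y. norm (u n y) \<partial>lborel) \<longlonglongrightarrow> 0"
      by (subst (asm) tendsto_ennreal_iff) auto
    from tendsto_L1_AE_subseq[OF ui this] obtain r' :: "nat \<Rightarrow> nat" where r': "strict_mono r'"
      "AE y in lborel. (\<lambda>n. u (r' n) y) \<longlonglongrightarrow> 0" by blast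
    show ?thesis
    proof (rule that[of "\<lambda>n. r' n + L1'"])
      show "AE y in lborel. y \<in> {0..<h0} \<longrightarrow> (\<lambda>n. R (r' n + L1') y) \<longlonglongrightarrow> J"
        using r'(2)
      proof eventually_elim
        case (elim y)
        show ?case
        proof
          assume "y \<in> {0..<h0}"
          then have "(\<lambda>n. R (r' n + L1') y - J) \<longlonglongrightarrow> 0" using elim by (simp add: u_def)
          then show "(\<lambda>n. R (r' n + L1') y) \<longlonglongrightarrow> J" by (rule LIM_zero_cancel)
        qed
      qed
      show "filterlim (\<lambda>n. r' n + L1') at_top sequentially"
        using filterlim_subseq[OF r'(1)] by (rule filterlim_at_top_mono) auto
    qed
  qed
  \<comment> \<open>Markov's inequality: if Qs were at least twice its average bound T / h0 at
    almost every offset, its integral would exceed T.\<close>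
  obtain y where y: "(\<lambda>n. R (r n) y) \<longlonglongrightarrow> J" "Qs y < ennreal (2 * T / h0)"
  proof (rule ccontr)
    assume "\<not> thesis"
    then have no: "\<And>y. (\<lambda>n. R (r n) y) \<longlonglongrightarrow> J \<Longrightarrow> ennreal (2 * T / h0) \<le> Qs y"
      using that by (meson not_le)
    have "AE y in lborel. ennreal (2 * T / h0) * indicator {0..<h0} y \<le> Qs y * indicator {0..<h0} y"
      using r(1) by eventually_elim (auto simp: indicator_def no)
    then have "(\<integral>\<^sup>+y. ennreal (2 * T / h0) * indicator {0..<h0} y \<partial>lborel) \<le> (\<integral>\<^sup>+y\<in>{0..<h0}. Qs y \<partial>lborel)"
      by (rule nn_integral_mono_AE)
    also have "\<dots> \<le> ennreal T" by (rule intQs)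
    finally have "ennreal (2 * T / h0) * ennreal h0 \<le> ennreal T" using h0 by (simp add: nn_integral_cmult_indicator)
    then have "ennreal (2 * T) \<le> ennreal T" using h0 T by (simp add: ennreal_mult'[symmetric])
    then show False using T by (simp add: ennreal_le_iff)
  qed
  define e where "e l = D l y powr (1 / p)" for l
  have e0: "0 \<le> e l" for l by (simp add: e_def)
  obtain p0 where p0: "degree p0 < m"
    "\<And>L i. i < m * 2 ^ L \<Longrightarrow> \<bar>f (lat A h0 y L i) - poly p0 (lat A h0 y L i)\<bar> \<le> C * (\<Sum>l=1..L. e l)"
    unfolding C_def
  proof (rule dyadic_chain[OF m h0 e0, of f A y])
    fix l i :: nat assume "1 \<le> l" and i: "i + m < m * 2 ^ l"
    have "\<bar>fin_diff m (h0 / 2 ^ l) f (lat A h0 y l i)\<bar> powr p \<le> D l y"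
      unfolding D_def using i by (intro member_le_sum) auto
    then have "(\<bar>fin_diff m (h0 / 2 ^ l) f (lat A h0 y l i)\<bar> powr p) powr (1 / p) \<le> e l"
      unfolding e_def using p by (intro powr_mono2) auto
    then show "\<bar>fin_diff m (h0 / 2 ^ l) f (lat A h0 y l i)\<bar> \<le> e l" using p by (simp add: powr_powr)
  qed (blast intro: that)
  define E where "E = (2 * Kc) powr (1 / p) * (T / h0) powr (1 / p)"
  have sumE: "(\<Sum>l=1..L. e l) \<le> E" for L
  proof -
    have "ennreal (Q L y) \<le> Qs y" unfolding Qs_def by (rule SUP_upper) simp
    then have "ennreal (Q L y) < ennreal (2 * T / h0)" using y(2) by (rule order_le_less_trans)
    then have QL: "Q L y \<le> 2 * T / h0" using Qn[of L y] by (simp add: ennreal_less_iff)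
    have "(\<Sum>l=1..L. e l) powr p \<le> Kc * (\<Sum>l=1..L. 2 powr (\<delta> * p * real l) * e l powr p)"
      unfolding Kc_def by (rule sum_powr_le_weighted[OF p \<delta> e0])
    also have "(\<Sum>l=1..L. 2 powr (\<delta> * p * real l) * e l powr p) = Q L y"
      unfolding Q_def e_def using p D0 by (simp add: powr_powr)
    also have "Kc * Q L y \<le> Kc * (2 * T / h0)" using QL by (intro mult_left_mono) (auto simp: Kc_def)
    finally have "(\<Sum>l=1..L. e l) powr p \<le> 2 * Kc * (T / h0)" by (simp add: mult_ac)
    then have "((\<Sum>l=1..L. e l) powr p) powr (1 / p) \<le> (2 * Kc * (T / h0)) powr (1 / p)"
      using p by (intro powr_mono2) auto
    also have "\<dots> = E" unfolding E_def using T h0 by (subst powr_mult) (auto simp: Kc_def)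
    finally show ?thesis using p e0 by (simp add: powr_powr sum_nonneg)
  qed
  have E0: "0 \<le> E" by (simp add: E_def)
  have Rb: "\<bar>R L y\<bar> \<le> real m * h0 * (C * E * \<Gamma>) + \<bar>(h0 / 2 ^ L) * (\<Sum>i<m * 2 ^ L. poly p0 (lat A h0 y L i) * g (lat A h0 y L i))\<bar>" for L
  proof -
    define h where "h = h0 / 2 ^ L"
    have h: "0 \<le> h" using h0 by (simp add: h_def)
    have "R L y = h * (\<Sum>i<m * 2 ^ L. (f (lat A h0 y L i) - poly p0 (lat A h0 y L i)) * g (lat A h0 y L i)) +
        h * (\<Sum>i<m * 2 ^ L. poly p0 (lat A h0 y L i) * g (lat A h0 y L i))"
      unfolding R_def h_def F_def distrib_left[symmetric] sum.distrib[symmetric] by (simp add: left_diff_distrib)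
    moreover have "\<bar>h * (\<Sum>i<m * 2 ^ L. (f (lat A h0 y L i) - poly p0 (lat A h0 y L i)) * g (lat A h0 y L i))\<bar> \<le>
        h * (\<Sum>i<m * 2 ^ L. C * E * \<Gamma>)"
    proof -
      have "\<bar>\<Sum>i<m * 2 ^ L. (f (lat A h0 y L i) - poly p0 (lat A h0 y L i)) * g (lat A h0 y L i)\<bar> \<le> (\<Sum>i<m * 2 ^ L. C * E * \<Gamma>)"
      proof (rule order_trans[OF sum_abs], rule sum_mono)
        fix i assume "i \<in> {..<m * 2 ^ L}"
        then have i: "i < m * 2 ^ L" by simp
        have "\<bar>f (lat A h0 y L i) - poly p0 (lat A h0 y L i)\<bar> \<le> C * E"
          using p0(2)[OF i] mult_left_mono[OF sumE[of L] C] by linarith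
        moreover have "\<bar>g (lat A h0 y L i)\<bar> \<le> \<Gamma>" using lat_mem[OF h0 i, of A y] by (intro \<Gamma>) (auto simp: I_def)
        ultimately show "\<bar>(f (lat A h0 y L i) - poly p0 (lat A h0 y L i)) * g (lat A h0 y L i)\<bar> \<le> C * E * \<Gamma>"
          unfolding abs_mult using C E0 by (intro mult_mono) auto
      qed
      then show ?thesis using h by (simp add: abs_mult mult_left_mono)
    qed
    moreover have "h * (\<Sum>i<m * 2 ^ L. C * E * \<Gamma>) = real m * h0 * (C * E * \<Gamma>)" by (simp add: h_def)
    moreover have "\<lbrakk>V = X + Y; \<bar>X\<bar> \<le> Z; Z = U\<rbrakk> \<Longrightarrow> \<bar>V\<bar> \<le> U + \<bar>Y\<bar>" for U V X Y Z :: real by linarith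
    ultimately show ?thesis unfolding h_def by blast
  qed
  have poly0: "(\<lambda>L. (h0 / 2 ^ L) * (\<Sum>i<m * 2 ^ L. poly p0 (lat A h0 y L i) * g (lat A h0 y L i))) \<longlonglongrightarrow> 0"
  proof (rule LIMSEQ_I)
    fix \<eta> :: real assume \<eta>: "0 < \<eta>"
    have c: "continuous_on {A..A + real m * h0} (\<lambda>x. poly p0 x * g x)"
      using gc unfolding I_def by (intro continuous_intros)
    have "0 < \<eta> / 2" using \<eta> by simp
    from Riemann_sums_uniform[OF c h0 m this] obtain L0 where L0: "\<And>L y. L0 \<le> L \<Longrightarrow>
      \<bar>(h0 / 2 ^ L) * (\<Sum>i<m * 2 ^ L. poly p0 (lat A h0 y L i) * g (lat A h0 y L i)) - (\<integral>x. indicator I x * (poly p0 x * g x) \<partial>lborel)\<bar> \<le> \<eta> / 2"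
      unfolding I_def by blast
    show "\<exists>L0. \<forall>L\<ge>L0. norm ((h0 / 2 ^ L) * (\<Sum>i<m * 2 ^ L. poly p0 (lat A h0 y L i) * g (lat A h0 y L i)) - 0) < \<eta>"
    proof (intro exI allI impI)
      fix L assume "L0 \<le> L"
      have half: "\<eta> / 2 < \<eta>" using \<eta> by simp
      show "norm ((h0 / 2 ^ L) * (\<Sum>i<m * 2 ^ L. poly p0 (lat A h0 y L i) * g (lat A h0 y L i)) - 0) < \<eta>"
        unfolding diff_0_right real_norm_def
        by (rule order_le_less_trans[OF L0[OF \<open>L0 \<le> L\<close>, of y, unfolded orth[OF p0(1)] diff_0_right] half])
    qed
  qed
  have "\<bar>J\<bar> \<le> real m * h0 * (C * E * \<Gamma>) + \<bar>0\<bar>"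
  proof (rule LIMSEQ_le)
    show "(\<lambda>n. \<bar>R (r n) y\<bar>) \<longlonglongrightarrow> \<bar>J\<bar>" using y(1) by (rule tendsto_rabs)
    show "(\<lambda>n. real m * h0 * (C * E * \<Gamma>) + \<bar>(h0 / 2 ^ r n) * (\<Sum>i<m * 2 ^ r n. poly p0 (lat A h0 y (r n) i) * g (lat A h0 y (r n) i))\<bar>)
        \<longlonglongrightarrow> real m * h0 * (C * E * \<Gamma>) + \<bar>0\<bar>"
      using filterlim_compose[OF poly0 r(2)] by (intro tendsto_add tendsto_const tendsto_rabs)
    show "\<exists>N. \<forall>n\<ge>N. \<bar>R (r n) y\<bar> \<le> real m * h0 * (C * E * \<Gamma>) + \<bar>(h0 / 2 ^ r n) * (\<Sum>i<m * 2 ^ r n. poly p0 (lat A h0 y (r n) i) * g (lat A h0 y (r n) i))\<bar>"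
      using Rb by blast
  qed
  then show ?thesis
    unfolding J_def F_def C_def[symmetric] Kc_def[symmetric] E_def by (simp add: mult_ac)
qed

subsection \<open>Finite differences of functions in Besov balls\<close>

lemma enn_powr_mono: "x \<le> y \<Longrightarrow> 0 < a \<Longrightarrow> enn_powr x a \<le> enn_powr y a"
  unfolding enn_powr_def
  by (auto simp: top_unique less_top[symmetric] intro!: ennreal_leI powr_mono2 enn2real_mono)

lemma enn_powr_ennreal: "0 \<le> x \<Longrightarrow> enn_powr (ennreal x) a = ennreal (x powr a)"
  by (simp add: enn_powr_def)

lemma enn_powr_le_imp:
  assumes "enn_powr x (1 / a) \<le> ennreal b" "0 < a" "0 \<le> b"
  shows "x \<le> ennreal (b powr a)"
proof (cases x)
  case (real r)
  then have "r powr (1 / a) \<le> b" using assms by (simp add: enn_powr_ennreal ennreal_le_iff)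
  then have "(r powr (1 / a)) powr a \<le> b powr a" using assms by (intro powr_mono2) auto
  then show ?thesis using real assms by (simp add: powr_powr ennreal_leI)
qed (use assms in \<open>simp add: enn_powr_def top_unique\<close>)

lemma enn_powr_le_imp':
  assumes "enn_powr x a \<le> ennreal b" "0 < a" "0 \<le> b"
  shows "x \<le> ennreal (b powr (1 / a))"
  using enn_powr_le_imp[of x "1 / a" b] assms by simp

lemma modulus_mono: "t \<le> t' \<Longrightarrow> modulus m f p t \<le> modulus m f p t'"
  unfolding modulus_def by (intro SUP_subset_mono) auto

lemma ennreal_powr_cancel:
  assumes h: "0 < h" and le: "ennreal (h powr (- s)) * x \<le> ennreal b"
  shows "x \<le> ennreal (b * h powr s)"
proof -
  have "x = ennreal (h powr s) * (ennreal (h powr (- s)) * x)"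
    using h by (simp add: mult.assoc[symmetric] ennreal_mult'[symmetric] powr_add[symmetric])
  also have "\<dots> \<le> ennreal (h powr s) * ennreal b" using le by (intro mult_left_mono) auto
  also have "\<dots> = ennreal (b * h powr s)" by (simp add: ennreal_mult'' mult.commute)
  finally show ?thesis .
qed

text \<open>The embedding into the space with q = \<infinity>. For finite q the integral is
  restricted to [h, 2 h], where the modulus is at least its value at h, the weight at least (2
  h)^(-s), and 1 / t at least 1 / (2 h).\<close>

lemma besov_ball_modulus:
  assumes q: "0 < q" and s: "0 < s" and M: "0 < M"
  obtains K where "0 < K"
    "\<And>f h. f \<in> besov_ball s p q M \<Longrightarrow> 0 < h \<Longrightarrow> modulus (nat \<lfloor>s\<rfloor> + 1) f p h \<le> ennreal (K * h powr s)"
proof (cases "q = \<infinity>")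
  case True
  show ?thesis
  proof (rule that[OF M])
    fix f h assume f: "f \<in> besov_ball s p q M" and h: "(0::real) < h"
    have "ennreal (h powr (- s)) * modulus (nat \<lfloor>s\<rfloor> + 1) f p h \<le> besov_seminorm s p q f"
      using True h by (auto simp: besov_seminorm_def Let_def intro: SUP_upper2[of h])
    also have "\<dots> \<le> besov_norm s p q f" by (simp add: besov_norm_def)
    also have "\<dots> \<le> ennreal M" using f by (simp add: besov_ball_def)
    finally show "modulus (nat \<lfloor>s\<rfloor> + 1) f p h \<le> ennreal (M * h powr s)" by (rule ennreal_powr_cancel[OF h])
  qed
next
  case False
  define qr where "qr = enn2real q"
  have qr: "0 < qr" using False q by (simp add: qr_def enn2real_positive_iff less_top)
  define K where "K = (2 * M powr qr) powr (1 / qr) * 2 powr s"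
  show ?thesis
  proof (rule that[of K])
    show "0 < K" using M by (simp add: K_def)
    fix f h assume f: "f \<in> besov_ball s p q M" and h: "(0::real) < h"
    define w where "w t = ennreal (t powr (- s)) * modulus (nat \<lfloor>s\<rfloor> + 1) f p t" for t
    define c where "c = ennreal ((2 * h) powr (- s)) * modulus (nat \<lfloor>s\<rfloor> + 1) f p h"
    have cw: "c \<le> w t" if "t \<in> {h..2 * h}" for t
      unfolding c_def w_def using that h s
      by (intro mult_mono modulus_mono ennreal_leI powr_mono2') auto
    have "besov_seminorm s p q f \<le> besov_norm s p q f" by (simp add: besov_norm_def)
    also have "\<dots> \<le> ennreal M" using f by (simp add: besov_ball_def)
    finally have "enn_powr (\<integral>\<^sup>+t\<in>{0<..}. enn_powr (w t) qr * ennreal (1 / t) \<partial>lborel) (1 / qr) \<le> ennreal M"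
      using False by (simp add: besov_seminorm_def Let_def w_def qr_def)
    then have X: "(\<integral>\<^sup>+t\<in>{0<..}. enn_powr (w t) qr * ennreal (1 / t) \<partial>lborel) \<le> ennreal (M powr qr)"
      using qr M by (intro enn_powr_le_imp) auto
    have "enn_powr c qr * ennreal (1 / 2) = enn_powr c qr * ennreal (1 / (2 * h)) * ennreal h"
      using h by (simp add: mult.assoc ennreal_mult'[symmetric])
    also have "\<dots> = (\<integral>\<^sup>+t\<in>{h..2 * h}. enn_powr c qr * ennreal (1 / (2 * h)) \<partial>lborel)"
      using h by (simp add: nn_integral_cmult_indicator)
    also have "\<dots> \<le> (\<integral>\<^sup>+t\<in>{0<..}. enn_powr (w t) qr * ennreal (1 / t) \<partial>lborel)"
    proof (rule nn_integral_mono)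
      fix t
      have "enn_powr c qr * ennreal (1 / (2 * h)) \<le> enn_powr (w t) qr * ennreal (1 / t)" if "t \<in> {h..2 * h}"
        using cw[OF that] that h qr by (intro mult_mono enn_powr_mono ennreal_leI divide_left_mono) auto
      then show "enn_powr c qr * ennreal (1 / (2 * h)) * indicator {h..2 * h} t \<le> enn_powr (w t) qr * ennreal (1 / t) * indicator {0<..} t"
        using h by (auto simp: indicator_def)
    qed
    finally have "enn_powr c qr * ennreal (1 / 2) \<le> ennreal (M powr qr)" using X by (rule order_trans)
    then have "ennreal 2 * (enn_powr c qr * ennreal (1 / 2)) \<le> ennreal 2 * ennreal (M powr qr)" by (intro mult_left_mono) auto
    moreover have "ennreal 2 * (enn_powr c qr * ennreal (1 / 2)) = enn_powr c qr * (ennreal 2 * ennreal (1 / 2))"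
      by (simp only: mult_ac)
    moreover have "ennreal 2 * ennreal (1 / 2) = 1" by (subst ennreal_mult[symmetric]) auto
    moreover have "ennreal 2 * ennreal (M powr qr) = ennreal (2 * M powr qr)" by (rule ennreal_mult[symmetric]) auto
    ultimately have "enn_powr c qr \<le> ennreal (2 * M powr qr)" by simp
    then have "c \<le> ennreal ((2 * M powr qr) powr (1 / qr))" using qr by (intro enn_powr_le_imp') auto
    then have "modulus (nat \<lfloor>s\<rfloor> + 1) f p h \<le> ennreal ((2 * M powr qr) powr (1 / qr) * (2 * h) powr s)"
      unfolding c_def using h by (intro ennreal_powr_cancel) auto
    then show "modulus (nat \<lfloor>s\<rfloor> + 1) f p h \<le> ennreal (K * h powr s)"
      using h by (simp add: K_def powr_mult mult.assoc)
  qed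
qed

text \<open>The case \<open>p = \<infinity>\<close> is reduced to a finite exponent.\<close>
lemma besov_ball_differences:
  assumes p: "0 < p" "inverse p < ennreal s" and q: "0 < q" and M: "0 < M"
  obtains p' K where "0 < p'" "1 / p' < s" "0 < K"
    "\<And>f h. f \<in> besov_ball s p q M \<Longrightarrow> 0 < h \<Longrightarrow>
      (\<integral>\<^sup>+x\<in>{0..1 - real (nat \<lfloor>s\<rfloor> + 1) * h}. ennreal (\<bar>fin_diff (nat \<lfloor>s\<rfloor> + 1) h f x\<bar> powr p') \<partial>lborel) \<le>
        ennreal ((K * h powr s) powr p')"
proof -
  \<comment> \<open>\<open>ennreal\<close> maps nonpositive reals to 0, so the strict inequality
    forces s to be positive.\<close>
  have s: "0 < s" using p(2) by (metis ennreal_eq_0_iff linorder_not_le not_less_zero)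
  obtain K where K: "0 < K"
    "\<And>f h. f \<in> besov_ball s p q M \<Longrightarrow> 0 < h \<Longrightarrow> modulus (nat \<lfloor>s\<rfloor> + 1) f p h \<le> ennreal (K * h powr s)"
    by (rule besov_ball_modulus[OF q s M, of p]) blast
  define m where "m = nat \<lfloor>s\<rfloor> + 1"
  have Lp: "Lp_norm p {0..1 - real m * h} (fin_diff m h f) \<le> ennreal (K * h powr s)"
    if "f \<in> besov_ball s p q M" "0 < h" for f h
  proof -
    have "Lp_norm p {0..1 - real m * h} (fin_diff m h f) \<le> modulus m f p h"
      unfolding modulus_def using that by (intro SUP_upper) auto
    also have "\<dots> \<le> ennreal (K * h powr s)" unfolding m_def by (rule K(2)[OF that])
    finally show ?thesis .
  qed
  show ?thesis
  proof (cases "p = \<infinity>")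
    case False
    define p' where "p' = enn2real p"
    have p': "0 < p'" "p = ennreal p'" using False p by (auto simp: p'_def enn2real_positive_iff less_top)
    have "inverse p = ennreal (1 / p')" using p' by (simp add: inverse_ennreal divide_inverse)
    then have "1 / p' < s" using p(2) p'(1) by (simp add: ennreal_less_iff)
    then show ?thesis
    proof (rule that[OF p'(1) _ K(1)])
      fix f h assume fh: "f \<in> besov_ball s p q M" "(0::real) < h"
      have "enn_powr (\<integral>\<^sup>+x\<in>{0..1 - real m * h}. ennreal (\<bar>fin_diff m h f x\<bar> powr p') \<partial>lborel) (1 / p') \<le> ennreal (K * h powr s)"
        using Lp[OF fh] False by (simp add: Lp_norm_def p'_def)
      then show "(\<integral>\<^sup>+x\<in>{0..1 - real (nat \<lfloor>s\<rfloor> + 1) * h}. ennreal (\<bar>fin_diff (nat \<lfloor>s\<rfloor> + 1) h f x\<bar> powr p') \<partial>lborel) \<le>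
          ennreal ((K * h powr s) powr p')"
        unfolding m_def[symmetric] using p' K by (intro enn_powr_le_imp) auto
    qed
  next
    case True
    \<comment> \<open>Any finite exponent above 1 / s would serve: the interval has length at most
      1, so the essential supremum bounds the mean of the p'-th power.\<close>
    define p' where "p' = 2 / s"
    have p': "0 < p'" "1 / p' < s" using s by (auto simp: p'_def)
    then show ?thesis
    proof (rule that[OF _ _ K(1)])
      fix f h assume fh: "f \<in> besov_ball s p q M" "(0::real) < h"
      define A where "A = {0..1 - real m * h}"
      have "AE x in restrict_space lborel A. ennreal \<bar>fin_diff m h f x\<bar> \<le> esssup (restrict_space lborel A) (\<lambda>x. ennreal \<bar>fin_diff m h f x\<bar>)"
        by (rule esssup_AE)
      moreover have "esssup (restrict_space lborel A) (\<lambda>x. ennreal \<bar>fin_diff m h f x\<bar>) \<le> ennreal (K * h powr s)"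
        using Lp[OF fh] True by (simp add: Lp_norm_def A_def)
      ultimately have "AE x in restrict_space lborel A. ennreal \<bar>fin_diff m h f x\<bar> \<le> ennreal (K * h powr s)"
        by (auto elim: eventually_mono order_trans)
      then have "AE x in lborel. x \<in> A \<longrightarrow> ennreal \<bar>fin_diff m h f x\<bar> \<le> ennreal (K * h powr s)"
        by (subst (asm) AE_restrict_space_iff) (auto simp: A_def)
      then have "AE x in lborel. ennreal (\<bar>fin_diff m h f x\<bar> powr p') * indicator A x \<le> ennreal ((K * h powr s) powr p') * indicator A x"
      proof eventually_elim
        case (elim x)
        then show ?case using K fh p' by (auto simp: indicator_def ennreal_le_iff intro!: ennreal_leI powr_mono2)
      qed
      then have "(\<integral>\<^sup>+x\<in>A. ennreal (\<bar>fin_diff m h f x\<bar> powr p') \<partial>lborel) \<le> (\<integral>\<^sup>+x. ennreal ((K * h powr s) powr p') * indicator A x \<partial>lborel)"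
        by (rule nn_integral_mono_AE)
      also have "\<dots> = ennreal ((K * h powr s) powr p') * emeasure lborel A"
        by (rule nn_integral_cmult_indicator) (simp add: A_def)
      also have "\<dots> \<le> ennreal ((K * h powr s) powr p') * 1"
      proof (rule mult_left_mono)
        have "emeasure lborel A \<le> emeasure lborel {0..1::real}" using fh by (intro emeasure_mono) (auto simp: A_def)
        then show "emeasure lborel A \<le> 1" by simp
      qed simp
      finally show "(\<integral>\<^sup>+x\<in>{0..1 - real (nat \<lfloor>s\<rfloor> + 1) * h}. ennreal (\<bar>fin_diff (nat \<lfloor>s\<rfloor> + 1) h f x\<bar> powr p') \<partial>lborel) \<le>
          ennreal ((K * h powr s) powr p')"
        by (simp add: A_def m_def)
    qed
  qed
qed

section \<open>Finite orthonormal expansions\<close>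

lemma inner_unit_diff_lincomb:
  assumes A: "finite A" and e: "\<And>i. i \<in> A \<Longrightarrow> e i \<in> L2_unit"
    and on: "\<And>i k. i \<in> A \<Longrightarrow> k \<in> A \<Longrightarrow> inner_unit (e i) (e k) = (if i = k then 1 else 0)"
    and f: "f \<in> L2_unit"
  shows "inner_unit (\<lambda>t. f t - (\<Sum>i\<in>A. c i * e i t)) (\<lambda>t. f t - (\<Sum>i\<in>A. c i * e i t)) =
    inner_unit f f - (\<Sum>i\<in>A. (inner_unit f (e i))\<^sup>2) + (\<Sum>i\<in>A. (c i - inner_unit f (e i))\<^sup>2)"
proof -
  define v where "v t = (\<Sum>i\<in>A. c i * e i t)" for t
  have v: "v \<in> L2_unit" unfolding v_def[abs_def] using e by (rule L2_unit_lincomb)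
  have vl: "inner_unit v h = (\<Sum>i\<in>A. c i * inner_unit (e i) h)" if "h \<in> L2_unit" for h
    unfolding v_def[abs_def] using e that by (intro inner_unit_lincomb_left)
  have ev: "inner_unit (e k) v = c k" if k: "k \<in> A" for k
  proof -
    have "inner_unit (e k) v = (\<Sum>i\<in>A. c i * inner_unit (e i) (e k))"
      unfolding inner_unit_commute[of "e k"] by (rule vl[OF e[OF k]])
    also have "\<dots> = (\<Sum>i\<in>A. if i = k then c i else 0)" using on k by (intro sum.cong) auto
    finally show ?thesis using A k by simp
  qed
  have vv: "inner_unit v v = (\<Sum>i\<in>A. (c i)\<^sup>2)" unfolding vl[OF v] using ev by (simp add: power2_eq_square)
  have fv: "inner_unit f v = (\<Sum>i\<in>A. c i * inner_unit f (e i))"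
    unfolding inner_unit_commute[of f] by (rule vl[OF f])
  have "inner_unit (\<lambda>t. f t - v t) (\<lambda>t. f t - v t) = inner_unit f f - 2 * (\<Sum>i\<in>A. c i * inner_unit f (e i)) + (\<Sum>i\<in>A. (c i)\<^sup>2)"
    using inner_unit_diff_square[OF f v, of 1] by (simp add: vv fv)
  also have "\<dots> = inner_unit f f - (\<Sum>i\<in>A. (inner_unit f (e i))\<^sup>2) + (\<Sum>i\<in>A. (c i - inner_unit f (e i))\<^sup>2)"
    by (simp add: power2_diff sum.distrib sum_subtractf sum_distrib_left mult.assoc)
  finally show ?thesis by (simp add: v_def)
qed

lemma norm_unit_lincomb:
  assumes A: "finite A" and e: "\<And>i. i \<in> A \<Longrightarrow> e i \<in> L2_unit"
    and on: "\<And>i k. i \<in> A \<Longrightarrow> k \<in> A \<Longrightarrow> inner_unit (e i) (e k) = (if i = k then 1 else 0)"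
  shows "(norm_unit (\<lambda>t. \<Sum>i\<in>A. c i * e i t))\<^sup>2 = (\<Sum>i\<in>A. (c i)\<^sup>2)"
proof -
  have z: "(\<lambda>_. 0) \<in> L2_unit" by (simp add: L2_unit_iff)
  have "inner_unit (\<lambda>t. 0 - (\<Sum>i\<in>A. (- c i) * e i t)) (\<lambda>t. 0 - (\<Sum>i\<in>A. (- c i) * e i t)) = (\<Sum>i\<in>A. (c i)\<^sup>2)"
    using inner_unit_diff_lincomb[OF A e on z, of "\<lambda>i. - c i"] by (simp add: inner_unit_eq)
  then show ?thesis by (simp add: norm_unit_sq sum_negf)
qed

lemma norm_unit_projection_le:
  assumes A: "finite A" and e: "\<And>i. i \<in> A \<Longrightarrow> e i \<in> L2_unit"
    and on: "\<And>i k. i \<in> A \<Longrightarrow> k \<in> A \<Longrightarrow> inner_unit (e i) (e k) = (if i = k then 1 else 0)"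
    and f: "f \<in> L2_unit"
  shows "norm_unit (\<lambda>t. f t - (\<Sum>i\<in>A. inner_unit f (e i) * e i t)) \<le> norm_unit (\<lambda>t. f t - (\<Sum>i\<in>A. c i * e i t))"
  unfolding norm_unit_def
  by (rule real_sqrt_le_mono) (simp add: inner_unit_diff_lincomb[OF A e on f] sum_nonneg)

lemma norm_unit_cong: "(\<And>t. t \<in> {0..1} \<Longrightarrow> f t = g t) \<Longrightarrow> norm_unit f = norm_unit g"
proof -
  assume "\<And>t. t \<in> {0..1} \<Longrightarrow> f t = g t"
  then have "inner_unit f f = inner_unit g g" by (intro inner_unit_cong)
  then show ?thesis by (simp add: norm_unit_def)
qed

subsection \<open>Compactly supported continuous functions\<close>

definition cc_fun :: "(real \<Rightarrow> real) \<Rightarrow> bool" where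
  "cc_fun g \<longleftrightarrow> continuous_on UNIV g \<and> (\<exists>K. \<forall>x. K < \<bar>x\<bar> \<longrightarrow> g x = 0)"

lemma cc_fun_bounded: "cc_fun g \<Longrightarrow> \<exists>\<Gamma>. \<forall>x. \<bar>g x\<bar> \<le> \<Gamma>"
proof -
  assume g: "cc_fun g"
  then obtain K where K: "\<And>x. K < \<bar>x\<bar> \<Longrightarrow> g x = 0" by (auto simp: cc_fun_def)
  have "continuous_on {-K..K} g" using g by (auto simp: cc_fun_def intro: continuous_on_subset)
  then have "bounded (g ` {-K..K})" by (intro compact_imp_bounded compact_continuous_image) auto
  then obtain B where B: "\<And>x. x \<in> {-K..K} \<Longrightarrow> \<bar>g x\<bar> \<le> B" unfolding bounded_iff real_norm_def by blast
  have "\<bar>g x\<bar> \<le> max B 0" for x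
  proof (cases "K < \<bar>x\<bar>")
    case True
    then show ?thesis using K[of x] by simp
  next
    case False
    then have "x \<in> {-K..K}" by auto
    from B[OF this] show ?thesis by linarith
  qed
  then show ?thesis by blast
qed

lemma cc_fun_lincomb_affine:
  assumes S: "finite S" and g: "cc_fun g" and \<rho>: "\<rho> \<noteq> 0"
  shows "cc_fun (\<lambda>x. \<Sum>m\<in>S. c m * g (\<rho> * x - of_int m))"
proof -
  obtain K where K: "\<And>x. K < \<bar>x\<bar> \<Longrightarrow> g x = 0" using g by (auto simp: cc_fun_def)
  have "continuous_on UNIV (\<lambda>x. g (\<rho> * x - of_int m))" for m :: int
  proof -
    have "continuous_on UNIV g" using g by (simp add: cc_fun_def)
    moreover have "continuous_on UNIV (\<lambda>x. \<rho> * x - of_int m)" by (intro continuous_intros)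
    ultimately show ?thesis by (rule continuous_on_compose2) simp
  qed
  then have "continuous_on UNIV (\<lambda>x. \<Sum>m\<in>S. c m * g (\<rho> * x - of_int m))"
    by (intro continuous_on_sum continuous_on_mult continuous_on_const)
  moreover have "\<exists>K. \<forall>x. K < \<bar>x\<bar> \<longrightarrow> (\<Sum>m\<in>S. c m * g (\<rho> * x - of_int m)) = 0"
  proof (intro exI allI impI sum.neutral ballI)
    fix x and m assume x: "(K + (\<Sum>m\<in>S. \<bar>of_int m :: real\<bar>)) / \<bar>\<rho>\<bar> < \<bar>x\<bar>" and m: "m \<in> S"
    have "K + (\<Sum>m\<in>S. \<bar>of_int m :: real\<bar>) < \<bar>\<rho> * x\<bar>" using x \<rho> by (simp add: abs_mult divide_less_eq mult.commute)
    moreover have "\<bar>of_int m :: real\<bar> \<le> (\<Sum>m\<in>S. \<bar>of_int m :: real\<bar>)" using m S by (intro member_le_sum) auto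
    ultimately have "K < \<bar>\<rho> * x - of_int m\<bar>" by linarith
    then show "c m * g (\<rho> * x - of_int m) = 0" using K by simp
  qed
  ultimately show ?thesis by (simp add: cc_fun_def)
qed

lemma cc_fun_edge: "cc_fun \<phi> \<Longrightarrow> \<rho> \<noteq> 0 \<Longrightarrow> e \<in> edge_functions \<phi> \<rho> \<Longrightarrow> cc_fun e"
  unfolding edge_functions_def using cc_fun_lincomb_affine by blast

lemma cont_diff_continuous: "cont_diff r g \<Longrightarrow> continuous_on UNIV g"
proof -
  assume "cont_diff r g"
  then obtain D where D: "D 0 = g" "\<And>i x. i < r \<Longrightarrow> (D i has_real_derivative D (Suc i) x) (at x)" "continuous_on UNIV (D r)"
    unfolding cont_diff_def by blast
  show ?thesis
  proof (cases r)
    case (Suc r')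
    then have "(g has_real_derivative D 1 x) (at x)" for x using D(2)[of 0 x] D(1) by simp
    then show ?thesis by (intro continuous_at_imp_continuous_on ballI DERIV_isCont)
  qed (use D in simp)
qed

text \<open>Collects what is used about the shape of the basis functions: size, localization around
  a centre, and bounded overlap of the functions of one level. Edge functions get the end points 0
  and 2^j as centres whatever their index; this is harmless because their number a + b, the value of
  n0, is the same on all levels.\<close>

lemma boundary_adapted_bounds:
  assumes ba: "boundary_adapted j0 N g EL ER G" and g: "cc_fun g"
    and E: "\<And>e. e \<in> EL \<Longrightarrow> cc_fun e" "\<And>e. e \<in> ER \<Longrightarrow> cc_fun e"
  obtains \<Gamma> K0 :: real and n0 :: nat and u0 :: real and ctr :: "nat \<Rightarrow> nat \<Rightarrow> real" where
    "0 \<le> \<Gamma>" "1 \<le> K0" "0 \<le> u0"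
    "\<And>j k. j0 \<le> j \<Longrightarrow> k < N j \<Longrightarrow> continuous_on {0..1} (G j k)"
    "\<And>j k t. j0 \<le> j \<Longrightarrow> k < N j \<Longrightarrow> t \<in> {0..1} \<Longrightarrow> \<bar>G j k t\<bar> \<le> \<Gamma> * 2 powr (real j / 2)"
    "\<And>j k t. j0 \<le> j \<Longrightarrow> k < N j \<Longrightarrow> t \<in> {0..1} \<Longrightarrow> G j k t \<noteq> 0 \<Longrightarrow> \<bar>2 ^ j * t - ctr j k\<bar> \<le> K0"
    "\<And>j k. j0 \<le> j \<Longrightarrow> k < N j \<Longrightarrow> - u0 \<le> ctr j k \<and> ctr j k \<le> max (2 ^ j) (real (N j)) + u0"
    "\<And>j x X. j0 \<le> j \<Longrightarrow> 0 \<le> X \<Longrightarrow> real (card {k\<in>{..<N j}. \<bar>x - ctr j k\<bar> \<le> X}) \<le> real n0 + 2 * X + 1"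
proof -
  obtain a b :: nat and u :: int and gl gr where
    gl: "\<And>i. i < a \<Longrightarrow> gl i \<in> EL" and gr: "\<And>i. i < b \<Longrightarrow> gr i \<in> ER" and
    ab: "\<And>j. j0 \<le> j \<Longrightarrow> a + b \<le> N j" and
    G: "\<And>j k t. j0 \<le> j \<Longrightarrow> k < N j \<Longrightarrow> t \<in> {0..1} \<Longrightarrow> G j k t = 2 powr (real j / 2) *
              (if k < a then gl k (2 ^ j * t)
               else if k < N j - b then g (2 ^ j * t - (real k + of_int u))
               else gr (N j - 1 - k) (2 ^ j * (1 - t)))"
    using ba unfolding boundary_adapted_def by blast
  \<comment> \<open>Only finitely many profiles occur over all levels, which makes the constants
    independent of j.\<close>
  define Fam where "Fam = insert g (gl ` {..<a} \<union> gr ` {..<b})"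
  have Fam: "finite Fam" "\<And>e. e \<in> Fam \<Longrightarrow> cc_fun e" using g E gl gr by (auto simp: Fam_def)
  have "\<forall>e\<in>Fam. \<exists>K. \<forall>x. K < \<bar>x\<bar> \<longrightarrow> e x = 0" using Fam(2) by (auto simp: cc_fun_def)
  then obtain Ke where Ke: "\<And>e x. e \<in> Fam \<Longrightarrow> Ke e < \<bar>x\<bar> \<Longrightarrow> e x = 0" by metis
  have "\<forall>e\<in>Fam. \<exists>\<Gamma>. \<forall>x. \<bar>e x\<bar> \<le> \<Gamma>" using Fam(2) cc_fun_bounded by blast
  then obtain \<Gamma>e where \<Gamma>e: "\<And>e x. e \<in> Fam \<Longrightarrow> \<bar>e x\<bar> \<le> \<Gamma>e e" by metis
  define K0 where "K0 = 1 + (\<Sum>e\<in>Fam. \<bar>Ke e\<bar>)"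
  define \<Gamma> where "\<Gamma> = (\<Sum>e\<in>Fam. \<bar>\<Gamma>e e\<bar>)"
  have K0: "K0 < \<bar>x\<bar> \<Longrightarrow> e x = 0" if e: "e \<in> Fam" for e x
  proof -
    assume x: "K0 < \<bar>x\<bar>"
    have "\<bar>Ke e\<bar> \<le> (\<Sum>e\<in>Fam. \<bar>Ke e\<bar>)" using e Fam(1) by (intro member_le_sum) auto
    then show "e x = 0" using x by (intro Ke[OF e]) (simp add: K0_def)
  qed
  have \<Gamma>: "\<bar>e x\<bar> \<le> \<Gamma>" if e: "e \<in> Fam" for e x
  proof -
    have "\<bar>\<Gamma>e e\<bar> \<le> \<Gamma>" unfolding \<Gamma>_def using e Fam(1) by (intro member_le_sum) auto
    then show ?thesis using \<Gamma>e[OF e, of x] by linarith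
  qed
  define ctr where "ctr j k = (if k < a then 0 else if k < N j - b then real k + of_int u else 2 ^ j)" for j k
  define e where "e j k = (if k < a then gl k else if k < N j - b then g else gr (N j - 1 - k))" for j k
  define y where "y j k t = (if k < a then 2 ^ j * t else if k < N j - b then 2 ^ j * t - (real k + of_int u) else 2 ^ j * (1 - t))" for j k t
  have eF: "e j k \<in> Fam" if "j0 \<le> j" "k < N j" for j k
    using that ab[OF that(1)] by (auto simp: e_def Fam_def)
  have Ge: "G j k t = 2 powr (real j / 2) * e j k (y j k t)" if "j0 \<le> j" "k < N j" "t \<in> {0..1}" for j k t
    using G[OF that] by (auto simp: e_def y_def)
  show ?thesis
  proof (rule that[of \<Gamma> K0 "\<bar>of_int u\<bar>" ctr "a + b"])
    show "0 \<le> \<Gamma>" "1 \<le> K0" by (auto simp: \<Gamma>_def K0_def intro!: sum_nonneg)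
    show "0 \<le> \<bar>real_of_int u\<bar>" by simp
  next
    fix j k assume jk: "j0 \<le> j" "k < N j"
    have "continuous_on UNIV (e j k)" using Fam(2)[OF eF[OF jk]] by (simp add: cc_fun_def)
    moreover have "continuous_on {0..1} (y j k)"
      by (cases "k < a"; cases "k < N j - b") (auto simp: y_def[abs_def] intro!: continuous_intros)
    ultimately have "continuous_on {0..1} (\<lambda>t. e j k (y j k t))" by (rule continuous_on_compose2) simp
    then have "continuous_on {0..1} (\<lambda>t. 2 powr (real j / 2) * e j k (y j k t))"
      by (intro continuous_on_mult continuous_on_const)
    then show "continuous_on {0..1} (G j k)"
      using continuous_on_cong[OF refl, of "{0..1}" "G j k" "\<lambda>t. 2 powr (real j / 2) * e j k (y j k t)"] Ge[OF jk] by blast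
  next
    fix j k t assume jk: "j0 \<le> j" "k < N j" "t \<in> {0..1::real}"
    show "\<bar>G j k t\<bar> \<le> \<Gamma> * 2 powr (real j / 2)"
      using \<Gamma>[OF eF[OF jk(1,2)], of "y j k t"] unfolding Ge[OF jk] by (simp add: abs_mult mult.commute)
    show "\<bar>2 ^ j * t - ctr j k\<bar> \<le> K0" if "G j k t \<noteq> 0"
    proof -
      have "e j k (y j k t) \<noteq> 0" using that Ge[OF jk] by auto
      then have "\<bar>y j k t\<bar> \<le> K0" using K0[OF eF[OF jk(1,2)], of "y j k t"] by linarith
      then show ?thesis by (auto simp: y_def ctr_def right_diff_distrib abs_minus_commute split: if_splits)
    qed
  next
    fix j k assume jk: "j0 \<le> j" "k < N j"
    have 1: "real k \<le> max (2 ^ j) (real (N j))" using jk by (simp add: le_max_iff_disj)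
    have 2: "(2::real) ^ j \<le> max (2 ^ j) (real (N j))" "0 \<le> (2::real) ^ j" by auto
    have "ctr j k = 0 \<or> ctr j k = real k + of_int u \<or> ctr j k = 2 ^ j" by (auto simp: ctr_def)
    then show "- \<bar>real_of_int u\<bar> \<le> ctr j k \<and> ctr j k \<le> max (2 ^ j) (real (N j)) + \<bar>real_of_int u\<bar>"
      using 1 2 by (elim disjE; intro conjI; linarith)
  next
    fix j and x X :: real assume j: "j0 \<le> j" and X: "0 \<le> X"
    define S where "S = {k. \<bar>x - (real k + of_int u)\<bar> \<le> X}"
    have S: "real (card S) \<le> 2 * X + 1" and finS: "finite S"
    proof -
      define lo where "lo = \<lceil>x - of_int u - X\<rceil>"
      define hi where "hi = \<lfloor>x - of_int u + X\<rfloor>"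
      have sub: "int ` S \<subseteq> {lo..hi}"
      proof
        fix i assume "i \<in> int ` S"
        then obtain k where k: "i = int k" "\<bar>x - (real k + of_int u)\<bar> \<le> X" by (auto simp: S_def)
        then show "i \<in> {lo..hi}" by (auto simp: lo_def hi_def ceiling_le_iff le_floor_iff abs_le_iff)
      qed
      show fin: "finite S" using finite_subset[OF sub] by (rule finite_imageD) (auto simp: inj_on_def)
      have "card S = card (int ` S)" by (rule card_image[symmetric]) (auto simp: inj_on_def)
      also have "\<dots> \<le> card {lo..hi}" by (rule card_mono[OF _ sub]) simp
      also have "\<dots> = nat (hi + 1 - lo)" by simp
      finally have "real (card S) \<le> real (nat (hi + 1 - lo))" by simp
      also have "\<dots> \<le> 2 * X + 1"
      proof -
        have "of_int hi \<le> x - of_int u + X" "x - of_int u - X \<le> of_int lo" by (auto simp: lo_def hi_def)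
        then show ?thesis using X by (cases "0 \<le> hi + 1 - lo") auto
      qed
      finally show "real (card S) \<le> 2 * X + 1" .
    qed
    have sub: "{k\<in>{..<N j}. \<bar>x - ctr j k\<bar> \<le> X} \<subseteq> {..<a} \<union> {N j - b..<N j} \<union> S"
      by (auto simp: ctr_def S_def)
    have "card {k\<in>{..<N j}. \<bar>x - ctr j k\<bar> \<le> X} \<le> card ({..<a} \<union> {N j - b..<N j} \<union> S)"
      using finS by (intro card_mono sub) auto
    also have "\<dots> \<le> card ({..<a} \<union> {N j - b..<N j}) + card S" by (rule card_Un_le)
    also have "card ({..<a} \<union> {N j - b..<N j}) \<le> card {..<a} + card {N j - b..<N j}" by (rule card_Un_le)
    also have "card {..<a} + card {N j - b..<N j} \<le> a + b" by simp
    finally have "real (card {k\<in>{..<N j}. \<bar>x - ctr j k\<bar> \<le> X}) \<le> real (a + b) + real (card S)"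
      by (simp only: of_nat_add[symmetric] of_nat_le_iff)
    then show "real (card {k\<in>{..<N j}. \<bar>x - ctr j k\<bar> \<le> X}) \<le> real (a + b) + 2 * X + 1" using S by simp
  qed
qed

subsection \<open>Boundary-corrected wavelet bases\<close>

locale cdv =
  fixes r j0 :: nat and \<phi> \<psi> :: "real \<Rightarrow> real" and C :: "nat \<Rightarrow> nat" and \<Phi> \<Psi> :: "nat \<Rightarrow> nat \<Rightarrow> real \<Rightarrow> real"
  assumes basis: "cdv_basis r \<phi> \<psi> j0 C \<Phi> \<Psi>"
begin

lemma adapted:
  "boundary_adapted j0 C \<phi> (edge_functions \<phi> 1) (edge_functions \<phi> (-1)) \<Phi>"
  "boundary_adapted j0 (\<lambda>j. 2 ^ j) \<psi> (edge_functions \<phi> 2) (edge_functions \<phi> (-2)) \<Psi>"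
  using basis unfolding cdv_basis_def by blast+

lemma monomials_in_span: "j0 \<le> j \<Longrightarrow> d < r \<Longrightarrow> (\<lambda>t. t ^ d) \<in> span_unit (C j) (\<Phi> j)"
  using basis unfolding cdv_basis_def by blast

lemma \<Phi>_orthonormal: "j0 \<le> j \<Longrightarrow> k < C j \<Longrightarrow> l < C j \<Longrightarrow> inner_unit (\<Phi> j k) (\<Phi> j l) = (if k = l then 1 else 0)"
  using basis unfolding cdv_basis_def by blast

lemma \<Psi>_orthonormal: "j0 \<le> j \<Longrightarrow> k < 2 ^ j \<Longrightarrow> l < 2 ^ j \<Longrightarrow> inner_unit (\<Psi> j k) (\<Psi> j l) = (if k = l then 1 else 0)"
  using basis unfolding cdv_basis_def by blast

lemma \<Phi>_\<Psi>_orthogonal: "j0 \<le> j \<Longrightarrow> k < C j \<Longrightarrow> l < 2 ^ j \<Longrightarrow> inner_unit (\<Phi> j k) (\<Psi> j l) = 0"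
  using basis unfolding cdv_basis_def by blast

lemma span_Suc: "j0 \<le> j \<Longrightarrow> span_unit (C (Suc j)) (\<Phi> (Suc j)) =
          {(\<lambda>t. v t + w t) | v w. v \<in> span_unit (C j) (\<Phi> j) \<and> w \<in> span_unit (2 ^ j) (\<Psi> j)}"
  using basis unfolding cdv_basis_def by blast

lemma span_dense: "f \<in> L2_unit \<Longrightarrow> 0 < e \<Longrightarrow> \<exists>j\<ge>j0. \<exists>v\<in>span_unit (C j) (\<Phi> j). sq_dist_unit f v < ennreal e"
  using basis unfolding cdv_basis_def by blast

lemma cc_fun_\<phi>: "cc_fun \<phi>"
proof -
  have "wavelet_regularity r \<phi> \<psi>" using basis unfolding cdv_basis_def by blast
  then have "continuous_on UNIV \<phi>" unfolding wavelet_regularity_def using cont_diff_continuous by blast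
  moreover obtain h where "scaling_function h \<phi>" using basis unfolding cdv_basis_def by blast
  then have "bounded {x. \<phi> x \<noteq> 0}" unfolding scaling_function_def by blast
  then obtain K where K: "\<And>x. \<phi> x \<noteq> 0 \<Longrightarrow> \<bar>x\<bar> \<le> K" by (auto simp: bounded_iff)
  then have "\<forall>x. K < \<bar>x\<bar> \<longrightarrow> \<phi> x = 0" using linorder_not_le by blast
  ultimately show ?thesis unfolding cc_fun_def by blast
qed

lemma cc_fun_\<psi>: "cc_fun \<psi>"
proof -
  obtain h where h: "scaling_function h \<phi>" "\<psi> = mother_wavelet h \<phi>"
    using basis unfolding cdv_basis_def by blast
  have "finite {m. h (1 - m) \<noteq> 0}"
  proof -
    have "{m. h (1 - m) \<noteq> 0} \<subseteq> (\<lambda>m. 1 - m) ` {m. h m \<noteq> 0}"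
      by (auto intro!: image_eqI[where x = "1 - _"])
    then show ?thesis using h(1) finite_surj unfolding scaling_function_def by blast
  qed
  from cc_fun_lincomb_affine[OF this cc_fun_\<phi>, of 2 "\<lambda>m. sqrt 2 * ((-1) powi m * h (1 - m))"]
  show ?thesis unfolding h(2) mother_wavelet_def[abs_def] by (simp add: sum_distrib_left mult.assoc)
qed

lemma \<Phi>_continuous: "j0 \<le> j \<Longrightarrow> k < C j \<Longrightarrow> continuous_on {0..1} (\<Phi> j k)"
proof (rule boundary_adapted_bounds[OF adapted(1) cc_fun_\<phi>], goal_cases)
  case (1 e) then show ?case using cc_fun_edge[OF cc_fun_\<phi>, of 1 e] by simp
next
  case (2 e) then show ?case using cc_fun_edge[OF cc_fun_\<phi>, of "-1" e] by simp
next
  case (3 \<Gamma> K0 n0 u0 ctr)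
  show ?case by (rule 3(6)[OF 3(1,2)])
qed

lemma \<Psi>_bounds:
  obtains \<Gamma> K0 :: real and n0 :: nat and u0 :: real and ctr :: "nat \<Rightarrow> nat \<Rightarrow> real" where
    "0 \<le> \<Gamma>" "1 \<le> K0" "0 \<le> u0"
    "\<And>j k t. j0 \<le> j \<Longrightarrow> k < 2 ^ j \<Longrightarrow> t \<in> {0..1} \<Longrightarrow> \<bar>\<Psi> j k t\<bar> \<le> \<Gamma> * 2 powr (real j / 2)"
    "\<And>j k t. j0 \<le> j \<Longrightarrow> k < 2 ^ j \<Longrightarrow> t \<in> {0..1} \<Longrightarrow> \<Psi> j k t \<noteq> 0 \<Longrightarrow> \<bar>2 ^ j * t - ctr j k\<bar> \<le> K0"
    "\<And>j k. j0 \<le> j \<Longrightarrow> k < 2 ^ j \<Longrightarrow> - u0 \<le> ctr j k \<and> ctr j k \<le> 2 ^ j + u0"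
    "\<And>j x X. j0 \<le> j \<Longrightarrow> 0 \<le> X \<Longrightarrow> real (card {k\<in>{..<2 ^ j}. \<bar>x - ctr j k\<bar> \<le> X}) \<le> real n0 + 2 * X + 1"
proof (rule boundary_adapted_bounds[OF adapted(2) cc_fun_\<psi>], goal_cases)
  case (1 e) then show ?case using cc_fun_edge[OF cc_fun_\<phi>, of 2 e] by simp
next
  case (2 e) then show ?case using cc_fun_edge[OF cc_fun_\<phi>, of "-2" e] by simp
next
  case (3 \<Gamma> K0 n0 u0 ctr)
  show ?case
  proof (rule that[of \<Gamma> K0 u0 ctr n0])
    show "- u0 \<le> ctr j k \<and> ctr j k \<le> 2 ^ j + u0" if "j0 \<le> j" "k < 2 ^ j" for j k
      using 3(8)[OF that] by simp
  qed (fact 3)+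
qed

lemma \<Psi>_continuous: "j0 \<le> j \<Longrightarrow> k < 2 ^ j \<Longrightarrow> continuous_on {0..1} (\<Psi> j k)"
proof (rule boundary_adapted_bounds[OF adapted(2) cc_fun_\<psi>], goal_cases)
  case (1 e) then show ?case using cc_fun_edge[OF cc_fun_\<phi>, of 2 e] by simp
next
  case (2 e) then show ?case using cc_fun_edge[OF cc_fun_\<phi>, of "-2" e] by simp
next
  case (3 \<Gamma> K0 n0 u0 ctr)
  show ?case by (rule 3(6)[OF 3(1,2)])
qed

lemma \<Phi>_L2: "j0 \<le> j \<Longrightarrow> k < C j \<Longrightarrow> \<Phi> j k \<in> L2_unit"
  using \<Phi>_continuous by (rule L2_unit_continuous) auto

lemma \<Psi>_L2: "j0 \<le> j \<Longrightarrow> k < 2 ^ j \<Longrightarrow> \<Psi> j k \<in> L2_unit"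
  using \<Psi>_continuous by (rule L2_unit_continuous) auto

lemma span_continuous: "j0 \<le> j \<Longrightarrow> v \<in> span_unit (C j) (\<Phi> j) \<Longrightarrow> continuous_on {0..1} v"
proof -
  assume j: "j0 \<le> j" and "v \<in> span_unit (C j) (\<Phi> j)"
  then obtain c where c: "\<And>t. t \<in> {0..1} \<Longrightarrow> v t = (\<Sum>k<C j. c k * \<Phi> j k t)" by (auto simp: span_unit_def)
  have "continuous_on {0..1} (\<lambda>t. \<Sum>k<C j. c k * \<Phi> j k t)"
    using \<Phi>_continuous[OF j] by (intro continuous_on_sum continuous_on_mult continuous_on_const) auto
  then show ?thesis by (rule continuous_on_eq) (use c in simp)
qed

lemma span_L2: "j0 \<le> j \<Longrightarrow> v \<in> span_unit (C j) (\<Phi> j) \<Longrightarrow> v \<in> L2_unit"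
  using span_continuous by (rule L2_unit_continuous) auto

lemma span_mono: "j0 \<le> i \<Longrightarrow> i \<le> j \<Longrightarrow> span_unit (C i) (\<Phi> i) \<subseteq> span_unit (C j) (\<Phi> j)"
proof (induction j)
  case (Suc j)
  show ?case
  proof (cases "i = Suc j")
    case False
    then have ij: "i \<le> j" using Suc.prems by simp
    have z: "(\<lambda>_. 0) \<in> span_unit (2 ^ j) (\<Psi> j)" unfolding span_unit_def by (auto intro!: exI[of _ "\<lambda>_. 0"])
    have "span_unit (C j) (\<Phi> j) \<subseteq> span_unit (C (Suc j)) (\<Phi> (Suc j))"
    proof
      fix v assume "v \<in> span_unit (C j) (\<Phi> j)"
      then have "\<exists>v' w. v = (\<lambda>t. v' t + w t) \<and> v' \<in> span_unit (C j) (\<Phi> j) \<and> w \<in> span_unit (2 ^ j) (\<Psi> j)"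
        using z by (intro exI[of _ v] exI[of _ "\<lambda>_. 0"]) auto
      then show "v \<in> span_unit (C (Suc j)) (\<Phi> (Suc j))" using span_Suc Suc.prems ij by auto
    qed
    then show ?thesis using Suc.IH Suc.prems ij by blast
  qed simp
qed simp

lemma span_\<Psi>_orthogonal:
  assumes j: "j0 \<le> j" and v: "v \<in> span_unit (C j) (\<Phi> j)" and l: "l < 2 ^ j"
  shows "inner_unit v (\<Psi> j l) = 0"
proof -
  obtain c where c: "\<And>t. t \<in> {0..1} \<Longrightarrow> v t = (\<Sum>k<C j. c k * \<Phi> j k t)" using v by (auto simp: span_unit_def)
  have "inner_unit v (\<Psi> j l) = inner_unit (\<lambda>t. \<Sum>k<C j. c k * \<Phi> j k t) (\<Psi> j l)"
    using c by (intro inner_unit_cong) auto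
  also have "\<dots> = (\<Sum>k<C j. c k * inner_unit (\<Phi> j k) (\<Psi> j l))"
    using \<Phi>_L2 \<Psi>_L2 j l by (intro inner_unit_lincomb_left) auto
  finally show ?thesis using \<Phi>_\<Psi>_orthogonal[OF j _ l] by simp
qed

lemma \<Psi>_in_span: "j0 \<le> i \<Longrightarrow> i < j \<Longrightarrow> k < 2 ^ i \<Longrightarrow> \<Psi> i k \<in> span_unit (C j) (\<Phi> j)"
proof -
  assume i: "j0 \<le> i" "i < j" "k < 2 ^ i"
  have "(\<lambda>_. 0) \<in> span_unit (C i) (\<Phi> i)" unfolding span_unit_def by (auto intro!: exI[of _ "\<lambda>_. 0"])
  moreover have "\<Psi> i k \<in> span_unit (2 ^ i) (\<Psi> i)"
  proof -
    have "(\<Sum>l<2 ^ i. (if l = k then 1 else 0) * \<Psi> i l t) = \<Psi> i k t" for t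
    proof -
      have "(\<Sum>l<2 ^ i. (if l = k then 1 else 0) * \<Psi> i l t) = (\<Sum>l<2 ^ i. if l = k then \<Psi> i l t else 0)"
        by (intro sum.cong) auto
      then show ?thesis using i(3) by simp
    qed
    then show ?thesis unfolding span_unit_def by (auto intro!: exI[of _ "\<lambda>l. if l = k then 1 else 0"])
  qed
  ultimately have "\<exists>v w. \<Psi> i k = (\<lambda>t. v t + w t) \<and> v \<in> span_unit (C i) (\<Phi> i) \<and> w \<in> span_unit (2 ^ i) (\<Psi> i)"
    by (intro exI[of _ "\<lambda>_. 0"] exI[of _ "\<Psi> i k"]) auto
  then have "\<Psi> i k \<in> span_unit (C (Suc i)) (\<Phi> (Suc i))" using span_Suc[OF i(1)] by auto
  then show ?thesis using span_mono[of "Suc i" j] i by auto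
qed

text \<open>Polynomials lie in every space \<open>span_unit (C j) (\<Phi> j)\<close>, to which the
  wavelets of level j are orthogonal; interior and edge wavelets are covered alike.\<close>

lemma poly_\<Psi>_orthogonal:
  assumes j: "j0 \<le> j" and l: "l < 2 ^ j" and q: "degree q < r"
  shows "inner_unit (poly q) (\<Psi> j l) = 0"
proof -
  have mono: "(\<lambda>t::real. t ^ d) \<in> L2_unit" for d
    by (rule L2_unit_continuous[of "\<lambda>t. t ^ d"]) (auto intro!: continuous_intros)
  have "poly q = (\<lambda>t. \<Sum>d\<le>degree q. coeff q d * t ^ d)" by (simp add: poly_altdef fun_eq_iff)
  then have "inner_unit (poly q) (\<Psi> j l) = (\<Sum>d\<le>degree q. coeff q d * inner_unit (\<lambda>t. t ^ d) (\<Psi> j l))"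
    using inner_unit_lincomb_left[of "{..degree q}" "\<lambda>d t. t ^ d" "\<Psi> j l" "coeff q"] mono \<Psi>_L2[OF j l] by simp
  also have "\<dots> = 0"
  proof (intro sum.neutral ballI)
    fix d assume "d \<in> {..degree q}"
    then have "(\<lambda>t. t ^ d) \<in> span_unit (C j) (\<Phi> j)" using q j by (intro monomials_in_span) auto
    then show "coeff q d * inner_unit (\<lambda>t. t ^ d) (\<Psi> j l) = 0" using span_\<Psi>_orthogonal[OF j _ l] by simp
  qed
  finally show ?thesis .
qed

text \<open>The basis up to level \<open>J\<close>, with the index \<open>0\<close> for the scaling functions at level \<open>j0\<close> and
  \<open>Suc j\<close> for the wavelets at level \<open>j\<close>.\<close>
definition ix :: "nat \<Rightarrow> (nat \<times> nat) set" where
  "ix J = {0} \<times> {..<C j0} \<union> (SIGMA i:Suc ` {j0..<J}. {..<2 ^ (i - 1)})"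

definition bf :: "nat \<times> nat \<Rightarrow> real \<Rightarrow> real" where
  "bf p = (case fst p of 0 \<Rightarrow> \<Phi> j0 (snd p) | Suc j \<Rightarrow> \<Psi> j (snd p))"

lemma finite_ix: "finite (ix J)" by (auto simp: ix_def)

lemma sum_ix: "(\<Sum>p\<in>ix J. F p) = (\<Sum>k<C j0. F (0, k)) + (\<Sum>j=j0..<J. \<Sum>k<2 ^ j. F (Suc j, k))" for F :: "nat \<times> nat \<Rightarrow> real"
proof -
  have "(\<Sum>p\<in>ix J. F p) = (\<Sum>p\<in>{0} \<times> {..<C j0}. F p) + (\<Sum>p\<in>(SIGMA i:Suc ` {j0..<J}. {..<2 ^ (i - 1)}). F p)"
    unfolding ix_def by (rule sum.union_disjoint) auto
  also have "(\<Sum>p\<in>{0} \<times> {..<C j0}. F p) = (\<Sum>k<C j0. F (0, k))"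
  proof -
    have pair: "{0} \<times> {..<C j0} = Pair 0 ` {..<C j0}" by auto
    show ?thesis unfolding pair by (simp add: sum.reindex inj_on_def)
  qed
  also have "(\<Sum>p\<in>(SIGMA i:Suc ` {j0..<J}. {..<2 ^ (i - 1)}). F p) = (\<Sum>i\<in>Suc ` {j0..<J}. \<Sum>k<2 ^ (i - 1). F (i, k))"
    by (subst sum.Sigma) auto
  also have "\<dots> = (\<Sum>j=j0..<J. \<Sum>k<2 ^ j. F (Suc j, k))"
    by (subst sum.reindex) auto
  finally show ?thesis .
qed

lemma bf_L2: "p \<in> ix J \<Longrightarrow> bf p \<in> L2_unit"
  by (auto simp: ix_def bf_def \<Phi>_L2 \<Psi>_L2 split: nat.split)

text \<open>Across levels, the coarser function lies in the span of the scaling functions at the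
  finer level, to which the wavelets of that level are orthogonal.\<close>

lemma bf_orthonormal:
  assumes "p \<in> ix J" "p' \<in> ix J"
  shows "inner_unit (bf p) (bf p') = (if p = p' then 1 else 0)"
proof -
  have \<Phi>_mem: "\<Phi> j0 k \<in> span_unit (C j) (\<Phi> j)" if "j0 \<le> j" "k < C j0" for j k
  proof -
    have "(\<Sum>l<C j0. (if l = k then 1 else 0) * \<Phi> j0 l t) = \<Phi> j0 k t" for t
    proof -
      have "(\<Sum>l<C j0. (if l = k then 1 else 0) * \<Phi> j0 l t) = (\<Sum>l<C j0. if l = k then \<Phi> j0 l t else 0)"
        by (intro sum.cong) auto
      then show ?thesis using that by simp
    qed
    then have "\<Phi> j0 k \<in> span_unit (C j0) (\<Phi> j0)"
      unfolding span_unit_def by (auto intro!: exI[of _ "\<lambda>l. if l = k then 1 else 0"])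
    then show ?thesis using span_mono[of j0 j] that by auto
  qed
  have \<Phi>\<Psi>: "inner_unit (\<Phi> j0 k) (\<Psi> j l) = 0" if "j0 \<le> j" "k < C j0" "l < 2 ^ j" for j k l
    using span_\<Psi>_orthogonal[OF that(1) \<Phi>_mem[OF that(1,2)] that(3)] .
  have \<Psi>\<Psi>: "inner_unit (\<Psi> i k) (\<Psi> j l) = 0" if "j0 \<le> i" "i < j" "k < 2 ^ i" "l < 2 ^ j" for i j k l
    using span_\<Psi>_orthogonal[OF _ \<Psi>_in_span[OF that(1-3)] that(4)] that by simp
  obtain i k where p: "p = (i, k)" by (cases p)
  obtain i' k' where p': "p' = (i', k')" by (cases p')
  show ?thesis
  proof (cases i)
    case 0
    then show ?thesis
    proof (cases i')
      case 0
      then show ?thesis using \<open>i = 0\<close> assms by (auto simp: p p' ix_def bf_def \<Phi>_orthonormal)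
    next
      case (Suc j')
      then show ?thesis using \<open>i = 0\<close> assms by (auto simp: p p' ix_def bf_def \<Phi>\<Psi>)
    qed
  next
    case (Suc j)
    note ij = this
    then show ?thesis
    proof (cases i')
      case 0
      then show ?thesis using ij assms by (auto simp: p p' ix_def bf_def \<Phi>\<Psi> inner_unit_commute[of "\<Psi> j k"])
    next
      case (Suc j')
      have m: "j0 \<le> j" "k < 2 ^ j" "j0 \<le> j'" "k' < 2 ^ j'" using ij Suc assms by (auto simp: p p' ix_def)
      consider "j = j'" | "j < j'" | "j' < j" by linarith
      then show ?thesis
      proof cases
        case 1
        then show ?thesis using m ij Suc by (simp add: p p' bf_def \<Psi>_orthonormal)
      next
        case 2
        then show ?thesis using m ij Suc \<Psi>\<Psi>[of j j' k k'] by (simp add: p p' bf_def)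
      next
        case 3
        then show ?thesis using m ij Suc \<Psi>\<Psi>[of j' j k' k] by (simp add: p p' bf_def inner_unit_commute[of "\<Psi> j k"])
      qed
    qed
  qed
qed

lemma span_expansion:
  assumes "j0 \<le> J" "v \<in> span_unit (C J) (\<Phi> J)"
  shows "\<exists>c. \<forall>t\<in>{0..1}. v t = (\<Sum>p\<in>ix J. c p * bf p t)"
  using assms
proof (induction J arbitrary: v rule: dec_induct)
  case base
  then obtain c where c: "\<And>t. t \<in> {0..1} \<Longrightarrow> v t = (\<Sum>k<C j0. c k * \<Phi> j0 k t)" by (auto simp: span_unit_def)
  then show ?case by (intro exI[of _ "\<lambda>p. c (snd p)"]) (auto simp: sum_ix bf_def)
next
  case (step J)
  obtain v' w where vw: "v = (\<lambda>t. v' t + w t)" "v' \<in> span_unit (C J) (\<Phi> J)" "w \<in> span_unit (2 ^ J) (\<Psi> J)"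
    using step.prems span_Suc[OF step.hyps(1)] by auto
  obtain c where c: "\<And>t. t \<in> {0..1} \<Longrightarrow> v' t = (\<Sum>p\<in>ix J. c p * bf p t)" using step.IH[OF vw(2)] by auto
  obtain d where d: "\<And>t. t \<in> {0..1} \<Longrightarrow> w t = (\<Sum>k<2 ^ J. d k * \<Psi> J k t)" using vw(3) by (auto simp: span_unit_def)
  define c' where "c' p = (if fst p = Suc J then d (snd p) else c p)" for p
  have "v t = (\<Sum>p\<in>ix (Suc J). c' p * bf p t)" if "t \<in> {0..1}" for t
    using c[OF that] d[OF that] step.hyps by (simp add: vw(1) sum_ix c'_def bf_def)
  then show ?case by blast
qed

text \<open>Infinite series are avoided: f is approximated within sqrt e in the span at some level
  J', its projection onto that span is at least as close, and the coefficients up to J' differ by at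
  most the claimed sum. Then e tends to 0.\<close>

lemma sq_dist_expansion_le:
  assumes f: "f \<in> L2_unit" and J: "j0 \<le> J" and T: "0 \<le> T"
    and tail: "\<And>J'. J \<le> J' \<Longrightarrow> (\<Sum>j=J..<J'. \<Sum>k<2 ^ j. (inner_unit f (\<Psi> j k))\<^sup>2) \<le> T"
  shows "sq_dist_unit (\<lambda>t. (\<Sum>k<C j0. a k * \<Phi> j0 k t) + (\<Sum>j=j0..<J. \<Sum>k<2 ^ j. b j k * \<Psi> j k t)) f \<le>
    ennreal ((\<Sum>k<C j0. (a k - inner_unit f (\<Phi> j0 k))\<^sup>2) +
      (\<Sum>j=j0..<J. \<Sum>k<2 ^ j. (b j k - inner_unit f (\<Psi> j k))\<^sup>2) + T)"
proof -
  \<comment> \<open>The estimated coefficients, continued by 0 from level J on, where the estimator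
    discards everything.\<close>
  define x where "x p = (case fst p of 0 \<Rightarrow> a (snd p) | Suc j \<Rightarrow> (if j < J then b j (snd p) else 0))" for p :: "nat \<times> nat"
  define \<theta> where "\<theta> p = inner_unit f (bf p)" for p
  define fhat where "fhat t = (\<Sum>k<C j0. a k * \<Phi> j0 k t) + (\<Sum>j=j0..<J. \<Sum>k<2 ^ j. b j k * \<Psi> j k t)" for t
  define S where "S = (\<Sum>k<C j0. (a k - inner_unit f (\<Phi> j0 k))\<^sup>2) +
      (\<Sum>j=j0..<J. \<Sum>k<2 ^ j. (b j k - inner_unit f (\<Psi> j k))\<^sup>2) + T"
  have S0: "0 \<le> S" unfolding S_def using T by (intro add_nonneg_nonneg sum_nonneg) auto
  have split: "(\<Sum>j=j0..<J'. F j) = (\<Sum>j=j0..<J. F j) + (\<Sum>j=J..<J'. F j)" if "J \<le> J'" for J' and F :: "nat \<Rightarrow> real"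
    using sum.atLeastLessThan_concat[OF J that] by metis
  have fhat_ix: "fhat t = (\<Sum>p\<in>ix J'. x p * bf p t)" if "J \<le> J'" for J' t
  proof -
    have "(\<Sum>j=J..<J'. \<Sum>k<2 ^ j. x (Suc j, k) * bf (Suc j, k) t) = 0"
      by (intro sum.neutral ballI) (auto simp: x_def)
    then show ?thesis unfolding fhat_def sum_ix split[OF that] by (simp add: x_def bf_def)
  qed
  have fhatL: "fhat \<in> L2_unit"
    unfolding fhat_ix[OF order_refl, abs_def] using bf_L2 by (rule L2_unit_lincomb)
  have S_ix: "(\<Sum>p\<in>ix J'. (x p - \<theta> p)\<^sup>2) \<le> S" if "J \<le> J'" for J'
  proof -
    have "(\<Sum>p\<in>ix J'. (x p - \<theta> p)\<^sup>2) = (\<Sum>k<C j0. (a k - inner_unit f (\<Phi> j0 k))\<^sup>2) +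
      (\<Sum>j=j0..<J. \<Sum>k<2 ^ j. (b j k - inner_unit f (\<Psi> j k))\<^sup>2) + (\<Sum>j=J..<J'. \<Sum>k<2 ^ j. (inner_unit f (\<Psi> j k))\<^sup>2)"
      unfolding sum_ix split[OF that] by (simp add: x_def \<theta>_def bf_def)
    then show ?thesis using tail[OF that] by (simp add: S_def)
  qed
  have close: "norm_unit (\<lambda>t. fhat t - f t) \<le> sqrt S + sqrt e" if e: "0 < e" for e
  proof -
    obtain i v where v: "j0 \<le> i" "v \<in> span_unit (C i) (\<Phi> i)" "sq_dist_unit f v < ennreal e"
      using span_dense[OF f e] by blast
    define J' where "J' = max i J"
    have J': "J \<le> J'" "j0 \<le> J'" "i \<le> J'" using J by (auto simp: J'_def)
    have vJ': "v \<in> span_unit (C J') (\<Phi> J')" using span_mono[OF v(1) J'(3)] v(2) by auto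
    obtain c where c: "\<And>t. t \<in> {0..1} \<Longrightarrow> v t = (\<Sum>p\<in>ix J'. c p * bf p t)" using span_expansion[OF J'(2) vJ'] by auto
    define Pf where "Pf t = (\<Sum>p\<in>ix J'. \<theta> p * bf p t)" for t
    have PfL: "Pf \<in> L2_unit" unfolding Pf_def[abs_def] using bf_L2 by (rule L2_unit_lincomb)
    have "(\<lambda>t. fhat t - Pf t) = (\<lambda>t. \<Sum>p\<in>ix J'. (x p - \<theta> p) * bf p t)"
      by (simp add: fhat_ix[OF J'(1)] Pf_def sum_subtractf left_diff_distrib fun_eq_iff)
    moreover have "(norm_unit (\<lambda>t. \<Sum>p\<in>ix J'. (x p - \<theta> p) * bf p t))\<^sup>2 = (\<Sum>p\<in>ix J'. (x p - \<theta> p)\<^sup>2)"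
      by (rule norm_unit_lincomb[OF finite_ix bf_L2 bf_orthonormal])
    ultimately have "(norm_unit (\<lambda>t. fhat t - Pf t))\<^sup>2 = (\<Sum>p\<in>ix J'. (x p - \<theta> p)\<^sup>2)" by simp
    also have "\<dots> \<le> S" by (rule S_ix[OF J'(1)])
    finally have 1: "norm_unit (\<lambda>t. fhat t - Pf t) \<le> sqrt S" by (rule real_le_rsqrt)
    have "norm_unit (\<lambda>t. f t - Pf t) \<le> norm_unit (\<lambda>t. f t - (\<Sum>p\<in>ix J'. c p * bf p t))"
      unfolding Pf_def \<theta>_def by (rule norm_unit_projection_le[OF finite_ix bf_L2 bf_orthonormal f])
    also have "\<dots> = norm_unit (\<lambda>t. f t - v t)" using c by (intro norm_unit_cong) simp
    also have "\<dots> \<le> sqrt e"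
    proof (rule real_le_rsqrt)
      have "ennreal ((norm_unit (\<lambda>t. f t - v t))\<^sup>2) < ennreal e"
        using v(3) sq_dist_unit_norm[OF f span_L2[OF v(1,2)]] by simp
      then show "(norm_unit (\<lambda>t. f t - v t))\<^sup>2 \<le> e" by (simp add: ennreal_less_iff)
    qed
    finally have 2: "norm_unit (\<lambda>t. f t - Pf t) \<le> sqrt e" .
    have "norm_unit (\<lambda>t. (fhat t - Pf t) - (f t - Pf t)) \<le> norm_unit (\<lambda>t. fhat t - Pf t) + norm_unit (\<lambda>t. f t - Pf t)"
      by (intro norm_unit_diff_triangle L2_unit_diff fhatL PfL f)
    then show ?thesis using 1 2 by simp
  qed
  have "norm_unit (\<lambda>t. fhat t - f t) \<le> sqrt S"
  proof (rule field_le_epsilon)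
    fix e :: real assume "0 < e"
    then show "norm_unit (\<lambda>t. fhat t - f t) \<le> sqrt S + e" using close[of "e\<^sup>2"] by simp
  qed
  then have "(norm_unit (\<lambda>t. fhat t - f t))\<^sup>2 \<le> (sqrt S)\<^sup>2" by (intro power_mono norm_unit_nonneg)
  then have "(norm_unit (\<lambda>t. fhat t - f t))\<^sup>2 \<le> S" using S0 by simp
  then have "sq_dist_unit fhat f \<le> ennreal S" using sq_dist_unit_norm[OF fhatL f] by (simp add: ennreal_leI)
  then show ?thesis by (simp add: fhat_def[abs_def] S_def)
qed

end

subsection \<open>Wavelet coefficients of functions in Besov balls\<close>

lemma fin_diff_cong:
  "(\<And>i. i \<le> m \<Longrightarrow> f (x + real i * h) = g (x + real i * h)) \<Longrightarrow> fin_diff m h f x = fin_diff m h g x"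
  unfolding fin_diff_def by (intro sum.cong) auto

lemma borel_extension: "f \<in> L2_unit \<Longrightarrow> (\<lambda>x. indicator {0..1} x * f x) \<in> borel_measurable borel"
  unfolding L2_unit_def set_borel_measurable_def by simp

lemma integral_unit_indicator:
  "(\<integral>t. F t \<partial>unit_meas) = (\<integral>t. indicator {0..1} t * F t \<partial>lborel)" for F :: "real \<Rightarrow> real"
  by (simp add: integral_restrict_space)

context cdv
begin

text \<open>The multiresolution spaces consist of functions continuous on [0, 1] and are dense in
  L^2; the Cauchy-Schwarz inequality with the constant function 1 passes to L^1.\<close>

lemma L1_dense_continuous:
  assumes f: "f \<in> L2_unit" and \<eta>: "0 < \<eta>"
  obtains v where "continuous_on {0..1} v" "v \<in> L2_unit" "(\<integral>\<^sup>+x. ennreal \<bar>f x - v x\<bar> \<partial>unit_meas) \<le> ennreal \<eta>"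
proof -
  have "0 < \<eta>\<^sup>2" using \<eta> by simp
  from span_dense[OF f this] obtain j v where v: "j0 \<le> j" "v \<in> span_unit (C j) (\<Phi> j)" "sq_dist_unit f v < ennreal (\<eta>\<^sup>2)" by blast
  have vL: "v \<in> L2_unit" using span_L2[OF v(1,2)] .
  define d where "d x = \<bar>f x - v x\<bar>" for x
  have dL: "(\<lambda>x. f x - v x) \<in> L2_unit" by (rule L2_unit_diff[OF f vL])
  have dL': "d \<in> L2_unit" using dL unfolding d_def[abs_def] L2_unit_iff by auto
  have one: "(\<lambda>_. 1) \<in> L2_unit" by (rule L2_unit_continuous[of "\<lambda>_. 1"]) auto
  have n1: "inner_unit (\<lambda>_. 1) (\<lambda>_. 1) = 1"
    unfolding inner_unit_eq integral_unit_indicator by simp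
  have "norm_unit d = norm_unit (\<lambda>x. f x - v x)" by (simp add: norm_unit_def inner_unit_eq d_def)
  also have "\<dots> \<le> \<eta>"
  proof -
    have "ennreal ((norm_unit (\<lambda>t. f t - v t))\<^sup>2) < ennreal (\<eta>\<^sup>2)" using v(3) sq_dist_unit_norm[OF f vL] by simp
    then have "(norm_unit (\<lambda>t. f t - v t))\<^sup>2 \<le> \<eta>\<^sup>2" by (simp add: ennreal_less_iff)
    then show ?thesis using \<eta> norm_unit_nonneg by (simp add: power2_le_iff_abs_le)
  qed
  finally have "inner_unit d (\<lambda>_. 1) \<le> \<eta>"
    using inner_unit_Cauchy_Schwarz[OF dL' one] by (simp add: n1 norm_unit_def)
  then have "(\<integral>x. d x \<partial>unit_meas) \<le> \<eta>" by (simp add: inner_unit_eq)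
  moreover have "(\<integral>\<^sup>+x. ennreal (d x) \<partial>unit_meas) = ennreal (\<integral>x. d x \<partial>unit_meas)"
    using L2_unit_integrable[OF dL'] by (rule nn_integral_eq_integral) (simp add: d_def)
  ultimately have "(\<integral>\<^sup>+x. ennreal \<bar>f x - v x\<bar> \<partial>unit_meas) \<le> ennreal \<eta>" by (simp add: d_def ennreal_leI)
  then show ?thesis using that[OF span_continuous[OF v(1,2)] vL] by blast
qed

text \<open>Both f and the wavelet are set to 0 outside the unit interval, because their
  measurability is known only on it. The interval carrying the wavelet lies inside, so the inner
  product is unchanged.\<close>

lemma coefficient_bound:
  assumes f: "f \<in> L2_unit" and j: "j0 \<le> j" and k: "k < 2 ^ j"
    and m: "0 < m" "m \<le> r" and p: "0 < p" and \<delta>: "0 < \<delta>" and h0: "0 < h0"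
    and I: "0 \<le> A" "A + real m * h0 \<le> 1"
    and supp: "\<And>t. t \<in> {0..1} \<Longrightarrow> \<Psi> j k t \<noteq> 0 \<Longrightarrow> t \<in> {A..A + real m * h0}"
    and \<Gamma>: "\<And>t. t \<in> {0..1} \<Longrightarrow> \<bar>\<Psi> j k t\<bar> \<le> \<Gamma>"
    and T: "0 < T" and bound: "\<And>L. (\<Sum>l=1..L. ennreal (2 powr (\<delta> * p * real l) * 2 ^ l) *
      (\<integral>\<^sup>+x\<in>{A..A + real m * h0 - real m * (h0 / 2 ^ l)}. ennreal (\<bar>fin_diff m (h0 / 2 ^ l) (\<lambda>x. indicator {0..1} x * f x) x\<bar> powr p) \<partial>lborel)) \<le> ennreal T"
  shows "\<bar>inner_unit f (\<Psi> j k)\<bar> \<le>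
    real m * (2 * (real m * (2 * real m + 1) ^ m * (2 ^ m + 1) ^ (2 * m))) *
      (2 * (1 / (1 - 2 powr (- \<delta>))) powr p) powr (1 / p) * (\<Gamma> * h0 * (T / h0) powr (1 / p))"
proof -
  define I where "I = {A..A + real m * h0}"
  have sub: "I \<subseteq> {0..1}" using I by (auto simp: I_def)
  define f' where "f' x = indicator {0..1} x * f x" for x
  define g where "g x = indicator {0..1} x * \<Psi> j k x" for x
  have f'm [measurable]: "f' \<in> borel_measurable borel" unfolding f'_def[abs_def] by (rule borel_extension[OF f])
  have gm [measurable]: "g \<in> borel_measurable borel" unfolding g_def[abs_def] by (rule borel_extension[OF \<Psi>_L2[OF j k]])
  have restrict: "inner_unit u (\<Psi> j k) = (\<integral>x. indicator I x * (u' x * g x) \<partial>lborel)" if "\<And>x. x \<in> {0..1} \<Longrightarrow> u' x = u x" for u u'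
    unfolding inner_unit_eq integral_unit_indicator
  proof (intro Bochner_Integration.integral_cong refl)
    fix x show "indicator {0..1} x * (u x * \<Psi> j k x) = indicator I x * (u' x * g x)"
    proof (cases "x \<in> {0..1}")
      case True
      then show ?thesis using supp[OF True] that[OF True] by (cases "x \<in> I") (auto simp: g_def I_def)
    next
      case False
      then show ?thesis using sub by (auto simp: indicator_def)
    qed
  qed
  have "\<bar>\<integral>x. indicator {A..A + real m * h0} x * (f' x * g x) \<partial>lborel\<bar> \<le>
    real m * (2 * (real m * (2 * real m + 1) ^ m * (2 ^ m + 1) ^ (2 * m))) *
      (2 * (1 / (1 - 2 powr (- \<delta>))) powr p) powr (1 / p) * (\<Gamma> * h0 * (T / h0) powr (1 / p))"
  proof (rule difference_functional_bound[OF m(1) p \<delta> h0 f'm _ _ gm _ _ _ T])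
    show "integrable lborel (\<lambda>x. indicator {A..A + real m * h0} x * f' x)"
    proof (rule Bochner_Integration.integrable_bound)
      show "integrable lborel f'" using L2_unit_integrable[OF f] unfolding f'_def[abs_def] by (simp add: integrable_restrict_space)
      show "(\<lambda>x. indicator {A..A + real m * h0} x * f' x) \<in> borel_measurable lborel" by measurable
    qed (auto simp: indicator_def)
  next
    fix \<eta> :: real assume "0 < \<eta>"
    from L1_dense_continuous[OF f this] obtain v where v: "continuous_on {0..1} v" "v \<in> L2_unit"
      "(\<integral>\<^sup>+x. ennreal \<bar>f x - v x\<bar> \<partial>unit_meas) \<le> ennreal \<eta>" by blast
    define v' where "v' x = indicator {0..1} x * v x" for x
    have "v' \<in> borel_measurable borel" unfolding v'_def[abs_def] by (rule borel_extension[OF v(2)])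
    moreover have "continuous_on I v'"
    proof (rule continuous_on_eq[OF continuous_on_subset[OF v(1) sub]])
      show "v x = v' x" if "x \<in> I" for x using that sub by (auto simp: v'_def indicator_def)
    qed
    moreover have "(\<integral>\<^sup>+x\<in>I. ennreal \<bar>f' x - v' x\<bar> \<partial>lborel) \<le> ennreal \<eta>"
    proof -
      have "(\<integral>\<^sup>+x\<in>I. ennreal \<bar>f' x - v' x\<bar> \<partial>lborel) \<le> (\<integral>\<^sup>+x\<in>{0..1}. ennreal \<bar>f x - v x\<bar> \<partial>lborel)"
        using sub by (intro nn_integral_mono) (auto simp: f'_def v'_def indicator_def)
      also have "\<dots> = (\<integral>\<^sup>+x. ennreal \<bar>f x - v x\<bar> \<partial>unit_meas)" by (simp add: nn_integral_restrict_space)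
      finally show ?thesis using v(3) by (rule order_trans)
    qed
    ultimately show "\<exists>v. v \<in> borel_measurable borel \<and> continuous_on {A..A + real m * h0} v \<and>
        (\<integral>\<^sup>+x\<in>{A..A + real m * h0}. ennreal \<bar>f' x - v x\<bar> \<partial>lborel) \<le> ennreal \<eta>"
      unfolding I_def by blast
  next
    show "continuous_on {A..A + real m * h0} g"
      unfolding I_def[symmetric]
    proof (rule continuous_on_eq[OF continuous_on_subset[OF \<Psi>_continuous[OF j k] sub]])
      show "\<Psi> j k x = g x" if "x \<in> I" for x using that sub by (auto simp: g_def indicator_def)
    qed
    show "\<bar>g x\<bar> \<le> \<Gamma>" if "x \<in> {A..A + real m * h0}" for x
    proof -
      have "x \<in> {0..1}" using that sub by (auto simp: I_def)
      then show ?thesis using \<Gamma>[of x] by (simp add: g_def)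
    qed
    show "(\<integral>x. indicator {A..A + real m * h0} x * (poly q x * g x) \<partial>lborel) = 0" if "degree q < m" for q
    proof -
      have "(\<integral>x. indicator I x * (poly q x * g x) \<partial>lborel) = inner_unit (poly q) (\<Psi> j k)"
        by (rule restrict[symmetric]) simp
      also have "\<dots> = 0" using that m by (intro poly_\<Psi>_orthogonal[OF j k]) auto
      finally show ?thesis by (simp add: I_def)
    qed
    show "(\<Sum>l=1..L. ennreal (2 powr (\<delta> * p * real l) * 2 ^ l) *
      (\<integral>\<^sup>+x\<in>{A..A + real m * h0 - real m * (h0 / 2 ^ l)}. ennreal (\<bar>fin_diff m (h0 / 2 ^ l) f' x\<bar> powr p) \<partial>lborel)) \<le> ennreal T" for L
      using bound[of L] unfolding f'_def[abs_def] .
  qed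
  moreover have "inner_unit f (\<Psi> j k) = (\<integral>x. indicator I x * (f' x * g x) \<partial>lborel)"
    by (rule restrict) (simp add: f'_def)
  ultimately show ?thesis by (simp add: I_def)
qed

end

context cdv
begin

text \<open>The bound for a single coefficient is summed over \<open>k\<close>; the intervals carrying the wavelets of
  one level have bounded overlap.\<close>
lemma besov_coefficients:
  assumes p: "0 < p" "inverse p < ennreal s" and q: "0 < q" and M: "0 < M" and sr: "s < real r"
  obtains p' B :: real and j1 :: nat where "0 < p'" "1 / p' < s" "0 < B" "j0 \<le> j1"
    "\<And>f j. f \<in> besov_ball s p q M \<Longrightarrow> j1 \<le> j \<Longrightarrow>
      (\<Sum>k<2 ^ j. \<bar>inner_unit f (\<Psi> j k)\<bar> powr p') \<le> (B * 2 powr (- real j * (s + 1 / 2 - 1 / p'))) powr p'"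
proof -
  have s: "0 < s" using p(2) by (metis ennreal_eq_0_iff linorder_not_le not_less_zero)
  define m where "m = nat \<lfloor>s\<rfloor> + 1"
  have m: "0 < m" "m \<le> r"
  proof -
    have "\<lfloor>s\<rfloor> < int r" using sr by (simp add: floor_less_iff)
    moreover have "0 \<le> \<lfloor>s\<rfloor>" using s by simp
    ultimately show "m \<le> r" unfolding m_def by linarith
  qed (simp add: m_def)
  obtain p' K where p': "0 < p'" "1 / p' < s" and K: "0 < K"
    and diff: "\<And>f h. f \<in> besov_ball s p q M \<Longrightarrow> 0 < h \<Longrightarrow>
      (\<integral>\<^sup>+x\<in>{0..1 - real m * h}. ennreal (\<bar>fin_diff m h f x\<bar> powr p') \<partial>lborel) \<le> ennreal ((K * h powr s) powr p')"
    unfolding m_def by (rule besov_ball_differences[OF p q M]) blast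
  obtain \<Gamma> K0 :: real and n0 :: nat and u0 :: real and ctr :: "nat \<Rightarrow> nat \<Rightarrow> real" where
    \<Gamma>0: "0 \<le> \<Gamma>" and K0: "1 \<le> K0" and u0: "0 \<le> u0" and
    \<Gamma>: "\<And>j k t. j0 \<le> j \<Longrightarrow> k < 2 ^ j \<Longrightarrow> t \<in> {0..1} \<Longrightarrow> \<bar>\<Psi> j k t\<bar> \<le> \<Gamma> * 2 powr (real j / 2)" and
    supp: "\<And>j k t. j0 \<le> j \<Longrightarrow> k < 2 ^ j \<Longrightarrow> t \<in> {0..1} \<Longrightarrow> \<Psi> j k t \<noteq> 0 \<Longrightarrow> \<bar>2 ^ j * t - ctr j k\<bar> \<le> K0" and
    ctr: "\<And>j k. j0 \<le> j \<Longrightarrow> k < 2 ^ j \<Longrightarrow> - u0 \<le> ctr j k \<and> ctr j k \<le> 2 ^ j + u0" and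
    overlap: "\<And>j x X. j0 \<le> j \<Longrightarrow> 0 \<le> X \<Longrightarrow> real (card {k\<in>{..<2 ^ j}. \<bar>x - ctr j k\<bar> \<le> X}) \<le> real n0 + 2 * X + 1"
    by (rule \<Psi>_bounds) blast
  \<comment> \<open>From level j2 on, an interval of length 2 m K0 / 2^j fits into [0, 1]; the
    finitely many lower levels are excluded by j1.\<close>
  obtain j2 :: nat where j2: "2 * real m * K0 \<le> 2 ^ j2"
    using real_arch_pow[of 2 "2 * real m * K0"] by (auto intro: less_imp_le)
  define j1 where "j1 = max j0 j2"
  \<comment> \<open>Half of the gap between s and 1 / p' pays for the weights of the dyadic chain;
    the other half leaves a convergent series, see \<open>expo\<close>.\<close>
  define \<delta> where "\<delta> = (s - 1 / p') / 2"
  have \<delta>: "0 < \<delta>" using p' by (simp add: \<delta>_def)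
  define Kf where "Kf = real m * (2 * (real m * (2 * real m + 1) ^ m * (2 ^ m + 1) ^ (2 * m))) *
      (2 * (1 / (1 - 2 powr (- \<delta>))) powr p') powr (1 / p')"
  have Kf: "0 \<le> Kf" by (simp add: Kf_def)
  define X where "X = 2 * real m * K0 + u0 + K0"
  have X0: "0 \<le> X" using K0 u0 by (simp add: X_def)
  define Ov where "Ov = real n0 + 2 * X + 1"
  have Ov: "0 \<le> Ov" using X0 by (simp add: Ov_def)
  define \<rho> :: real where "\<rho> = 2 powr (\<delta> * p' + 1 - s * p')"
  have expo: "\<delta> * p' + 1 - s * p' < 0"
  proof -
    have "1 < s * p'" using p' by (simp add: field_simps)
    moreover have "\<delta> * p' = (s * p' - 1) / 2" using p' by (simp add: \<delta>_def field_simps)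
    ultimately show ?thesis by simp
  qed
  have \<rho>: "0 < \<rho>" "\<rho> < 1" using expo by (auto simp: \<rho>_def powr_less_one)
  define Q where "Q = (Kf * \<Gamma>) powr p' * (2 * K0) powr (p' - 1 + s * p') * (K powr p' * (Ov + 1) / (1 - \<rho>))"
  have Q: "0 \<le> Q" using Ov \<rho> unfolding Q_def by (intro mult_nonneg_nonneg divide_nonneg_nonneg) auto
  \<comment> \<open>The added 1 makes B positive even if Q vanishes.\<close>
  define B where "B = Q powr (1 / p') + 1"
  show ?thesis
  proof (rule that[of p' B j1])
    show "0 < p'" "1 / p' < s" by (fact p')+
    show "0 < B" by (simp add: B_def add_nonneg_pos)
    show "j0 \<le> j1" by (simp add: j1_def)
    fix f j assume fB: "f \<in> besov_ball s p q M" and j1j: "j1 \<le> j"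
    have f: "f \<in> L2_unit" using fB by (simp add: besov_ball_def)
    have j: "j0 \<le> j" "j2 \<le> j" using j1j by (auto simp: j1_def)
    \<comment> \<open>A single cell already has the length of the region carrying a wavelet; m cells
      are taken because interpolation on the coarsest lattice uses m nodes.\<close>
    define h0 where "h0 = 2 * K0 / 2 ^ j"
    have h0: "0 < h0" using K0 by (simp add: h0_def)
    have mh0: "real m * h0 \<le> 1"
    proof -
      have "(2::real) ^ j2 \<le> 2 ^ j" using j(2) by (rule power_increasing) simp
      with j2 have "2 * real m * K0 \<le> 2 ^ j" by (rule order_trans)
      then show ?thesis by (simp add: h0_def field_simps)
    qed
    have h02: "2 ^ j * h0 = 2 * K0" by (simp add: h0_def)
    define f' where "f' x = indicator {0..1} x * f x" for x
    have f'm [measurable]: "f' \<in> borel_measurable borel" unfolding f'_def[abs_def] by (rule borel_extension[OF f])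
    \<comment> \<open>The left end of the region carrying the wavelet, clipped so that the whole
      interval stays in [0, 1]; \<open>Acase\<close> lists the three outcomes.\<close>
    define A where "A k = max 0 (min ((ctr j k - K0) / 2 ^ j) (1 - real m * h0))" for k
    define I where "I k = {A k..A k + real m * h0}" for k
    have A: "0 \<le> A k" "A k + real m * h0 \<le> 1" for k using mh0 by (auto simp: A_def)
    have m1: "1 \<le> real m" using m by simp
    have mK: "2 * K0 \<le> 2 ^ j * (real m * h0)"
    proof -
      have "1 * (2 * K0) \<le> real m * (2 ^ j * h0)" unfolding h02 using m1 K0 by (intro mult_right_mono) auto
      then show ?thesis by (simp add: mult_ac)
    qed
    have mK': "2 ^ j * (real m * h0) = 2 * real m * K0" by (simp add: h0_def)
    have Acase: "A k = 0 \<and> ctr j k \<le> K0 \<or> A k = 1 - real m * h0 \<and> 2 ^ j - 2 * real m * K0 \<le> ctr j k - K0 \<or> 2 ^ j * A k = ctr j k - K0" for k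
    proof (cases "ctr j k \<le> K0")
      case True
      then have "(ctr j k - K0) / 2 ^ j \<le> 0" by (simp add: divide_le_0_iff)
      then show ?thesis using True mh0 by (auto simp: A_def min_def max_def)
    next
      case False
      then have nn: "0 \<le> (ctr j k - K0) / 2 ^ j" by simp
      show ?thesis
      proof (cases "(ctr j k - K0) / 2 ^ j \<le> 1 - real m * h0")
        case True
        then have "A k = (ctr j k - K0) / 2 ^ j" using nn by (simp add: A_def)
        then show ?thesis by simp
      next
        case False
        then have "A k = 1 - real m * h0" using mh0 by (simp add: A_def)
        moreover have "2 ^ j * (1 - real m * h0) \<le> 2 ^ j * ((ctr j k - K0) / 2 ^ j)" using False by (intro mult_left_mono) auto
        moreover have "2 ^ j * ((ctr j k - K0) / 2 ^ j) = ctr j k - K0" by simp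
        moreover have "2 ^ j * (1 - real m * h0) = 2 ^ j - 2 * real m * K0" by (simp only: right_diff_distrib mult_1_right mK')
        ultimately show ?thesis by simp
      qed
    qed
    have scale: "2 ^ j * x \<le> 2 ^ j * y \<longleftrightarrow> x \<le> y" for x y :: real by simp
    have suppI: "t \<in> I k" if k: "k < 2 ^ j" and t: "t \<in> {0..1}" and nz: "\<Psi> j k t \<noteq> 0" for k t
    proof -
      have c: "\<bar>2 ^ j * t - ctr j k\<bar> \<le> K0" by (rule supp[OF j(1) k t nz])
      have e: "2 ^ j * (A k + real m * h0) = 2 ^ j * A k + 2 ^ j * (real m * h0)" by (rule distrib_left)
      have "2 ^ j * A k \<le> 2 ^ j * t \<and> 2 ^ j * t \<le> 2 ^ j * (A k + real m * h0)"
        using Acase[of k]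
      proof (elim disjE conjE)
        assume a: "A k = 0" "ctr j k \<le> K0"
        have "2 ^ j * A k = 0" "0 \<le> 2 ^ j * t" using a t by auto
        then show ?thesis using a c mK unfolding e by linarith
      next
        assume a: "A k = 1 - real m * h0" "2 ^ j - 2 * real m * K0 \<le> ctr j k - K0"
        then have "2 ^ j * A k = 2 ^ j - 2 * real m * K0" by (simp only: right_diff_distrib mult_1_right mK')
        moreover have "2 ^ j * t \<le> 2 ^ j * 1" using t by (intro mult_left_mono) auto
        ultimately show ?thesis using a c unfolding e mK' by linarith
      next
        assume "2 ^ j * A k = ctr j k - K0"
        then show ?thesis using c mK unfolding e by linarith
      qed
      then show ?thesis unfolding scale I_def by simp
    qed
    have overlapI: "\<bar>2 ^ j * x - ctr j k\<bar> \<le> X" if k: "k < 2 ^ j" and x: "x \<in> I k" for k x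
    proof -
      have b: "2 ^ j * A k \<le> 2 ^ j * x" "2 ^ j * x \<le> 2 ^ j * (A k + real m * h0)" using x unfolding scale I_def by auto
      have e: "2 ^ j * (A k + real m * h0) = 2 ^ j * A k + 2 * real m * K0" unfolding distrib_left mK' ..
      have mK0: "0 \<le> 2 * real m * K0" using K0 by simp
      note c = ctr[OF j(1) k]
      show ?thesis using Acase[of k]
      proof (elim disjE conjE)
        assume a: "A k = 0" "ctr j k \<le> K0"
        then have "2 ^ j * A k = 0" by simp
        then have "0 \<le> 2 ^ j * x" "2 ^ j * x \<le> 2 * real m * K0" using b e by linarith+
        then show ?thesis using a c u0 K0 mK0 unfolding X_def by linarith
      next
        assume a: "A k = 1 - real m * h0" "2 ^ j - 2 * real m * K0 \<le> ctr j k - K0"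
        then have "2 ^ j * A k = 2 ^ j - 2 * real m * K0" by (simp only: right_diff_distrib mult_1_right mK')
        then show ?thesis using a b c e u0 K0 mK0 unfolding X_def by linarith
      next
        assume "2 ^ j * A k = ctr j k - K0"
        then show ?thesis using b e u0 K0 mK0 unfolding X_def by linarith
      qed
    qed
    define w where "w l = ennreal (2 powr (\<delta> * p' * real l) * 2 ^ l)" for l :: nat
    define D where "D l x = ennreal (\<bar>fin_diff m (h0 / 2 ^ l) f' x\<bar> powr p')" for l x
    have [measurable]: "D l \<in> borel_measurable borel" for l unfolding D_def[abs_def] by measurable
    \<comment> \<open>The differences of all mesh sizes, with their weights, form one density. Its
      integral over \<open>I k\<close> bounds what the coefficient k needs, and adding over k costs
      only the overlap of these intervals.\<close>
    define G where "G x = (\<Sum>l. w l * (D l x * indicator {0..1 - real m * (h0 / 2 ^ l)} x))" for x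
    have [measurable]: "G \<in> borel_measurable borel" unfolding G_def[abs_def] by measurable
    define S where "S = K powr p' * h0 powr (s * p') / (1 - \<rho>)"
    have S: "0 < S" using K h0 \<rho> by (simp add: S_def)
    have Dint: "(\<integral>\<^sup>+x\<in>{0..1 - real m * (h0 / 2 ^ l)}. D l x \<partial>lborel) \<le> ennreal ((K * (h0 / 2 ^ l) powr s) powr p')" for l
    proof -
      have h: "0 < h0 / 2 ^ l" using h0 by simp
      have "fin_diff m (h0 / 2 ^ l) f' x = fin_diff m (h0 / 2 ^ l) f x" if x: "x \<in> {0..1 - real m * (h0 / 2 ^ l)}" for x
      proof (rule fin_diff_cong)
        fix i assume "i \<le> m"
        then have "real i * (h0 / 2 ^ l) \<le> real m * (h0 / 2 ^ l)" by (intro mult_right_mono less_imp_le[OF h]) simp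
        moreover have "0 \<le> real i * (h0 / 2 ^ l)" by (intro mult_nonneg_nonneg less_imp_le[OF h]) simp
        ultimately have "x + real i * (h0 / 2 ^ l) \<in> {0..1}" using x unfolding atLeastAtMost_iff by linarith
        then show "f' (x + real i * (h0 / 2 ^ l)) = f (x + real i * (h0 / 2 ^ l))" by (simp add: f'_def)
      qed
      then have "(\<integral>\<^sup>+x\<in>{0..1 - real m * (h0 / 2 ^ l)}. D l x \<partial>lborel) =
          (\<integral>\<^sup>+x\<in>{0..1 - real m * (h0 / 2 ^ l)}. ennreal (\<bar>fin_diff m (h0 / 2 ^ l) f x\<bar> powr p') \<partial>lborel)"
        unfolding D_def by (intro nn_integral_cong) (auto simp: indicator_def)
      then show ?thesis using diff[OF fB h] by simp
    qed
    have Gint: "(\<integral>\<^sup>+x. G x \<partial>lborel) \<le> ennreal S"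
    proof -
      have weight: "w l * ennreal ((K * (h0 / 2 ^ l) powr s) powr p') = ennreal (K powr p' * h0 powr (s * p') * \<rho> ^ l)" for l
      proof -
        have "(K * (h0 / 2 ^ l) powr s) powr p' = K powr p' * (h0 powr (s * p') * 2 powr (- (real l * (s * p'))))"
        proof -
          have pw: "h0 / 2 ^ l = h0 * 2 powr (- real l)" by (simp add: powr_minus powr_realpow divide_inverse)
          show ?thesis unfolding pw using K h0 by (simp add: powr_mult powr_powr mult_ac)
        qed
        moreover have "2 powr (\<delta> * p' * real l) * 2 ^ l * 2 powr (- (real l * (s * p'))) = \<rho> ^ l"
        proof -
          have "\<rho> ^ l = 2 powr (\<delta> * p' * real l + real l + - (real l * (s * p')))"
            unfolding \<rho>_def by (simp add: powr_realpow[symmetric] powr_powr algebra_simps)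
          then show ?thesis by (simp only: powr_add powr_realpow zero_less_numeral)
        qed
        ultimately show ?thesis unfolding w_def by (simp add: ennreal_mult'[symmetric] mult_ac)
      qed
      have "(\<integral>\<^sup>+x. G x \<partial>lborel) = (\<Sum>l. \<integral>\<^sup>+x. w l * (D l x * indicator {0..1 - real m * (h0 / 2 ^ l)} x) \<partial>lborel)"
        unfolding G_def by (rule nn_integral_suminf) measurable
      also have "\<dots> = (\<Sum>l. w l * (\<integral>\<^sup>+x\<in>{0..1 - real m * (h0 / 2 ^ l)}. D l x \<partial>lborel))"
        by (intro suminf_cong nn_integral_cmult) measurable
      also have "\<dots> \<le> (\<Sum>l. ennreal (K powr p' * h0 powr (s * p') * \<rho> ^ l))"
        unfolding weight[symmetric] by (intro suminf_le mult_left_mono Dint) auto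
      also have "\<dots> = ennreal S"
      proof (rule suminf_ennreal_eq)
        show "0 \<le> K powr p' * h0 powr (s * p') * \<rho> ^ l" for l using \<rho> by simp
        have "(\<lambda>l. \<rho> ^ l) sums (1 / (1 - \<rho>))" using \<rho> by (intro geometric_sums) simp
        from sums_mult[OF this, of "K powr p' * h0 powr (s * p')"]
        show "(\<lambda>l. K powr p' * h0 powr (s * p') * \<rho> ^ l) sums S" by (simp add: S_def)
      qed
      finally show ?thesis .
    qed
    define IG where "IG k = (\<integral>\<^sup>+x\<in>I k. G x \<partial>lborel)" for k
    have Im [measurable]: "I k \<in> sets borel" for k by (simp add: I_def)
    have IGle: "IG k \<le> ennreal S" for k
    proof -
      have "IG k \<le> (\<integral>\<^sup>+x. G x \<partial>lborel)" unfolding IG_def by (intro nn_integral_mono) (auto simp: indicator_def)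
      then show ?thesis using Gint by (rule order_trans)
    qed
    \<comment> \<open>The second summand makes T k positive, as \<open>coefficient_bound\<close>
      requires, and contributes only S to the sum over k.\<close>
    define T where "T k = enn2real (IG k) + S / 2 ^ j" for k
    have T: "0 < T k" for k using S by (simp add: T_def add_nonneg_pos)
    have IGT: "IG k \<le> ennreal (T k)" for k
    proof -
      have "IG k = ennreal (enn2real (IG k))" using IGle[of k] by (metis ennreal_enn2real ennreal_less_top order_le_less_trans)
      also have "\<dots> \<le> ennreal (T k)" using S by (intro ennreal_leI) (simp add: T_def)
      finally show ?thesis .
    qed
    have Tsum: "(\<Sum>k<2 ^ j. T k) \<le> (Ov + 1) * S"
    proof -
      have "(\<Sum>k<2 ^ j. IG k) = (\<integral>\<^sup>+x. (\<Sum>k<2 ^ j. G x * indicator (I k) x) \<partial>lborel)"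
        unfolding IG_def by (rule nn_integral_sum[symmetric]) measurable
      also have "\<dots> \<le> (\<integral>\<^sup>+x. ennreal Ov * G x \<partial>lborel)"
      proof (rule nn_integral_mono)
        fix x
        have "(\<Sum>k<2 ^ j. G x * indicator (I k) x) = G x * of_nat (card {k\<in>{..<2 ^ j}. x \<in> I k})"
          by (simp add: sum_distrib_left[symmetric] indicator_def sum.If_cases Int_def)
        also have "\<dots> \<le> G x * ennreal Ov"
        proof (rule mult_left_mono)
          have "{k\<in>{..<2 ^ j}. x \<in> I k} \<subseteq> {k\<in>{..<2 ^ j}. \<bar>2 ^ j * x - ctr j k\<bar> \<le> X}" using overlapI by auto
          then have "card {k\<in>{..<2 ^ j}. x \<in> I k} \<le> card {k\<in>{..<2 ^ j}. \<bar>2 ^ j * x - ctr j k\<bar> \<le> X}" by (intro card_mono) auto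
          then have "real (card {k\<in>{..<2 ^ j}. x \<in> I k}) \<le> Ov" using overlap[OF j(1) X0, of "2 ^ j * x"] unfolding Ov_def by linarith
          then show "of_nat (card {k\<in>{..<2 ^ j}. x \<in> I k}) \<le> ennreal Ov" by (simp add: ennreal_of_nat_eq_real_of_nat ennreal_leI)
        qed simp
        finally show "(\<Sum>k<2 ^ j. G x * indicator (I k) x) \<le> ennreal Ov * G x" by (simp add: mult.commute)
      qed
      also have "\<dots> = ennreal Ov * (\<integral>\<^sup>+x. G x \<partial>lborel)" by (rule nn_integral_cmult) measurable
      also have "\<dots> \<le> ennreal Ov * ennreal S" using Gint by (intro mult_left_mono) auto
      also have "\<dots> = ennreal (Ov * S)" using Ov by (simp add: ennreal_mult')
      finally have "(\<Sum>k<2 ^ j. IG k) \<le> ennreal (Ov * S)" .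
      moreover have "(\<Sum>k<2 ^ j. IG k) = ennreal (\<Sum>k<2 ^ j. enn2real (IG k))"
      proof -
        have "IG k = ennreal (enn2real (IG k))" for k using IGle[of k] by (metis ennreal_enn2real ennreal_less_top order_le_less_trans)
        then show ?thesis by (subst sum_ennreal[symmetric]) auto
      qed
      ultimately have "(\<Sum>k<2 ^ j. enn2real (IG k)) \<le> Ov * S" using Ov S by (simp add: ennreal_le_iff)
      moreover have "(\<Sum>k<2 ^ j. T k) = (\<Sum>k<2 ^ j. enn2real (IG k)) + S" by (simp add: T_def sum.distrib)
      ultimately show ?thesis by (simp add: distrib_right)
    qed
    have coef: "\<bar>inner_unit f (\<Psi> j k)\<bar> \<le> Kf * (\<Gamma> * 2 powr (real j / 2) * h0 * (T k / h0) powr (1 / p'))" if k: "k < 2 ^ j" for k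
      unfolding Kf_def
    proof (rule coefficient_bound[OF f j(1) k m p'(1) \<delta> h0 A(1) A(2)])
      show "t \<in> {A k..A k + real m * h0}" if "t \<in> {0..1}" "\<Psi> j k t \<noteq> 0" for t
        using suppI[OF k that] by (simp add: I_def)
      show "\<bar>\<Psi> j k t\<bar> \<le> \<Gamma> * 2 powr (real j / 2)" if "t \<in> {0..1}" for t by (rule \<Gamma>[OF j(1) k that])
      show "0 < T k" by (rule T)
      fix L
      have "(\<Sum>l=1..L. ennreal (2 powr (\<delta> * p' * real l) * 2 ^ l) *
          (\<integral>\<^sup>+x\<in>{A k..A k + real m * h0 - real m * (h0 / 2 ^ l)}. ennreal (\<bar>fin_diff m (h0 / 2 ^ l) (\<lambda>x. indicator {0..1} x * f x) x\<bar> powr p') \<partial>lborel)) =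
        (\<Sum>l=1..L. \<integral>\<^sup>+x. w l * (D l x * indicator {A k..A k + real m * h0 - real m * (h0 / 2 ^ l)} x) \<partial>lborel)"
        unfolding w_def[symmetric] f'_def[abs_def, symmetric] D_def[symmetric]
        by (intro sum.cong refl nn_integral_cmult[symmetric]) measurable
      also have "\<dots> = (\<integral>\<^sup>+x. (\<Sum>l=1..L. w l * (D l x * indicator {A k..A k + real m * h0 - real m * (h0 / 2 ^ l)} x)) \<partial>lborel)"
        by (rule nn_integral_sum[symmetric]) measurable
      also have "\<dots> \<le> IG k" unfolding IG_def
      proof (rule nn_integral_mono)
        fix x
        show "(\<Sum>l=1..L. w l * (D l x * indicator {A k..A k + real m * h0 - real m * (h0 / 2 ^ l)} x)) \<le> G x * indicator (I k) x"
        proof (cases "x \<in> I k")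
          case False
          have "x \<notin> {A k..A k + real m * h0 - real m * (h0 / 2 ^ l)}" for l
          proof -
            have "0 \<le> real m * (h0 / 2 ^ l)" using h0 by simp
            then show ?thesis using False by (auto simp: I_def)
          qed
          then show ?thesis using False by simp
        next
          case True
          have "(\<Sum>l=1..L. w l * (D l x * indicator {A k..A k + real m * h0 - real m * (h0 / 2 ^ l)} x)) \<le>
              (\<Sum>l=1..L. w l * (D l x * indicator {0..1 - real m * (h0 / 2 ^ l)} x))"
            using A[of k] by (intro sum_mono mult_left_mono) (auto simp: indicator_def)
          also have "\<dots> \<le> G x" unfolding G_def by (intro sum_le_suminf) auto
          finally show ?thesis using True by simp
        qed
      qed
      also have "\<dots> \<le> ennreal (T k)" by (rule IGT)
      finally show "(\<Sum>l=1..L. ennreal (2 powr (\<delta> * p' * real l) * 2 ^ l) *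
          (\<integral>\<^sup>+x\<in>{A k..A k + real m * h0 - real m * (h0 / 2 ^ l)}. ennreal (\<bar>fin_diff m (h0 / 2 ^ l) (\<lambda>x. indicator {0..1} x * f x) x\<bar> powr p') \<partial>lborel)) \<le> ennreal (T k)" .
    qed
    have "(\<Sum>k<2 ^ j. \<bar>inner_unit f (\<Psi> j k)\<bar> powr p') \<le> (\<Sum>k<2 ^ j. (Kf * \<Gamma> * 2 powr (real j / 2) * h0) powr p' / h0 * T k)"
    proof (rule sum_mono)
      fix k :: nat assume "k \<in> {..<2 ^ j}"
      then have k: "k < 2 ^ j" by simp
      have "\<bar>inner_unit f (\<Psi> j k)\<bar> powr p' \<le> (Kf * (\<Gamma> * 2 powr (real j / 2) * h0 * (T k / h0) powr (1 / p'))) powr p'"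
        using coef[OF k] p' by (intro powr_mono2) auto
      also have "\<dots> = (Kf * \<Gamma> * 2 powr (real j / 2) * h0) powr p' * ((T k / h0) powr (1 / p')) powr p'"
        using Kf \<Gamma>0 h0 by (subst powr_mult[symmetric]) (auto simp: mult_ac)
      also have "((T k / h0) powr (1 / p')) powr p' = T k / h0" using p' T[of k] h0 by (simp add: powr_powr)
      finally show "\<bar>inner_unit f (\<Psi> j k)\<bar> powr p' \<le> (Kf * \<Gamma> * 2 powr (real j / 2) * h0) powr p' / h0 * T k" by simp
    qed
    also have "\<dots> = (Kf * \<Gamma> * 2 powr (real j / 2) * h0) powr p' / h0 * (\<Sum>k<2 ^ j. T k)" by (simp add: sum_distrib_left)
    also have "\<dots> \<le> (Kf * \<Gamma> * 2 powr (real j / 2) * h0) powr p' / h0 * ((Ov + 1) * S)"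
      using Tsum h0 by (intro mult_left_mono) auto
    \<comment> \<open>Per coefficient the powers are: 2^(j/2) from the size of the wavelet, h0 from
      the length of its interval, h0^(-1/p') from averaging over the offset, and h0^s from the
      differences. As h0 is a multiple of 2^(-j), the exponent is - j (s + 1/2 - 1/p').\<close>
    also have "\<dots> = Q * 2 powr (- real j * (s + 1 / 2 - 1 / p') * p')"
    proof -
      have h0p: "h0 powr x = (2 * K0) powr x * 2 powr (- real j * x)" for x
      proof -
        have pw: "h0 = 2 * K0 * 2 powr (- real j)" by (simp add: h0_def powr_minus powr_realpow divide_inverse)
        have "h0 powr x = (2 * K0) powr x * (2 powr (- real j)) powr x" unfolding pw using K0 by (subst powr_mult) auto
        then show ?thesis by (simp add: powr_powr)
      qed
      have e1: "(Kf * \<Gamma> * 2 powr (real j / 2) * h0) powr p' = (Kf * \<Gamma>) powr p' * (2 powr (real j / 2 * p') * h0 powr p')"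
        using Kf \<Gamma>0 h0 by (simp add: powr_mult powr_powr)
      have e2: "h0 powr p' / h0 * h0 powr (s * p') = h0 powr (p' - 1 + s * p')"
        using h0 by (simp add: powr_add powr_diff)
      have e3: "2 powr (real j / 2 * p') * 2 powr (- real j * (p' - 1 + s * p')) = 2 powr (- real j * (s + 1 / 2 - 1 / p') * p')"
      proof -
        have "real j / 2 * p' + - real j * (p' - 1 + s * p') = - real j * (s + 1 / 2 - 1 / p') * p'"
          using p' by (simp add: field_simps)
        then show ?thesis by (metis powr_add)
      qed
      have "(Kf * \<Gamma> * 2 powr (real j / 2) * h0) powr p' / h0 * ((Ov + 1) * S) =
          (Kf * \<Gamma>) powr p' * (2 powr (real j / 2 * p') * (h0 powr p' / h0 * h0 powr (s * p'))) * (K powr p' * (Ov + 1) / (1 - \<rho>))"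
        unfolding e1 S_def by (simp only: divide_inverse mult_ac)
      also have "\<dots> = (Kf * \<Gamma>) powr p' * (2 powr (real j / 2 * p') * h0 powr (p' - 1 + s * p')) * (K powr p' * (Ov + 1) / (1 - \<rho>))"
        unfolding e2 ..
      also have "2 powr (real j / 2 * p') * h0 powr (p' - 1 + s * p') =
          (2 * K0) powr (p' - 1 + s * p') * (2 powr (real j / 2 * p') * 2 powr (- real j * (p' - 1 + s * p')))"
        unfolding h0p[of "p' - 1 + s * p'"] by (simp only: mult_ac)
      also have "2 powr (real j / 2 * p') * 2 powr (- real j * (p' - 1 + s * p')) = 2 powr (- real j * (s + 1 / 2 - 1 / p') * p')" by (rule e3)
      finally show ?thesis unfolding Q_def by (simp only: mult_ac)
    qed
    also have "\<dots> \<le> (B * 2 powr (- real j * (s + 1 / 2 - 1 / p'))) powr p'"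
    proof -
      have "Q = (Q powr (1 / p')) powr p'" using p' Q by (simp add: powr_powr)
      also have "\<dots> \<le> B powr p'" using p' by (intro powr_mono2) (auto simp: B_def)
      finally have "Q * 2 powr (- real j * (s + 1 / 2 - 1 / p') * p') \<le> B powr p' * 2 powr (- real j * (s + 1 / 2 - 1 / p') * p')"
        by (intro mult_right_mono) auto
      also have "\<dots> = (B * 2 powr (- real j * (s + 1 / 2 - 1 / p'))) powr p'"
        by (subst powr_mult) (auto simp: powr_powr B_def)
      finally show ?thesis .
    qed
    finally show "(\<Sum>k<2 ^ j. \<bar>inner_unit f (\<Psi> j k)\<bar> powr p') \<le> (B * 2 powr (- real j * (s + 1 / 2 - 1 / p'))) powr p'" .
  qed
qed

end

subsection \<open>Risk of the estimator\<close>

lemma map_criterion_pen: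
  "map_criterion N v \<gamma> \<pi> y = (\<lambda>\<kappa>. (\<Sum>i=\<kappa>+1..N. (ord_abs N y i)\<^sup>2) + v * map_pen N \<gamma> \<pi> \<kappa>)"
  by (simp add: map_criterion_def map_pen_def fun_eq_iff)

text \<open>The selected number of coefficients need not depend measurably on the data, so the loss is
  only bounded above by a measurable function.\<close>
lemma level_risk:
  assumes \<gamma>m: "0 < \<gamma>min" "\<gamma>min \<le> \<gamma>max"
  obtains C where "0 < C"
    "\<And>(P::'a measure) W f \<epsilon> N g Y \<gamma> \<pi> \<kappa>h S. white_noise_coefficients P W f \<epsilon> N g Y \<Longrightarrow>
      \<gamma>min \<le> \<gamma> \<Longrightarrow> \<gamma> \<le> \<gamma>max \<Longrightarrow> set_pmf \<pi> = {0..N} \<Longrightarrow>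
      (\<And>y. is_arg_min (map_criterion N (\<epsilon>\<^sup>2) \<gamma> \<pi> y) (\<lambda>\<kappa>. \<kappa> \<le> N) (\<kappa>h y)) \<Longrightarrow> S \<subseteq> {..<N} \<Longrightarrow>
      \<exists>U\<in>borel_measurable P.
        (AE \<omega> in P. ennreal (\<Sum>k<N. (threshold N (\<kappa>h (\<lambda>k. Y k \<omega>)) (\<lambda>k. Y k \<omega>) k - inner_unit f (g k))\<^sup>2) \<le> U \<omega>) \<and>
        (\<integral>\<^sup>+\<omega>. U \<omega> \<partial>P) \<le>
          ennreal (C * ((\<Sum>k\<in>{..<N} - S. (inner_unit f (g k))\<^sup>2) + \<epsilon>\<^sup>2 * map_pen N \<gamma> \<pi> (card S) + \<epsilon>\<^sup>2))"
proof -
  obtain \<delta> K where \<delta>: "0 < \<delta>" "\<delta> \<le> 1 / 2" and K: "0 \<le> K" and dom: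
    "\<And>(M::'a measure) N z \<gamma> \<pi>. chi_square_family M N z \<Longrightarrow> \<gamma>min \<le> \<gamma> \<Longrightarrow> \<gamma> \<le> \<gamma>max \<Longrightarrow> set_pmf \<pi> = {0..N} \<Longrightarrow>
      (\<exists>R\<in>borel_measurable M. (\<forall>\<omega>. 0 \<le> R \<omega>) \<and>
        (\<forall>\<omega> S. S \<subseteq> {..<N} \<longrightarrow> (\<Sum>k\<in>S. (z k \<omega>)\<^sup>2) \<le> (1 - \<delta>) * map_pen N \<gamma> \<pi> (card S) + R \<omega>) \<and>
        (\<integral>\<^sup>+\<omega>. ennreal (R \<omega>) \<partial>M) \<le> ennreal K)"
    using noise_domination[OF \<gamma>m] by metis
  define C0 where "C0 = 2 / \<delta> * (1 + 2 / \<delta>)"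
  have C0: "0 < C0" using \<delta> by (simp add: C0_def add_pos_pos)
  show ?thesis
  \<comment> \<open>One unit for bias and penalty, six for the noise energy on S, which
    \<open>map_pen_ge\<close> compares with the penalty, and K for the excess.\<close>
  proof (rule that[of "C0 * (7 + K)"])
    show "0 < C0 * (7 + K)" using C0 K by simp
    fix P :: "'a measure" and W f \<epsilon> N g Y \<gamma> \<pi> \<kappa>h and S :: "nat set"
    assume wn: "white_noise_coefficients P W f \<epsilon> N g Y" and \<gamma>: "\<gamma>min \<le> \<gamma>" "\<gamma> \<le> \<gamma>max" and \<pi>: "set_pmf \<pi> = {0..N}"
      and min: "\<And>y. is_arg_min (map_criterion N (\<epsilon>\<^sup>2) \<gamma> \<pi> y) (\<lambda>\<kappa>. \<kappa> \<le> N) (\<kappa>h y)" and S: "S \<subseteq> {..<N}"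
    interpret white_noise_coefficients P W f \<epsilon> N g Y by fact
    interpret prob_space P by (rule prob)
    obtain R where R [measurable]: "R \<in> borel_measurable P" and R0: "\<And>\<omega>. 0 \<le> R \<omega>"
      and Rdom: "\<And>\<omega> S. S \<subseteq> {..<N} \<Longrightarrow> (\<Sum>k\<in>S. (z k \<omega>)\<^sup>2) \<le> (1 - \<delta>) * map_pen N \<gamma> \<pi> (card S) + R \<omega>"
      and RK: "(\<integral>\<^sup>+\<omega>. ennreal (R \<omega>) \<partial>P) \<le> ennreal K"
      using dom[OF chi_square_family_axioms \<gamma> \<pi>] by blast
    define \<theta> where "\<theta> k = inner_unit f (g k)" for k
    have cS: "card S \<le> N" using card_mono[OF _ S] by simp
    have \<gamma>0: "0 < \<gamma>" using \<gamma> \<gamma>m by simp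
    have \<pi>pos: "0 < pmf \<pi> \<kappa>" if "\<kappa> \<le> N" for \<kappa> using that \<pi> by (auto simp: pmf_positive_iff)
    have pen: "real \<kappa> \<le> map_pen N \<gamma> \<pi> \<kappa>" if "\<kappa> \<le> N" for \<kappa> using map_pen_ge[OF \<gamma>0 that \<pi>pos[OF that]] .
    define b where "b = (\<Sum>k\<in>{..<N} - S. (\<theta> k)\<^sup>2) + \<epsilon>\<^sup>2 * map_pen N \<gamma> \<pi> (card S)"
    have pen0: "0 \<le> map_pen N \<gamma> \<pi> (card S)" using pen[OF cS] by linarith
    have b0: "0 \<le> b" unfolding b_def using pen0 by (intro add_nonneg_nonneg sum_nonneg mult_nonneg_nonneg) auto
    define U where "U \<omega> = ennreal (C0 * b) + ennreal (C0 * \<epsilon>\<^sup>2) * (ennreal (\<Sum>k\<in>S. (z k \<omega>)\<^sup>2) + ennreal (R \<omega>))" for \<omega>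
    have pointwise: "AE \<omega> in P. ennreal (\<Sum>k<N. (threshold N (\<kappa>h (\<lambda>k. Y k \<omega>)) (\<lambda>k. Y k \<omega>) k - \<theta> k)\<^sup>2) \<le> U \<omega>"
      using AE_no_ties
    proof eventually_elim
      case (elim \<omega>)
      define y where "y k = Y k \<omega>" for k
      have sq: "(\<Sum>k\<in>A. (\<epsilon> * z k \<omega>)\<^sup>2) = \<epsilon>\<^sup>2 * (\<Sum>k\<in>A. (z k \<omega>)\<^sup>2)" for A
        by (simp add: power_mult_distrib sum_distrib_left)
      have "(\<Sum>k<N. (threshold N (\<kappa>h y) y k - \<theta> k)\<^sup>2) \<le>
          C0 * ((\<Sum>k\<in>{..<N} - S. (\<theta> k)\<^sup>2) + \<epsilon>\<^sup>2 * map_pen N \<gamma> \<pi> (card S) + (\<Sum>k\<in>S. (\<epsilon> * z k \<omega>)\<^sup>2) + \<epsilon>\<^sup>2 * R \<omega>)"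
        unfolding C0_def
      proof (rule penalized_selection_loss[OF _ _ _ \<delta>, where pen = "\<lambda>\<kappa>. \<epsilon>\<^sup>2 * map_pen N \<gamma> \<pi> \<kappa>"])
        show "inj_on (\<lambda>k. \<bar>y k\<bar>) {..<N}" using elim by (simp add: y_def)
        show "y k = \<theta> k + \<epsilon> * z k \<omega>" for k by (simp add: y_def \<theta>_def Y_eq)
        show "is_arg_min (\<lambda>\<kappa>. (\<Sum>i=\<kappa>+1..N. (ord_abs N y i)\<^sup>2) + \<epsilon>\<^sup>2 * map_pen N \<gamma> \<pi> \<kappa>) (\<lambda>\<kappa>. \<kappa> \<le> N) (\<kappa>h y)"
          using min[of y] unfolding map_criterion_pen .
        show "(\<Sum>k\<in>S. (\<epsilon> * z k \<omega>)\<^sup>2) \<le> (1 - \<delta>) * (\<epsilon>\<^sup>2 * map_pen N \<gamma> \<pi> (card S)) + \<epsilon>\<^sup>2 * R \<omega>" if "S \<subseteq> {..<N}" for S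
          unfolding sq using mult_left_mono[OF Rdom[OF that, of \<omega>], of "\<epsilon>\<^sup>2"] by (simp add: algebra_simps)
        show "0 \<le> \<epsilon>\<^sup>2 * map_pen N \<gamma> \<pi> \<kappa>" if "\<kappa> \<le> N" for \<kappa>
          using pen[OF that] by (intro mult_nonneg_nonneg) auto
        show "0 \<le> \<epsilon>\<^sup>2 * R \<omega>" using R0 by simp
      qed (fact S)
      also have "\<dots> = C0 * b + C0 * \<epsilon>\<^sup>2 * ((\<Sum>k\<in>S. (z k \<omega>)\<^sup>2) + R \<omega>)"
        unfolding sq b_def by (simp add: algebra_simps)
      finally have "ennreal (\<Sum>k<N. (threshold N (\<kappa>h y) y k - \<theta> k)\<^sup>2) \<le>
          ennreal (C0 * b + C0 * \<epsilon>\<^sup>2 * ((\<Sum>k\<in>S. (z k \<omega>)\<^sup>2) + R \<omega>))" by (rule ennreal_leI)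
      also have "\<dots> = ennreal (C0 * b) + ennreal (C0 * \<epsilon>\<^sup>2 * ((\<Sum>k\<in>S. (z k \<omega>)\<^sup>2) + R \<omega>))"
        using C0 b0 R0 by (intro ennreal_plus mult_nonneg_nonneg add_nonneg_nonneg sum_nonneg) auto
      also have "ennreal (C0 * \<epsilon>\<^sup>2 * ((\<Sum>k\<in>S. (z k \<omega>)\<^sup>2) + R \<omega>)) =
          ennreal (C0 * \<epsilon>\<^sup>2) * (ennreal (\<Sum>k\<in>S. (z k \<omega>)\<^sup>2) + ennreal (R \<omega>))"
        using C0 R0 by (subst ennreal_plus[symmetric]) (auto simp: ennreal_mult' sum_nonneg)
      finally show ?case by (simp add: y_def U_def)
    qed
    have Em: "(\<lambda>\<omega>. \<Sum>k\<in>S. (z k \<omega>)\<^sup>2) \<in> borel_measurable P" by (rule energy_meas[OF S])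
    have Um: "U \<in> borel_measurable P" unfolding U_def using Em by measurable
    have "(\<integral>\<^sup>+\<omega>. U \<omega> \<partial>P) = ennreal (C0 * b) + ennreal (C0 * \<epsilon>\<^sup>2) * ((\<integral>\<^sup>+\<omega>. ennreal (\<Sum>k\<in>S. (z k \<omega>)\<^sup>2) \<partial>P) + (\<integral>\<^sup>+\<omega>. ennreal (R \<omega>) \<partial>P))"
      unfolding U_def using Em by (simp add: nn_integral_add nn_integral_cmult emeasure_space_1)
    also have "\<dots> \<le> ennreal (C0 * b) + ennreal (C0 * \<epsilon>\<^sup>2) * (ennreal (6 * real (card S)) + ennreal K)"
      using nn_integral_energy_le[OF S] RK by (intro add_left_mono mult_left_mono add_mono) auto
    also have "\<dots> = ennreal (C0 * b + C0 * \<epsilon>\<^sup>2 * (6 * real (card S) + K))"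
    proof -
      have "ennreal (6 * real (card S)) + ennreal K = ennreal (6 * real (card S) + K)" using K by (intro ennreal_plus[symmetric]) auto
      then show ?thesis using C0 K b0 by (simp add: ennreal_mult'[symmetric] ennreal_plus[symmetric] del: ennreal_plus)
    qed
    also have "\<dots> \<le> ennreal (C0 * (7 + K) * (b + \<epsilon>\<^sup>2))"
    proof (rule ennreal_leI)
      have "\<epsilon>\<^sup>2 * real (card S) \<le> \<epsilon>\<^sup>2 * map_pen N \<gamma> \<pi> (card S)" using pen[OF cS] by (intro mult_left_mono) auto
      also have "\<dots> \<le> b" unfolding b_def by (simp add: sum_nonneg)
      finally have 1: "\<epsilon>\<^sup>2 * real (card S) \<le> b" .
      have "b + \<epsilon>\<^sup>2 * (6 * real (card S) + K) = b + 6 * (\<epsilon>\<^sup>2 * real (card S)) + K * \<epsilon>\<^sup>2" by (simp add: algebra_simps)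
      also have "\<dots> \<le> 7 * b + K * \<epsilon>\<^sup>2" using 1 by simp
      also have "\<dots> \<le> (7 + K) * (b + \<epsilon>\<^sup>2)" using K b0 by (simp add: algebra_simps)
      finally have "C0 * (b + \<epsilon>\<^sup>2 * (6 * real (card S) + K)) \<le> C0 * ((7 + K) * (b + \<epsilon>\<^sup>2))" using C0 by (intro mult_left_mono) auto
      then show "C0 * b + C0 * \<epsilon>\<^sup>2 * (6 * real (card S) + K) \<le> C0 * (7 + K) * (b + \<epsilon>\<^sup>2)"
        by (simp only: distrib_left[of C0 b "\<epsilon>\<^sup>2 * _"] mult.assoc)
    qed
    finally have "(\<integral>\<^sup>+\<omega>. U \<omega> \<partial>P) \<le> ennreal (C0 * (7 + K) * (b + \<epsilon>\<^sup>2))" .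
    with Um pointwise show "\<exists>U\<in>borel_measurable P.
        (AE \<omega> in P. ennreal (\<Sum>k<N. (threshold N (\<kappa>h (\<lambda>k. Y k \<omega>)) (\<lambda>k. Y k \<omega>) k - inner_unit f (g k))\<^sup>2) \<le> U \<omega>) \<and>
        (\<integral>\<^sup>+\<omega>. U \<omega> \<partial>P) \<le>
          ennreal (C0 * (7 + K) * ((\<Sum>k\<in>{..<N} - S. (inner_unit f (g k))\<^sup>2) + \<epsilon>\<^sup>2 * map_pen N \<gamma> \<pi> (card S) + \<epsilon>\<^sup>2))"
      unfolding \<theta>_def b_def by blast
  qed
qed

section \<open>Sparse approximation and upper bounds for the penalty\<close>

lemma sum_squares_le_powr:
  fixes \<theta> :: "'b \<Rightarrow> real"
  assumes "\<And>k. k \<in> A \<Longrightarrow> \<bar>\<theta> k\<bar> \<le> \<mu>" "p \<le> 2"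
  shows "(\<Sum>k\<in>A. (\<theta> k)\<^sup>2) \<le> \<mu> powr (2 - p) * (\<Sum>k\<in>A. \<bar>\<theta> k\<bar> powr p)"
  unfolding sum_distrib_left
proof (rule sum_mono)
  fix k assume k: "k \<in> A"
  show "(\<theta> k)\<^sup>2 \<le> \<mu> powr (2 - p) * \<bar>\<theta> k\<bar> powr p"
  proof (cases "\<theta> k = 0")
    case False
    then have "(\<theta> k)\<^sup>2 = \<bar>\<theta> k\<bar> powr (2 - p) * \<bar>\<theta> k\<bar> powr p"
      by (simp add: powr_add[symmetric])
    also have "\<dots> \<le> \<mu> powr (2 - p) * \<bar>\<theta> k\<bar> powr p"
      using assms k by (intro mult_right_mono powr_mono2) auto
    finally show ?thesis .
  qed simp
qed

lemma sum_squares_le_of_powr_sum: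
  fixes \<theta> :: "'b \<Rightarrow> real"
  assumes p: "0 < p" "p \<le> 2" and A: "0 < A" and fin: "finite I" and sum: "(\<Sum>k\<in>I. \<bar>\<theta> k\<bar> powr p) \<le> A powr p"
  shows "(\<Sum>k\<in>I. (\<theta> k)\<^sup>2) \<le> A\<^sup>2"
proof -
  have le: "\<bar>\<theta> k\<bar> \<le> A" if "k \<in> I" for k
  proof -
    have "\<bar>\<theta> k\<bar> powr p \<le> (\<Sum>k\<in>I. \<bar>\<theta> k\<bar> powr p)" using that fin by (intro member_le_sum) auto
    with sum have "\<bar>\<theta> k\<bar> powr p \<le> A powr p" by linarith
    then show ?thesis using p A powr_less_mono2[of p A "\<bar>\<theta> k\<bar>"] by linarith
  qed
  have "(\<Sum>k\<in>I. (\<theta> k)\<^sup>2) \<le> A powr (2 - p) * (\<Sum>k\<in>I. \<bar>\<theta> k\<bar> powr p)"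
    using le p by (intro sum_squares_le_powr) auto
  also have "\<dots> \<le> A powr (2 - p) * A powr p" using sum by (intro mult_left_mono) auto
  also have "\<dots> = A\<^sup>2" using A by (simp add: powr_add[symmetric])
  finally show ?thesis .
qed

text \<open>Keep the coefficients above A y^(-1/p): at most y of them can exist, and the squares of
  the others are bounded through their p-th powers. The size bound y is real and may be below 1, in
  which case S is empty.\<close>

lemma sparse_approximation:
  fixes \<theta> :: "nat \<Rightarrow> real"
  assumes p: "0 < p" "p \<le> 2" and A: "0 < A" and y: "0 < y" and sum: "(\<Sum>k<N. \<bar>\<theta> k\<bar> powr p) \<le> A powr p"
  obtains S where "S \<subseteq> {..<N}" "real (card S) \<le> y" "(\<Sum>k\<in>{..<N} - S. (\<theta> k)\<^sup>2) \<le> A\<^sup>2 * y powr (1 - 2 / p)"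
proof -
  define \<mu> where "\<mu> = A * y powr (- 1 / p)"
  have \<mu>: "0 < \<mu>" using A y by (simp add: \<mu>_def)
  have \<mu>p: "\<mu> powr p = A powr p / y"
  proof -
    have "\<mu> powr p = A powr p * y powr (- 1 / p * p)" unfolding \<mu>_def using A y by (simp only: powr_mult powr_powr)
    then show ?thesis using p y by (simp add: powr_minus divide_inverse)
  qed
  define S where "S = {k\<in>{..<N}. \<mu> < \<bar>\<theta> k\<bar>}"
  show ?thesis
  proof (rule that)
    show "S \<subseteq> {..<N}" by (auto simp: S_def)
    have "real (card S) * \<mu> powr p = (\<Sum>k\<in>S. \<mu> powr p)" by simp
    also have "\<dots> \<le> (\<Sum>k\<in>S. \<bar>\<theta> k\<bar> powr p)"
      using \<mu> p by (intro sum_mono powr_mono2) (auto simp: S_def)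
    also have "\<dots> \<le> (\<Sum>k<N. \<bar>\<theta> k\<bar> powr p)" by (intro sum_mono2) (auto simp: S_def)
    also note sum
    finally have "real (card S) * (A powr p / y) \<le> A powr p" by (simp add: \<mu>p)
    then have "real (card S) * A powr p \<le> y * A powr p" using y by (simp add: field_simps)
    then show "real (card S) \<le> y" using A by simp
    have "(\<Sum>k\<in>{..<N} - S. (\<theta> k)\<^sup>2) \<le> \<mu> powr (2 - p) * (\<Sum>k\<in>{..<N} - S. \<bar>\<theta> k\<bar> powr p)"
      using p by (intro sum_squares_le_powr) (auto simp: S_def)
    also have "\<dots> \<le> \<mu> powr (2 - p) * A powr p"
      using sum by (intro mult_left_mono order_trans[OF sum_mono2 sum]) auto
    finally have "(\<Sum>k\<in>{..<N} - S. (\<theta> k)\<^sup>2) \<le> \<mu> powr (2 - p) * A powr p" .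
    also have "\<dots> = (A powr (2 - p) * A powr p) * y powr (- 1 / p * (2 - p))"
      using A y by (simp add: \<mu>_def powr_mult powr_powr)
    also have "A powr (2 - p) * A powr p = A\<^sup>2" using A by (simp add: powr_add[symmetric])
    also have "- 1 / p * (2 - p) = 1 - 2 / p" using p by (simp add: field_simps)
    finally show "(\<Sum>k\<in>{..<N} - S. (\<theta> k)\<^sup>2) \<le> A\<^sup>2 * y powr (1 - 2 / p)" .
  qed
qed

text \<open>With x = \<kappa> / N, the term of index \<kappa> in the expansion of (1 + x)^N is at
  most exp (N x) = exp \<kappa>.\<close>

lemma ln_binomial_le:
  assumes "1 \<le> \<kappa>" "\<kappa> \<le> N"
  shows "ln (real (N choose \<kappa>)) \<le> real \<kappa> * (1 + ln (real N / real \<kappa>))"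
proof -
  define x where "x = real \<kappa> / real N"
  have x: "0 < x" using assms by (simp add: x_def)
  have "real (N choose \<kappa>) * x ^ \<kappa> \<le> (\<Sum>i\<le>N. real (N choose i) * x ^ i)"
    using assms x by (intro member_le_sum[where f = "\<lambda>i. real (N choose i) * x ^ i"]) auto
  also have "\<dots> = (x + 1) ^ N" by (simp add: binomial_ring)
  also have "\<dots> \<le> exp x ^ N" using x exp_ge_add_one_self[of x] by (intro power_mono) (auto simp: add.commute)
  also have "\<dots> = exp (real N * x)" by (simp add: exp_of_nat_mult)
  also have "real N * x = real \<kappa>" using assms by (simp add: x_def)
  finally have le: "real (N choose \<kappa>) * x ^ \<kappa> \<le> exp (real \<kappa>)" .
  have pos: "0 < real (N choose \<kappa>)" using assms by (simp add: zero_less_binomial_iff)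
  then have "ln (real (N choose \<kappa>) * x ^ \<kappa>) \<le> ln (exp (real \<kappa>))" using le x by (intro ln_mono) auto
  then have "ln (real (N choose \<kappa>)) + real \<kappa> * ln x \<le> real \<kappa>" using pos x by (simp add: ln_mult ln_realpow)
  moreover have "ln x = - ln (real N / real \<kappa>)" using assms by (simp add: x_def ln_div)
  ultimately show ?thesis by (simp add: algebra_simps)
qed

text \<open>Allows the size of the comparison set in the penalty to be replaced by its upper bound
  y; the inequality ln u \<le> u - 1 takes the place of differentiation.\<close>

lemma entropy_mono:
  fixes x y N :: real
  assumes "0 < x" "x \<le> y" "y \<le> N"
  shows "x * (1 + ln (N / x)) \<le> y * (1 + ln (N / y))"
proof -
  have "ln (y / x) \<le> y / x - 1" using assms by (intro ln_le_minus_one) auto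
  then have "x * ln (y / x) \<le> x * (y / x - 1)" using assms by (intro mult_left_mono) auto
  then have 1: "x * ln (y / x) \<le> y - x" using assms by (simp add: right_diff_distrib)
  have 2: "x * ln (N / y) \<le> y * ln (N / y)" using assms by (intro mult_right_mono) auto
  have "ln (N / x) = ln (N / y) + ln (y / x)" using assms by (simp add: ln_div)
  then have "x * (1 + ln (N / x)) = x + x * ln (y / x) + x * ln (N / y)" by (simp add: algebra_simps)
  also have "\<dots> \<le> y + y * ln (N / y)" using 1 2 by linarith
  finally show ?thesis by (simp add: algebra_simps)
qed

lemma map_pen_le:
  assumes \<gamma>: "0 < \<gamma>min" "\<gamma>min \<le> \<gamma>" "\<gamma> \<le> \<gamma>max" and \<kappa>: "\<kappa> \<le> N" and \<pi>: "exp (- L) \<le> pmf \<pi> \<kappa>" and L: "0 \<le> L"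
  shows "map_pen N \<gamma> \<pi> \<kappa> \<le> 2 * (1 + 1 / \<gamma>min) * (ln (real (N choose \<kappa>)) + L + real \<kappa> * \<gamma>max)"
proof -
  have pos: "0 < pmf \<pi> \<kappa>" using \<pi> exp_gt_zero[of "- L"] by linarith
  have "- L \<le> ln (pmf \<pi> \<kappa>)" using \<pi> pos by (simp add: ln_ge_iff)
  moreover have "ln (1 + \<gamma>) / 2 \<le> \<gamma>max" using ln_add_one_self_le_self[of \<gamma>] \<gamma> by linarith
  then have "real \<kappa> * (ln (1 + \<gamma>) / 2) \<le> real \<kappa> * \<gamma>max" by (intro mult_left_mono) auto
  ultimately have "ln (real (N choose \<kappa>)) + (- ln (pmf \<pi> \<kappa>)) + real \<kappa> * (ln (1 + \<gamma>) / 2) \<le>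
      ln (real (N choose \<kappa>)) + L + real \<kappa> * \<gamma>max" by linarith
  moreover have "0 \<le> ln (real (N choose \<kappa>)) + L + real \<kappa> * \<gamma>max" using ln_binomial_nonneg[OF \<kappa>] L \<gamma>
    by (intro add_nonneg_nonneg mult_nonneg_nonneg) auto
  moreover have "0 < \<gamma>" using \<gamma> by simp
  moreover have "2 * (1 + 1 / \<gamma>) \<le> 2 * (1 + 1 / \<gamma>min)" using \<gamma> by (simp add: frac_le)
  ultimately show ?thesis unfolding map_pen_eq[OF \<open>0 < \<gamma>\<close> \<kappa> pos]
    by (intro order_trans[OF mult_left_mono mult_right_mono]) (use \<gamma> in auto)
qed

section \<open>Geometric sums over the levels\<close>

lemma geometric_sum_from:
  fixes q :: real
  assumes "0 \<le> q" "q < 1"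
  shows "(\<Sum>j=m..<J. q ^ (j - m)) \<le> 1 / (1 - q)"
proof -
  have "(\<Sum>j=m..<J. q ^ (j - m)) = (\<Sum>i<J - m. q ^ i)"
    by (rule sum.reindex_bij_witness[of _ "\<lambda>i. i + m" "\<lambda>j. j - m"]) auto
  also have "\<dots> = (1 - q ^ (J - m)) / (1 - q)" using assms by (simp add: sum_gp_strict)
  also have "\<dots> \<le> 1 / (1 - q)" using assms by (intro divide_right_mono) auto
  finally show ?thesis .
qed

lemma sum_powr_decay_le:
  fixes \<eta> x :: real
  assumes \<eta>: "0 < \<eta>" and x: "0 \<le> x"
  shows "(\<Sum>j | j < J \<and> x < real j. 2 powr (- \<eta> * (real j - x))) \<le> 1 / (1 - 2 powr (- \<eta>))"
proof -
  define m where "m = nat \<lceil>x\<rceil>"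
  have q: "0 \<le> 2 powr (- \<eta>)" "2 powr (- \<eta>) < (1::real)" using \<eta> powr_less_mono[of "- \<eta>" 0 2] by auto
  have "(\<Sum>j | j < J \<and> x < real j. 2 powr (- \<eta> * (real j - x))) \<le> (\<Sum>j=m..<J. 2 powr (- \<eta> * (real j - x)))"
    by (intro sum_mono2) (auto simp: m_def nat_le_iff ceiling_le_iff)
  also have "\<dots> \<le> (\<Sum>j=m..<J. (2 powr (- \<eta>)) ^ (j - m))"
  proof (rule sum_mono)
    fix j assume j: "j \<in> {m..<J}"
    have "x \<le> real m" unfolding m_def by linarith
    then have "\<eta> * (real j - real m) \<le> \<eta> * (real j - x)" using \<eta> by (intro mult_left_mono) auto
    then have "2 powr (- \<eta> * (real j - x)) \<le> 2 powr (- \<eta> * real (j - m))" using j by (intro powr_mono) (auto simp: of_nat_diff)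
    also have "\<dots> = (2 powr (- \<eta>)) ^ (j - m)" unfolding powr_powr[symmetric] by (simp add: powr_realpow)
    finally show "2 powr (- \<eta> * (real j - x)) \<le> (2 powr (- \<eta>)) ^ (j - m)" .
  qed
  also have "\<dots> \<le> 1 / (1 - 2 powr (- \<eta>))" using q by (rule geometric_sum_from)
  finally show ?thesis .
qed

lemma sum_power2_le:
  fixes x :: real
  assumes "0 \<le> x"
  shows "(\<Sum>j | j < J \<and> real j \<le> x. 2 ^ j) \<le> 2 * 2 powr x"
proof -
  define m where "m = nat \<lfloor>x\<rfloor>"
  have "(\<Sum>j | j < J \<and> real j \<le> x. 2 ^ j) \<le> (\<Sum>j<Suc m. (2::real) ^ j)"
    using assms by (intro sum_mono2) (auto simp: m_def le_nat_iff le_floor_iff less_Suc_eq_le)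
  also have "\<dots> = 2 ^ Suc m - 1" by (induction m) auto
  also have "\<dots> \<le> 2 * 2 powr real m" by (simp add: powr_realpow)
  also have "\<dots> \<le> 2 * 2 powr x" using assms by (intro mult_left_mono powr_mono) (auto simp: m_def)
  finally show ?thesis .
qed

text \<open>If everything is kept, the binomial coefficient is 1 and the prior costs at most c0 N,
  so the penalty is linear in N without a logarithm.\<close>

lemma full_level_cost:
  assumes \<gamma>: "0 < \<gamma>min" "\<gamma>min \<le> \<gamma>" "\<gamma> \<le> \<gamma>max" and c0: "0 \<le> c0" and \<pi>: "exp (- c0 * real N) \<le> pmf \<pi> N"
  shows "map_pen N \<gamma> \<pi> N \<le> 2 * (1 + 1 / \<gamma>min) * (c0 + \<gamma>max) * real N"
proof -
  have "map_pen N \<gamma> \<pi> N \<le> 2 * (1 + 1 / \<gamma>min) * (ln (real (N choose N)) + c0 * real N + real N * \<gamma>max)"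
    using c0 \<pi> by (intro map_pen_le[OF \<gamma>]) auto
  also have "ln (real (N choose N)) + c0 * real N + real N * \<gamma>max = (c0 + \<gamma>max) * real N" by (simp add: algebra_simps)
  finally show ?thesis by (simp only: mult.assoc)
qed

text \<open>The conditions on the prior bound - ln of its masses by a multiple of \<kappa> ln (2^j /
  \<kappa>), the same order as the binomial term, so the penalty has the order of the entropy. For
  \<kappa> = 0 there is no entropy to compare with, whence the summand j.\<close>

lemma sparse_level_cost:
  assumes \<gamma>: "0 < \<gamma>min" "\<gamma>min \<le> \<gamma>" "\<gamma> \<le> \<gamma>max" and c: "0 \<le> c1" "0 \<le> c2"
    and \<pi>0: "2 powr (- c1 * real j) \<le> pmf \<pi> 0"
    and \<pi>: "\<And>\<kappa>. 1 \<le> \<kappa> \<Longrightarrow> real \<kappa> \<le> y \<Longrightarrow> (real \<kappa> / 2 ^ j) powr (c2 * real \<kappa>) \<le> pmf \<pi> \<kappa>"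
    and \<kappa>: "real \<kappa> \<le> y" and y: "0 < y" "y \<le> 2 ^ j"
  shows "map_pen (2 ^ j) \<gamma> \<pi> \<kappa> \<le> 2 * (1 + 1 / \<gamma>min) * (1 + c1 + c2 + \<gamma>max) * (y * (1 + ln (2 ^ j / y)) + real j)"
proof -
  define E where "E = y * (1 + ln (2 ^ j / y))"
  have \<gamma>0: "0 \<le> \<gamma>max" using \<gamma> by linarith
  have E0: "0 \<le> E" using y by (simp add: E_def)
  have "map_pen (2 ^ j) \<gamma> \<pi> \<kappa> \<le> 2 * (1 + 1 / \<gamma>min) * ((1 + c1 + c2 + \<gamma>max) * (E + real j))"
  proof (cases "\<kappa> = 0")
    case True
    have "2 powr (- c1 * real j) = exp (- (c1 * real j * ln 2))" by (simp add: powr_def)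
    then have "map_pen (2 ^ j) \<gamma> \<pi> 0 \<le> 2 * (1 + 1 / \<gamma>min) * (ln (real (2 ^ j choose 0)) + c1 * real j * ln 2 + real 0 * \<gamma>max)"
      using \<pi>0 c by (intro map_pen_le[OF \<gamma>]) auto
    also have "\<dots> \<le> 2 * (1 + 1 / \<gamma>min) * ((1 + c1 + c2 + \<gamma>max) * (E + real j))"
    proof (rule mult_left_mono)
      have "c1 * real j * ln 2 \<le> c1 * real j * 1" using c ln_2_less_1 by (intro mult_left_mono) auto
      also have "\<dots> \<le> (1 + c1 + c2 + \<gamma>max) * (E + real j)" using c \<gamma>0 E0 unfolding mult_1_right by (intro mult_mono) auto
      finally show "ln (real (2 ^ j choose 0)) + c1 * real j * ln 2 + real 0 * \<gamma>max \<le> (1 + c1 + c2 + \<gamma>max) * (E + real j)" by simp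
      show "0 \<le> 2 * (1 + 1 / \<gamma>min)" using \<gamma> by simp
    qed
    finally show ?thesis using True by simp
  next
    case False
    then have \<kappa>1: "1 \<le> \<kappa>" by simp
    define H where "H = real \<kappa> * (1 + ln (2 ^ j / real \<kappa>))"
    have "real \<kappa> \<le> 2 ^ j" using \<kappa> y by linarith
    then have \<kappa>j: "\<kappa> \<le> 2 ^ j" by (metis of_nat_le_iff of_nat_numeral of_nat_power)
    have HE: "H \<le> E" unfolding H_def E_def using \<kappa>1 \<kappa> y by (intro entropy_mono) auto
    have ln0: "0 \<le> ln (2 ^ j / real \<kappa>)" using \<kappa>1 \<open>real \<kappa> \<le> 2 ^ j\<close> by simp
    have \<kappa>H: "real \<kappa> \<le> H" "real \<kappa> * ln (2 ^ j / real \<kappa>) \<le> H" using ln0 by (auto simp: H_def algebra_simps)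
    have "(real \<kappa> / 2 ^ j) powr (c2 * real \<kappa>) = exp (- (c2 * (real \<kappa> * ln (2 ^ j / real \<kappa>))))"
      using \<kappa>1 by (simp add: powr_def ln_div algebra_simps)
    then have "map_pen (2 ^ j) \<gamma> \<pi> \<kappa> \<le> 2 * (1 + 1 / \<gamma>min) *
        (ln (real (2 ^ j choose \<kappa>)) + c2 * (real \<kappa> * ln (2 ^ j / real \<kappa>)) + real \<kappa> * \<gamma>max)"
      using \<pi>[OF \<kappa>1 \<kappa>] c ln0 \<kappa>j by (intro map_pen_le[OF \<gamma>]) auto
    also have "\<dots> \<le> 2 * (1 + 1 / \<gamma>min) * ((1 + c1 + c2 + \<gamma>max) * (E + real j))"
    proof (rule mult_left_mono)
      have 1: "ln (real (2 ^ j choose \<kappa>)) \<le> H" using ln_binomial_le[OF \<kappa>1 \<kappa>j] by (simp add: H_def)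
      have 2: "c2 * (real \<kappa> * ln (2 ^ j / real \<kappa>)) \<le> c2 * H" using c \<kappa>H by (intro mult_left_mono) auto
      have 3: "real \<kappa> * \<gamma>max \<le> \<gamma>max * H" using \<kappa>H \<gamma>0 unfolding mult.commute[of "real \<kappa>"] by (intro mult_left_mono)
      have H0: "0 \<le> H" using \<kappa>H by linarith
      have "H + c2 * H + \<gamma>max * H = (1 + c2 + \<gamma>max) * H" by (simp add: algebra_simps)
      also have "\<dots> \<le> (1 + c1 + c2 + \<gamma>max) * (E + real j)" using c \<gamma>0 HE H0 by (intro mult_mono) auto
      finally show "ln (real (2 ^ j choose \<kappa>)) + c2 * (real \<kappa> * ln (2 ^ j / real \<kappa>)) + real \<kappa> * \<gamma>max \<le> (1 + c1 + c2 + \<gamma>max) * (E + real j)"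
        using 1 2 3 by linarith
      show "0 \<le> 2 * (1 + 1 / \<gamma>min)" using \<gamma> by simp
    qed
    finally show ?thesis .
  qed
  then show ?thesis unfolding E_def by (simp only: mult.assoc)
qed

text \<open>The bound \<open>y\<close> on the number of retained coefficients decreases faster than \<open>2\<^sup>j\<close> grows, which makes
  the penalties summable; \<open>a w < 2 s\<close> keeps the bias summable as well.  The level \<open>x\<close> is the one where
  bias and variance balance.\<close>
lemma level_cost:
  fixes s w :: real
  assumes s: "0 < s" and w: "0 \<le> w" "w < 2 * s" and B: "0 < B" and \<gamma>m: "0 < \<gamma>min" "\<gamma>min \<le> \<gamma>max"
    and c: "0 \<le> c1" "0 \<le> c2" "0 < c\<alpha>"
  obtains K \<eta> D :: real where "0 < K" "0 < \<eta>" "0 \<le> D"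
    "\<And>\<gamma> \<pi> (\<theta> :: nat \<Rightarrow> real) v x j. \<gamma>min \<le> \<gamma> \<Longrightarrow> \<gamma> \<le> \<gamma>max \<Longrightarrow> 2 powr (- c1 * real j) \<le> pmf \<pi> 0 \<Longrightarrow>
      (\<And>\<kappa>. 1 \<le> \<kappa> \<Longrightarrow> real \<kappa> \<le> c\<alpha> * 2 ^ j \<Longrightarrow> (real \<kappa> / 2 ^ j) powr (c2 * real \<kappa>) \<le> pmf \<pi> \<kappa>) \<Longrightarrow>
      (\<Sum>k<2 ^ j. \<bar>\<theta> k\<bar> powr (2 / (1 + w))) \<le> (B * 2 powr (- real j * (s - w / 2))) powr (2 / (1 + w)) \<Longrightarrow>
      0 \<le> v \<Longrightarrow> x + D < real j \<Longrightarrow>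
      \<exists>S\<subseteq>{..<2 ^ j}. (\<Sum>k\<in>{..<2 ^ j} - S. (\<theta> k)\<^sup>2) + v * map_pen (2 ^ j) \<gamma> \<pi> (card S) \<le>
        K * ((2 powr (- 2 * s * x) + v * 2 powr x) * 2 powr (- \<eta> * (real j - x)) + v * real j)"
proof -
  \<comment> \<open>Any a > 1 with a w < 2 s would serve; this choice also makes sense for w =
    0.\<close>
  define a where "a = 1 + (2 * s - w) / (2 * (w + 1))"
  have a: "1 < a" using w by (simp add: a_def)
  have aw: "a * w < 2 * s"
  proof -
    have "(2 * s - w) * (w / (2 * (w + 1))) < (2 * s - w) * 1" using w by (intro mult_strict_left_mono) (auto simp: field_simps)
    then show ?thesis by (simp add: a_def algebra_simps)
  qed
  \<comment> \<open>The number of retained coefficients is 2^x times 2^(-(a - 1) t), with t the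
    distance of j from x. Half of this decay absorbs the logarithmic factor 1 + a t.\<close>
  define \<eta>0 where "\<eta>0 = (a - 1) / 2"
  define \<eta> where "\<eta> = min (2 * s - a * w) \<eta>0"
  have \<eta>0: "0 < \<eta>0" using a by (simp add: \<eta>0_def)
  have \<eta>: "0 < \<eta>" "\<eta> \<le> 2 * s - a * w" "\<eta> \<le> \<eta>0" using aw \<eta>0 by (auto simp: \<eta>_def)
  define Ca where "Ca = 1 + 2 * a / \<eta>0"
  have Ca: "0 < Ca" "1 \<le> Ca" using a \<eta>0 by (auto simp: Ca_def intro!: add_pos_nonneg)
  define Cp where "Cp = 2 * (1 + 1 / \<gamma>min) * (1 + c1 + c2 + \<gamma>max)"
  have Cp: "0 < Cp" using \<gamma>m c by (simp add: Cp_def add_pos_nonneg)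
  \<comment> \<open>Beyond x + D the size bound y is at most c\<alpha> 2^j, the range in which the
    lower bound on the prior is available.\<close>
  define D where "D = max 0 (log 2 (1 / c\<alpha>))"
  have D: "0 \<le> D" by (simp add: D_def)
  define K where "K = B\<^sup>2 + Cp * Ca"
  have K: "0 < K" "B\<^sup>2 \<le> K" "Cp * Ca \<le> K" using B Cp Ca by (auto simp: K_def add_pos_pos)
  have "Cp * 1 \<le> Cp * Ca" using Cp Ca by (intro mult_left_mono) auto
  then have CpK: "Cp \<le> K" using K(3) by linarith
  show ?thesis
  proof (rule that[OF K(1) \<eta>(1) D])
    fix \<gamma> v x :: real and \<pi> :: "nat pmf" and \<theta> :: "nat \<Rightarrow> real" and j :: nat
    assume \<gamma>: "\<gamma>min \<le> \<gamma>" "\<gamma> \<le> \<gamma>max" and \<pi>0: "2 powr (- c1 * real j) \<le> pmf \<pi> 0"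
      and \<pi>: "\<And>\<kappa>. 1 \<le> \<kappa> \<Longrightarrow> real \<kappa> \<le> c\<alpha> * 2 ^ j \<Longrightarrow> (real \<kappa> / 2 ^ j) powr (c2 * real \<kappa>) \<le> pmf \<pi> \<kappa>"
      and \<theta>: "(\<Sum>k<2 ^ j. \<bar>\<theta> k\<bar> powr (2 / (1 + w))) \<le> (B * 2 powr (- real j * (s - w / 2))) powr (2 / (1 + w))"
      and v: "0 \<le> v" and x: "x + D < real j"
    define t where "t = real j - x"
    have t: "0 \<le> t" "D \<le> t" using x D by (auto simp: t_def)
    define y where "y = 2 powr (real j - a * t)"
    have y0: "0 < y" by (simp add: y_def)
    have at: "t \<le> a * t" using a t by (simp add: mult_le_cancel_right1)
    have y_eq: "y = 2 powr (- a * t) * 2 ^ j" by (simp add: y_def powr_diff powr_minus powr_realpow divide_inverse mult.commute)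
    have "2 powr (- a * t) \<le> 2 powr (- log 2 (1 / c\<alpha>))"
      using at t by (intro powr_mono) (auto simp: D_def)
    also have "\<dots> = c\<alpha>" using c by (simp add: powr_minus)
    finally have yc: "y \<le> c\<alpha> * 2 ^ j" unfolding y_eq by (intro mult_right_mono) auto
    have "2 powr (- a * t) \<le> 2 powr 0" using at t by (intro powr_mono) auto
    then have y1: "y \<le> 2 ^ j" unfolding y_eq by simp
    obtain S where S: "S \<subseteq> {..<2 ^ j}" "real (card S) \<le> y"
      and bias: "(\<Sum>k\<in>{..<2 ^ j} - S. (\<theta> k)\<^sup>2) \<le> (B * 2 powr (- real j * (s - w / 2)))\<^sup>2 * y powr (1 - 2 / (2 / (1 + w)))"
    proof (rule sparse_approximation[OF _ _ _ y0 \<theta>])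
      show "0 < 2 / (1 + w)" "2 / (1 + w) \<le> 2" using w by (auto simp: field_simps)
      show "0 < B * 2 powr (- real j * (s - w / 2))" using B by simp
    qed
    have w': "1 - 2 / (2 / (1 + w)) = - w" using w by (simp add: field_simps)
    \<comment> \<open>Inserting y and j = x + t, the exponent becomes - 2 s x - (2 s - a w) t; the
      contributions w j cancel.\<close>
    have "(B * 2 powr (- real j * (s - w / 2)))\<^sup>2 * y powr (1 - 2 / (2 / (1 + w))) =
        B\<^sup>2 * (2 powr (- real j * (s - w / 2) * 2) * 2 powr ((real j - a * t) * (- w)))"
      unfolding w' by (simp add: power_mult_distrib y_def powr_powr powr_power mult.commute)
    also have "\<dots> = B\<^sup>2 * (2 powr (- 2 * s * x) * 2 powr (- (2 * s - a * w) * t))"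
      unfolding powr_add[symmetric] by (simp add: t_def algebra_simps)
    also have "\<dots> \<le> K * (2 powr (- 2 * s * x) * 2 powr (- \<eta> * t))"
    proof -
      have "2 powr (- (2 * s - a * w) * t) \<le> 2 powr (- \<eta> * t)"
        using mult_right_mono[OF \<eta>(2) t(1)] by (intro powr_mono) (auto simp only: mult_minus_left)
      then show ?thesis using K by (intro mult_mono[of "B\<^sup>2"] mult_left_mono) auto
    qed
    finally have bias': "(\<Sum>k\<in>{..<2 ^ j} - S. (\<theta> k)\<^sup>2) \<le> K * (2 powr (- 2 * s * x) * 2 powr (- \<eta> * t))" using bias by linarith
    have "map_pen (2 ^ j) \<gamma> \<pi> (card S) \<le> Cp * (y * (1 + ln (2 ^ j / y)) + real j)"
      unfolding Cp_def using \<gamma>m(1) \<gamma> c(1,2) \<pi>0 _ S(2) y0 y1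
    proof (rule sparse_level_cost)
      show "(real \<kappa> / 2 ^ j) powr (c2 * real \<kappa>) \<le> pmf \<pi> \<kappa>" if "1 \<le> \<kappa>" "real \<kappa> \<le> y" for \<kappa>
        using that yc by (intro \<pi>) auto
    qed
    moreover have "y * (1 + ln (2 ^ j / y)) \<le> Ca * (2 powr x * 2 powr (- \<eta> * t))"
    proof -
      have "2 ^ j / y = 2 powr (a * t)" by (simp add: y_def powr_diff powr_realpow)
      then have "ln (2 ^ j / y) = a * t * ln 2" by simp
      also have "\<dots> \<le> a * t * 1" using a t ln_2_less_1 by (intro mult_left_mono) auto
      finally have 1: "1 + ln (2 ^ j / y) \<le> 1 + a * t" by simp
      have "1 + \<eta>0 * t * (1 / 2) \<le> 1 + \<eta>0 * t * ln 2" using \<eta>0 t ln2_ge_two_thirds by (intro add_left_mono mult_left_mono) auto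
      also have "\<dots> \<le> exp (\<eta>0 * t * ln 2)" by (rule exp_ge_add_one_self)
      also have "\<dots> = 2 powr (\<eta>0 * t)" by (simp add: powr_def)
      finally have 2: "1 + \<eta>0 * t * (1 / 2) \<le> 2 powr (\<eta>0 * t)" .
      have "1 + a * t \<le> Ca * (1 + \<eta>0 * t * (1 / 2))"
      proof -
        have "Ca * (1 + \<eta>0 * t * (1 / 2)) = 1 + a * t + (2 * a / \<eta>0 + \<eta>0 * t / 2)" using \<eta>0 by (simp add: Ca_def field_simps)
        moreover have "0 \<le> 2 * a / \<eta>0 + \<eta>0 * t / 2" using a \<eta>0 t by simp
        ultimately show ?thesis by linarith
      qed
      also have "\<dots> \<le> Ca * 2 powr (\<eta>0 * t)" using 2 Ca by (intro mult_left_mono) auto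
      finally have "1 + ln (2 ^ j / y) \<le> Ca * 2 powr (\<eta>0 * t)" using 1 by linarith
      then have "y * (1 + ln (2 ^ j / y)) \<le> y * (Ca * 2 powr (\<eta>0 * t))" using y0 by (intro mult_left_mono) auto
      also have "\<dots> = Ca * (2 powr (real j - a * t) * 2 powr (\<eta>0 * t))" by (simp add: y_def)
      also have "\<dots> = Ca * (2 powr x * 2 powr (- \<eta>0 * t))"
        unfolding powr_add[symmetric] by (simp add: t_def \<eta>0_def field_simps)
      also have "\<dots> \<le> Ca * (2 powr x * 2 powr (- \<eta> * t))"
        using \<eta> t Ca by (intro mult_left_mono powr_mono) (auto intro: mult_right_mono)
      finally show ?thesis .
    qed
    ultimately have "map_pen (2 ^ j) \<gamma> \<pi> (card S) \<le> Cp * (Ca * (2 powr x * 2 powr (- \<eta> * t)) + real j)"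
      using Cp by (meson add_right_mono less_imp_le mult_left_mono order_trans)
    also have "\<dots> = (Cp * Ca) * (2 powr x * 2 powr (- \<eta> * t)) + Cp * real j" by (simp add: algebra_simps)
    also have "\<dots> \<le> K * (2 powr x * 2 powr (- \<eta> * t)) + K * real j" using K CpK by (intro add_mono mult_right_mono) auto
    finally have "v * map_pen (2 ^ j) \<gamma> \<pi> (card S) \<le> v * (K * (2 powr x * 2 powr (- \<eta> * t)) + K * real j)"
      using v by (intro mult_left_mono)
    with bias' have "(\<Sum>k\<in>{..<2 ^ j} - S. (\<theta> k)\<^sup>2) + v * map_pen (2 ^ j) \<gamma> \<pi> (card S) \<le>
        K * (2 powr (- 2 * s * x) * 2 powr (- \<eta> * t)) + v * (K * (2 powr x * 2 powr (- \<eta> * t)) + K * real j)" by linarith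
    also have "\<dots> = K * ((2 powr (- 2 * s * x) + v * 2 powr x) * 2 powr (- \<eta> * (real j - x)) + v * real j)"
      unfolding t_def by (simp only: algebra_simps)
    finally show "\<exists>S\<subseteq>{..<2 ^ j}. (\<Sum>k\<in>{..<2 ^ j} - S. (\<theta> k)\<^sup>2) + v * map_pen (2 ^ j) \<gamma> \<pi> (card S) \<le>
        K * ((2 powr (- 2 * s * x) + v * 2 powr x) * 2 powr (- \<eta> * (real j - x)) + v * real j)" using S(1) by blast
  qed
qed

text \<open>Up to level x + D the comparison set is everything: no bias, and nothing is asked of the
  coefficients there. This matters because the Besov bound on them starts only at some level j1,
  which lies below x once the sample size is large.\<close>

lemma level_cost_cases:
  fixes s w :: real
  assumes s: "0 < s" and w: "0 \<le> w" "w < 2 * s" and B: "0 < B" and \<gamma>m: "0 < \<gamma>min" "\<gamma>min \<le> \<gamma>max"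
    and c: "0 < c0" "0 \<le> c1" "0 \<le> c2" "0 < c\<alpha>"
  obtains K \<eta> D :: real where "0 < K" "0 < \<eta>" "0 \<le> D"
    "\<And>\<gamma> \<pi> (\<theta> :: nat \<Rightarrow> real) v x j. \<gamma>min \<le> \<gamma> \<Longrightarrow> \<gamma> \<le> \<gamma>max \<Longrightarrow> 2 powr (- c1 * real j) \<le> pmf \<pi> 0 \<Longrightarrow>
      (\<And>\<kappa>. 1 \<le> \<kappa> \<Longrightarrow> real \<kappa> \<le> c\<alpha> * 2 ^ j \<Longrightarrow> (real \<kappa> / 2 ^ j) powr (c2 * real \<kappa>) \<le> pmf \<pi> \<kappa>) \<Longrightarrow>
      exp (- c0 * 2 ^ j) \<le> pmf \<pi> (2 ^ j) \<Longrightarrow>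
      (x + D < real j \<Longrightarrow>
        (\<Sum>k<2 ^ j. \<bar>\<theta> k\<bar> powr (2 / (1 + w))) \<le> (B * 2 powr (- real j * (s - w / 2))) powr (2 / (1 + w))) \<Longrightarrow>
      0 \<le> v \<Longrightarrow>
      \<exists>S\<subseteq>{..<2 ^ j}. (\<Sum>k\<in>{..<2 ^ j} - S. (\<theta> k)\<^sup>2) + v * map_pen (2 ^ j) \<gamma> \<pi> (card S) \<le>
        K * (if real j \<le> x + D then v * 2 ^ j
          else (2 powr (- 2 * s * x) + v * 2 powr x) * 2 powr (- \<eta> * (real j - x)) + v * real j)"
proof -
  obtain K \<eta> D :: real where K: "0 < K" and \<eta>: "0 < \<eta>" and D: "0 \<le> D" and sparse:
    "\<And>\<gamma> \<pi> (\<theta> :: nat \<Rightarrow> real) v x j. \<gamma>min \<le> \<gamma> \<Longrightarrow> \<gamma> \<le> \<gamma>max \<Longrightarrow> 2 powr (- c1 * real j) \<le> pmf \<pi> 0 \<Longrightarrow>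
      (\<And>\<kappa>. 1 \<le> \<kappa> \<Longrightarrow> real \<kappa> \<le> c\<alpha> * 2 ^ j \<Longrightarrow> (real \<kappa> / 2 ^ j) powr (c2 * real \<kappa>) \<le> pmf \<pi> \<kappa>) \<Longrightarrow>
      (\<Sum>k<2 ^ j. \<bar>\<theta> k\<bar> powr (2 / (1 + w))) \<le> (B * 2 powr (- real j * (s - w / 2))) powr (2 / (1 + w)) \<Longrightarrow>
      0 \<le> v \<Longrightarrow> x + D < real j \<Longrightarrow>
      \<exists>S\<subseteq>{..<2 ^ j}. (\<Sum>k\<in>{..<2 ^ j} - S. (\<theta> k)\<^sup>2) + v * map_pen (2 ^ j) \<gamma> \<pi> (card S) \<le>
        K * ((2 powr (- 2 * s * x) + v * 2 powr x) * 2 powr (- \<eta> * (real j - x)) + v * real j)"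
    by (rule level_cost[OF s w B \<gamma>m c(2-4)]) blast
  define Kf where "Kf = 2 * (1 + 1 / \<gamma>min) * (c0 + \<gamma>max)"
  have Kf: "0 \<le> Kf" using \<gamma>m c by (simp add: Kf_def)
  show ?thesis
  proof (rule that[of "K + Kf", OF _ \<eta> D])
    show "0 < K + Kf" using K Kf by simp
    fix \<gamma> v x :: real and \<pi> :: "nat pmf" and \<theta> :: "nat \<Rightarrow> real" and j :: nat
    assume \<gamma>: "\<gamma>min \<le> \<gamma>" "\<gamma> \<le> \<gamma>max" and \<pi>0: "2 powr (- c1 * real j) \<le> pmf \<pi> 0"
      and \<pi>: "\<And>\<kappa>. 1 \<le> \<kappa> \<Longrightarrow> real \<kappa> \<le> c\<alpha> * 2 ^ j \<Longrightarrow> (real \<kappa> / 2 ^ j) powr (c2 * real \<kappa>) \<le> pmf \<pi> \<kappa>"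
      and \<pi>N: "exp (- c0 * 2 ^ j) \<le> pmf \<pi> (2 ^ j)"
      and \<theta>: "x + D < real j \<Longrightarrow>
        (\<Sum>k<2 ^ j. \<bar>\<theta> k\<bar> powr (2 / (1 + w))) \<le> (B * 2 powr (- real j * (s - w / 2))) powr (2 / (1 + w))"
      and v: "0 \<le> v"
    show "\<exists>S\<subseteq>{..<2 ^ j}. (\<Sum>k\<in>{..<2 ^ j} - S. (\<theta> k)\<^sup>2) + v * map_pen (2 ^ j) \<gamma> \<pi> (card S) \<le>
        (K + Kf) * (if real j \<le> x + D then v * 2 ^ j
          else (2 powr (- 2 * s * x) + v * 2 powr x) * 2 powr (- \<eta> * (real j - x)) + v * real j)"
    proof (cases "real j \<le> x + D")
      case True
      have "map_pen (2 ^ j) \<gamma> \<pi> (2 ^ j) \<le> Kf * real (2 ^ j)"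
        unfolding Kf_def using \<pi>N c by (intro full_level_cost[OF \<gamma>m(1) \<gamma>]) auto
      then have "v * map_pen (2 ^ j) \<gamma> \<pi> (2 ^ j) \<le> v * (Kf * 2 ^ j)" using v by (intro mult_left_mono) auto
      also have "\<dots> = Kf * (v * 2 ^ j)" by simp
      also have "\<dots> \<le> (K + Kf) * (v * 2 ^ j)" using K v by (intro mult_right_mono) auto
      finally show ?thesis using True by (intro exI[of _ "{..<2 ^ j}"]) simp
    next
      case False
      then have "x + D < real j" by simp
      from sparse[OF \<gamma> \<pi>0 \<pi> \<theta>[OF this] v this] obtain S where S: "S \<subseteq> {..<2 ^ j}"
        "(\<Sum>k\<in>{..<2 ^ j} - S. (\<theta> k)\<^sup>2) + v * map_pen (2 ^ j) \<gamma> \<pi> (card S) \<le>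
        K * ((2 powr (- 2 * s * x) + v * 2 powr x) * 2 powr (- \<eta> * (real j - x)) + v * real j)" by blast
      have "K * ((2 powr (- 2 * s * x) + v * 2 powr x) * 2 powr (- \<eta> * (real j - x)) + v * real j) \<le>
        (K + Kf) * ((2 powr (- 2 * s * x) + v * 2 powr x) * 2 powr (- \<eta> * (real j - x)) + v * real j)"
        using Kf v by (intro mult_right_mono) auto
      then show ?thesis unfolding if_not_P[OF False] using S by (meson order_trans)
    qed
  qed
qed

text \<open>The level x is chosen with J = (2 s + 1) x, so that v 2^x and 2^(-2 s x) agree up to the
  factor \<sigma>^2. The coarse levels sum to a multiple of the former, the geometric decay of the
  fine levels to a multiple of both; the terms v j and v are of lower order.\<close>

lemma level_bounds_sum:
  fixes s \<sigma> K \<eta> D :: real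
  assumes s: "0 < s" and K: "0 < K" and \<eta>: "0 < \<eta>" and D: "0 \<le> D"
  obtains K1 where "0 < K1"
    "\<And>J x v. x = real J / (2 * s + 1) \<Longrightarrow> v = \<sigma>\<^sup>2 / 2 ^ J \<Longrightarrow> v \<le> K1 * 2 powr (- 2 * s * x)"
    "\<And>J j0 x v. x = real J / (2 * s + 1) \<Longrightarrow> v = \<sigma>\<^sup>2 / 2 ^ J \<Longrightarrow>
      (\<Sum>j=j0..<J. K * (if real j \<le> x + D then v * 2 ^ j
          else (2 powr (- 2 * s * x) + v * 2 powr x) * 2 powr (- \<eta> * (real j - x)) + v * real j) + v) \<le>
        K1 * 2 powr (- 2 * s * x)"
proof -
  define \<eta>' where "\<eta>' = ln 2 / (2 * s + 1)"
  have \<eta>': "0 < \<eta>'" using s by (simp add: \<eta>'_def)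
  define Cv where "Cv = \<sigma>\<^sup>2 * (2 * exp \<eta>' / \<eta>'\<^sup>2)"
  have Cv: "0 \<le> Cv" using \<eta>' by (simp add: Cv_def)
  define G where "G = 1 / (1 - 2 powr (- \<eta>))"
  have G: "0 \<le> G" using \<eta> powr_less_mono[of "- \<eta>" 0 2] by (simp add: G_def)
  define K1 where "K1 = 1 + Cv + (K * (\<sigma>\<^sup>2 * (2 * 2 powr D)) + K * (1 + \<sigma>\<^sup>2) * G + (K + 1) * Cv)"
  have "0 \<le> K * (\<sigma>\<^sup>2 * (2 * 2 powr D)) + K * (1 + \<sigma>\<^sup>2) * G + (K + 1) * Cv"
    using K G Cv by (intro add_nonneg_nonneg mult_nonneg_nonneg) auto
  then have K1: "0 < K1" "Cv \<le> K1" "K * (\<sigma>\<^sup>2 * (2 * 2 powr D)) + K * (1 + \<sigma>\<^sup>2) * G + (K + 1) * Cv \<le> K1"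
    using Cv by (auto simp: K1_def)
  have facts: "v * 2 powr x = \<sigma>\<^sup>2 * 2 powr (- 2 * s * x)" "v * (real J + 1)\<^sup>2 \<le> Cv * 2 powr (- 2 * s * x)" "0 \<le> v" "0 \<le> x" "v \<le> v * (real J + 1)\<^sup>2"
    if x: "x = real J / (2 * s + 1)" and v: "v = \<sigma>\<^sup>2 / 2 ^ J" for J x v
  proof -
    have Jx: "real J = (2 * s + 1) * x" using s x by simp
    show v0: "0 \<le> v" using v by simp
    show "0 \<le> x" using s x by simp
    have v_eq: "v = \<sigma>\<^sup>2 * 2 powr (- real J)" by (simp add: v powr_minus powr_realpow divide_inverse)
    show "v * 2 powr x = \<sigma>\<^sup>2 * 2 powr (- 2 * s * x)"
      unfolding v_eq mult.assoc powr_add[symmetric] Jx by (simp add: algebra_simps)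
    \<comment> \<open>The noise variance is smaller than the rate by the factor 2^(-x),
      exponentially small in J, which absorbs the square of the number of levels.\<close>
    have "2 powr (- real J) = 2 powr (- 2 * s * x) * 2 powr (- x)"
      unfolding powr_add[symmetric] Jx by (simp add: algebra_simps)
    also have "2 powr (- x) = exp (- \<eta>' * real J)" by (simp add: powr_def \<eta>'_def x)
    finally have "v * (real J + 1)\<^sup>2 = \<sigma>\<^sup>2 * 2 powr (- 2 * s * x) * ((real J + 1)\<^sup>2 * exp (- \<eta>' * real J))"
      unfolding v_eq by (simp only: ac_simps)
    also have "\<dots> \<le> \<sigma>\<^sup>2 * 2 powr (- 2 * s * x) * (2 * exp \<eta>' / \<eta>'\<^sup>2)"
      by (intro mult_left_mono polynomial_exp_bound \<eta>') auto
    also have "\<dots> = Cv * 2 powr (- 2 * s * x)" by (simp only: Cv_def ac_simps)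
    finally show "v * (real J + 1)\<^sup>2 \<le> Cv * 2 powr (- 2 * s * x)" .
    have "v * 1 \<le> v * (real J + 1)\<^sup>2" using v0 by (intro mult_left_mono) (auto intro: one_le_power)
    then show "v \<le> v * (real J + 1)\<^sup>2" by simp
  qed
  show ?thesis
  proof (rule that[OF K1(1)])
    fix J x v assume x: "x = real J / (2 * s + 1)" and v: "v = \<sigma>\<^sup>2 / 2 ^ J"
    have "v \<le> Cv * 2 powr (- 2 * s * x)" using facts[OF x v] by linarith
    also have "\<dots> \<le> K1 * 2 powr (- 2 * s * x)" using K1 by (intro mult_right_mono) auto
    finally show "v \<le> K1 * 2 powr (- 2 * s * x)" .
  next
    fix J j0 x v assume x: "x = real J / (2 * s + 1)" and v: "v = \<sigma>\<^sup>2 / 2 ^ J"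
    note F = facts[OF x v]
    define \<rho> where "\<rho> = 2 powr (- 2 * s * x)"
    have \<rho>: "0 < \<rho>" by (simp add: \<rho>_def)
    define b where "b j = K * (if real j \<le> x + D then v * 2 ^ j
          else (\<rho> + v * 2 powr x) * 2 powr (- \<eta> * (real j - x)) + v * real j) + v" for j
    define b1 where "b1 j = (if real j \<le> x + D then 2 ^ j else (0::real))" for j
    define b2 where "b2 j = (if x < real j then 2 powr (- \<eta> * (real j - x)) else 0)" for j
    have nn: "0 \<le> b1 j" "0 \<le> b2 j" for j by (auto simp: b1_def b2_def)
    \<comment> \<open>The contributions of the two cases are added, so that each can be summed
      separately over all j < J.\<close>
    have b: "b j \<le> K * v * b1 j + K * ((1 + \<sigma>\<^sup>2) * \<rho>) * b2 j + (K + 1) * (v * (real j + 1))" for j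
    proof (cases "real j \<le> x + D")
      case True
      have "0 \<le> K * ((1 + \<sigma>\<^sup>2) * \<rho>) * b2 j" using K \<rho> nn by simp
      moreover have "1 * v \<le> (K + 1) * (v * (real j + 1))"
        using K F mult_left_mono[of 1 "real j + 1" v] by (intro mult_mono) auto
      ultimately show ?thesis using True by (simp add: b_def b1_def)
    next
      case False
      have "K * ((1 + \<sigma>\<^sup>2) * \<rho>) * b2 j = K * ((\<rho> + v * 2 powr x) * 2 powr (- \<eta> * (real j - x)))"
        using False D F(1) by (simp add: b2_def \<rho>_def algebra_simps)
      moreover have "(K + 1) * (v * (real j + 1)) = K * (v * real j) + v + v * real j + K * v" by (simp add: algebra_simps)
      moreover have "0 \<le> v * real j + K * v" using F K by simp
      moreover have "b j = K * ((\<rho> + v * 2 powr x) * 2 powr (- \<eta> * (real j - x))) + K * (v * real j) + v"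
        using False by (simp add: b_def distrib_left)
      moreover have "K * v * b1 j = 0" using False by (simp add: b1_def)
      ultimately show ?thesis by linarith
    qed
    have b0: "0 \<le> K * v * b1 j + K * ((1 + \<sigma>\<^sup>2) * \<rho>) * b2 j + (K + 1) * (v * (real j + 1))" for j
      using K F \<rho> nn by (intro add_nonneg_nonneg mult_nonneg_nonneg) auto
    have "(\<Sum>j=j0..<J. b j) \<le> (\<Sum>j=j0..<J. K * v * b1 j + K * ((1 + \<sigma>\<^sup>2) * \<rho>) * b2 j + (K + 1) * (v * (real j + 1)))"
      by (intro sum_mono b)
    also have "\<dots> \<le> (\<Sum>j<J. K * v * b1 j + K * ((1 + \<sigma>\<^sup>2) * \<rho>) * b2 j + (K + 1) * (v * (real j + 1)))"
      by (intro sum_mono2 b0) auto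
    also have "\<dots> = K * (v * (\<Sum>j<J. b1 j)) + K * ((1 + \<sigma>\<^sup>2) * \<rho>) * (\<Sum>j<J. b2 j) + (K + 1) * (v * (\<Sum>j<J. real j + 1))"
    proof -
      have "(\<Sum>j<J. K * v * b1 j + K * ((1 + \<sigma>\<^sup>2) * \<rho>) * b2 j + (K + 1) * (v * c j)) =
          K * (v * (\<Sum>j<J. b1 j)) + K * ((1 + \<sigma>\<^sup>2) * \<rho>) * (\<Sum>j<J. b2 j) + (K + 1) * (v * (\<Sum>j<J. c j))" for c
        by (simp add: sum.distrib sum_distrib_left mult.assoc)
      from this[of "\<lambda>j. real j + 1"] show ?thesis .
    qed
    also have "\<dots> \<le> K * (\<sigma>\<^sup>2 * \<rho> * (2 * 2 powr D)) + K * ((1 + \<sigma>\<^sup>2) * \<rho>) * G + (K + 1) * (Cv * \<rho>)"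
    proof (intro add_mono mult_left_mono)
      have "(\<Sum>j<J. b1 j) = (\<Sum>j | j < J \<and> real j \<le> x + D. 2 ^ j)"
        unfolding b1_def by (subst sum.inter_filter[symmetric]) auto
      also have "\<dots> \<le> 2 * 2 powr (x + D)" using F D by (intro sum_power2_le) auto
      finally have "v * (\<Sum>j<J. b1 j) \<le> v * (2 * 2 powr (x + D))" using F by (intro mult_left_mono)
      also have "\<dots> = (v * 2 powr x) * (2 * 2 powr D)" by (simp add: powr_add)
      also have "\<dots> = \<sigma>\<^sup>2 * \<rho> * (2 * 2 powr D)" unfolding F(1) \<rho>_def ..
      finally show "v * (\<Sum>j<J. b1 j) \<le> \<sigma>\<^sup>2 * \<rho> * (2 * 2 powr D)" .
      have "(\<Sum>j<J. b2 j) = (\<Sum>j | j < J \<and> x < real j. 2 powr (- \<eta> * (real j - x)))"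
        unfolding b2_def by (subst sum.inter_filter[symmetric]) auto
      also have "\<dots> \<le> G" unfolding G_def using F \<eta> by (intro sum_powr_decay_le) auto
      finally show "(\<Sum>j<J. b2 j) \<le> G" .
      have "(\<Sum>j<J. real j + 1) \<le> (\<Sum>j<J. real J + 1)" by (intro sum_mono) auto
      also have "\<dots> \<le> (real J + 1)\<^sup>2" by (simp add: power2_eq_square algebra_simps)
      finally have "v * (\<Sum>j<J. real j + 1) \<le> v * (real J + 1)\<^sup>2" using F by (intro mult_left_mono)
      with F(2) show "v * (\<Sum>j<J. real j + 1) \<le> Cv * \<rho>" unfolding \<rho>_def by linarith
    qed (use K \<rho> in auto)
    also have "\<dots> = (K * (\<sigma>\<^sup>2 * (2 * 2 powr D)) + K * (1 + \<sigma>\<^sup>2) * G + (K + 1) * Cv) * \<rho>" by (simp add: algebra_simps)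
    also have "\<dots> \<le> K1 * \<rho>" using K1 \<rho> by (intro mult_right_mono) auto
    finally show "(\<Sum>j=j0..<J. K * (if real j \<le> x + D then v * 2 ^ j
          else (2 powr (- 2 * s * x) + v * 2 powr x) * 2 powr (- \<eta> * (real j - x)) + v * real j) + v) \<le>
        K1 * 2 powr (- 2 * s * x)" unfolding b_def \<rho>_def .
  qed
qed

text \<open>Hoelder's inequality up to the factor 2, by splitting at \<mu> = A n^(-1/p) with n the
  number of coefficients: the smaller ones count at most \<mu>^2 each, and for the larger ones the
  square is at most \<mu>^(2 - p) times the p-th power.\<close>

lemma sum_squares_le_of_large_powr:
  fixes \<theta> :: "'b \<Rightarrow> real"
  assumes p: "2 \<le> p" and A: "0 < A" and fin: "finite I" "I \<noteq> {}" and sum: "(\<Sum>k\<in>I. \<bar>\<theta> k\<bar> powr p) \<le> A powr p"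
  shows "(\<Sum>k\<in>I. (\<theta> k)\<^sup>2) \<le> 2 * (A\<^sup>2 * real (card I) powr (1 - 2 / p))"
proof -
  define n where "n = real (card I)"
  have n: "0 < n" using fin by (simp add: n_def card_gt_0_iff)
  define \<mu> where "\<mu> = A * n powr (- 1 / p)"
  have \<mu>: "0 < \<mu>" using A n by (simp add: \<mu>_def)
  have "(\<theta> k)\<^sup>2 \<le> \<mu>\<^sup>2 + \<mu> powr (2 - p) * \<bar>\<theta> k\<bar> powr p" for k
  proof (cases "\<bar>\<theta> k\<bar> \<le> \<mu>")
    case True
    then have "(\<theta> k)\<^sup>2 \<le> \<mu>\<^sup>2" using \<mu> by (metis abs_le_square_iff abs_of_pos)
    moreover have "0 \<le> \<mu> powr (2 - p) * \<bar>\<theta> k\<bar> powr p" by simp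
    ultimately show ?thesis by linarith
  next
    case False
    then have "\<theta> k \<noteq> 0" using \<mu> by auto
    then have "(\<theta> k)\<^sup>2 = \<bar>\<theta> k\<bar> powr (2 - p) * \<bar>\<theta> k\<bar> powr p" by (simp add: powr_add[symmetric])
    also have "\<dots> \<le> \<mu> powr (2 - p) * \<bar>\<theta> k\<bar> powr p"
      using False p \<mu> by (intro mult_right_mono powr_mono2') auto
    finally show ?thesis using zero_le_power2[of \<mu>] by linarith
  qed
  then have "(\<Sum>k\<in>I. (\<theta> k)\<^sup>2) \<le> (\<Sum>k\<in>I. \<mu>\<^sup>2 + \<mu> powr (2 - p) * \<bar>\<theta> k\<bar> powr p)" by (intro sum_mono)
  also have "\<dots> = n * \<mu>\<^sup>2 + \<mu> powr (2 - p) * (\<Sum>k\<in>I. \<bar>\<theta> k\<bar> powr p)"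
    by (simp add: sum.distrib sum_distrib_left n_def)
  also have "\<dots> \<le> n * \<mu>\<^sup>2 + \<mu> powr (2 - p) * A powr p" using sum by (intro add_left_mono mult_left_mono) auto
  also have "n * \<mu>\<^sup>2 = A\<^sup>2 * (n powr 1 * n powr (- 1 / p * 2))"
    using n by (simp add: \<mu>_def power_mult_distrib powr_power)
  also have "n powr 1 * n powr (- 1 / p * 2) = n powr (1 - 2 / p)" unfolding powr_add[symmetric] by simp
  also have "\<mu> powr (2 - p) * A powr p = (A powr (2 - p) * A powr p) * n powr (- 1 / p * (2 - p))"
    unfolding \<mu>_def using A n by (simp only: powr_mult powr_powr ac_simps)
  also have "A powr (2 - p) * A powr p = A\<^sup>2" using A by (simp add: powr_add[symmetric])
  also have "- 1 / p * (2 - p) = 1 - 2 / p" using p by (simp add: field_simps)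
  finally show ?thesis by (simp add: n_def)
qed

context cdv
begin

text \<open>In the notation of the theorem, \<open>w = 2 / p - 1\<close> for \<open>p < 2\<close>, and \<open>w = 0\<close> for \<open>p \<ge> 2\<close>.\<close>
lemma besov_coefficients_sparse:
  assumes p: "0 < p" "inverse p < ennreal s" and q: "0 < q" and M: "0 < M" and sr: "s < real r"
  obtains w B :: real and j1 :: nat where "0 \<le> w" "2 * s / (2 * s + 1) \<le> 2 * s - w" "0 < B" "j0 \<le> j1"
    "\<And>f j. f \<in> besov_ball s p q M \<Longrightarrow> j1 \<le> j \<Longrightarrow>
      (\<Sum>k<2 ^ j. \<bar>inner_unit f (\<Psi> j k)\<bar> powr (2 / (1 + w))) \<le> (B * 2 powr (- real j * (s - w / 2))) powr (2 / (1 + w))"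
proof -
  obtain p' B :: real and j1 :: nat where p': "0 < p'" "1 / p' < s" and B: "0 < B" and j1: "j0 \<le> j1" and bd:
    "\<And>f j. f \<in> besov_ball s p q M \<Longrightarrow> j1 \<le> j \<Longrightarrow>
      (\<Sum>k<2 ^ j. \<bar>inner_unit f (\<Psi> j k)\<bar> powr p') \<le> (B * 2 powr (- real j * (s + 1 / 2 - 1 / p'))) powr p'"
    by (rule besov_coefficients[OF p q M sr]) blast
  have s: "0 < s" using p' by (smt (verit) divide_pos_pos)
  show ?thesis
  proof (cases "p' \<le> 2")
    case True
    show ?thesis
    proof (rule that[of "2 / p' - 1" B j1, OF _ _ B j1])
      show "0 \<le> 2 / p' - 1" using True p' by simp
      \<comment> \<open>With w = 2 / p' - 1, the gap 2 s - w equals 1 + 2 (s - 1 / p') and exceeds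
        1.\<close>
      have "2 * s / (2 * s + 1) \<le> 1" using s by simp
      also have "1 \<le> 2 * s - (2 / p' - 1)" using p' by simp
      finally show "2 * s / (2 * s + 1) \<le> 2 * s - (2 / p' - 1)" .
      have e: "2 / (1 + (2 / p' - 1)) = p'" "s - (2 / p' - 1) / 2 = s + 1 / 2 - 1 / p'" using p' by (auto simp: diff_divide_distrib)
      show "(\<Sum>k<2 ^ j. \<bar>inner_unit f (\<Psi> j k)\<bar> powr (2 / (1 + (2 / p' - 1)))) \<le>
          (B * 2 powr (- real j * (s - (2 / p' - 1) / 2))) powr (2 / (1 + (2 / p' - 1)))"
        if "f \<in> besov_ball s p q M" "j1 \<le> j" for f j unfolding e by (rule bd[OF that])
    qed
  next
    case False
    show ?thesis
    \<comment> \<open>The factor 2 of \<open>sum_squares_le_of_large_powr\<close> is rounded up to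
      4, the square of the 2 in \<open>2 * B\<close>.\<close>
    proof (rule that[of 0 "2 * B" j1, OF _ _ _ j1])
      show "2 * s / (2 * s + 1) \<le> 2 * s - 0" using s by (simp add: field_simps)
      show "0 < 2 * B" using B by simp
      fix f j assume fj: "f \<in> besov_ball s p q M" "j1 \<le> j"
      define A where "A = B * 2 powr (- real j * (s + 1 / 2 - 1 / p'))"
      have A: "0 < A" using B by (simp add: A_def)
      have "(\<Sum>k<2 ^ j. (inner_unit f (\<Psi> j k))\<^sup>2) \<le> 2 * (A\<^sup>2 * real (card {..<2 ^ j :: nat}) powr (1 - 2 / p'))"
        using False bd[OF fj] A by (intro sum_squares_le_of_large_powr) (auto simp: A_def lessThan_empty_iff)
      also have "real (card {..<2 ^ j :: nat}) = 2 powr real j" by (simp add: powr_realpow)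
      also have "A\<^sup>2 * (2 powr real j) powr (1 - 2 / p') =
          B\<^sup>2 * (2 powr (- real j * (s + 1 / 2 - 1 / p') * 2) * 2 powr (real j * (1 - 2 / p')))"
        by (simp add: A_def power_mult_distrib powr_power powr_powr mult.commute)
      also have "\<dots> = B\<^sup>2 * 2 powr (- real j * s * 2)"
        unfolding powr_add[symmetric] by (simp add: algebra_simps)
      also have "2 * (B\<^sup>2 * 2 powr (- real j * s * 2)) \<le> 4 * (B\<^sup>2 * 2 powr (- real j * s * 2))" by simp
      also have "\<dots> = (2 * B * 2 powr (- real j * s))\<^sup>2" by (simp add: power_mult_distrib powr_power mult.commute)
      finally show "(\<Sum>k<2 ^ j. \<bar>inner_unit f (\<Psi> j k)\<bar> powr (2 / (1 + 0))) \<le>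
          (2 * B * 2 powr (- real j * (s - 0 / 2))) powr (2 / (1 + 0))"
        using B by simp
    qed simp
  qed
qed

text \<open>The energy of level j decays like 2^(- (2 s - w) j). Cutting at J, the binary logarithm
  of the sample size, therefore stays within the rate precisely because 2 s - w is at least 2 s / (2
  s + 1).\<close>

lemma coefficient_tail:
  fixes w s B :: real and \<theta> :: "nat \<Rightarrow> nat \<Rightarrow> real"
  assumes s: "0 < s" and w: "0 \<le> w" "2 * s / (2 * s + 1) \<le> 2 * s - w" and B: "0 < B" and J: "j1 \<le> J"
    and bd: "\<And>j. j1 \<le> j \<Longrightarrow>
      (\<Sum>k<2 ^ j. \<bar>\<theta> j k\<bar> powr (2 / (1 + w))) \<le> (B * 2 powr (- real j * (s - w / 2))) powr (2 / (1 + w))"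
  shows "(\<Sum>j=J..<J'. \<Sum>k<2 ^ j. (\<theta> j k)\<^sup>2) \<le>
    B\<^sup>2 / (1 - 2 powr (- (2 * s - w))) * 2 powr (- 2 * s * (real J / (2 * s + 1)))"
proof -
  define u where "u = 2 * s - w"
  have u: "0 < u" using w s divide_pos_pos[of "2 * s" "2 * s + 1"] unfolding u_def by linarith
  define q where "q = 2 powr (- u)"
  have q: "0 < q" "q < 1" using u powr_less_mono[of "- u" 0 2] by (auto simp: q_def)
  have "(\<Sum>j=J..<J'. \<Sum>k<2 ^ j. (\<theta> j k)\<^sup>2) \<le> (\<Sum>j=J..<J'. B\<^sup>2 * q ^ J * q ^ (j - J))"
  proof (rule sum_mono)
    fix j assume j: "j \<in> {J..<J'}"
    have "(\<Sum>k<2 ^ j. (\<theta> j k)\<^sup>2) \<le> (B * 2 powr (- real j * (s - w / 2)))\<^sup>2"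
      using j J B w bd[of j] by (intro sum_squares_le_of_powr_sum[of "2 / (1 + w)"]) (auto simp: divide_le_eq)
    also have "\<dots> = B\<^sup>2 * 2 powr (- u * real j)" by (simp add: power_mult_distrib powr_power u_def algebra_simps)
    also have "2 powr (- u * real j) = q ^ j" unfolding q_def powr_powr[symmetric] by (simp add: powr_realpow)
    also have "q ^ j = q ^ J * q ^ (j - J)" using j by (simp add: power_add[symmetric])
    finally show "(\<Sum>k<2 ^ j. (\<theta> j k)\<^sup>2) \<le> B\<^sup>2 * q ^ J * q ^ (j - J)" by simp
  qed
  also have "\<dots> = B\<^sup>2 * q ^ J * (\<Sum>j=J..<J'. q ^ (j - J))" by (simp add: sum_distrib_left)
  also have "\<dots> \<le> B\<^sup>2 * q ^ J * (1 / (1 - q))" using q by (intro mult_left_mono geometric_sum_from) auto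
  also have "\<dots> = B\<^sup>2 / (1 - q) * q ^ J" by simp
  also have "q ^ J = 2 powr (- u * real J)" unfolding q_def powr_powr[symmetric] by (simp add: powr_realpow)
  also have "B\<^sup>2 / (1 - q) * \<dots> \<le> B\<^sup>2 / (1 - q) * 2 powr (- 2 * s * (real J / (2 * s + 1)))"
  proof (intro mult_left_mono powr_mono)
    have "2 * s / (2 * s + 1) * real J \<le> u * real J" using w by (intro mult_right_mono) (auto simp: u_def)
    then show "- u * real J \<le> - 2 * s * (real J / (2 * s + 1))" by simp
    show "0 \<le> B\<^sup>2 / (1 - q)" using q by simp
  qed auto
  finally show ?thesis by (simp add: q_def u_def)
qed

text \<open>Monotonicity of the integral is available for the possibly non-measurable loss;
  additivity is applied to the measurable majorants only.\<close>

lemma L2_risk_le: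
  assumes P: "prob_space P" and f: "f \<in> L2_unit" and J: "j0 \<le> J" and T: "0 \<le> T"
    and tail: "\<And>J'. J \<le> J' \<Longrightarrow> (\<Sum>j=J..<J'. \<Sum>k<2 ^ j. (inner_unit f (\<Psi> j k))\<^sup>2) \<le> T"
    and U0: "U0 \<in> borel_measurable P" "AE \<omega> in P. ennreal (\<Sum>k<C j0. (y0 k \<omega> - inner_unit f (\<Phi> j0 k))\<^sup>2) \<le> U0 \<omega>"
    and U: "\<And>j. j \<in> {j0..<J} \<Longrightarrow> U j \<in> borel_measurable P"
      "\<And>j. j \<in> {j0..<J} \<Longrightarrow> AE \<omega> in P. ennreal (\<Sum>k<2 ^ j.
        (threshold (2 ^ j) (\<kappa>h j (\<lambda>k. y j k \<omega>)) (\<lambda>k. y j k \<omega>) k - inner_unit f (\<Psi> j k))\<^sup>2) \<le> U j \<omega>"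
  shows "L2_risk P (\<lambda>\<omega>. map_estimator j0 C \<Phi> \<Psi> J \<kappa>h (\<lambda>k. y0 k \<omega>) (\<lambda>j k. y j k \<omega>)) f \<le>
    (\<integral>\<^sup>+\<omega>. U0 \<omega> \<partial>P) + (\<Sum>j=j0..<J. \<integral>\<^sup>+\<omega>. U j \<omega> \<partial>P) + ennreal T"
proof -
  interpret prob_space P by fact
  have "AE \<omega> in P. \<forall>j\<in>{j0..<J}. ennreal (\<Sum>k<2 ^ j.
        (threshold (2 ^ j) (\<kappa>h j (\<lambda>k. y j k \<omega>)) (\<lambda>k. y j k \<omega>) k - inner_unit f (\<Psi> j k))\<^sup>2) \<le> U j \<omega>"
    using U(2) by (intro AE_finite_allI) auto
  with U0(2) have "AE \<omega> in P. sq_dist_unit (map_estimator j0 C \<Phi> \<Psi> J \<kappa>h (\<lambda>k. y0 k \<omega>) (\<lambda>j k. y j k \<omega>)) f \<le>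
      U0 \<omega> + (\<Sum>j=j0..<J. U j \<omega>) + ennreal T"
  proof eventually_elim
    case (elim \<omega>)
    define E0 where "E0 = (\<Sum>k<C j0. (y0 k \<omega> - inner_unit f (\<Phi> j0 k))\<^sup>2)"
    define E where "E j = (\<Sum>k<2 ^ j. (threshold (2 ^ j) (\<kappa>h j (\<lambda>k. y j k \<omega>)) (\<lambda>k. y j k \<omega>) k - inner_unit f (\<Psi> j k))\<^sup>2)" for j
    have nn: "0 \<le> E0" "\<And>j. 0 \<le> E j" by (auto simp: E0_def E_def sum_nonneg)
    have "sq_dist_unit (map_estimator j0 C \<Phi> \<Psi> J \<kappa>h (\<lambda>k. y0 k \<omega>) (\<lambda>j k. y j k \<omega>)) f \<le> ennreal (E0 + (\<Sum>j=j0..<J. E j) + T)"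
      unfolding map_estimator_def E0_def E_def by (rule sq_dist_expansion_le[OF f J T tail])
    also have "\<dots> = ennreal E0 + (\<Sum>j=j0..<J. ennreal (E j)) + ennreal T"
      using nn T by (simp add: sum_nonneg sum_ennreal)
    also have "\<dots> \<le> U0 \<omega> + (\<Sum>j=j0..<J. U j \<omega>) + ennreal T"
      using elim by (intro add_mono sum_mono order_refl) (auto simp: E0_def E_def)
    finally show ?case .
  qed
  then have "L2_risk P (\<lambda>\<omega>. map_estimator j0 C \<Phi> \<Psi> J \<kappa>h (\<lambda>k. y0 k \<omega>) (\<lambda>j k. y j k \<omega>)) f \<le>
      (\<integral>\<^sup>+\<omega>. U0 \<omega> + (\<Sum>j=j0..<J. U j \<omega>) + ennreal T \<partial>P)"
    unfolding L2_risk_def by (rule nn_integral_mono_AE)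
  also have "\<dots> = (\<integral>\<^sup>+\<omega>. U0 \<omega> \<partial>P) + (\<integral>\<^sup>+\<omega>. (\<Sum>j=j0..<J. U j \<omega>) \<partial>P) + ennreal T"
    using U0(1) U(1) by (simp add: nn_integral_add emeasure_space_1)
  also have "(\<integral>\<^sup>+\<omega>. (\<Sum>j=j0..<J. U j \<omega>) \<partial>P) = (\<Sum>j=j0..<J. \<integral>\<^sup>+\<omega>. U j \<omega> \<partial>P)"
    using U(1) by (rule nn_integral_sum)
  finally show ?thesis .
qed

end

text \<open>With n = 2^J the rate is 2^(-2 s x) at the balancing level x = J / (2 s + 1). The
  scaling coefficients, the thresholded levels and the discarded tail each cost at most a multiple
  of it, with factors fixed before J and f.\<close>

theorem theorem2:
  fixes r j0 :: nat and \<phi> \<psi> :: "real \<Rightarrow> real"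
    and C :: "nat \<Rightarrow> nat" and \<Phi> \<Psi> :: "nat \<Rightarrow> nat \<Rightarrow> real \<Rightarrow> real"
    and P :: "'a measure" and W :: "real \<Rightarrow> 'a \<Rightarrow> real"
    and s M \<sigma> \<gamma>min \<gamma>max c0 c1 c2 c\<alpha> :: real and p q :: ennreal
    and \<tau> \<gamma> \<alpha> :: "nat \<Rightarrow> nat \<Rightarrow> real" and \<pi> :: "nat \<Rightarrow> nat \<Rightarrow> nat pmf"
    and \<kappa>hat :: "nat \<Rightarrow> nat \<Rightarrow> (nat \<Rightarrow> real) \<Rightarrow> nat"
    and Y0 :: "nat \<Rightarrow> (real \<Rightarrow> real) \<Rightarrow> nat \<Rightarrow> 'a \<Rightarrow> real"
    and Y :: "nat \<Rightarrow> (real \<Rightarrow> real) \<Rightarrow> nat \<Rightarrow> nat \<Rightarrow> 'a \<Rightarrow> real"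
  assumes basis: "cdv_basis r \<phi> \<psi> j0 C \<Phi> \<Psi>"
    and wiener: "wiener_process P W" and \<sigma>: "\<sigma> > 0"
    and besov: "0 < p" "0 < q" "inverse p < ennreal s" "s < real r" "M > 0"
    \<comment> \<open>Empirical coefficients at sample size \<open>n = 2^J\<close> if the unknown function is \<open>f\<close>.\<close>
    and Y0: "\<And>J f k. f \<in> L2_unit \<Longrightarrow> k < C j0 \<Longrightarrow>
          is_stoch_integral P (white_noise_obs f (\<sigma> / sqrt (2 ^ J)) W) (\<Phi> j0 k) (Y0 J f k)"
    and Y: "\<And>J f j k. f \<in> L2_unit \<Longrightarrow> j0 \<le> j \<Longrightarrow> k < 2 ^ j \<Longrightarrow>
          is_stoch_integral P (white_noise_obs f (\<sigma> / sqrt (2 ^ J)) W) (\<Psi> j k) (Y J f j k)"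
    \<comment> \<open>Hyperparameters and selected numbers of non-zero coefficients, at sample size \<open>n = 2^J\<close>
      and level \<open>j\<close>.\<close>
    and \<tau>: "\<And>J j. j0 \<le> j \<Longrightarrow> j < J \<Longrightarrow> \<tau> J j > 0"
    and \<gamma>: "\<And>J j. j0 \<le> j \<Longrightarrow> j < J \<Longrightarrow> \<gamma> J j = (\<tau> J j)\<^sup>2 / \<sigma>\<^sup>2"
    and prior: "\<And>J j. j0 \<le> j \<Longrightarrow> j < J \<Longrightarrow> set_pmf (\<pi> J j) = {0..2 ^ j}"
    and \<kappa>hat: "\<And>J j y. j0 \<le> j \<Longrightarrow> j < J \<Longrightarrow>
          is_arg_min (map_criterion (2 ^ j) (\<sigma>\<^sup>2 / 2 ^ J) (\<gamma> J j) (\<pi> J j) y)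
            (\<lambda>\<kappa>. \<kappa> \<le> 2 ^ j) (\<kappa>hat J j y)"
    and pos: "\<gamma>min > 0" "\<gamma>max > 0" "c0 > 0" "c1 > 0" "c2 > 0" "c\<alpha> > 0"
    and \<gamma>_bounds: "\<And>J j. j0 \<le> j \<Longrightarrow> j < J \<Longrightarrow> \<gamma>min \<le> \<gamma> J j \<and> \<gamma> J j \<le> \<gamma>max"
    and prior_zero: "\<And>J j. j0 \<le> j \<Longrightarrow> j < J \<Longrightarrow> pmf (\<pi> J j) 0 \<ge> 2 powr (- c1 * real j)"
    and \<alpha>_bounds: "\<And>J j. j0 \<le> j \<Longrightarrow> j < J \<Longrightarrow>
          c\<alpha> \<le> \<alpha> J j \<and> \<alpha> J j \<le> exp (- (8 * (\<gamma> J j + 3 / 4)\<^sup>2))"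
    and prior_sparse: "\<And>J j \<kappa>. j0 \<le> j \<Longrightarrow> j < J \<Longrightarrow> 1 \<le> \<kappa> \<Longrightarrow> real \<kappa> \<le> \<alpha> J j * 2 ^ j \<Longrightarrow>
          pmf (\<pi> J j) \<kappa> \<ge> (real \<kappa> / 2 ^ j) powr (c2 * real \<kappa>)"
    and prior_full: "\<And>J j. j0 \<le> j \<Longrightarrow> j < J \<Longrightarrow> pmf (\<pi> J j) (2 ^ j) \<ge> exp (- c0 * 2 ^ j)"
  shows "\<exists>K>0. \<forall>\<^sub>F J in sequentially.
    (SUP f\<in>besov_ball s p q M.
       L2_risk P (\<lambda>\<omega>. map_estimator j0 C \<Phi> \<Psi> J (\<kappa>hat J)
                     (\<lambda>k. Y0 J f k \<omega>) (\<lambda>j k. Y J f j k \<omega>)) f)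
      \<le> ennreal (K * real (2 ^ J) powr (- (2 * s / (2 * s + 1))))"
proof -
  interpret cdv r j0 \<phi> \<psi> C \<Phi> \<Psi> by unfold_locales (rule basis)
  have s: "0 < s" using besov(3) by (metis ennreal_eq_0_iff linorder_not_le not_less_zero)
  \<comment> \<open>A single instance of the bounds on \<gamma>, at a level that occurs, shows that
    their range is non-empty.\<close>
  have \<gamma>m: "\<gamma>min \<le> \<gamma>max" using \<gamma>_bounds[of j0 "Suc j0"] by simp
  obtain w B :: real and j1 :: nat where w: "0 \<le> w" "2 * s / (2 * s + 1) \<le> 2 * s - w" and B: "0 < B" and j1: "j0 \<le> j1"
    and coeff: "\<And>f j. f \<in> besov_ball s p q M \<Longrightarrow> j1 \<le> j \<Longrightarrow>
      (\<Sum>k<2 ^ j. \<bar>inner_unit f (\<Psi> j k)\<bar> powr (2 / (1 + w))) \<le> (B * 2 powr (- real j * (s - w / 2))) powr (2 / (1 + w))"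
    by (rule besov_coefficients_sparse[OF besov(1,3,2,5,4)]) blast
  have ws: "w < 2 * s" using w s divide_pos_pos[of "2 * s" "2 * s + 1"] by linarith
  obtain Cl where Cl: "0 < Cl" and risk:
    "\<And>(P::'a measure) W f \<epsilon> N g Y \<gamma> \<pi> \<kappa>h S. white_noise_coefficients P W f \<epsilon> N g Y \<Longrightarrow>
      \<gamma>min \<le> \<gamma> \<Longrightarrow> \<gamma> \<le> \<gamma>max \<Longrightarrow> set_pmf \<pi> = {0..N} \<Longrightarrow>
      (\<And>y. is_arg_min (map_criterion N (\<epsilon>\<^sup>2) \<gamma> \<pi> y) (\<lambda>\<kappa>. \<kappa> \<le> N) (\<kappa>h y)) \<Longrightarrow> S \<subseteq> {..<N} \<Longrightarrow>
      \<exists>U\<in>borel_measurable P.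
        (AE \<omega> in P. ennreal (\<Sum>k<N. (threshold N (\<kappa>h (\<lambda>k. Y k \<omega>)) (\<lambda>k. Y k \<omega>) k - inner_unit f (g k))\<^sup>2) \<le> U \<omega>) \<and>
        (\<integral>\<^sup>+\<omega>. U \<omega> \<partial>P) \<le>
          ennreal (Cl * ((\<Sum>k\<in>{..<N} - S. (inner_unit f (g k))\<^sup>2) + \<epsilon>\<^sup>2 * map_pen N \<gamma> \<pi> (card S) + \<epsilon>\<^sup>2))"
    by (rule level_risk[OF pos(1) \<gamma>m]) blast
  obtain K \<eta> D :: real where K: "0 < K" and \<eta>: "0 < \<eta>" and D: "0 \<le> D" and cost:
    "\<And>\<gamma> \<pi> (\<theta> :: nat \<Rightarrow> real) v x j. \<gamma>min \<le> \<gamma> \<Longrightarrow> \<gamma> \<le> \<gamma>max \<Longrightarrow> 2 powr (- c1 * real j) \<le> pmf \<pi> 0 \<Longrightarrow>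
      (\<And>\<kappa>. 1 \<le> \<kappa> \<Longrightarrow> real \<kappa> \<le> c\<alpha> * 2 ^ j \<Longrightarrow> (real \<kappa> / 2 ^ j) powr (c2 * real \<kappa>) \<le> pmf \<pi> \<kappa>) \<Longrightarrow>
      exp (- c0 * 2 ^ j) \<le> pmf \<pi> (2 ^ j) \<Longrightarrow>
      (x + D < real j \<Longrightarrow>
        (\<Sum>k<2 ^ j. \<bar>\<theta> k\<bar> powr (2 / (1 + w))) \<le> (B * 2 powr (- real j * (s - w / 2))) powr (2 / (1 + w))) \<Longrightarrow>
      0 \<le> v \<Longrightarrow>
      \<exists>S\<subseteq>{..<2 ^ j}. (\<Sum>k\<in>{..<2 ^ j} - S. (\<theta> k)\<^sup>2) + v * map_pen (2 ^ j) \<gamma> \<pi> (card S) \<le>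
        K * (if real j \<le> x + D then v * 2 ^ j
          else (2 powr (- 2 * s * x) + v * 2 powr x) * 2 powr (- \<eta> * (real j - x)) + v * real j)"
    by (rule level_cost_cases[OF s w(1) ws B pos(1) \<gamma>m pos(3) less_imp_le[OF pos(4)] less_imp_le[OF pos(5)] pos(6)]) blast
  obtain K1 where K1: "0 < K1"
    and v_le: "\<And>J x v. x = real J / (2 * s + 1) \<Longrightarrow> v = \<sigma>\<^sup>2 / 2 ^ J \<Longrightarrow> v \<le> K1 * 2 powr (- 2 * s * x)"
    and sum_le: "\<And>J j0 x v. x = real J / (2 * s + 1) \<Longrightarrow> v = \<sigma>\<^sup>2 / 2 ^ J \<Longrightarrow>
      (\<Sum>j=j0..<J. K * (if real j \<le> x + D then v * 2 ^ j
          else (2 powr (- 2 * s * x) + v * 2 powr x) * 2 powr (- \<eta> * (real j - x)) + v * real j) + v) \<le>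
        K1 * 2 powr (- 2 * s * x)"
    by (rule level_bounds_sum[OF s K \<eta> D, of \<sigma>]) blast
  define K2 where "K2 = B\<^sup>2 / (1 - 2 powr (- (2 * s - w)))"
  have K2: "0 \<le> K2" using ws powr_less_mono[of "- (2 * s - w)" 0 2] by (simp add: K2_def)
  define K3 where "K3 = 6 * real (C j0) * K1 + Cl * K1 + K2"
  have K3: "0 < K3" unfolding K3_def using K1 K2 Cl by (intro add_pos_nonneg add_nonneg_pos mult_nonneg_nonneg mult_pos_pos) auto
  \<comment> \<open>From J0 on the balancing level x is at least j1, so the coefficient bound holds
    on all levels above x + D; J \<ge> j1 is needed for the tail.\<close>
  define J0 where "J0 = nat \<lceil>(2 * s + 1) * real j1\<rceil> + j1"
  show ?thesis
  proof (intro exI[of _ K3] conjI K3 eventually_sequentiallyI[of J0] SUP_least)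
    fix J f assume J: "J0 \<le> J" and f: "f \<in> besov_ball s p q M"
    have fL: "f \<in> L2_unit" using f by (simp add: besov_ball_def)
    have Jj1: "j1 \<le> J" "j0 \<le> J" using J j1 by (auto simp: J0_def)
    define x where "x = real J / (2 * s + 1)"
    have "(2 * s + 1) * real j1 \<le> real J" using J unfolding J0_def by linarith
    then have xj1: "real j1 \<le> x" using s by (simp add: x_def field_simps)
    define v where "v = \<sigma>\<^sup>2 / 2 ^ J"
    define \<epsilon> where "\<epsilon> = \<sigma> / sqrt (2 ^ J)"
    have v: "0 \<le> v" by (simp add: v_def)
    have \<epsilon>: "0 < \<epsilon>" "\<epsilon>\<^sup>2 = v" using \<sigma> by (auto simp: \<epsilon>_def v_def power_divide)
    define \<rho> where "\<rho> = 2 powr (- 2 * s * x)"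
    have \<rho>: "0 < \<rho>" by (simp add: \<rho>_def)
    define b where "b j = K * (if real j \<le> x + D then v * 2 ^ j
          else (2 powr (- 2 * s * x) + v * 2 powr x) * 2 powr (- \<eta> * (real j - x)) + v * real j)" for j
    have b0: "0 \<le> b j" for j using K v by (auto simp: b_def)
    have level: "\<exists>U. U \<in> borel_measurable P \<and>
        (AE \<omega> in P. ennreal (\<Sum>k<2 ^ j. (threshold (2 ^ j) (\<kappa>hat J j (\<lambda>k. Y J f j k \<omega>)) (\<lambda>k. Y J f j k \<omega>) k
          - inner_unit f (\<Psi> j k))\<^sup>2) \<le> U \<omega>) \<and>
        (\<integral>\<^sup>+\<omega>. U \<omega> \<partial>P) \<le> ennreal (Cl * (b j + v))" if j: "j \<in> {j0..<J}" for j
    proof -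
      have jJ: "j0 \<le> j" "j < J" using j by auto
      have wn: "white_noise_coefficients P W f \<epsilon> (2 ^ j) (\<Psi> j) (Y J f j)"
        using wiener fL \<epsilon>(1) \<Psi>_L2[OF jJ(1)] \<Psi>_orthonormal[OF jJ(1)] Y[OF fL jJ(1)]
        unfolding \<epsilon>_def by unfold_locales auto
      have \<gamma>': "\<gamma>min \<le> \<gamma> J j" "\<gamma> J j \<le> \<gamma>max" using \<gamma>_bounds[OF jJ] by auto
      have sparse: "(real \<kappa> / 2 ^ j) powr (c2 * real \<kappa>) \<le> pmf (\<pi> J j) \<kappa>" if "1 \<le> \<kappa>" "real \<kappa> \<le> c\<alpha> * 2 ^ j" for \<kappa>
      proof (rule prior_sparse[OF jJ that(1)])
        have "c\<alpha> * 2 ^ j \<le> \<alpha> J j * 2 ^ j" using \<alpha>_bounds[OF jJ] by (intro mult_right_mono) auto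
        then show "real \<kappa> \<le> \<alpha> J j * 2 ^ j" using that(2) by linarith
      qed
      have "(\<Sum>k<2 ^ j. \<bar>inner_unit f (\<Psi> j k)\<bar> powr (2 / (1 + w))) \<le> (B * 2 powr (- real j * (s - w / 2))) powr (2 / (1 + w))"
        if "x + D < real j" using that xj1 D by (intro coeff[OF f]) linarith
      from cost[OF \<gamma>' prior_zero[OF jJ] sparse prior_full[OF jJ] this v] obtain S where S: "S \<subseteq> {..<2 ^ j}"
        and le: "(\<Sum>k\<in>{..<2 ^ j} - S. (inner_unit f (\<Psi> j k))\<^sup>2) + v * map_pen (2 ^ j) (\<gamma> J j) (\<pi> J j) (card S) \<le> b j"
        unfolding b_def by blast
      have "is_arg_min (map_criterion (2 ^ j) (\<epsilon>\<^sup>2) (\<gamma> J j) (\<pi> J j) y) (\<lambda>\<kappa>. \<kappa> \<le> 2 ^ j) (\<kappa>hat J j y)" for y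
        using \<kappa>hat[OF jJ] unfolding \<epsilon>(2) v_def .
      from risk[OF wn \<gamma>' prior[OF jJ] this S] obtain U where U: "U \<in> borel_measurable P"
        "AE \<omega> in P. ennreal (\<Sum>k<2 ^ j. (threshold (2 ^ j) (\<kappa>hat J j (\<lambda>k. Y J f j k \<omega>)) (\<lambda>k. Y J f j k \<omega>) k
          - inner_unit f (\<Psi> j k))\<^sup>2) \<le> U \<omega>"
        "(\<integral>\<^sup>+\<omega>. U \<omega> \<partial>P) \<le> ennreal (Cl * ((\<Sum>k\<in>{..<2 ^ j} - S. (inner_unit f (\<Psi> j k))\<^sup>2) +
          v * map_pen (2 ^ j) (\<gamma> J j) (\<pi> J j) (card S) + v))"
        unfolding \<epsilon>(2) by blast
      note U(3)
      also have "ennreal (Cl * ((\<Sum>k\<in>{..<2 ^ j} - S. (inner_unit f (\<Psi> j k))\<^sup>2) +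
          v * map_pen (2 ^ j) (\<gamma> J j) (\<pi> J j) (card S) + v)) \<le> ennreal (Cl * (b j + v))"
        using le Cl by (intro ennreal_leI mult_left_mono) auto
      finally show ?thesis using U(1,2) by blast
    qed
    obtain U where "\<forall>j\<in>{j0..<J}. U j \<in> borel_measurable P \<and>
        (AE \<omega> in P. ennreal (\<Sum>k<2 ^ j. (threshold (2 ^ j) (\<kappa>hat J j (\<lambda>k. Y J f j k \<omega>)) (\<lambda>k. Y J f j k \<omega>) k
          - inner_unit f (\<Psi> j k))\<^sup>2) \<le> U j \<omega>) \<and>
        (\<integral>\<^sup>+\<omega>. U j \<omega> \<partial>P) \<le> ennreal (Cl * (b j + v))"
      using bchoice[OF ballI[OF level]] ..
    then have U: "\<And>j. j \<in> {j0..<J} \<Longrightarrow> U j \<in> borel_measurable P"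
      "\<And>j. j \<in> {j0..<J} \<Longrightarrow> AE \<omega> in P. ennreal (\<Sum>k<2 ^ j.
        (threshold (2 ^ j) (\<kappa>hat J j (\<lambda>k. Y J f j k \<omega>)) (\<lambda>k. Y J f j k \<omega>) k - inner_unit f (\<Psi> j k))\<^sup>2) \<le> U j \<omega>"
      "\<And>j. j \<in> {j0..<J} \<Longrightarrow> (\<integral>\<^sup>+\<omega>. U j \<omega> \<partial>P) \<le> ennreal (Cl * (b j + v))"
      by blast+
    \<comment> \<open>The scaling coefficients are kept without thresholding. Their number C j0 does
      not grow with J, so their risk is of the order of the noise variance v.\<close>
    interpret scaling: white_noise_coefficients P W f \<epsilon> "C j0" "\<Phi> j0" "Y0 J f"
      using wiener fL \<epsilon>(1) \<Phi>_L2[of j0] \<Phi>_orthonormal[of j0] Y0[OF fL]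
      unfolding \<epsilon>_def by unfold_locales auto
    define U0 where "U0 \<omega> = ennreal v * ennreal (\<Sum>k<C j0. (scaling.z k \<omega>)\<^sup>2)" for \<omega>
    have meas: "(\<lambda>\<omega>. \<Sum>k<C j0. (scaling.z k \<omega>)\<^sup>2) \<in> borel_measurable P" by (rule scaling.energy_meas) simp
    have U0m: "U0 \<in> borel_measurable P" unfolding U0_def using meas by measurable
    have U0_eq: "ennreal (\<Sum>k<C j0. (Y0 J f k \<omega> - inner_unit f (\<Phi> j0 k))\<^sup>2) = U0 \<omega>" for \<omega>
    proof -
      have "(\<Sum>k<C j0. (Y0 J f k \<omega> - inner_unit f (\<Phi> j0 k))\<^sup>2) = v * (\<Sum>k<C j0. (scaling.z k \<omega>)\<^sup>2)"
        by (simp add: scaling.Y_eq power_mult_distrib \<epsilon>(2) sum_distrib_left)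
      then show ?thesis using v by (simp add: U0_def ennreal_mult')
    qed
    have "(\<integral>\<^sup>+\<omega>. U0 \<omega> \<partial>P) = ennreal v * (\<integral>\<^sup>+\<omega>. ennreal (\<Sum>k<C j0. (scaling.z k \<omega>)\<^sup>2) \<partial>P)"
      unfolding U0_def using meas by (intro nn_integral_cmult) measurable
    also have "\<dots> \<le> ennreal v * ennreal (6 * real (C j0))"
      using scaling.nn_integral_energy_le[of "{..<C j0}"] by (intro mult_left_mono) auto
    also have "\<dots> = ennreal (6 * real (C j0) * v)" using v by (simp add: ennreal_mult'[symmetric] mult.commute)
    finally have U0: "(\<integral>\<^sup>+\<omega>. U0 \<omega> \<partial>P) \<le> ennreal (6 * real (C j0) * v)" .
    have tail: "(\<Sum>j=J..<J'. \<Sum>k<2 ^ j. (inner_unit f (\<Psi> j k))\<^sup>2) \<le> K2 * \<rho>" for J'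
      unfolding K2_def \<rho>_def x_def by (rule coefficient_tail[OF s w B Jj1(1) coeff[OF f]])
    have "L2_risk P (\<lambda>\<omega>. map_estimator j0 C \<Phi> \<Psi> J (\<kappa>hat J) (\<lambda>k. Y0 J f k \<omega>) (\<lambda>j k. Y J f j k \<omega>)) f \<le>
        (\<integral>\<^sup>+\<omega>. U0 \<omega> \<partial>P) + (\<Sum>j=j0..<J. \<integral>\<^sup>+\<omega>. U j \<omega> \<partial>P) + ennreal (K2 * \<rho>)"
      using K2 \<rho> U0_eq by (intro L2_risk_le[OF scaling.prob fL Jj1(2) _ tail U0m _ U(1,2)]) auto
    also have "\<dots> \<le> ennreal (6 * real (C j0) * v) + (\<Sum>j=j0..<J. ennreal (Cl * (b j + v))) + ennreal (K2 * \<rho>)"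
      by (intro add_mono sum_mono U0 U(3) order_refl)
    also have "\<dots> = ennreal (6 * real (C j0) * v + Cl * (\<Sum>j=j0..<J. b j + v) + K2 * \<rho>)"
    proof -
      have nn: "0 \<le> Cl * (b j + v)" for j using Cl b0[of j] v by simp
      have "(\<Sum>j=j0..<J. ennreal (Cl * (b j + v))) = ennreal (Cl * (\<Sum>j=j0..<J. b j + v))"
        unfolding sum_distrib_left by (rule sum_ennreal) (rule nn)
      moreover have "0 \<le> Cl * (\<Sum>j=j0..<J. b j + v)" unfolding sum_distrib_left by (intro sum_nonneg nn)
      ultimately show ?thesis using v K2 \<rho> by simp
    qed
    also have "\<dots> \<le> ennreal (K3 * \<rho>)"
    proof (rule ennreal_leI)
      have 1: "6 * real (C j0) * v \<le> 6 * real (C j0) * (K1 * \<rho>)"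
        unfolding \<rho>_def by (intro mult_left_mono v_le[OF x_def v_def]) simp
      have 2: "Cl * (\<Sum>j=j0..<J. b j + v) \<le> Cl * (K1 * \<rho>)"
        unfolding \<rho>_def b_def using Cl by (intro mult_left_mono sum_le[OF x_def v_def]) simp
      have "K3 * \<rho> = 6 * real (C j0) * (K1 * \<rho>) + Cl * (K1 * \<rho>) + K2 * \<rho>" by (simp add: K3_def algebra_simps)
      with 1 2 show "6 * real (C j0) * v + Cl * (\<Sum>j=j0..<J. b j + v) + K2 * \<rho> \<le> K3 * \<rho>" by linarith
    qed
    also have "\<rho> = real (2 ^ J) powr (- (2 * s / (2 * s + 1)))"
      by (simp add: \<rho>_def x_def powr_realpow[symmetric] powr_powr mult.commute)
    finally show "L2_risk P (\<lambda>\<omega>. map_estimator j0 C \<Phi> \<Psi> J (\<kappa>hat J) (\<lambda>k. Y0 J f k \<omega>) (\<lambda>j k. Y J f j k \<omega>)) f \<le>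
        ennreal (K3 * real (2 ^ J) powr (- (2 * s / (2 * s + 1))))" .
  qed
qed

end
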